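(* Let $n\ge 1$, $0<s<t<1$, and let $\Omega\subset\mathbb{R}^n$ be a bounded Lipschitz domain, $\Omega_e=\mathbb{R}^n\setminus\overline{\Omega}$. Let $b_1,b_2,q_1,q_2\in L^\infty(\Omega)$ be (real valued and) compactly supported in $\Omega$, and suppose that for $k=1,2$ the operator $\mathscr{L}_{b_k,q_k}=(-\Delta)^t+(-\Delta)^{s/2}_\Omega\, b_k\,(-\Delta)^{s/2}_\Omega+q_k$ satisfies the eigenvalue condition: the only $\varphi\in H^t(\mathbb{R}^n)$ with $\mathscr{L}_{b_k,q_k}\varphi=0$ in $\Omega$ and $\varphi=0$ in $\Omega_e$ is $\varphi=0$. Let $W,\widetilde W\subset\Omega_e$ be any two non-empty open subsets. If $\mathcal{C}_{b_1,q_1}(W,\widetilde W)=\mathcal{C}_{b_2,q_2}(W,\widetilde W)$, then $q_1=q_2$ and $b_1=b_2$ in $\Omega$.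
   Context: All functions are real valued. Sobolev spaces: $H^r(\mathbb{R}^n)$ is the $L^2$-based Sobolev space with norm $\|\langle\xi\rangle^r\widehat u\|_{L^2}$, $\langle\xi\rangle=(1+|\xi|^2)^{1/2}$; for an open set $U$, $\widetilde H^r(U)$ is the closure of $C_c^\infty(U)$ in $H^r(\mathbb{R}^n)$, and $H^r(U)$ is the space of restrictions to $U$ of elements of $H^r(\mathbb{R}^n)$ with the quotient norm. Operators: $(-\Delta)^t$ is the Fourier multiplier $|\xi|^{2t}$ on $\mathbb{R}^n$; for $0<a<1$, $C_{n,a}>0$ is the constant for which $(-\Delta)^a u(x)=C_{n,a}\,\mathrm{p.v.}\int_{\mathbb{R}^n}\frac{u(x)-u(y)}{|x-y|^{n+2a}}dy$ for Schwartz $u$. The regional fractional Laplacian on $\Omega$ is $(-\Delta)^a_\Omega u(x)=C_{n,a}\,\mathrm{p.v.}\int_\Omega\frac{u(x)-u(y)}{|x-y|^{n+2a}}dy$ for smooth $u$ on $\overline\Omega$, extended to $u\in H^a(\Omega)$ weakly by $\langle(-\Delta)^a_\Omega u,v\rangle=\frac{C_{n,a}}{2}\int_\Omega\int_\Omega\frac{(u(x)-u(y))(v(x)-v(y))}{|x-y|^{n+2a}}dy\,dx$; applied to functions on $\mathbb{R}^n$ it acts on their restriction to $\Omega$. Weak solutions: for $f\in\widetilde H^t(\Omega_e)$, $u\in H^t(\mathbb{R}^n)$ solves $\mathscr{L}_{b,q}u=0$ in $\Omega$, $u=f$ in $\Omega_e$, if $u=f$ in $\Omega_e$ and for all $\varphi\in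 C_c^\infty(\Omega)$, $$\int_{\mathbb{R}^n}(-\Delta)^{t/2}u\,(-\Delta)^{t/2}\varphi\,dx+\int_\Omega b\,(-\Delta)^{s/2}_\Omega u\,(-\Delta)^{s/2}_\Omega\varphi\,dx+\int_\Omega q\,u\,\varphi\,dx=0.$$ (Here $u|_\Omega=(u-f)|_\Omega$ with $u-f\in\widetilde H^t(\Omega)$, and $(-\Delta)^{s/2}_\Omega u\in L^2(\Omega)$.) Under the eigenvalue condition there is a unique such solution, denoted $u_f$. Non-local Neumann data: $\mathscr{N}_{b,q}(f)(x)=C_{n,t}\int_\Omega\frac{u_f(x)-u_f(y)}{|x-y|^{n+2t}}dy$ for (a.e.) $x\in\Omega_e$. Non-local partial Cauchy data: $\mathcal{C}_{b,q}(W,\widetilde W)=\{(f,\mathscr{N}_{b,q}(f)|_{\widetilde W}):\ f\in\widetilde H^t(W)\}$. *)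

theory Defs
  imports "HOL-Analysis.Analysis"
begin

text \<open>
  The type \<open>'a::euclidean_space\<close> plays the role of \<open>\<real>\<^sup>n\<close>, with \<open>n = DIM('a)\<close>. Elements of Lebesgue and
  Sobolev spaces are represented by Borel functions, and equality of such elements is equality
  almost everywhere. Operators with values in such spaces choose a representative with \<open>SOME\<close>;
  every definition that uses the result is insensitive to the choice.
\<close>

section \<open>Bounded Lipschitz domains\<close>

text \<open>
  Near each boundary point, in coordinates \<open>(x - (x \<bullet> e) e, x \<bullet> e)\<close> given by a unit vector \<open>e\<close>, the
  domain is the strict epigraph of a Lipschitz function \<open>\<gamma>\<close> on the hyperplane orthogonal to \<open>e\<close>.
\<close>

definition bounded_lipschitz_domain :: "'a::euclidean_space set \<Rightarrow> bool" where
  "bounded_lipschitz_domain \<Omega> \<longleftrightarrow>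
     open \<Omega> \<and> connected \<Omega> \<and> \<Omega> \<noteq> {} \<and> bounded \<Omega> \<and>
     (\<forall>p\<in>frontier \<Omega>. \<exists>r>0. \<exists>e L \<gamma>. norm e = 1 \<and> L-lipschitz_on {y. y \<bullet> e = 0} \<gamma> \<and>
        \<Omega> \<inter> ball p r = {x \<in> ball p r. \<gamma> (x - (x \<bullet> e) *\<^sub>R e) < x \<bullet> e})"

definition exterior :: "'a::euclidean_space set \<Rightarrow> 'a set" where
  "exterior \<Omega> = - closure \<Omega>"


section \<open>Test functions and Schwartz functions\<close>

primrec partial_derivs :: "'a::euclidean_space list \<Rightarrow> ('a \<Rightarrow> real) \<Rightarrow> 'a \<Rightarrow> real" where
  "partial_derivs [] f = f"
| "partial_derivs (v # vs) f = (\<lambda>x. frechet_derivative (partial_derivs vs f) (at x) v)"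

definition C_infinity :: "('a::euclidean_space \<Rightarrow> real) \<Rightarrow> bool" where
  "C_infinity f \<longleftrightarrow> (\<forall>vs x. set vs \<subseteq> Basis \<longrightarrow> partial_derivs vs f differentiable (at x))"

definition test_functions :: "'a::euclidean_space set \<Rightarrow> ('a \<Rightarrow> real) set" where
  "test_functions U =
     {\<phi>. C_infinity \<phi> \<and> compact (closure {x. \<phi> x \<noteq> 0}) \<and> closure {x. \<phi> x \<noteq> 0} \<subseteq> U}"

definition schwartz_functions :: "('a::euclidean_space \<Rightarrow> real) set" where
  "schwartz_functions =
     {\<phi>. C_infinity \<phi> \<and>
        (\<forall>vs k. set vs \<subseteq> Basis \<longrightarrow> bounded (range (\<lambda>x. norm x ^ k * partial_derivs vs \<phi> x)))}"


section \<open>Lebesgue spaces\<close>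

definition square_integrable_on ::
    "'a::euclidean_space set \<Rightarrow> ('a \<Rightarrow> 'b::{banach, second_countable_topology}) \<Rightarrow> bool" where
  "square_integrable_on A f \<longleftrightarrow>
     set_borel_measurable lborel A f \<and> set_integrable lborel A (\<lambda>x. (norm (f x))\<^sup>2)"

definition L_infinity :: "'a::euclidean_space set \<Rightarrow> ('a \<Rightarrow> real) \<Rightarrow> bool" where
  "L_infinity A f \<longleftrightarrow> set_borel_measurable lborel A f \<and> (\<exists>M. AE x\<in>A in lborel. \<bar>f x\<bar> \<le> M)"

definition compactly_supported_in :: "'a::euclidean_space set \<Rightarrow> ('a \<Rightarrow> real) \<Rightarrow> bool" where
  "compactly_supported_in A f \<longleftrightarrow>
     (\<exists>K. compact K \<and> K \<subseteq> A \<and> (AE x\<in>A in lborel. x \<notin> K \<longrightarrow> f x = 0))"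


section \<open>Fourier transform and Sobolev spaces\<close>

definition fourier_integral :: "('a::euclidean_space \<Rightarrow> real) \<Rightarrow> 'a \<Rightarrow> complex" where
  "fourier_integral u \<xi> = (CLINT x|lborel. cis (- (x \<bullet> \<xi>)) * complex_of_real (u x))"

text \<open>
  The Fourier transform of \<open>u \<in> L\<^sup>2\<close> is the \<open>L\<^sup>2\<close> limit, as \<open>R\<close> tends to infinity, of the transforms
  of the integrable functions obtained by truncating \<open>u\<close> to balls of radius \<open>R\<close>.
\<close>

definition has_fourier :: "('a::euclidean_space \<Rightarrow> real) \<Rightarrow> ('a \<Rightarrow> complex) \<Rightarrow> bool" where
  "has_fourier u g \<longleftrightarrow> square_integrable_on UNIV u \<and> square_integrable_on UNIV g \<and>
     ((\<lambda>R. \<integral>\<^sup>+\<xi>. ennreal ((cmod (g \<xi> - fourier_integral (\<lambda>x. indicator (cball 0 R) x * u x) \<xi>))\<^sup>2)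
             \<partial>lborel) \<longlongrightarrow> 0) at_top"

definition fourier :: "('a::euclidean_space \<Rightarrow> real) \<Rightarrow> 'a \<Rightarrow> complex" where
  "fourier u = (SOME g. has_fourier u g)"

definition sobolev_weighted_fourier ::
    "real \<Rightarrow> ('a::euclidean_space \<Rightarrow> real) \<Rightarrow> 'a \<Rightarrow> complex" where
  "sobolev_weighted_fourier r u \<xi> = ((1 + (norm \<xi>)\<^sup>2) powr (r / 2)) *\<^sub>R fourier u \<xi>"

text \<open>
  Only orders \<open>r \<ge> 0\<close> are needed; for these the elements of \<open>H\<^sup>r\<close> are functions in \<open>L\<^sup>2\<close>, and no
  tempered distributions are involved.
\<close>

definition sobolev :: "real \<Rightarrow> ('a::euclidean_space \<Rightarrow> real) set" where
  "sobolev r = {u. square_integrable_on UNIV u \<and>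
                   square_integrable_on UNIV (sobolev_weighted_fourier r u)}"

definition sobolev_norm :: "real \<Rightarrow> ('a::euclidean_space \<Rightarrow> real) \<Rightarrow> real" where
  "sobolev_norm r u = sqrt (LINT \<xi>|lborel. (cmod (sobolev_weighted_fourier r u \<xi>))\<^sup>2)"

definition sobolev_tilde :: "real \<Rightarrow> 'a::euclidean_space set \<Rightarrow> ('a \<Rightarrow> real) set" where
  "sobolev_tilde r U =
     {f \<in> sobolev r. \<forall>\<epsilon>>0. \<exists>\<phi>\<in>test_functions U. sobolev_norm r (\<lambda>x. f x - \<phi> x) < \<epsilon>}"


section \<open>Fractional Laplacians\<close>

definition frac_laplacian :: "real \<Rightarrow> ('a::euclidean_space \<Rightarrow> real) \<Rightarrow> 'a \<Rightarrow> real" where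
  "frac_laplacian a u = (SOME g. has_fourier g (\<lambda>\<xi>. (norm \<xi> powr (2 * a)) *\<^sub>R fourier u \<xi>))"

text \<open>
  The constant \<open>C\<^bsub>n,a\<^esub>\<close>; the dimension \<open>n\<close> is passed as a type. The limit is the principal value, and
  it is taken for almost every \<open>x\<close> because \<^term>\<open>frac_laplacian a u\<close> is an \<open>L\<^sup>2\<close> representative.
\<close>

definition frac_constant :: "'a::euclidean_space itself \<Rightarrow> real \<Rightarrow> real" where
  "frac_constant _ a = (THE c. 0 < c \<and>
     (\<forall>u\<in>(schwartz_functions :: ('a \<Rightarrow> real) set). AE x in lborel.
        ((\<lambda>\<epsilon>. c * (LINT y:{y. \<epsilon> < dist x y}|lborel.
                      (u x - u y) / norm (x - y) powr (real DIM('a) + 2 * a)))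
           \<longlongrightarrow> frac_laplacian a u x) (at_right 0)))"

definition regional_form ::
    "'a::euclidean_space set \<Rightarrow> real \<Rightarrow> ('a \<Rightarrow> real) \<Rightarrow> ('a \<Rightarrow> real) \<Rightarrow> real" where
  "regional_form \<Omega> a u v = frac_constant TYPE('a) a / 2 *
     (LINT x:\<Omega>|lborel. LINT y:\<Omega>|lborel.
        (u x - u y) * (v x - v y) / norm (x - y) powr (real DIM('a) + 2 * a))"

text \<open>
  The weakly defined regional fractional Laplacian of \<open>u\<close>, as an element of \<open>L\<^sup>2(\<Omega>)\<close>. Only the values
  of \<open>u\<close> on \<open>\<Omega>\<close> matter.
\<close>

definition regional_frac_laplacian ::
    "'a::euclidean_space set \<Rightarrow> real \<Rightarrow> ('a \<Rightarrow> real) \<Rightarrow> 'a \<Rightarrow> real" where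
  "regional_frac_laplacian \<Omega> a u = (SOME g. square_integrable_on \<Omega> g \<and>
     (\<forall>v\<in>test_functions \<Omega>. (LINT x:\<Omega>|lborel. g x * v x) = regional_form \<Omega> a u v))"


section \<open>The exterior value problem and its Cauchy data\<close>

definition weak_solution ::
    "'a::euclidean_space set \<Rightarrow> real \<Rightarrow> real \<Rightarrow> ('a \<Rightarrow> real) \<Rightarrow> ('a \<Rightarrow> real) \<Rightarrow>
     ('a \<Rightarrow> real) \<Rightarrow> ('a \<Rightarrow> real) \<Rightarrow> bool" where
  "weak_solution \<Omega> s t b q f u \<longleftrightarrow>
     u \<in> sobolev t \<and> (AE x\<in>exterior \<Omega> in lborel. u x = f x) \<and>
     (\<forall>\<phi>\<in>test_functions \<Omega>.
        (LINT x|lborel. frac_laplacian (t / 2) u x * frac_laplacian (t / 2) \<phi> x) +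
        (LINT x:\<Omega>|lborel. b x * regional_frac_laplacian \<Omega> (s / 2) u x *
                                 regional_frac_laplacian \<Omega> (s / 2) \<phi> x) +
        (LINT x:\<Omega>|lborel. q x * u x * \<phi> x) = 0)"

definition eigenvalue_condition ::
    "'a::euclidean_space set \<Rightarrow> real \<Rightarrow> real \<Rightarrow> ('a \<Rightarrow> real) \<Rightarrow> ('a \<Rightarrow> real) \<Rightarrow> bool" where
  "eigenvalue_condition \<Omega> s t b q \<longleftrightarrow>
     (\<forall>\<phi>. weak_solution \<Omega> s t b q (\<lambda>_. 0) \<phi> \<longrightarrow> (AE x in lborel. \<phi> x = 0))"

definition solution ::
    "'a::euclidean_space set \<Rightarrow> real \<Rightarrow> real \<Rightarrow> ('a \<Rightarrow> real) \<Rightarrow> ('a \<Rightarrow> real) \<Rightarrow>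
     ('a \<Rightarrow> real) \<Rightarrow> 'a \<Rightarrow> real" where
  "solution \<Omega> s t b q f = (SOME u. weak_solution \<Omega> s t b q f u)"

definition neumann_data ::
    "'a::euclidean_space set \<Rightarrow> real \<Rightarrow> real \<Rightarrow> ('a \<Rightarrow> real) \<Rightarrow> ('a \<Rightarrow> real) \<Rightarrow>
     ('a \<Rightarrow> real) \<Rightarrow> 'a \<Rightarrow> real" where
  "neumann_data \<Omega> s t b q f x = frac_constant TYPE('a) t *
     (LINT y:\<Omega>|lborel. (solution \<Omega> s t b q f x - solution \<Omega> s t b q f y) /
                         norm (x - y) powr (real DIM('a) + 2 * t))"

text \<open>
  The second component is the a.e. class on \<open>W'\<close> of the Neumann data: the set contains all of its
  Borel representatives \<open>g\<close>, with arbitrary values off \<open>W'\<close>. Equality of two such sets is therefore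
  equality of the corresponding sets of classes.
\<close>

definition cauchy_data ::
    "'a::euclidean_space set \<Rightarrow> real \<Rightarrow> real \<Rightarrow> ('a \<Rightarrow> real) \<Rightarrow> ('a \<Rightarrow> real) \<Rightarrow>
     'a set \<Rightarrow> 'a set \<Rightarrow> (('a \<Rightarrow> real) \<times> ('a \<Rightarrow> real)) set" where
  "cauchy_data \<Omega> s t b q W W' =
     {(f, g). f \<in> sobolev_tilde t W \<and> g \<in> borel_measurable lborel \<and>
              (AE x\<in>W' in lborel. g x = neumann_data \<Omega> s t b q f x)}"

end

theory Submission
 imports Defs "HOL-Probability.Characteristic_Functions" "HOL-Complex_Analysis.Great_Picard"
begin

text \<open>
 Write \<open>R u\<close> for the regional Laplacian of order \<open>s\<close> of \<open>u\<close>. Test functions in \<open>W\<close> suffice as exterior data.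

 The Neumann data of two solutions with the same exterior data \<open>f\<close> differ by the potential
 \<open>\<integral> w y / norm (x - y) powr (n + 2 t) dy\<close> of their difference \<open>w\<close>, which lives in the domain. A Riesz
 potential of a function on a compact set determines the function by its values on any open set
 away from it (\<open>riesz_unique_continuation\<close>): differentiating the kernel yields, after an
 inversion, all moments of the function. Hence equal Cauchy data give equal solutions
 (\<open>common_solution\<close>).

 Put \<open>b = b\<^sub>1 - b\<^sub>2\<close> and \<open>q = q\<^sub>1 - q\<^sub>2\<close>, with support in a compact set \<open>K\<close>. Subtracting the two equations gives
 \<open>\<integral> b R u R phi + \<integral> q u phi = 0\<close> for all test functions \<open>phi\<close>. If \<open>phi\<close> lives in a ball away from \<open>K\<close>, only
 the first term survives and \<open>R phi\<close> is on \<open>K\<close> a Riesz potential of \<open>phi\<close>; so \<open>b R u\<close> has vanishing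
 potential in the ball, and \<open>b R u = 0\<close>, whence also \<open>q u = 0\<close> (\<open>coefficients_annihilate\<close>).

 Finally let \<open>E\<close> be the set where \<open>q\<close> (or \<open>b\<close>) does not vanish. The functional \<open>phi \<mapsto> \<integral>\<^sub>E phi\<close> (or \<open>\<integral>\<^sub>E R phi\<close>)
 annihilates every solution with data in \<open>W\<close>. Represent it by the form of the first equation and an
 adjoint solution \<open>v\<close>; then the potential of \<open>v\<close> vanishes in \<open>W\<close>, so \<open>v = 0\<close> and the functional is zero
 (\<open>runge\<close>). For \<open>q\<close> this says that \<open>E\<close> is a null set; for \<open>b\<close> it says that the indicator of \<open>E\<close> has vanishing
 potential in a ball, which again makes \<open>E\<close> a null set.

 The analytic input is the following. The form has a Garding inequality, since \<open>R\<close> is of lower order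
 on \<open>K\<close>, and the eigenvalue condition makes it injective, so it is solvable (\<open>fredholm\<close>). The Gagliardo
 double integral equals the Fourier energy (\<open>gagliardo_energy\<close>), and so the constant of the principal
 value is positive (\<open>frac_constant_eq\<close>). Removing from it the part off \<open>Om \<times> Om\<close> exhibits \<open>R u\<close> as
 the restricted Laplacian minus a multiple of the density \<open>killing s\<close>; Hardy's inequality, the only
 place that uses the Lipschitz boundary beyond its measure zero, keeps this in \<open>L\<^sup>2\<close>.
\<close>

section \<open>Notation\<close>

text \<open>Integrals and null sets without a named measure refer to Lebesgue measure.\<close>

abbreviation "Borel \<equiv> borel_measurable borel"
abbreviation "L1 \<equiv> integrable lborel"
abbreviation "lborel2 \<equiv> lborel \<Otimes>\<^sub>M lborel"
abbreviation Nint (binder "NN " 10) where "Nint f \<equiv> nn_integral lborel f"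
abbreviation Lint (binder "LI " 10) where "Lint f \<equiv> integral\<^sup>L lborel f"
abbreviation AElborel (binder "ae " 10) where "AElborel P \<equiv> almost_everywhere lborel P"
abbreviation "cplx \<equiv> complex_of_real"
abbreviation "\<Lambda> t \<equiv> frac_laplacian (t / 2)"
notation LIMSEQ (infixr "---->" 55)
notation tendsto (infixr "--->" 55)

text \<open>The unqualified names belong to the Henstock-Kurzweil integral.\<close>

lemmas L1_integrable_bound = Bochner_Integration.integrable_bound
lemmas L1_integral_cong = Bochner_Integration.integral_cong
lemmas L1_integral_add = Bochner_Integration.integral_add
lemmas L1_integrable_add = Bochner_Integration.integrable_add
lemmas L1_integral_diff = Bochner_Integration.integral_diff
lemmas L1_integral_sum = Bochner_Integration.integral_sum
lemmas L1_integral_cnj = Bochner_Integration.integral_cnj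
lemmas L1_integrable_diff = Bochner_Integration.integrable_diff

section \<open>Symmetric forms with a Garding inequality\<close>

lemma quadratic_nonneg_imp_discriminant:
 fixes a b c :: real
 assumes "!!r. 0 <= a * r\<^sup>2 + 2 * b * r + c" and a: "0 <= a"
 shows "b\<^sup>2 <= a * c"
proof (cases "a = 0")
 case True
 have "b = 0"
 proof (rule ccontr)
  assume "b ~= 0"
  then show False using assms(1)[of "- (c + 1) / (2 * b)"] True by (simp add: field_simps)
 qed
 then show ?thesis using True by simp
next
 case False
 then have "a > 0" using a by simp
 have "0 <= a * (- b / a)\<^sup>2 + 2 * b * (- b / a) + c" by (rule assms(1))
 also have "... = c - b\<^sup>2 / a" using \<open>a > 0\<close> by (simp add: field_simps power2_eq_square)
 finally show ?thesis using \<open>a > 0\<close> by (simp add: field_simps)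
qed

text \<open>Functions are not identified almost everywhere: \<open>ip\<close> is semidefinite, and limits are not unique.\<close>

locale semi_hilbert =
 fixes X :: "('a => real) set" and ip :: "('a => real) => ('a => real) => real"
 assumes nonempty: "X ~= {}"
  and lincomb: "u \<in> X ==> v \<in> X ==> (%x. a * u x + b * v x) \<in> X"
  and sym: "u \<in> X ==> v \<in> X ==> ip u v = ip v u"
  and lin: "u \<in> X ==> v \<in> X ==> w \<in> X ==>
        ip (%x. a * u x + b * v x) w = a * ip u w + b * ip v w"
  and nonneg: "u \<in> X ==> 0 <= ip u u"
  and complete: "(!!n. f n \<in> X) ==>
   (!!e. 0 < e ==> \<exists>N. \<forall>m\<ge>N. \<forall>n\<ge>N. ip (%x. f m x - f n x) (%x. f m x - f n x) < e) ==>
   \<exists>l\<in>X. (%n::nat. ip (%x. f n x - l x) (%x. f n x - l x)) ----> 0"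
begin

lemma diff_mem: "u \<in> X ==> v \<in> X ==> (%x. u x - v x) \<in> X"
 using lincomb[of u v 1 "-1"] by simp

lemma scale_mem: "u \<in> X ==> (%x. a * u x) \<in> X"
 using lincomb[of u u a 0] by simp

lemma lin_right: "u \<in> X ==> v \<in> X ==> w \<in> X ==>
  ip w (%x. a * u x + b * v x) = a * ip w u + b * ip w v"
 using sym lin lincomb by (metis (no_types, lifting))

lemma ip_diff_left: "u \<in> X ==> v \<in> X ==> w \<in> X ==> ip (%x. u x - v x) w = ip u w - ip v w"
 using lin[of u v w 1 "-1"] by simp

lemma ip_scale_left: "u \<in> X ==> w \<in> X ==> ip (%x. a * u x) w = a * ip u w"
 using lin[of u u w a 0] by simp

lemma ip_square_lincomb: "u \<in> X ==> v \<in> X ==>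
  ip (%x. a * u x + b * v x) (%x. a * u x + b * v x) =
   a\<^sup>2 * ip u u + 2 * a * b * ip u v + b\<^sup>2 * ip v v"
 using sym[of u v]
 by (simp add: lin lin_right lincomb algebra_simps power2_eq_square)

lemma ip_square_diff: "u \<in> X ==> v \<in> X ==>
  ip (%x. u x - v x) (%x. u x - v x) = ip u u - 2 * ip u v + ip v v"
 using ip_square_lincomb[of u v 1 "-1"] by simp

lemma cauchy_schwarz:
 assumes "u \<in> X" "v \<in> X"
 shows "(ip u v)\<^sup>2 <= ip u u * ip v v"
proof (rule quadratic_nonneg_imp_discriminant)
 fix r
 have "0 <= ip (%x. r * u x + 1 * v x) (%x. r * u x + 1 * v x)"
  by (rule nonneg[OF lincomb[OF assms]])
 then show "0 <= ip u u * r\<^sup>2 + 2 * ip u v * r + ip v v"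
  unfolding ip_square_lincomb[OF assms] by (simp add: algebra_simps)
qed (use assms nonneg in auto)

lemma ip_tendsto:
 assumes f: "!!n. f n \<in> X" and l: "l \<in> X" and v: "v \<in> X"
  and lim: "(%n::nat. ip (%x. f n x - l x) (%x. f n x - l x)) ----> 0"
 shows "(%n. ip (f n) v) ----> ip l v"
proof -
 have "(%n. (ip (f n) v - ip l v)\<^sup>2) ----> 0"
 proof (rule Lim_null_comparison)
  have "(ip (f n) v - ip l v)\<^sup>2 <= ip (%x. f n x - l x) (%x. f n x - l x) * ip v v" for n
   using cauchy_schwarz[OF diff_mem[OF f l] v, of n] by (simp add: ip_diff_left f l v)
  then show "\<forall>\<^sub>F n in sequentially. norm ((ip (f n) v - ip l v)\<^sup>2)
    <= ip (%x. f n x - l x) (%x. f n x - l x) * ip v v" by simp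
  show "(%n. ip (%x. f n x - l x) (%x. f n x - l x) * ip v v) ----> 0"
   using tendsto_mult_right[OF lim, of "ip v v"] by simp
 qed
 then have "(%n. sqrt ((ip (f n) v - ip l v)\<^sup>2)) ----> sqrt 0" by (rule tendsto_real_sqrt)
 then have "(%n. ip (f n) v - ip l v) ----> 0" by (simp add: tendsto_rabs_zero_iff)
 then show ?thesis by (simp add: LIM_zero_iff)
qed

text \<open>
 The representing element minimises \<open>ip u u - 2 * F u\<close>; the parallelogram identity makes every
 minimising sequence a Cauchy sequence.
\<close>

theorem riesz_representation:
 assumes F_lin: "!!u v a b. u \<in> X ==> v \<in> X ==> F (%x. a * u x + b * v x) = a * F u + b * F v"
  and F_bound: "!!u. u \<in> X ==> (F u)\<^sup>2 <= C * ip u u"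
 shows "\<exists>g\<in>X. \<forall>v\<in>X. F v = ip g v"
proof -
 define J where "J u = ip u u - 2 * F u" for u
 define m where "m = Inf (J ` X)"
 have C_nonneg: "0 <= C" if "u \<in> X" "ip u u > 0" for u
  using F_bound[OF that(1)] that(2) zero_le_power2[of "F u"] by (metis order_trans zero_le_mult_iff not_le)
 have J_lower: "- \<bar>C\<bar> <= J u" if u: "u \<in> X" for u
 proof -
  have "(F u)\<^sup>2 <= \<bar>C\<bar> * ip u u"
   using F_bound[OF u] nonneg[OF u] by (meson abs_ge_self mult_right_mono order_trans)
  moreover have "4 * (\<bar>C\<bar> * ip u u) <= (\<bar>C\<bar> + ip u u)\<^sup>2"
   using zero_le_power2[of "\<bar>C\<bar> - ip u u"] by (simp add: power2_eq_square algebra_simps)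
  ultimately have "(2 * F u)\<^sup>2 <= (\<bar>C\<bar> + ip u u)\<^sup>2" by (simp add: power_mult_distrib)
  then have "2 * F u <= \<bar>C\<bar> + ip u u"
   using nonneg[OF u] by (metis abs_ge_zero add_nonneg_nonneg power2_le_imp_le)
  then show ?thesis unfolding J_def by simp
 qed
 have bdd: "bdd_below (J ` X)" using J_lower by (auto intro!: bdd_belowI2)
 have m_le: "m <= J u" if "u \<in> X" for u
  unfolding m_def using bdd that by (auto intro: cInf_lower)
 have "\<exists>u\<in>X. J u < m + 1 / (real n + 1)" for n
 proof -
  have "Inf (J ` X) < m + 1 / (real n + 1)" unfolding m_def by simp
  then show ?thesis using cInf_lessD[of "J ` X"] nonempty by auto
 qed
 then obtain f where f: "!!n. f n \<in> X" "!!n. J (f n) < m + 1 / (real n + 1)"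
  by metis
 have par: "ip (%x. u x - v x) (%x. u x - v x) <= 2 * (J u - m) + 2 * (J v - m)"
  if u: "u \<in> X" and v: "v \<in> X" for u v
  using m_le[OF lincomb[OF u v, of "1/2" "1/2"]] u v
  unfolding J_def ip_square_lincomb[OF u v] ip_square_diff[OF u v] F_lin[OF u v]
  by (simp add: power2_eq_square)
 have "\<exists>l\<in>X. (%n. ip (%x. f n x - l x) (%x. f n x - l x)) ----> 0"
 proof (rule complete[OF f(1)])
  fix e :: real assume "0 < e"
  then obtain N where N: "4 / e < real N" using reals_Archimedean2 by blast
  show "\<exists>N. \<forall>m\<ge>N. \<forall>n\<ge>N. ip (%x. f m x - f n x) (%x. f m x - f n x) < e"
  proof (intro exI allI impI)
   fix i j assume "N <= i" "N <= j"
   have small: "4 * (J (f k) - m) < e" if "N <= k" for k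
   proof -
    have "4 / e < real k + 1" using N that by linarith
    then have "4 * (1 / (real k + 1)) < e" using \<open>0 < e\<close> by (simp add: field_simps)
    moreover have "J (f k) - m < 1 / (real k + 1)" using f(2)[of k] by linarith
    ultimately show ?thesis
     by (metis (no_types, opaque_lifting) mult_less_cancel_left_pos order_less_trans zero_less_numeral)
   qed
   show "ip (%x. f i x - f j x) (%x. f i x - f j x) < e"
    by (rule order.strict_trans1[OF par[OF f(1) f(1)]])
     (use small[OF \<open>N <= i\<close>] small[OF \<open>N <= j\<close>] in \<open>simp add: algebra_simps\<close>)
  qed
 qed
 then obtain l where l: "l \<in> X" and lim: "(%n. ip (%x. f n x - l x) (%x. f n x - l x)) ----> 0"
  by blast
 have "F v = ip l v" if v: "v \<in> X" for v
 proof -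
  have "0 <= ip v v * r\<^sup>2 + 2 * (ip l v - F v) * r + 0" for r
  proof (rule LIMSEQ_le)
   have "(%n. 1 / (real n + 1)) ----> 0"
    using LIMSEQ_inverse_real_of_nat by (simp add: inverse_eq_divide add.commute)
   then show "(%n. ip v v * r\<^sup>2 + 2 * (ip (f n) v - F v) * r + 1 / (real n + 1))
     ----> ip v v * r\<^sup>2 + 2 * (ip l v - F v) * r + 0"
    by (intro tendsto_intros ip_tendsto f l v lim)
   show "(%n::nat. 0) ----> (0::real)" by simp
   have "0 <= ip v v * r\<^sup>2 + 2 * (ip (f n) v - F v) * r + 1 / (real n + 1)" for n
    using m_le[OF lincomb[OF f(1) v, of 1 n r]] f(2)[of n]
    unfolding J_def ip_square_lincomb[OF f(1) v] F_lin[OF f(1) v]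
    by (simp add: algebra_simps)
   then show "\<exists>N. \<forall>n\<ge>N. 0 <= ip v v * r\<^sup>2 + 2 * (ip (f n) v - F v) * r + 1 / (real n + 1)"
    by blast
  qed
  then have "(ip l v - F v)\<^sup>2 <= ip v v * 0"
   by (rule quadratic_nonneg_imp_discriminant) (use nonneg v in auto)
  then show ?thesis by simp
 qed
 then show ?thesis using l by blast
qed

end

text \<open>\<open>B\<close> is coercive up to a compact term, and injective: the Fredholm alternative with trivial kernel.\<close>

locale symmetric_garding_form = semi_hilbert +
 fixes B :: "('a => real) => ('a => real) => real" and Q :: "('a => real) => real" and M c :: real
 assumes B_lin: "u \<in> X ==> v \<in> X ==> w \<in> X ==>
        B (%x. a * u x + b * v x) w = a * B u w + b * B v w"
  and B_sym: "u \<in> X ==> v \<in> X ==> B u v = B v u"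
  and B_bound: "u \<in> X ==> v \<in> X ==> (B u v)\<^sup>2 <= M * ip u u * ip v v"
  and garding: "0 < c" "u \<in> X ==> c * ip u u <= \<bar>B u u\<bar> + Q u"
  and Q_compact: "(!!n::nat. f n \<in> X) ==> (!!n. ip (f n) (f n) <= 1) ==>
   \<exists>r::nat => nat. strict_mono r \<and> (\<forall>e>0. \<exists>N. \<forall>i\<ge>N. \<forall>j\<ge>N. Q (%x. f (r i) x - f (r j) x) < e)"
  and B_injective: "u \<in> X ==> (!!v. v \<in> X ==> B u v = 0) ==> ip u u = 0"
begin

lemma B_diff: "u \<in> X ==> v \<in> X ==> w \<in> X ==> B (%x. u x - v x) w = B u w - B v w"
 using B_lin[of u v w 1 "-1"] by simp

lemma operator_ex: "\<exists>A. \<forall>u\<in>X. A u \<in> X \<and> (\<forall>v\<in>X. B u v = ip (A u) v)"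
proof -
 have "\<exists>g\<in>X. \<forall>v\<in>X. B u v = ip g v" if "u \<in> X" for u
 proof (rule riesz_representation[where C = "M * ip u u"])
  show "B u (%x. a * v x + b * w x) = a * B u v + b * B u w" if "v \<in> X" "w \<in> X" for v w a b
   using B_sym B_lin lincomb that \<open>u \<in> X\<close> by (metis (no_types, lifting))
 qed (use B_bound that in auto)
 then show ?thesis by metis
qed

text \<open>
 Otherwise normalised elements \<open>f n\<close> with \<open>A (f n)\<close> tending to zero would, along a subsequence that
 is Cauchy for \<open>Q\<close>, be Cauchy by the inequality \<open>garding\<close>, and their limit would be a nonzero
 element of the kernel.
\<close>

lemma bounded_below:
 assumes A: "!!u. u \<in> X ==> A u \<in> X" "!!u v. u \<in> X ==> v \<in> X ==> B u v = ip (A u) v"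
 shows "\<exists>delta>0. \<forall>u\<in>X. delta * ip u u <= ip (A u) (A u)"
proof (rule ccontr)
 assume neg: "\<not> ?thesis"
 have "\<exists>u g. u \<in> X \<and> g \<in> X \<and> ip u u = 1 \<and> ip g g < 1 / (real n + 1) \<and> (\<forall>v\<in>X. B u v = ip g v)" for n
 proof -
  have "1 / (real n + 1) > 0" by simp
  with neg obtain u where u: "u \<in> X" and less: "ip (A u) (A u) < 1 / (real n + 1) * ip u u"
   by (meson not_le)
  then have "0 < ip u u"
   using nonneg[OF A(1)[OF u]] by (smt (verit) \<open>1 / (real n + 1) > 0\<close> mult_nonneg_nonpos nonneg)
  define k where "k = 1 / sqrt (ip u u)"
  have k2: "k * k = 1 / ip u u" using \<open>0 < ip u u\<close> by (simp add: k_def)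
  have "ip (%x. k * u x) (%x. k * u x) = 1"
   using ip_square_lincomb[OF u u, of k 0] k2 \<open>0 < ip u u\<close> by (simp add: power2_eq_square)
  moreover have "ip (%x. k * A u x) (%x. k * A u x) = ip (A u) (A u) / ip u u"
   using ip_square_lincomb[OF A(1) A(1), OF u u, of k 0] k2 by (simp add: power2_eq_square)
  moreover have "ip (A u) (A u) / ip u u < 1 / (real n + 1)"
   using \<open>0 < ip u u\<close> less by (simp add: pos_divide_less_eq)
  moreover have "B (%x. k * u x) v = ip (%x. k * A u x) v" if "v \<in> X" for v
   using B_lin[OF u u that, of k 0] ip_scale_left[OF A(1)[OF u] that] A(2)[OF u that] by simp
  ultimately show ?thesis using u A(1)[OF u] scale_mem by metis
 qed
 then obtain f g where fg: "!!n. f n \<in> X" "!!n. g n \<in> X" "!!n. ip (f n) (f n) = 1"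
   "!!n. ip (g n) (g n) < 1 / (real n + 1)" "!!n v. v \<in> X ==> B (f n) v = ip (g n) v"
  by metis
 obtain r where r: "strict_mono (r :: nat => nat)"
   and Qr: "!!e. 0 < e ==> \<exists>N. \<forall>i\<ge>N. \<forall>j\<ge>N. Q (%x. f (r i) x - f (r j) x) < e"
  using Q_compact[of f] fg by auto
 have g_lim: "(%n. ip (g (r n)) (g (r n))) ----> 0"
 proof (rule LIMSEQ_subseq_LIMSEQ[OF _ r, of "%n. ip (g n) (g n)", unfolded o_def])
  show "(%n. ip (g n) (g n)) ----> 0"
  proof (rule Lim_null_comparison)
   show "\<forall>\<^sub>F n in sequentially. norm (ip (g n) (g n)) <= 1 / (real n + 1)"
    using fg(4) nonneg[OF fg(2)] by (simp add: less_imp_le)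
   show "(%n. 1 / (real n + 1)) ----> 0"
    using LIMSEQ_inverse_real_of_nat by (simp add: inverse_eq_divide add.commute)
  qed
 qed
 have gip: "\<bar>ip (g n) v\<bar> <= sqrt (ip (g n) (g n)) * sqrt (ip v v)" if "v \<in> X" for n v
  using real_sqrt_le_mono[OF cauchy_schwarz[OF fg(2) that]] by (simp add: real_sqrt_mult)
 have "\<exists>l\<in>X. (%n. ip (%x. f (r n) x - l x) (%x. f (r n) x - l x)) ----> 0"
 proof (rule complete[OF fg(1)])
  fix e :: real assume e: "0 < e"
  obtain N1 where N1: "!!i j. i >= N1 ==> j >= N1 ==> Q (%x. f (r i) x - f (r j) x) < c * e / 2"
   using Qr[of "c * e / 2"] garding(1) e by auto
  have "(%n. sqrt (ip (g (r n)) (g (r n)))) ----> sqrt 0" by (rule tendsto_real_sqrt[OF g_lim])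
  then have "\<forall>\<^sub>F n in sequentially. sqrt (ip (g (r n)) (g (r n))) < c * e / 8"
   using garding(1) e by (intro order_tendstoD(2)[of _ 0]) auto
  then obtain N2 where N2: "!!n. n >= N2 ==> sqrt (ip (g (r n)) (g (r n))) < c * e / 8"
   unfolding eventually_sequentially by blast
  show "\<exists>N. \<forall>m\<ge>N. \<forall>n\<ge>N. ip (%x. f (r m) x - f (r n) x) (%x. f (r m) x - f (r n) x) < e"
  proof (intro exI[of _ "max N1 N2"] allI impI)
   fix i j assume ij: "max N1 N2 <= i" "max N1 N2 <= j"
   let ?d = "%x. f (r i) x - f (r j) x"
   have d: "?d \<in> X" by (rule diff_mem[OF fg(1) fg(1)])
   have "ip ?d ?d + ip (%x. 1 * f (r i) x + 1 * f (r j) x) (%x. 1 * f (r i) x + 1 * f (r j) x) = 4"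
    unfolding ip_square_diff[OF fg(1) fg(1)] ip_square_lincomb[OF fg(1) fg(1)] using fg(3) by simp
   then have "ip ?d ?d <= 4"
    using nonneg[OF lincomb[OF fg(1) fg(1), of 1 "r i" 1 "r j"]] by linarith
   then have sd: "sqrt (ip ?d ?d) <= 2" using real_sqrt_le_mono[of "ip ?d ?d" 4] by simp
   have b: "\<bar>ip (g (r k)) ?d\<bar> < c * e / 4" if "k >= N2" for k
   proof -
    have "\<bar>ip (g (r k)) ?d\<bar> <= sqrt (ip (g (r k)) (g (r k))) * 2"
     by (rule order_trans[OF gip[OF d]], rule mult_left_mono[OF sd]) (simp add: nonneg fg)
    then show ?thesis using N2[OF that] by linarith
   qed
   have "\<bar>B ?d ?d\<bar> < c * e / 2"
    using b[of i] b[of j] ij abs_triangle_ineq4[of "ip (g (r i)) ?d" "ip (g (r j)) ?d"]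
    by (simp add: B_diff fg d)
   then have "c * ip ?d ?d < c * e"
    using garding(2)[OF d] N1[of i j] ij by linarith
   then show "ip ?d ?d < e" using garding(1) by simp
  qed
 qed
 then obtain l where l: "l \<in> X"
  and lim: "(%n. ip (%x. f (r n) x - l x) (%x. f (r n) x - l x)) ----> 0" by blast
 have "ip l l = 0"
 proof (rule B_injective[OF l])
  fix v assume v: "v \<in> X"
  have "(%n. ip (f (r n)) (A v)) ----> ip l (A v)"
   by (rule ip_tendsto[OF fg(1) l A(1)[OF v] lim])
  moreover have "ip (f (r n)) (A v) = ip (g (r n)) v" for n
   using fg A v sym B_sym by metis
  moreover have "(%n. ip (g (r n)) v) ----> 0"
  proof (rule Lim_null_comparison)
   show "\<forall>\<^sub>F n in sequentially. norm (ip (g (r n)) v) <= sqrt (ip (g (r n)) (g (r n))) * sqrt (ip v v)"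
    using gip[OF v] by simp
   show "(%n. sqrt (ip (g (r n)) (g (r n))) * sqrt (ip v v)) ----> 0"
    using tendsto_mult_right[OF tendsto_real_sqrt[OF g_lim], of "sqrt (ip v v)"] by simp
  qed
  ultimately have "ip l (A v) = 0" by (simp add: LIMSEQ_unique)
  then show "B l v = 0" using A v l sym B_sym by metis
 qed
 have "(%n. 1 - 2 * ip (f (r n)) l + ip l l) ----> 1 - 2 * ip l l + ip l l"
  by (intro tendsto_intros ip_tendsto fg l lim)
 moreover have "(%n. 1 - 2 * ip (f (r n)) l + ip l l) ----> 0"
  using lim unfolding ip_square_diff[OF fg(1) l] fg(3) .
 ultimately have "1 - 2 * ip l l + ip l l = 0" by (rule LIMSEQ_unique)
 then show False using \<open>ip l l = 0\<close> by simp
qed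

text \<open>
 With \<open>A\<close> the operator of \<open>B\<close>, the form \<open>ip (A u) (A v)\<close> is again complete. Representing
 \<open>B g\<close> by it, where \<open>g\<close> represents \<open>F\<close>, gives \<open>v\<close> with \<open>A v - g\<close> in the kernel of \<open>B\<close>.
\<close>

theorem solvable:
 assumes F_lin: "!!u v a b. u \<in> X ==> v \<in> X ==> F (%x. a * u x + b * v x) = a * F u + b * F v"
  and F_bound: "!!u. u \<in> X ==> (F u)\<^sup>2 <= C * ip u u"
 shows "\<exists>v\<in>X. \<forall>w\<in>X. B v w = F w"
proof -
 obtain A where A: "!!u. u \<in> X ==> A u \<in> X" "!!u v. u \<in> X ==> v \<in> X ==> B u v = ip (A u) v"
  using operator_ex by metis
 obtain delta where delta: "delta > 0" "!!u. u \<in> X ==> delta * ip u u <= ip (A u) (A u)"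
  using bounded_below[OF A] by auto
 have A_bound: "ip (A u) (A u) <= \<bar>M\<bar> * ip u u" if u: "u \<in> X" for u
 proof -
  have "(ip (A u) (A u))\<^sup>2 <= M * ip u u * ip (A u) (A u)"
   using B_bound[OF u A(1)[OF u]] A(2)[OF u A(1)[OF u]] by simp
  also have "... <= \<bar>M\<bar> * ip u u * ip (A u) (A u)"
   by (intro mult_right_mono nonneg u A) auto
  finally have "ip (A u) (A u) * ip (A u) (A u) <= (\<bar>M\<bar> * ip u u) * ip (A u) (A u)"
   by (simp add: power2_eq_square)
  then show ?thesis
   using nonneg[OF A(1)[OF u]] nonneg[OF u]
   by (metis abs_ge_zero mult_le_cancel_right mult_nonneg_nonneg order_le_less)
 qed
 define G where "G u v = ip (A u) (A v)" for u v
 have G_eq: "G u v = B u (A v)" if "u \<in> X" "v \<in> X" for u v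
  unfolding G_def using A that by simp
 interpret G: semi_hilbert X G
 proof
  show "X ~= {}" by (rule nonempty)
  show "(%x. a * u x + b * v x) \<in> X" if "u \<in> X" "v \<in> X" for u v a b by (rule lincomb[OF that])
  show "G u v = G v u" if "u \<in> X" "v \<in> X" for u v unfolding G_def using that A sym by simp
  show "G (%x. a * u x + b * v x) w = a * G u w + b * G v w" if "u \<in> X" "v \<in> X" "w \<in> X" for u v w a b
   using that by (simp add: G_eq lincomb B_lin A(1))
  show "0 <= G u u" if "u \<in> X" for u unfolding G_def using that A nonneg by simp
  fix f :: "nat => _"
  assume f: "!!n. f n \<in> X"
   and C: "!!e. 0 < e ==> \<exists>N. \<forall>m\<ge>N. \<forall>n\<ge>N. G (%x. f m x - f n x) (%x. f m x - f n x) < e"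
  have "\<exists>l\<in>X. (%n::nat. ip (%x. f n x - l x) (%x. f n x - l x)) ----> 0"
  proof (rule complete[OF f])
   fix e :: real assume "0 < e"
   then obtain N where N: "!!m n. m >= N ==> n >= N ==>
     G (%x. f m x - f n x) (%x. f m x - f n x) < delta * e"
    using C[of "delta * e"] delta(1) by auto
   have "ip (%x. f m x - f n x) (%x. f m x - f n x) < e" if "m >= N" "n >= N" for m n
    using N[OF that] delta(2)[OF diff_mem[OF f f], of m n] delta(1) unfolding G_def
    by (smt (verit) mult_less_cancel_left_pos)
   then show "\<exists>N. \<forall>m\<ge>N. \<forall>n\<ge>N. ip (%x. f m x - f n x) (%x. f m x - f n x) < e" by blast
  qed
  then obtain l where l: "l \<in> X" and lim: "(%n. ip (%x. f n x - l x) (%x. f n x - l x)) ----> 0"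
   by blast
  have "(%n. G (%x. f n x - l x) (%x. f n x - l x)) ----> 0"
  proof (rule Lim_null_comparison)
   show "\<forall>\<^sub>F n in sequentially. norm (G (%x. f n x - l x) (%x. f n x - l x))
     <= \<bar>M\<bar> * ip (%x. f n x - l x) (%x. f n x - l x)"
    unfolding G_def using A_bound[OF diff_mem[OF f l]] nonneg[OF A(1)[OF diff_mem[OF f l]]] by simp
   show "(%n. \<bar>M\<bar> * ip (%x. f n x - l x) (%x. f n x - l x)) ----> 0"
    using tendsto_mult_left[OF lim, of "\<bar>M\<bar>"] by simp
  qed
  then show "\<exists>l\<in>X. (%n. G (%x. f n x - l x) (%x. f n x - l x)) ----> 0" using l by blast
 qed
 obtain g where g: "g \<in> X" "!!w. w \<in> X ==> F w = ip g w"
  using riesz_representation[OF F_lin F_bound] by blast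
 have "\<exists>v\<in>X. \<forall>w\<in>X. B g w = G v w"
 proof (rule G.riesz_representation[where C = "\<bar>M\<bar> * ip g g / delta"])
  show "B g (%x. a * v x + b * w x) = a * B g v + b * B g w" if "v \<in> X" "w \<in> X" for v w a b
   using B_sym B_lin lincomb that g(1) by (metis (no_types, lifting))
  fix u assume u: "u \<in> X"
  have "(B g u)\<^sup>2 <= (\<bar>M\<bar> * ip g g) * ip u u"
   using B_bound[OF g(1) u] nonneg[OF g(1)] nonneg[OF u]
   by (smt (verit) mult_right_mono mult_nonneg_nonneg)
  also have "... <= (\<bar>M\<bar> * ip g g) * (G u u / delta)"
   using delta(2)[OF u] delta(1) nonneg[OF g(1)] unfolding G_def
   by (intro mult_left_mono) (auto simp: field_simps)
  finally show "(B g u)\<^sup>2 <= \<bar>M\<bar> * ip g g / delta * G u u" by simp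
 qed
 then obtain v where v: "v \<in> X" "!!w. w \<in> X ==> B g w = G v w" by blast
 let ?d = "%x. A v x - g x"
 have d: "?d \<in> X" by (rule diff_mem[OF A(1)[OF v(1)] g(1)])
 have "ip ?d ?d = 0"
 proof (rule B_injective[OF d])
  fix w assume w: "w \<in> X"
  have "B (A v) w = G v w" using v(1) w A G_eq G.sym B_sym by metis
  then show "B ?d w = 0" using v w g A(1) by (simp add: B_diff)
 qed
 have "B v w = F w" if w: "w \<in> X" for w
 proof -
  have "(ip ?d w)\<^sup>2 <= 0" using cauchy_schwarz[OF d w] \<open>ip ?d ?d = 0\<close> by simp
  then have "ip (A v) w = ip g w" using ip_diff_left[OF A(1)[OF v(1)] g(1) w] by simp
  then show ?thesis using A(2)[OF v(1) w] g(2)[OF w] by simp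
 qed
 then show ?thesis using v(1) by blast
qed

end

section \<open>Square integrable functions\<close>

definition L2 :: "('a::euclidean_space => 'b::euclidean_space) => bool" where
 "L2 f \<longleftrightarrow> f \<in> Borel \<and> L1 (%x. (norm (f x))\<^sup>2)"

definition sqint :: "('a::euclidean_space => 'b::euclidean_space) => real" where
 "sqint f = (LI x. (norm (f x))\<^sup>2)"

definition inner2 :: "('a::euclidean_space => 'b::euclidean_space) => ('a => 'b) => real" where
 "inner2 f g = (LI x. f x \<bullet> g x)"

lemma L2_iff_square_integrable: "L2 f \<longleftrightarrow> square_integrable_on UNIV f"
 unfolding L2_def square_integrable_on_def set_borel_measurable_def set_integrable_def by simp

lemma L2_borel [measurable_dest]: "L2 f ==> f \<in> Borel"
 by (simp add: L2_def)

lemma L2_integrable: "L2 f ==> L1 (%x. (norm (f x))\<^sup>2)"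
 by (simp add: L2_def)

lemma L2_iff_nn: "L2 f \<longleftrightarrow> f \<in> Borel \<and> (NN x. ennreal ((norm (f x))\<^sup>2)) < \<infinity>"
 unfolding L2_def by (auto simp: integrable_iff_bounded)

lemma nn_sqint: "L2 f ==> (NN x. ennreal ((norm (f x))\<^sup>2)) = ennreal (sqint f)"
 unfolding sqint_def L2_def by (intro nn_integral_eq_integral) auto

lemma sqint_nonneg [simp]: "0 <= sqint f"
 by (simp add: sqint_def)

lemma inner2_self: "inner2 f f = sqint f"
 by (simp add: inner2_def sqint_def power2_norm_eq_inner)

lemma inner2_commute: "inner2 f g = inner2 g f"
 by (simp add: inner2_def inner_commute)

lemma L2_dominated:
 assumes f: "f \<in> Borel" and g: "L2 g" and le: "!!x. norm (f x) <= C * norm (g x)"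
 shows "L2 f"
 unfolding L2_def
proof
 show "L1 (%x. (norm (f x))\<^sup>2)"
 proof (rule L1_integrable_bound)
  show "L1 (%x. C\<^sup>2 * (norm (g x))\<^sup>2)" using g by (simp add: L2_def)
  show "ae x. norm ((norm (f x))\<^sup>2) <= norm (C\<^sup>2 * (norm (g x))\<^sup>2)"
   using power_mono[OF le norm_ge_zero, of _ 2] by (simp add: power_mult_distrib)
 qed (use f in auto)
qed (fact f)

lemma L2_scaleR: "L2 f ==> L2 (%x. c *\<^sub>R f x)"
 by (rule L2_dominated[of _ f "\<bar>c\<bar>"]) (auto simp: L2_def)

lemma L2_mult: "L2 f ==> L2 (%x. c * f x)" for f :: "_ => real"
 using L2_scaleR[of f c] by simp

lemma L2_minus: "L2 f ==> L2 (%x. - f x)"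
 using L2_scaleR[of f "-1"] by simp

lemma norm_add_square_le: "(norm (a + b))\<^sup>2 <= 2 * (norm a)\<^sup>2 + 2 * (norm (b::'b::real_inner))\<^sup>2"
proof -
 have "0 <= (norm (a - b))\<^sup>2" by simp
 then show ?thesis unfolding power2_norm_eq_inner by (simp add: inner_simps inner_commute)
qed

lemma L2_add: assumes "L2 f" "L2 g" shows "L2 (%x. f x + g x)"
 unfolding L2_def
proof
 have [measurable]: "f \<in> Borel" "g \<in> Borel" using assms by (auto simp: L2_def)
 show "(%x. f x + g x) \<in> Borel" by measurable
 show "L1 (%x. (norm (f x + g x))\<^sup>2)"
 proof (rule L1_integrable_bound)
  show "L1 (%x. 2 * (norm (f x))\<^sup>2 + 2 * (norm (g x))\<^sup>2)" using assms by (simp add: L2_def)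
  show "ae x. norm ((norm (f x + g x))\<^sup>2) <= norm (2 * (norm (f x))\<^sup>2 + 2 * (norm (g x))\<^sup>2)"
   using norm_add_square_le[of "f _" "g _"] by auto
 qed auto
qed

lemma L2_diff: "L2 f ==> L2 g ==> L2 (%x. f x - g x)"
 using L2_add[OF _ L2_minus, of f g] by simp

lemma L2_zero [simp]: "L2 (%x. 0)"
 by (simp add: L2_def)

lemma L2_AE_cong:
 assumes "L2 f" "g \<in> Borel" "ae x. f x = g x"
 shows "L2 g"
proof -
 have [measurable]: "f \<in> Borel" using assms(1) by (simp add: L2_def)
 note [measurable] = assms(2)
 have "L1 (%x. (norm (f x))\<^sup>2) \<longleftrightarrow> L1 (%x. (norm (g x))\<^sup>2)"
  by (rule integrable_cong_AE) (use assms(3) in auto)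
 then show ?thesis using assms by (simp add: L2_def)
qed

lemma sqint_AE_cong:
 assumes [measurable]: "f \<in> Borel" "g \<in> Borel" and "ae x. f x = g x"
 shows "sqint f = sqint g"
 unfolding sqint_def by (rule integral_cong_AE) (use assms in auto)

lemma inner2_AE_cong:
 assumes [measurable]: "f \<in> Borel" "g \<in> Borel" "h \<in> Borel"
  and "ae x. f x = g x"
 shows "inner2 f h = inner2 g h"
 unfolding inner2_def by (rule integral_cong_AE) (use assms in auto)

lemma L2_inner_integrable:
 assumes "L2 f" "L2 g" shows "L1 (%x. f x \<bullet> g x)"
proof (rule L1_integrable_bound)
 have [measurable]: "f \<in> Borel" "g \<in> Borel" using assms by (auto simp: L2_def)
 show "L1 (%x. (norm (f x))\<^sup>2 + (norm (g x))\<^sup>2)" using assms by (simp add: L2_def)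
 have "\<bar>a \<bullet> b\<bar> <= (norm a)\<^sup>2 + (norm b)\<^sup>2" for a b :: 'b
 proof -
  have "\<bar>a \<bullet> b\<bar> <= norm a * norm b" by (rule Cauchy_Schwarz_ineq2)
  also have "... <= 2 * (norm a * norm b)" by simp
  also have "... <= (norm a)\<^sup>2 + (norm b)\<^sup>2"
   using sum_squares_bound[of "norm a" "norm b"] by (simp add: mult.assoc)
  finally show ?thesis .
 qed
 then show "ae x. norm (f x \<bullet> g x) <= norm ((norm (f x))\<^sup>2 + (norm (g x))\<^sup>2)" by simp
 show "(%x. f x \<bullet> g x) \<in> borel_measurable lborel" by measurable
qed

lemma L2_mult_integrable: "L2 f ==> L2 g ==> L1 (%x. f x * g x)" for f g :: "_ => real"
 using L2_inner_integrable[of f g] by simp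

lemma inner2_add_left: "L2 f ==> L2 g ==> L2 h ==> inner2 (%x. f x + g x) h = inner2 f h + inner2 g h"
 unfolding inner2_def by (simp add: inner_add_left L2_inner_integrable)

lemma inner2_diff_left: "L2 f ==> L2 g ==> L2 h ==> inner2 (%x. f x - g x) h = inner2 f h - inner2 g h"
 unfolding inner2_def by (simp add: inner_diff_left L2_inner_integrable)

lemma inner2_scaleR_left: "inner2 (%x. c *\<^sub>R f x) h = c * inner2 f h"
 unfolding inner2_def by simp

lemma inner2_lincomb_left:
 fixes f g h :: "'a::euclidean_space => real"
 assumes "L2 f" "L2 g" "L2 h"
 shows "inner2 (%x. a * f x + b * g x) h = a * inner2 f h + b * inner2 g h"
 using inner2_add_left[OF L2_scaleR[OF assms(1)] L2_scaleR[OF assms(2)] assms(3), of a b]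
 by (simp add: inner2_scaleR_left[where 'b=real, simplified])

lemma sqint_scaleR: "sqint (%x. c *\<^sub>R f x) = c\<^sup>2 * sqint f"
 unfolding sqint_def by (simp add: power_mult_distrib)

lemma sqint_add: "L2 f ==> L2 g ==> sqint (%x. f x + g x) = sqint f + 2 * inner2 f g + sqint g"
 unfolding inner2_self[symmetric]
 by (simp add: inner2_add_left L2_add inner2_commute[of f "%x. f x + g x"]
   inner2_commute[of g "%x. f x + g x"] inner2_commute[of g f])

lemma sqint_diff: "L2 f ==> L2 g ==> sqint (%x. f x - g x) = sqint f - 2 * inner2 f g + sqint g"
 using sqint_add[OF _ L2_minus, of f g] inner2_scaleR_left[of "-1" g f] inner2_commute[of f]
 by (simp add: sqint_def inner2_def)

lemma sqint_add_le: "L2 f ==> L2 g ==> sqint (%x. f x + g x) <= 2 * sqint f + 2 * sqint g"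
 using sqint_add[of f g] sqint_diff[of f g] sqint_nonneg[of "%x. f x - g x"] by linarith

lemma sqint_diff_le: "L2 f ==> L2 g ==> sqint (%x. f x - g x) <= 2 * sqint f + 2 * sqint g"
 using sqint_add[of f g] sqint_diff[of f g] sqint_nonneg[of "%x. f x + g x"] by linarith

lemma sqint_triangle:
 assumes "L2 f" "L2 g" "L2 h"
 shows "sqint (%x. f x - h x) <= 2 * sqint (%x. f x - g x) + 2 * sqint (%x. g x - h x)"
 using sqint_add_le[OF L2_diff[OF assms(1,2)] L2_diff[OF assms(2,3)]] by simp

lemma sqint_commute: "sqint (%x. f x - g x) = sqint (%x. g x - f x)"
 unfolding sqint_def by (simp add: norm_minus_commute)

lemma sqint_eq_0_iff: "L2 f ==> sqint f = 0 \<longleftrightarrow> (ae x. f x = 0)"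
 unfolding sqint_def using integral_nonneg_eq_0_iff_AE[of lborel "%x. (norm (f x))\<^sup>2"]
 by (simp add: L2_def)

lemma inner2_cauchy_schwarz:
 assumes "L2 f" "L2 g" shows "(inner2 f g)\<^sup>2 <= sqint f * sqint g"
proof (rule quadratic_nonneg_imp_discriminant)
 show "0 <= sqint f * r\<^sup>2 + 2 * inner2 f g * r + sqint g" for r
  using sqint_add[OF L2_scaleR[OF assms(1), of r] assms(2)] sqint_nonneg[of "%x. r *\<^sub>R f x + g x"]
  by (simp add: sqint_scaleR inner2_scaleR_left algebra_simps)
qed simp

lemma inner2_tendsto:
 assumes f: "!!n. L2 (f n)" "L2 l" and g: "L2 g"
  and lim: "((%n. sqint (%x. f n x - l x)) ---> 0) F"
 shows "((%n. inner2 (f n) g) ---> inner2 l g) F"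
proof -
 have "((%n. (inner2 (f n) g - inner2 l g)\<^sup>2) ---> 0) F"
 proof (rule Lim_null_comparison)
  have "(inner2 (f n) g - inner2 l g)\<^sup>2 <= sqint (%x. f n x - l x) * sqint g" for n
   using inner2_cauchy_schwarz[OF L2_diff[OF f] g, of n] by (simp add: inner2_diff_left f g)
  then show "\<forall>\<^sub>F n in F. norm ((inner2 (f n) g - inner2 l g)\<^sup>2) <= sqint (%x. f n x - l x) * sqint g" by simp
  show "((%n. sqint (%x. f n x - l x) * sqint g) ---> 0) F"
   using tendsto_mult_right[OF lim, of "sqint g"] by simp
 qed
 then have "((%n. sqrt ((inner2 (f n) g - inner2 l g)\<^sup>2)) ---> sqrt 0) F" by (rule tendsto_real_sqrt)
 then have "((%n. inner2 (f n) g - inner2 l g) ---> 0) F" by (simp add: tendsto_rabs_zero_iff)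
 then show ?thesis by (simp add: LIM_zero_iff)
qed

lemma sqint_tendsto:
 assumes f: "!!n. L2 (f n)" "L2 l"
  and lim: "((%n. sqint (%x. f n x - l x)) ---> 0) F"
 shows "((%n. sqint (f n)) ---> sqint l) F"
proof -
 have "sqint (f n) = sqint (%x. f n x - l x) + 2 * inner2 (f n) l - sqint l" for n
  using sqint_diff[OF f(1) f(2)] by simp
 moreover have "((%n. sqint (%x. f n x - l x) + 2 * inner2 (f n) l - sqint l) ---> 0 + 2 * inner2 l l - sqint l) F"
  by (intro tendsto_intros lim inner2_tendsto f)
 ultimately show ?thesis by (simp add: inner2_self)
qed

text \<open>
 Along a subsequence with \<open>sqint (f (r (Suc k)) - f (r k)) <= 4 ^ (- k)\<close> the series of the functions
 \<open>2 ^ k * (norm (f (r (Suc k)) - f (r k)))\<^sup>2\<close> is integrable, hence finite almost everywhere, and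
 the subsequence converges there. Fatou's lemma identifies the limit in the mean.
\<close>

theorem L2_complete:
 fixes f :: "nat => 'a::euclidean_space => 'b::euclidean_space"
 assumes f: "!!n. L2 (f n)"
  and C: "!!e. 0 < e ==> \<exists>N. \<forall>m\<ge>N. \<forall>n\<ge>N. sqint (%x. f m x - f n x) < e"
 shows "\<exists>l r. L2 l \<and> strict_mono r \<and> (%n. sqint (%x. f n x - l x)) ----> 0 \<and>
     (ae x. (%k::nat. f (r k) x) ----> l x)"
proof -
 have [measurable]: "f n \<in> Borel" for n using f by (simp add: L2_def)
 have "\<exists>N. \<forall>m\<ge>N. \<forall>n\<ge>N. sqint (%x. f m x - f n x) < (1/4)^k" for k::nat by (rule C) simp
 then obtain N where N: "!!k m n. m >= N k ==> n >= N k ==> sqint (%x. f m x - f n x) < (1/4)^k"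
  by metis
 define r where "r k = (\<Sum>i\<le>k. N i) + k" for k
 have r: "strict_mono r" unfolding r_def strict_mono_Suc_iff by simp
 have rN: "r j >= N k" if "j >= k" for j k
 proof -
  have "N k <= (\<Sum>i\<le>j. N i)" by (rule member_le_sum) (use that in auto)
  then show ?thesis by (simp add: r_def)
 qed
 let ?d = "%k x. f (r (Suc k)) x - f (r k) x"
 have d: "(NN x. ennreal (2^k * (norm (?d k x))\<^sup>2)) <= ennreal ((1/2)^k)" for k
 proof -
  have "(NN x. ennreal (2^k * (norm (?d k x))\<^sup>2)) = ennreal (2^k) * ennreal (sqint (?d k))"
   by (simp add: ennreal_mult nn_integral_cmult nn_sqint[OF L2_diff[OF f f], symmetric])
  also have "... <= ennreal (2^k) * ennreal ((1/4)^k)"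
   using N[where k=k, OF rN rN, of "Suc k" k] by (intro mult_left_mono ennreal_leI) auto
  also have "... = ennreal ((1/2)^k)" by (simp flip: ennreal_mult power_mult_distrib)
  finally show ?thesis .
 qed
 have "(NN x. (\<Sum>k. ennreal (2^k * (norm (?d k x))\<^sup>2))) <= (\<Sum>k. ennreal ((1/2)^k))"
  by (subst nn_integral_suminf) (auto intro!: suminf_le d)
 also have "(\<Sum>k. ennreal ((1/2)^k)) = ennreal 2"
  by (rule suminf_ennreal_eq) (use geometric_sums[of "1/2::real"] in auto)
 also have "ennreal 2 < \<infinity>" by simp
 finally have "ae x. (\<Sum>k. ennreal (2^k * (norm (?d k x))\<^sup>2)) ~= \<infinity>"
  by (intro nn_integral_PInf_AE) auto
 then have conv: "ae x. convergent (%k. f (r k) x)"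
 proof (rule AE_mp, intro AE_I2 impI)
  fix x assume "(\<Sum>k. ennreal (2^k * (norm (?d k x))\<^sup>2)) ~= \<infinity>"
  then have "summable (%k. 2^k * (norm (?d k x))\<^sup>2)" by (intro summable_suminf_not_top) auto
  then have "(%k. 2^k * (norm (?d k x))\<^sup>2) ----> 0" by (rule summable_LIMSEQ_zero)
  then have "Bseq (%k. 2^k * (norm (?d k x))\<^sup>2)" by (intro convergent_imp_Bseq convergentI)
  then obtain K where K: "!!k. norm (2^k * (norm (?d k x))\<^sup>2) <= K" and "K > 0" unfolding Bseq_def by blast
  have le: "norm (?d k x) <= sqrt K * (1 / sqrt 2)^k" for k
  proof (rule power2_le_imp_le)
   have "2^k * (norm (?d k x))\<^sup>2 <= K" using K[of k] by simp
   moreover have "((1 / sqrt 2)^k)\<^sup>2 = ((1 / sqrt 2)\<^sup>2)^k" by (simp only: power_mult[symmetric] mult.commute)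
   ultimately show "(norm (?d k x))\<^sup>2 <= (sqrt K * (1 / sqrt 2)^k)\<^sup>2"
    using \<open>K > 0\<close> by (simp add: power_mult_distrib power_divide field_simps)
  qed (use \<open>K > 0\<close> in simp)
  have "summable (%k. sqrt K * (1 / sqrt 2)^k)"
   by (intro summable_mult summable_geometric) (simp add: field_simps)
  then have "summable (%k. ?d k x)" by (rule summable_comparison_test[rotated]) (use le in blast)
  then have "convergent (%n. \<Sum>k<n. ?d k x)" by (simp add: summable_iff_convergent)
  then have "convergent (%n. (\<Sum>k<n. ?d k x) + f (r 0) x)" by (intro convergent_add) (auto simp: convergent_const)
  moreover have "(\<Sum>k<n. ?d k x) + f (r 0) x = f (r n) x" for n
   using sum_lessThan_telescope[of "%k. f (r k) x" n] by simp
  ultimately show "convergent (%k. f (r k) x)" by simp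
 qed
 define l where "l x = lim (%k. f (r k) x)" for x
 have [measurable]: "l \<in> Borel" unfolding l_def by (rule borel_measurable_lim_metric) measurable
 have lim: "ae x. (%k. f (r k) x) ----> l x"
  using conv unfolding l_def by (simp add: convergent_LIMSEQ_iff)
 have fatou: "(NN x. ennreal ((norm (f n x - l x))\<^sup>2)) <= ennreal e"
  if "!!k. k >= M ==> sqint (%x. f n x - f k x) <= e" for n M e
 proof -
  have "(NN x. ennreal ((norm (f n x - l x))\<^sup>2))
    = (NN x. liminf (%k. ennreal ((norm (f n x - f (r k) x))\<^sup>2)))"
  proof (rule nn_integral_cong_AE, rule AE_mp[OF lim], intro AE_I2 impI)
   fix x assume "(%k. f (r k) x) ----> l x"
   then have "(%k. ennreal ((norm (f n x - f (r k) x))\<^sup>2)) ----> ennreal ((norm (f n x - l x))\<^sup>2)"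
    by (intro tendsto_intros tendsto_ennrealI)
   then show "ennreal ((norm (f n x - l x))\<^sup>2) = liminf (%k. ennreal ((norm (f n x - f (r k) x))\<^sup>2))"
    by (rule lim_imp_Liminf[OF trivial_limit_sequentially, symmetric])
  qed
  also have "... <= liminf (%k. NN x. ennreal ((norm (f n x - f (r k) x))\<^sup>2))"
   by (rule nn_integral_liminf) measurable
  also have "... <= ennreal e"
  proof (rule order_trans[OF Liminf_le_Limsup[OF trivial_limit_sequentially] Limsup_bounded],
    unfold eventually_sequentially, intro exI allI impI)
   fix k assume "M <= k"
   then have "M <= r k" using strict_mono_imp_increasing[OF r, of k] by linarith
   then show "(NN x. ennreal ((norm (f n x - f (r k) x))\<^sup>2)) <= ennreal e"
    unfolding nn_sqint[OF L2_diff[OF f f]] by (intro ennreal_leI that)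
  qed
  finally show ?thesis .
 qed
 obtain N1 where N1: "!!m n. m >= N1 ==> n >= N1 ==> sqint (%x. f m x - f n x) < 1" using C[of 1] by auto
 have "(NN x. ennreal ((norm (f N1 x - l x))\<^sup>2)) <= ennreal 1"
  by (rule fatou[where M=N1]) (use N1 in \<open>auto intro: less_imp_le\<close>)
 also have "ennreal 1 < \<infinity>" by simp
 finally have "L2 (%x. f N1 x - l x)"
  by (simp add: L2_iff_nn)
 then have l: "L2 l" using L2_diff[OF f[of N1]] by fastforce
 have "(%n. sqint (%x. f n x - l x)) ----> 0"
 proof (rule LIMSEQ_I)
  fix e :: real assume "0 < e"
  then obtain N2 where N2: "!!m n. m >= N2 ==> n >= N2 ==> sqint (%x. f m x - f n x) < e / 2"
   using C[of "e/2"] by auto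
  have "sqint (%x. f n x - l x) <= e / 2" if "n >= N2" for n
  proof -
   have "ennreal (sqint (%x. f n x - l x)) <= ennreal (e / 2)"
    unfolding nn_sqint[OF L2_diff[OF f l], symmetric]
    by (rule fatou[where M=N2]) (use N2 that in \<open>auto intro: less_imp_le\<close>)
   then show ?thesis using \<open>0 < e\<close> by (subst (asm) ennreal_le_iff) auto
  qed
  moreover have "e / 2 < e" using \<open>0 < e\<close> by simp
  ultimately have "\<bar>sqint (%x. f n x - l x)\<bar> < e" if "n >= N2" for n
   using that by (simp only: abs_of_nonneg[OF sqint_nonneg]) (rule order.strict_trans1)
  then show "\<exists>N. \<forall>n\<ge>N. norm (sqint (%x. f n x - l x) - 0) < e"
   by (intro exI[of _ N2]) simp
 qed
 then show ?thesis using l r lim by blast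
qed

lemma nn_integral_translate:
 assumes [measurable]: "f \<in> Borel"
 shows "(NN x. f (h + x)) = (\<integral>\<^sup>+x. f x \<partial>(lborel::'a::euclidean_space measure))"
 by (subst (2) lborel_distr_plus[of h, symmetric]) (simp add: nn_integral_distr)

lemma integrable_translate_iff:
 fixes f :: "'a::euclidean_space => 'b::{banach,second_countable_topology}"
 assumes [measurable]: "f \<in> Borel"
 shows "L1 (%x. f (h + x)) \<longleftrightarrow> L1 f"
 by (subst (2) lborel_distr_plus[of h, symmetric]) (simp add: integrable_distr_eq)

lemma integral_translate:
 fixes f :: "'a::euclidean_space => 'b::{banach,second_countable_topology}"
 assumes [measurable]: "f \<in> Borel"
 shows "(LI x. f (h + x)) = (LI x. f x)"
 by (subst (2) lborel_distr_plus[of h, symmetric]) (simp add: integral_distr)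

lemma L2_translate:
 assumes "L2 f" shows "L2 (%x. f (h + x))"
proof -
 have [measurable]: "f \<in> Borel" using assms by (simp add: L2_def)
 show ?thesis using integrable_translate_iff[of "%x. (norm (f x))\<^sup>2" h] assms by (simp add: L2_def)
qed

lemma sqint_translate:
 assumes "L2 f" shows "sqint (%x. f (h + x)) = sqint f"
proof -
 have [measurable]: "f \<in> Borel" using assms by (simp add: L2_def)
 show ?thesis using integral_translate[of "%x. (norm (f x))\<^sup>2" h] by (simp add: sqint_def)
qed

lemma sqint_le:
 fixes f :: "'a::euclidean_space => 'b::euclidean_space" and g :: "'a => 'c::euclidean_space"
 assumes f: "f \<in> Borel" and g: "L2 g" and le: "!!x. norm (f x) <= C * norm (g x)"
 shows "sqint f <= C\<^sup>2 * sqint g"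
proof -
 have "sqint f <= (LI x. C\<^sup>2 * (norm (g x))\<^sup>2)"
  unfolding sqint_def
 proof (rule integral_mono[OF L2_integrable[OF L2_dominated[OF f _ le]]])
  show "L1 (%x. C\<^sup>2 * (norm (g x))\<^sup>2)" by (rule integrable_mult_right[OF L2_integrable[OF g]])
  show "(norm (f x))\<^sup>2 <= C\<^sup>2 * (norm (g x))\<^sup>2" for x
   using power_mono[OF le[of x] norm_ge_zero, of 2] by (simp only: power_mult_distrib)
 qed (rule g)
 then show ?thesis by (simp add: sqint_def)
qed

lemma L2_indicator_set:
 assumes "E \<in> sets borel" "emeasure lborel E < \<infinity>" shows "L2 (indicator E :: 'a::euclidean_space => real)"
proof -
 have "(%x. (norm (indicator E x :: real))\<^sup>2) = indicator E" by (auto simp: indicator_def)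
 then show ?thesis unfolding L2_def using assms by (auto intro!: borel_measurable_indicator)
qed

section \<open>Moments determine a function\<close>

lemma zero_AE_if_integral_closed_zero:
 fixes w :: "'a::euclidean_space => real"
 assumes w: "L1 w" and z: "!!C. closed C ==> (LI x. indicator C x * w x) = 0"
 shows "ae x. w x = 0"
proof (rule sigma_finite_measure.density_zero[OF sigma_finite_lborel w])
 fix A :: "'a set" assume "A \<in> sets lborel"
 then have A: "A \<in> sigma_sets UNIV {C. closed C}" by (simp add: borel_eq_closed)
 have stable: "Int_stable {C :: 'a set. closed C}" "{C :: 'a set. closed C} \<subseteq> Pow UNIV"
  by (auto simp: Int_stable_def)
 from stable A have "A \<in> sets borel \<and> (LI x. indicator A x * w x) = 0"
 proof (induction rule: sigma_sets_induct_disjoint)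
  case (basic A) then show ?case using z by auto
 next
  case (compl A)
  have "(LI x. indicator (UNIV - A) x * w x) = (LI x. w x - indicator A x * w x)"
   by (rule L1_integral_cong) (auto simp: indicator_def)
  also have "... = 0"
   using compl z[of UNIV] integrable_real_mult_indicator[of A lborel w] w
   by (subst L1_integral_diff) (auto simp: mult.commute)
  finally show ?case using compl by auto
 next
  case (union A)
  have [measurable]: "A i \<in> sets borel" for i using union by auto
  have "(LINT x:(\<Union>i. A i)|lborel. w x) = (\<Sum>i. LINT x:A i|lborel. w x)"
  proof (rule lebesgue_integral_countable_add)
   show "set_integrable lborel (\<Union>i. A i) w"
    using integrable_real_mult_indicator[of "\<Union>i. A i" lborel w] w by (simp add: set_integrable_def mult.commute)
  qed (use union in \<open>auto simp: disjoint_family_on_def\<close>)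
  then show ?case using union by (auto simp: set_lebesgue_integral_def)
 qed auto
 then show "set_lebesgue_integral lborel A w = 0" by (simp add: set_lebesgue_integral_def)
qed

lemma integrable_mult_bounded_on:
 fixes w :: "'a::euclidean_space => real"
 assumes w: "L1 w" and w0: "!!x. x \<notin> K ==> w x = 0"
  and f: "f \<in> Borel" "!!x. x \<in> K ==> \<bar>f x\<bar> <= M"
 shows "L1 (%x. w x * f x)"
proof (rule L1_integrable_bound[OF integrable_mult_right[OF w, of "\<bar>M\<bar>"]])
 have [measurable]: "w \<in> Borel" using w by auto
 note [measurable] = f(1)
 show "(%x. w x * f x) \<in> borel_measurable lborel" by measurable
 have "\<bar>w x\<bar> * \<bar>f x\<bar> <= \<bar>w x\<bar> * \<bar>M\<bar>" for x
  by (cases "x \<in> K") (auto simp: w0 intro!: mult_left_mono order_trans[OF f(2)])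
 then show "ae x. norm (w x * f x) <= norm (\<bar>M\<bar> * w x)" by (simp add: abs_mult mult.commute)
qed

text \<open>By Stone and Weierstrass \<open>w\<close> is orthogonal to the continuous functions on \<open>K\<close>, and by dominated convergence to the indicators of closed sets.\<close>

theorem zero_AE_if_orthogonal_to_ring:
 fixes w :: "'a::euclidean_space => real"
 assumes w: "L1 w" and w0: "!!x. x \<notin> K ==> w x = 0"
  and R: "function_ring_on R K" and orth: "!!g. g \<in> R ==> (LI x. w x * g x) = 0"
 shows "ae x. w x = 0"
proof -
 interpret function_ring_on R K by (rule R)
 have K: "compact K" "closed K" using compact compact_imp_closed by auto
 have [measurable]: "w \<in> Borel" using w by auto
 have int: "L1 (%x. w x * f x)" if f: "continuous_on K f" for f
 proof -
  have m: "(%x. indicator K x *\<^sub>R f x) \<in> Borel"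
   using f K by (intro borel_measurable_continuous_on_indicator) auto
  obtain M where M: "!!x. x \<in> K ==> norm (f x) <= M"
   using compact_imp_bounded[OF compact_continuous_image[OF f K(1)]] by (auto simp: bounded_iff)
  have "L1 (%x. w x * (indicator K x *\<^sub>R f x))"
   by (rule integrable_mult_bounded_on[OF w w0 m]) (use M in auto)
  moreover have "(%x. w x * (indicator K x *\<^sub>R f x)) = (%x. w x * f x)"
  proof
   fix x show "w x * (indicator K x *\<^sub>R f x) = w x * f x" using w0[of x] by (cases "x \<in> K") auto
  qed
  ultimately show ?thesis by (simp only:)
 qed
 have cont: "(LI x. w x * f x) = 0" if f: "continuous_on K f" for f
 proof (rule ccontr)
  assume nz: "(LI x. w x * f x) ~= 0"
  define W where "W = (LI x. \<bar>w x\<bar>)"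
  have W: "W >= 0" by (simp add: W_def)
  define e where "e = \<bar>LI x. w x * f x\<bar> / (W + 1)"
  have "e > 0" using nz W by (simp add: e_def)
  then obtain g where g: "g \<in> R" "!!x. x \<in> K ==> \<bar>f x - g x\<bar> < e"
   using Stone_Weierstrass_basic[OF f] by blast
  have ig: "L1 (%x. w x * g x)" by (rule int[OF continuous[OF g(1)]])
  have "(LI x. w x * f x) = (LI x. w x * f x - w x * g x)"
   using orth[OF g(1)] int[OF f] ig by simp
  also have "\<bar>...\<bar> <= (LI x. \<bar>w x * f x - w x * g x\<bar>)" by (rule integral_abs_bound)
  also have "... <= (LI x. e * \<bar>w x\<bar>)"
  proof (rule integral_mono)
   fix x
   have "\<bar>w x * f x - w x * g x\<bar> = \<bar>w x\<bar> * \<bar>f x - g x\<bar>" by (simp flip: right_diff_distrib abs_mult)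
   also have "... <= \<bar>w x\<bar> * e"
    by (cases "x \<in> K") (auto simp: w0 intro!: mult_left_mono less_imp_le[OF g(2)])
   finally show "\<bar>w x * f x - w x * g x\<bar> <= e * \<bar>w x\<bar>" by (simp only: mult.commute)
  qed (use int[OF f] ig w in auto)
  also have "... = e * W" by (simp add: W_def)
  finally have "\<bar>LI x. w x * f x\<bar> <= \<bar>LI x. w x * f x\<bar> * (W / (W + 1))"
   unfolding e_def by simp
  also have "... < \<bar>LI x. w x * f x\<bar> * 1"
   using nz W by (intro mult_strict_left_mono) auto
  finally show False by simp
 qed
 show ?thesis
 proof (rule zero_AE_if_integral_closed_zero[OF w])
  fix C :: "'a set" assume C: "closed C"
  show "(LI x. indicator C x * w x) = 0"
  proof (cases "C = {}")
   case False
   define f where "f n x = max 0 (1 - real n * infdist x C)" for n x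
   have [measurable]: "C \<in> sets borel" using C by auto
   have fc: "continuous_on UNIV (f n)" for n
    unfolding f_def by (intro continuous_intros)
   have [measurable]: "f n \<in> Borel" for n using fc by (rule borel_measurable_continuous_onI)
   have "(%n. LI x. w x * f n x) ----> (LI x. indicator C x * w x)"
   proof (rule integral_dominated_convergence[OF _ _ integrable_norm[OF w]])
    show "ae x. (%n. w x * f n x) ----> indicator C x * w x"
    proof (rule AE_I2)
     fix x
     have "(%n. f n x) ----> indicator C x"
     proof (cases "x \<in> C")
      case True then show ?thesis by (simp add: f_def)
     next
      case False
      then have d: "infdist x C > 0" using C \<open>C ~= {}\<close> by (simp add: infdist_pos_not_in_closed)
      have "\<forall>\<^sub>F n in sequentially. f n x = 0"
      proof -
       obtain N where N: "real N > 1 / infdist x C" using reals_Archimedean2 by blast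
       have "f n x = 0" if "n >= N" for n
       proof -
        have "1 / infdist x C < real n" using N that by linarith
        then have "1 < real n * infdist x C" using d by (simp add: field_simps)
        then show ?thesis by (simp add: f_def)
       qed
       then show ?thesis unfolding eventually_sequentially by blast
      qed
      then show ?thesis using False by (simp add: tendsto_eventually)
     qed
     from tendsto_mult_left[OF this, of "w x"]
     show "(%n. w x * f n x) ----> indicator C x * w x" by (simp add: mult.commute)
    qed
    have "\<bar>f n x\<bar> <= 1" for n x unfolding f_def using infdist_nonneg[of x C] by (auto simp: max_def)
    then show "ae x. norm (w x * f n x) <= norm (w x)" for n
     by (auto simp: abs_mult intro!: mult_left_le)
   qed measurable
   moreover have "(LI x. w x * f n x) = 0" for n
    using cont continuous_on_subset[OF fc] by blast
   ultimately show ?thesis by (simp add: LIMSEQ_const_iff)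
  qed simp
 qed
qed

subsection \<open>Monomials\<close>

definition monomial :: "'a::euclidean_space list => 'a => real" where
 "monomial es z = prod_list (map (%e. e \<bullet> z) es)"

lemma monomial_simps [simp]:
 "monomial [] z = 1" "monomial (e # es) z = (e \<bullet> z) * monomial es z"
 "monomial (es @ fs) z = monomial es z * monomial fs z"
 by (simp_all add: monomial_def)

fun dmonomial :: "'a::euclidean_space => 'a list => 'a => real" where
 "dmonomial h [] z = 0"
| "dmonomial h (e # es) z = (e \<bullet> h) * monomial es z + (e \<bullet> z) * dmonomial h es z"

lemma monomial_has_derivative:
 "(monomial es has_derivative (%h. dmonomial h es z)) (at z)"
proof (induction es)
 case (Cons e es)
 have "((%z. (e \<bullet> z) * monomial es z) has_derivative (%h. (e \<bullet> z) * dmonomial h es z + (e \<bullet> h) * monomial es z)) (at z)"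
  by (intro has_derivative_mult Cons.IH) (auto intro!: derivative_eq_intros)
 then show ?case by (simp add: add.commute)
qed simp

lemma continuous_on_monomial: "continuous_on S (monomial es)"
 by (induction es) (auto intro!: continuous_intros)

lemma monomial_scaleR: "monomial es (c *\<^sub>R z) = c ^ length es * monomial es z"
 by (induction es) auto

text \<open>Each term of the derivative of a monomial of degree \<open>m + 1\<close> is a monomial of degree \<open>m\<close>.\<close>

lemma dmonomial_induct:
 assumes lin: "!!a b f g. L f ==> L g ==> L (%z. a * f z + b * g z)" and zero: "L (%z. 0)"
  and mono: "!!es'. length es' + 1 = length fs + length es ==> L (monomial es')"
 shows "L (%z. monomial fs z * dmonomial h es z)"
 using mono
proof (induction es arbitrary: fs)
 case Nil then show ?case using zero by simp
next
 case (Cons e es)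
 have "L (%z. (e \<bullet> h) * monomial (fs @ es) z + 1 * (monomial (fs @ [e]) z * dmonomial h es z))"
  by (rule lin) (rule Cons.prems, simp, rule Cons.IH, rule Cons.prems, simp)
 then show ?case by (simp add: algebra_simps)
qed

inductive_set polynomials :: "('a::euclidean_space => real) set" where
 mono: "(%z. c * monomial es z) \<in> polynomials"
| add: "f \<in> polynomials ==> g \<in> polynomials ==> (%z. f z + g z) \<in> polynomials"

lemma polynomials_mult:
 assumes "f \<in> polynomials" "g \<in> polynomials" shows "(%z. f z * g z) \<in> polynomials"
 using assms
proof (induction rule: polynomials.induct)
 case (mono c es)
 from mono show ?case
 proof (induction rule: polynomials.induct)
  case (mono d fs)
  show ?case using polynomials.mono[of "c * d" "es @ fs"] by (simp add: mult_ac)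
 next
  case (add f g) then show ?case using polynomials.add by (simp add: distrib_left)
 qed
next
 case (add f g) then show ?case using polynomials.add[of "%z. f z * _ z"] by (simp add: distrib_right polynomials.add)
qed

lemma polynomials_continuous: "f \<in> polynomials ==> continuous_on S f"
 by (induction rule: polynomials.induct) (auto intro!: continuous_intros continuous_on_monomial)

lemma function_ring_polynomials:
 assumes K: "compact K" and zeta: "continuous_on K zeta" "inj_on zeta K"
 shows "function_ring_on ((%p y. p (zeta y)) ` polynomials) K"
proof
 show "compact K" by (rule K)
 show "continuous_on K f" if "f \<in> (%p y. p (zeta y)) ` polynomials" for f
  using that continuous_on_compose2[OF polynomials_continuous[of _ UNIV] zeta(1)] by auto
 show "(%x. f x + g x) \<in> (%p y. p (zeta y)) ` polynomials"
  if "f \<in> (%p y. p (zeta y)) ` polynomials" "g \<in> (%p y. p (zeta y)) ` polynomials" for f g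
  using that polynomials.add by (force simp: image_iff)
 show "(%x. f x * g x) \<in> (%p y. p (zeta y)) ` polynomials"
  if "f \<in> (%p y. p (zeta y)) ` polynomials" "g \<in> (%p y. p (zeta y)) ` polynomials" for f g
  using that polynomials_mult by (force simp: image_iff)
 show "(%_. c) \<in> (%p y. p (zeta y)) ` polynomials" for c
  using polynomials.mono[of c "[]"] by (force simp: image_iff)
 fix x y assume xy: "x \<in> K" "y \<in> K" "x ~= y"
 then have "zeta x ~= zeta y" using zeta(2) by (auto dest: inj_onD)
 then obtain b where "b \<in> Basis" "zeta x \<bullet> b ~= zeta y \<bullet> b" using euclidean_eqI by blast
 moreover have "(%z. z \<bullet> b) \<in> polynomials" using polynomials.mono[of 1 "[b]"] by (simp add: inner_commute)
 ultimately show "\<exists>f\<in>(%p y. p (zeta y)) ` polynomials. f x ~= f y"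
  by (intro bexI[of _ "%y. zeta y \<bullet> b"] image_eqI[of _ _ "%z. z \<bullet> b"]) auto
qed

theorem zero_AE_if_moments_zero:
 fixes w :: "'a::euclidean_space => real" and zeta :: "'a => 'b::euclidean_space"
 assumes w: "L1 w" and K: "compact K" and w0: "!!x. x \<notin> K ==> w x = 0"
  and zeta: "continuous_on K zeta" "inj_on zeta K" "zeta \<in> Borel"
  and mom: "!!es. (LI x. w x * monomial es (zeta x)) = 0"
 shows "ae x. w x = 0"
proof (rule zero_AE_if_orthogonal_to_ring[OF w w0 function_ring_polynomials[OF K zeta(1,2)]])
 note [measurable] = zeta(3)
 have [measurable]: "w \<in> Borel" using w by auto
 have pint: "L1 (%x. w x * p (zeta x))" if p: "p \<in> polynomials" for p
 proof -
  have [measurable]: "p \<in> Borel"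
   by (rule borel_measurable_continuous_onI[OF polynomials_continuous[OF p]])
  obtain M where M: "!!x. x \<in> K ==> norm (p (zeta x)) <= M"
   using compact_imp_bounded[OF compact_continuous_image[OF continuous_on_compose2[OF polynomials_continuous[OF p, of UNIV] zeta(1)] K]]
   by (auto simp: bounded_iff)
  show ?thesis by (rule integrable_mult_bounded_on[OF w w0, of K]) (use M in auto)
 qed
 fix g assume "g \<in> (%p y. p (zeta y)) ` polynomials"
 then obtain p where p: "p \<in> polynomials" and g: "g = (%y. p (zeta y))" by auto
 from p have "(LI x. w x * p (zeta x)) = 0"
 proof (induction rule: polynomials.induct)
  case (mono c es) then show ?case using mom[of es] by (simp add: mult.left_commute[of _ c])
 next
  case (add f g) then show ?case using pint by (simp add: distrib_left)
 qed
 then show "(LI x. w x * g x) = 0" by (simp add: g)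
qed

section \<open>Unique continuation for Riesz kernels\<close>

lemma differentiate_under_integral:
 fixes w :: "'a::euclidean_space => real"
 assumes w: "L1 w" and K: "compact K" and w0: "!!y. y \<notin> K ==> w y = 0"
  and U: "open U" "U \<inter> K = {}"
  and meas: "phi \<in> Borel" "psi \<in> Borel"
  and cont: "continuous_on (- {0}) psi"
  and der: "!!z. z ~= 0 ==> ((%s. phi (z + s *\<^sub>R e)) has_real_derivative psi z) (at 0)"
  and phi: "!!x. x \<in> U ==> L1 (%y. w y * phi (x - y))"
  and zero: "!!x. x \<in> U ==> (LI y. w y * phi (x - y)) = 0" and x: "x \<in> U"
 shows "(LI y. w y * psi (x - y)) = 0"
proof -
 note [measurable] = meas
 have [measurable]: "w \<in> Borel" using w by auto
 obtain r where r: "r > 0" "cball x r \<subseteq> U" using U(1) x open_contains_cball by blast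
 define d where "d = r / (norm e + 1)"
 have d: "d > 0" using r(1) by (simp add: d_def add_nonneg_pos)
 have inU: "x + s *\<^sub>R e \<in> U" if "0 <= s" "s <= d" for s
 proof -
  have "norm e + 1 > 0" by (simp add: add_nonneg_pos)
  then have "d * (norm e + 1) = r" by (simp add: d_def)
  moreover have "norm (s *\<^sub>R e) <= d * (norm e + 1)" using that by (simp add: mult_mono)
  ultimately have "norm (s *\<^sub>R e) <= r" by simp
  then show ?thesis using r(2) by (auto simp: dist_norm)
 qed
 let ?C = "(%(s, y). x + s *\<^sub>R e - y) ` ({0..d} \<times> K)"
 have C: "compact ?C"
  by (intro compact_continuous_image compact_Times K)
   (auto intro!: continuous_intros simp: case_prod_unfold)
 have nz: "x + s *\<^sub>R e - y ~= 0" if "0 <= s" "s <= d" "y \<in> K" for s y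
  using inU[OF that(1,2)] that(3) U(2) by auto
 have "?C \<subseteq> - {0}" using nz by auto
 then have "bounded (psi ` ?C)"
  using compact_imp_bounded[OF compact_continuous_image[OF continuous_on_subset[OF cont] C]] by blast
 then obtain M where M: "!!z. z \<in> ?C ==> norm (psi z) <= M" unfolding bounded_iff by blast
 define s where "s n = d / real (Suc n)" for n
 have s: "0 < s n" "s n <= d" for n using d by (auto simp: s_def divide_le_eq)
 have s_lim: "s ----> 0"
  unfolding s_def[abs_def] using tendsto_mult_left[OF LIMSEQ_inverse_real_of_nat, of d] by (simp add: divide_inverse)
 define q where "q n y = w y * ((phi (x + s n *\<^sub>R e - y) - phi (x - y)) / s n)" for n y
 have [measurable]: "q n \<in> Borel" for n unfolding q_def[abs_def] by measurable
 have bound: "\<bar>(phi (x + s n *\<^sub>R e - y) - phi (x - y)) / s n\<bar> <= M" if y: "y \<in> K" for n y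
 proof -
  have "\<exists>z>0. z < s n \<and> phi (x - y + s n *\<^sub>R e) - phi (x - y + 0 *\<^sub>R e) = (s n - 0) * psi (x - y + z *\<^sub>R e)"
  proof (rule MVT2[OF s(1)])
   fix tau assume tau: "0 <= tau" "tau <= s n"
   then have "x - y + tau *\<^sub>R e ~= 0" using nz[of tau y] y s(2)[of n] by (simp add: algebra_simps)
   from der[OF this] have "((%u. phi (x - y + (u + tau) *\<^sub>R e)) has_real_derivative psi (x - y + tau *\<^sub>R e)) (at 0)"
    by (simp add: algebra_simps)
   then show "((%u. phi (x - y + u *\<^sub>R e)) has_real_derivative psi (x - y + tau *\<^sub>R e)) (at tau)"
    using DERIV_at_within_shift[of "%u. phi (x - y + u *\<^sub>R e)" "psi (x - y + tau *\<^sub>R e)" tau 0 UNIV]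
    by (simp add: add.commute)
  qed
  then obtain z where z: "0 < z" "z < s n" "phi (x - y + s n *\<^sub>R e) - phi (x - y) = s n * psi (x - y + z *\<^sub>R e)" by auto
  have "x + z *\<^sub>R e - y \<in> ?C" using z s(2)[of n] y by (intro image_eqI[of _ _ "(z, y)"]) auto
  from M[OF this] show ?thesis using z s(1)[of n] by (simp add: algebra_simps)
 qed
 have "(%n. LI y. q n y) ----> (LI y. w y * psi (x - y))"
 proof (rule integral_dominated_convergence[OF _ _ integrable_mult_right[OF integrable_norm[OF w], of "\<bar>M\<bar>"]])
  show "ae y. (%n. q n y) ----> w y * psi (x - y)"
  proof (rule AE_I2)
   fix y show "(%n. q n y) ----> w y * psi (x - y)"
   proof (cases "y \<in> K")
    case True
    then have "x - y ~= 0" using nz[of 0 y] d by simp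
    from der[OF this] have "((%h. (phi (x - y + h *\<^sub>R e) - phi (x - y)) / h) ---> psi (x - y)) (at 0)"
     by (simp add: DERIV_def)
    moreover have "filterlim s (at 0) sequentially"
     unfolding filterlim_at using s_lim s(1) by (auto intro!: always_eventually dest: less_imp_neq[symmetric])
    ultimately have "(%n. (phi (x - y + s n *\<^sub>R e) - phi (x - y)) / s n) ----> psi (x - y)"
     by (rule filterlim_compose)
    from tendsto_mult_left[OF this, of "w y"] show ?thesis by (simp add: q_def algebra_simps)
   qed (simp add: q_def w0)
  qed
  show "ae y. norm (q n y) <= \<bar>M\<bar> * norm (w y)" for n
  proof (rule AE_I2)
   fix y show "norm (q n y) <= \<bar>M\<bar> * norm (w y)"
   proof (cases "y \<in> K")
    case True
    have "norm (q n y) = \<bar>w y\<bar> * \<bar>(phi (x + s n *\<^sub>R e - y) - phi (x - y)) / s n\<bar>"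
     unfolding q_def by (simp only: real_norm_def abs_mult)
    also have "... <= \<bar>w y\<bar> * \<bar>M\<bar>" by (intro mult_left_mono order_trans[OF bound[OF True]]) auto
    finally show ?thesis by (simp add: mult.commute)
   qed (simp add: q_def w0)
  qed
 qed measurable
 moreover have "(LI y. q n y) = 0" for n
 proof -
  have "q n y = (w y * phi (x + s n *\<^sub>R e - y) - w y * phi (x - y)) / s n" for y
   by (simp add: q_def right_diff_distrib)
  then show ?thesis
   using phi[OF inU[of "s n"]] phi[OF x] zero[OF inU[of "s n"]] zero[OF x] s[of n] by (simp add: less_imp_le)
 qed
 ultimately show ?thesis by (simp add: LIMSEQ_const_iff)
qed

text \<open>The Riesz kernel \<open>norm z powr (-gam)\<close>, in the form that is convenient to differentiate.\<close>

definition riesz :: "real => 'a::euclidean_space => real" where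
 "riesz gam z = (z \<bullet> z) powr (- gam / 2)"

lemma riesz_eq: "riesz gam z = 1 / norm z powr gam"
proof (cases "z = 0")
 case False
 have "z \<bullet> z = norm z powr 2" using False by (simp add: powr_numeral power2_norm_eq_inner)
 then have "riesz gam z = norm z powr (2 * (- gam / 2))" by (simp only: riesz_def powr_powr)
 then have "riesz gam z = norm z powr (- gam)" by simp
 then show ?thesis by (simp add: powr_minus divide_inverse)
qed (simp add: riesz_def)

lemma borel_measurable_riesz [measurable]: "riesz gam \<in> Borel"
 unfolding riesz_def[abs_def] by measurable

lemma continuous_on_riesz: "continuous_on (- {0}) (riesz gam)"
 unfolding riesz_def[abs_def] by (intro continuous_intros) auto

lemma riesz_inner:
 assumes "z ~= 0" shows "(z \<bullet> z) * riesz (gam + 2) z = riesz gam z"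
proof -
 have "(z \<bullet> z) * riesz (gam + 2) z = (z \<bullet> z) powr 1 * (z \<bullet> z) powr (- (gam + 2) / 2)"
  using assms by (simp add: riesz_def)
 also have "... = (z \<bullet> z) powr (1 + - (gam + 2) / 2)" by (rule powr_add[symmetric])
 also have "1 + - (gam + 2) / 2 = - gam / 2" by (simp add: field_simps)
 finally show ?thesis by (simp add: riesz_def)
qed

lemma riesz_power:
 assumes "z ~= 0" shows "riesz gam z * (1 / (z \<bullet> z)) ^ k = riesz (gam + 2 * real k) z"
proof (induction k)
 case (Suc k)
 have e: "gam + 2 * real (Suc k) = gam + 2 * real k + 2" by simp
 have "(z \<bullet> z) * riesz (gam + 2 * real (Suc k)) z = riesz (gam + 2 * real k) z"
  unfolding e by (rule riesz_inner[OF assms])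
 then have "riesz (gam + 2 * real (Suc k)) z = riesz (gam + 2 * real k) z * (1 / (z \<bullet> z))"
  using assms by (simp add: field_simps)
 then show ?case using Suc.IH by (simp add: mult.assoc mult.commute)
qed simp

lemma riesz_has_derivative:
 assumes z: "z ~= 0"
 shows "((%s. riesz gam (z + s *\<^sub>R e)) has_real_derivative - gam * (e \<bullet> z) * riesz (gam + 2) z) (at 0)"
proof -
 have g: "((%s. (z + s *\<^sub>R e) \<bullet> (z + s *\<^sub>R e)) has_real_derivative 2 * (e \<bullet> z)) (at 0)"
 proof -
  have "(%s. (z + s *\<^sub>R e) \<bullet> (z + s *\<^sub>R e)) = (%s. z \<bullet> z + 2 * (e \<bullet> z) * s + (e \<bullet> e) * s\<^sup>2)"
   by (auto simp: inner_simps inner_commute power2_eq_square algebra_simps)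
  then show ?thesis by (auto intro!: derivative_eq_intros)
 qed
 have "z \<bullet> z > 0" using z by simp
 have "((%s. ((z + s *\<^sub>R e) \<bullet> (z + s *\<^sub>R e)) powr (- gam / 2)) has_real_derivative
   (- gam / 2) * (z \<bullet> z) powr (- gam / 2 - 1) * (2 * (e \<bullet> z))) (at 0)"
  using DERIV_fun_powr[OF g, of "- gam / 2"] z by simp
 moreover have "- gam / 2 - 1 = - (gam + 2) / 2" by (simp add: field_simps)
 moreover have "(- gam / 2) * p * (2 * (e \<bullet> z)) = - gam * (e \<bullet> z) * p" for p by simp
 ultimately show ?thesis unfolding riesz_def by (simp only:)
qed

lemma integrable_kernel:
 fixes w :: "'a::euclidean_space => real"
 assumes w: "L1 w" and K: "compact K" and w0: "!!y. y \<notin> K ==> w y = 0" and x: "x \<notin> K"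
  and phi: "continuous_on (- {0}) phi" "phi \<in> Borel"
 shows "L1 (%y. w y * phi (x - y))"
proof -
 note [measurable] = phi(2)
 have [measurable]: "w \<in> Borel" using w by auto
 have c: "continuous_on K (%y. phi (x - y))"
  by (rule continuous_on_compose2[OF phi(1)]) (use x in \<open>auto intro!: continuous_intros\<close>)
 obtain M where "!!y. y \<in> K ==> norm (phi (x - y)) <= M"
  using compact_imp_bounded[OF compact_continuous_image[OF c K]] by (auto simp: bounded_iff)
 then show ?thesis by (intro integrable_mult_bounded_on[OF w w0, of K]) auto
qed

text \<open>
 Differentiating the potential along the members of a list of directions produces, at each point of
 \<open>U\<close>, the integrals of \<open>w\<close> against all products of a monomial of degree \<open>m\<close> with the kernel of
 exponent \<open>beta + 2 m\<close>; the Laplacian, whose factor \<open>DIM('a) - (beta + 2 k + 2)\<close> does not vanish, provides the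
 radial ones. In the inverted coordinates \<open>(x - y) / norm (x - y) ^ 2\<close> these products are
 the polynomials times a fixed weight, so all moments of \<open>w\<close> vanish.
\<close>

theorem riesz_unique_continuation:
 fixes w :: "'a::euclidean_space => real"
 assumes w: "L1 w" and K: "compact K" and w0: "!!y. y \<notin> K ==> w y = 0"
  and U: "open U" "U ~= {}" "U \<inter> K = {}" and beta: "beta >= real DIM('a)"
  and zero: "!!x. x \<in> U ==> (LI y. w y / norm (x - y) powr beta) = 0"
 shows "ae y. w y = 0"
proof -
 have [measurable]: "w \<in> Borel" using w by auto
 have cm: "continuous_on (- {0}) (%z. f z * riesz gam z)" if "continuous_on UNIV f" for f gam
  using continuous_on_subset[OF that] continuous_on_riesz by (intro continuous_intros) auto
 have mono_c: "continuous_on UNIV (monomial es)" for es :: "'a list" by (rule continuous_on_monomial)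
 have dmono_c: "continuous_on UNIV (dmonomial e es)" for e and es :: "'a list"
  by (induction es) (auto intro!: continuous_intros continuous_on_monomial)
 have int: "L1 (%y. w y * (f (x - y) * riesz gam (x - y)))"
  if "x \<in> U" "continuous_on UNIV f" for x f gam
  using integrable_kernel[OF w K w0, of x "%z. f z * riesz gam z"] U(3) that cm[OF that(2)]
   borel_measurable_continuous_onI[OF that(2)] by auto
 have der: "((%s. monomial es (z + s *\<^sub>R e) * riesz gam (z + s *\<^sub>R e)) has_real_derivative
   dmonomial e es z * riesz gam z + monomial es z * (- gam * (e \<bullet> z) * riesz (gam + 2) z)) (at 0)"
  if "z ~= 0" for es e z gam
 proof -
  have "((%s. monomial es (z + s *\<^sub>R e)) has_derivative (%s. dmonomial (s *\<^sub>R e) es (z + 0 *\<^sub>R e))) (at 0)"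
   by (rule has_derivative_compose[of "%s. z + s *\<^sub>R e" "%s. s *\<^sub>R e" 0 UNIV "monomial es"])
    (auto intro!: derivative_eq_intros monomial_has_derivative)
  moreover have "dmonomial (s *\<^sub>R e) es z = s * dmonomial e es z" for s
   by (induction es) (auto simp: algebra_simps)
  ultimately have "((%s. monomial es (z + s *\<^sub>R e)) has_real_derivative dmonomial e es z) (at 0)"
   by (simp add: has_field_derivative_def mult.commute[of _ "dmonomial e es z"])
  from DERIV_mult[OF this riesz_has_derivative[OF that, of gam e]] show ?thesis by (simp add: algebra_simps)
 qed
 let ?I = "%x f k. LI y. w y * (f (x - y) * riesz (beta + 2 * real k) (x - y))"
 have diff: "?I x (dmonomial e es) k - (beta + 2 * real k) * ?I x (monomial (e # es)) (Suc k) = 0"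
  if z: "!!x. x \<in> U ==> ?I x (monomial es) k = 0" and x: "x \<in> U" for x es e k
 proof -
  let ?gam = "beta + 2 * real k"
  have m: "(%z. f z * riesz gam z) \<in> Borel" if "continuous_on UNIV f" for f :: "'a => real" and gam
   using borel_measurable_continuous_onI[OF that] by measurable
  let ?psi = "%z. dmonomial e es z * riesz ?gam z - ?gam * (monomial (e # es) z * riesz (?gam + 2) z)"
  have "(LI y. w y * ?psi (x - y)) = 0"
  proof (rule differentiate_under_integral[OF w K w0 U(1,3) m[OF mono_c[of es], of ?gam]])
   show "?psi \<in> Borel"
    by (intro borel_measurable_diff borel_measurable_times borel_measurable_const m dmono_c mono_c)
   show "continuous_on (- {0}) ?psi"
    by (intro continuous_on_diff continuous_on_mult continuous_on_const cm dmono_c mono_c)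
   show "((%s. monomial es (z + s *\<^sub>R e) * riesz ?gam (z + s *\<^sub>R e)) has_real_derivative ?psi z) (at 0)" if "z ~= 0" for z
    using der[OF that, of es e ?gam] by (simp add: algebra_simps)
   show "L1 (%y. w y * (monomial es (x - y) * riesz ?gam (x - y)))" if "x \<in> U" for x
    by (rule int[OF that mono_c])
  qed (use z x in auto)
  moreover have "(%y. w y * ?psi (x - y)) = (%y. w y * (dmonomial e es (x - y) * riesz ?gam (x - y))
    - ?gam * (w y * (monomial (e # es) (x - y) * riesz (?gam + 2) (x - y))))"
   by (simp add: right_diff_distrib fun_eq_iff)
  moreover have "?gam + 2 = beta + 2 * real (Suc k)" by simp
  ultimately show ?thesis
   using int[OF x dmono_c] int[OF x mono_c] by (simp del: monomial_simps of_nat_Suc)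
 qed
 have beta_pos: "beta + 2 * real k > 0" for k using beta DIM_positive[where 'a='a] by linarith
 have T: "\<forall>es x. length es <= k \<longrightarrow> x \<in> U \<longrightarrow> ?I x (monomial es) k = 0" for k
 proof (induction k)
  case 0
  show ?case using zero by (simp add: riesz_eq)
 next
  case (Suc k)
  have up: "?I x (monomial (e # es)) (Suc k) = 0" if "length es <= k" "x \<in> U" for e es x
  proof -
   have "?I x (%z. monomial [] z * dmonomial e es z) k = 0"
   proof (rule dmonomial_induct[where L = "%f. continuous_on UNIV f \<and> ?I x f k = 0", THEN conjunct2])
    show "continuous_on UNIV (%z. a * f z + b * g z) \<and> ?I x (%z. a * f z + b * g z) k = 0"
     if "continuous_on UNIV f \<and> ?I x f k = 0" "continuous_on UNIV g \<and> ?I x g k = 0" for a b f g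
    proof -
     have "?I x (%z. a * f z + b * g z) k = a * ?I x f k + b * ?I x g k"
      using int[OF \<open>x \<in> U\<close>, of f] int[OF \<open>x \<in> U\<close>, of g] that
      by (simp add: distrib_left distrib_right mult.left_commute[of _ a] mult.left_commute[of _ b] mult.assoc)
     then show ?thesis using that by (auto intro!: continuous_intros)
    qed
    show "continuous_on UNIV (monomial es') \<and> ?I x (monomial es') k = 0"
     if "length es' + 1 = length ([]::'a list) + length es" for es'
     using Suc.IH that \<open>length es <= k\<close> \<open>x \<in> U\<close> mono_c by auto
   qed auto
   then show ?thesis
    using diff[of es k x e] Suc.IH that beta_pos[of k] by simp
  qed
  have rad: "?I x (monomial []) (Suc k) = 0" if x: "x \<in> U" for x
  proof -
   let ?k = "Suc k" let ?gam = "beta + 2 * real (Suc k)"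
   have "?I x (dmonomial b [b]) ?k - ?gam * ?I x (monomial [b, b]) (Suc ?k) = 0" for b
    by (rule diff[OF up x]) auto
   then have "(\<Sum>b\<in>Basis. ?I x (dmonomial b [b]) ?k - ?gam * ?I x (monomial [b, b]) (Suc ?k)) = 0"
    by (intro sum.neutral) blast
   then have "(\<Sum>b\<in>Basis. ?I x (dmonomial b [b]) ?k) = ?gam * (\<Sum>b\<in>Basis. ?I x (monomial [b, b]) (Suc ?k))"
    by (simp only: sum_subtractf sum_distrib_left)
   moreover have "(\<Sum>b\<in>Basis. ?I x (dmonomial b [b]) ?k) = real DIM('a) * ?I x (monomial []) ?k"
    by (simp add: inner_Basis)
   moreover have "(\<Sum>b\<in>Basis. ?I x (monomial [b, b]) (Suc ?k)) = ?I x (monomial []) ?k"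
   proof -
    have "(\<Sum>b\<in>Basis. ?I x (monomial [b, b]) (Suc ?k))
     = (LI y. (\<Sum>b\<in>Basis. w y * (monomial [b, b] (x - y) * riesz (beta + 2 * real (Suc ?k)) (x - y))))"
     by (rule L1_integral_sum[symmetric]) (rule int[OF x mono_c])
    also have "... = ?I x (monomial []) ?k"
    proof (rule L1_integral_cong[OF refl])
     fix y
     have s: "(\<Sum>b\<in>Basis. (b \<bullet> z) * (b \<bullet> z)) = z \<bullet> z" for z :: 'a
      by (subst (3) euclidean_inner) (simp add: inner_commute)
     have g: "beta + 2 * real (Suc ?k) = ?gam + 2" by simp
     have "(\<Sum>b\<in>Basis. w y * (monomial [b, b] (x - y) * riesz (beta + 2 * real (Suc ?k)) (x - y)))
      = w y * ((\<Sum>b\<in>Basis. (b \<bullet> (x - y)) * (b \<bullet> (x - y))) * riesz (?gam + 2) (x - y))"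
      unfolding g by (simp add: sum_distrib_left sum_distrib_right)
     also have "... = w y * riesz ?gam (x - y)"
     proof (cases "y \<in> K")
      case True
      then have "x - y ~= 0" using x U(3) by auto
      then show ?thesis by (simp only: s riesz_inner[OF \<open>x - y ~= 0\<close>])
     qed (simp add: w0)
     finally show "(\<Sum>b\<in>Basis. w y * (monomial [b, b] (x - y) * riesz (beta + 2 * real (Suc ?k)) (x - y)))
      = w y * (monomial [] (x - y) * riesz ?gam (x - y))" by simp
    qed
    finally show ?thesis .
   qed
   ultimately have "(real DIM('a) - ?gam) * ?I x (monomial []) ?k = 0" by (simp only: left_diff_distrib)
   moreover have "real DIM('a) - ?gam ~= 0" using beta by simp
   ultimately show ?thesis by simp
  qed
  show ?case
  proof (intro allI impI)
   fix es :: "'a list" and x assume "length es <= Suc k" "x \<in> U"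
   then show "?I x (monomial es) (Suc k) = 0" using up rad by (cases es) auto
  qed
 qed
 obtain x where x: "x \<in> U" using U(2) by blast
 have nz: "x - y ~= 0" if "y \<in> K" for y using that x U(3) by auto
 define zeta where "zeta y = (1 / ((x - y) \<bullet> (x - y))) *\<^sub>R (x - y)" for y
 have "ae y. w y * riesz beta (x - y) = 0"
 proof (rule zero_AE_if_moments_zero[OF _ K])
  show "L1 (%y. w y * riesz beta (x - y))" using int[OF x continuous_on_const, of 1 beta] by simp
  show "w y * riesz beta (x - y) = 0" if "y \<notin> K" for y using w0[OF that] by simp
  show "continuous_on K zeta" unfolding zeta_def using nz by (intro continuous_intros) auto
  show "inj_on zeta K"
  proof (rule inj_onI)
   fix y y' assume y: "y \<in> K" "y' \<in> K" and eq: "zeta y = zeta y'"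
   have inv: "(1 / (zeta y \<bullet> zeta y)) *\<^sub>R zeta y = x - y" if "y \<in> K" for y
   proof -
    let ?q = "(x - y) \<bullet> (x - y)"
    have q: "?q ~= 0" using nz[OF that] by simp
    have "zeta y \<bullet> zeta y = (1 / ?q) * ((1 / ?q) * ?q)"
     unfolding zeta_def inner_scaleR_left inner_scaleR_right ..
    also have "... = 1 / ?q" using q by (metis mult.right_neutral nonzero_eq_divide_eq)
    finally have "(1 / (zeta y \<bullet> zeta y)) *\<^sub>R zeta y = (?q * (1 / ?q)) *\<^sub>R (x - y)"
     unfolding zeta_def by (simp only: scaleR_scaleR divide_divide_eq_right mult_1 div_by_1)
    moreover have "?q * (1 / ?q) = 1" using q by simp
    ultimately show ?thesis by (simp only: scaleR_one)
   qed
   have "x - y = x - y'" using inv[OF y(1), unfolded eq] inv[OF y(2)] by (rule trans[OF sym])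
   then show "y = y'" by (rule diff_left_imp_eq)
  qed
  show "zeta \<in> Borel" unfolding zeta_def by measurable
  fix es
  have "(LI y. w y * riesz beta (x - y) * monomial es (zeta y)) = ?I x (monomial es) (length es)"
  proof (rule L1_integral_cong[OF refl])
   fix y
   show "w y * riesz beta (x - y) * monomial es (zeta y) = w y * (monomial es (x - y) * riesz (beta + 2 * real (length es)) (x - y))"
   proof (cases "y \<in> K")
    case True
    let ?q = "(x - y) \<bullet> (x - y)"
    have q: "?q > 0" using nz[OF True] by simp
    have "riesz beta (x - y) * (1 / ?q) ^ length es = riesz (beta + 2 * real (length es)) (x - y)"
     by (rule riesz_power[OF nz[OF True]])
    then show ?thesis by (simp add: zeta_def monomial_scaleR)
   qed (simp add: w0)
  qed
  also have "... = 0" using T x by blast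
  finally show "(LI y. w y * riesz beta (x - y) * monomial es (zeta y)) = 0" .
 qed
 then show ?thesis
 proof (rule AE_mp, intro AE_I2 impI)
  fix y assume "w y * riesz beta (x - y) = 0"
  then show "w y = 0" using nz[of y] w0[of y] by (cases "y \<in> K") (auto simp: riesz_eq)
 qed
qed

section \<open>Test functions\<close>

text \<open>The powers of \<open>r\<close> in the denominator keep the derivatives within the family.\<close>

definition flat :: "nat => real => real" where
 "flat k r = (if 0 < r then exp (- 1 / r) / r ^ k else 0)"

lemma flat_bound: "\<bar>flat k r\<bar> <= (real k + 1) ^ (k + 1) * \<bar>r\<bar>"
proof (cases "0 < r")
 case True
 define n where "n = k + 1"
 have n: "n > 0" by (simp add: n_def)
 have "(1 / r / real n) ^ n <= (1 + 1 / r / real n) ^ n" using True by (intro power_mono) auto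
 also have "... <= exp (1 / r)"
  using True by (intro exp_ge_one_plus_x_over_n_power_n) (use n in \<open>auto intro: order_trans[of _ 0]\<close>)
 finally have "exp (- (1 / r)) * (1 / r / real n) ^ n <= exp (- (1 / r)) * exp (1 / r)"
  by (intro mult_left_mono) auto
 also have "... = 1" by (simp flip: exp_add)
 also have "(1 / r / real n) ^ n = 1 / (r ^ n * real n ^ n)" by (simp add: power_divide power_mult_distrib)
 finally have "exp (- (1 / r)) / (r ^ n * real n ^ n) <= 1" by simp
 then have "exp (- (1 / r)) <= r ^ n * real n ^ n" using True n by (simp add: divide_le_eq)
 then have "exp (- (1 / r)) <= (real n ^ n * r) * r ^ k" by (simp add: n_def mult_ac)
 then have "exp (- (1 / r)) / r ^ k <= real n ^ n * r" using True by (simp add: divide_le_eq)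
 moreover have "real n = real k + 1" by (simp add: n_def)
 ultimately show ?thesis using True by (simp add: flat_def n_def add.commute[of 1])
next
 case False
 have "0 <= (real k + 1) ^ (k + 1) * \<bar>r\<bar>" by (intro mult_nonneg_nonneg zero_le_power) auto
 then show ?thesis using False unfolding flat_def by (simp only: if_False abs_zero)
qed

lemma flat_DERIV: "(flat k has_real_derivative flat (k + 2) r - real k * flat (k + 1) r) (at r)"
proof (cases "r = 0")
 case True
 have "((%h. (flat k (0 + h) - flat k 0) / h) ---> 0) (at 0)"
 proof (rule Lim_null_comparison)
  have "norm ((flat k (0 + h) - flat k 0) / h) <= (real (k + 1) + 1) ^ (k + 1 + 1) * \<bar>h\<bar>" for h
  proof -
   have "norm ((flat k (0 + h) - flat k 0) / h) = \<bar>flat (k + 1) h\<bar>"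
    by (auto simp: flat_def abs_mult)
   then show ?thesis using flat_bound[of "k + 1" h] by simp
  qed
  then show "\<forall>\<^sub>F h in at 0. norm ((flat k (0 + h) - flat k 0) / h) <= (real (k + 1) + 1) ^ (k + 1 + 1) * \<bar>h\<bar>" by simp
  have "((%h. (real (k + 1) + 1) ^ (k + 1 + 1) * \<bar>h\<bar>) ---> (real (k + 1) + 1) ^ (k + 1 + 1) * \<bar>0\<bar>) (at 0)"
   by (intro tendsto_intros)
  then show "((%h. (real (k + 1) + 1) ^ (k + 1 + 1) * \<bar>h\<bar>) ---> 0) (at 0)" by simp
 qed
 then show ?thesis using True by (simp add: DERIV_def flat_def)
next
 case False
 show ?thesis
 proof (cases "0 < r")
  case True
  have "((%r. exp (- 1 / r) * inverse (r ^ k)) has_real_derivative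
   exp (- 1 / r) * (1 / r\<^sup>2) * inverse (r ^ k) + exp (- 1 / r) * (- real k * inverse (r ^ (k + 1)))) (at r)"
  proof -
   have d1: "((%r. exp (- 1 / r)) has_real_derivative exp (- 1 / r) * (1 / r\<^sup>2)) (at r)"
    using True by (auto intro!: derivative_eq_intros simp: power2_eq_square)
   have d2: "((%r. inverse (r ^ k)) has_real_derivative - real k * inverse (r ^ (k + 1))) (at r)"
   proof (cases k)
    case (Suc m)
    have "((%r. inverse (r ^ k)) has_real_derivative - (inverse (r ^ k) * (real k * r ^ (k - 1)) * inverse (r ^ k))) (at r)"
     using True by (intro DERIV_inverse' DERIV_pow) auto
    moreover have "inverse (r ^ k) * (real k * r ^ (k - 1)) * inverse (r ^ k) = real k * inverse (r ^ (k + 1))"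
     using True unfolding Suc by (simp add: field_simps)
    ultimately show ?thesis by (simp only: mult_minus_left)
   qed simp
   show ?thesis using DERIV_mult[OF d1 d2] by (simp add: algebra_simps)
  qed
  moreover have "exp (- 1 / r) * (1 / r\<^sup>2) * inverse (r ^ k) + exp (- 1 / r) * (- real k * inverse (r ^ (k + 1)))
   = flat (k + 2) r - real k * flat (k + 1) r"
   using True by (simp add: flat_def divide_inverse power_add power2_eq_square mult_ac)
  ultimately have "((%r. exp (- 1 / r) * inverse (r ^ k)) has_real_derivative flat (k + 2) r - real k * flat (k + 1) r) (at r)"
   by simp
  then show ?thesis
   by (rule has_field_derivative_transform_within_open[where S="{0<..}"]) (use True in \<open>auto simp: flat_def divide_inverse\<close>)
 next
  case neg: False
  then have "r < 0" using False by simp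
  have "((%r. 0) has_real_derivative flat (k + 2) r - real k * flat (k + 1) r) (at r)"
   using \<open>r < 0\<close> by (simp add: flat_def)
  then show ?thesis
   by (rule has_field_derivative_transform_within_open[where S="{..<0}"]) (use \<open>r < 0\<close> in \<open>auto simp: flat_def\<close>)
 qed
qed

text \<open>A class that is visibly closed under differentiation, so that its members are smooth.\<close>

inductive_set bumps :: "'a::euclidean_space => real => ('a => real) set" for p :: 'a and rho :: real where
 mono: "(%x. c * (monomial es x * flat k (rho\<^sup>2 - (norm (x - p))\<^sup>2))) \<in> bumps p rho"
| add: "f \<in> bumps p rho ==> g \<in> bumps p rho ==> (%x. f x + g x) \<in> bumps p rho"

lemma bumps_scale: "f \<in> bumps p rho ==> (%x. a * f x) \<in> bumps p rho"
proof (induction rule: bumps.induct)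
 case (mono c es k)
 then show ?case using bumps.mono[of "a * c" es k] by (simp add: mult.assoc)
next
 case (add f g)
 then show ?case using bumps.add by (simp add: distrib_left)
qed

lemma bumps_lincomb: "f \<in> bumps p rho ==> g \<in> bumps p rho ==> (%x. a * f x + b * g x) \<in> bumps p rho"
 by (intro bumps.add bumps_scale)

lemma bumps_zero: "(%x. 0) \<in> bumps p rho"
 using bumps.mono[of 0 "[]" 0] by simp

lemma bumps_mono1: "(%x. monomial es x * flat k (rho\<^sup>2 - (norm (x - p))\<^sup>2)) \<in> bumps p rho"
 using bumps.mono[of 1] by simp

lemma bumps_has_derivative:
 assumes "f \<in> bumps p rho"
 shows "\<exists>F. (\<forall>x. (f has_derivative F x) (at x)) \<and> (\<forall>h. (%x. F x h) \<in> bumps p rho)"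
 using assms
proof (induction rule: bumps.induct)
 case (mono c es k)
 let ?g = "%x. rho\<^sup>2 - (norm (x - p))\<^sup>2"
 let ?d = "%r. flat (k + 2) r - real k * flat (k + 1) r"
 define F where "F x h = c * (monomial es x * (?d (?g x) * (- 2 * ((x - p) \<bullet> h))) + dmonomial h es x * flat k (?g x))" for x h
 have "((%x. c * (monomial es x * flat k (?g x))) has_derivative F x) (at x)" for x
 proof -
  have g: "(?g has_derivative (%h. - 2 * ((x - p) \<bullet> h))) (at x)"
   unfolding power2_norm_eq_inner by (auto intro!: derivative_eq_intros simp: inner_commute)
  have "((%x. flat k (?g x)) has_derivative (%h. ?d (?g x) * (- 2 * ((x - p) \<bullet> h)))) (at x)"
   by (rule has_derivative_compose[OF g, of "flat k", OF has_field_derivative_imp_has_derivative[OF flat_DERIV]])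
  from has_derivative_mult[OF monomial_has_derivative this, of es]
  show ?thesis unfolding F_def by (rule has_derivative_mult_right)
 qed
 moreover have "(%x. F x h) \<in> bumps p rho" for h
 proof -
  have 1: "(%x. monomial es x * (?d (?g x) * (- 2 * ((x - p) \<bullet> h)))) \<in> bumps p rho"
  proof -
   have m: "(%x. monomial es x * flat j (?g x) * ((x - p) \<bullet> h)) \<in> bumps p rho" for j
    using bumps_lincomb[OF bumps_mono1[of "h # es" j] bumps_mono1[of es j], where a = 1 and b = "- (p \<bullet> h)"]
    by (simp add: inner_diff_left inner_commute algebra_simps)
   show ?thesis
    using bumps_lincomb[OF m[of "k + 2"] m[of "k + 1"], where a = "- 2" and b = "2 * real k"]
    by (simp add: algebra_simps)
  qed
  have 2: "(%x. dmonomial h es x * flat k (?g x)) \<in> bumps p rho"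
  proof -
   have "(%z. (monomial [] z * dmonomial h es z) * flat k (?g z)) \<in> bumps p rho"
   proof (rule dmonomial_induct[where L = "%q. (%z. q z * flat k (?g z)) \<in> bumps p rho"])
    show "(%z. (a * u z + b * v z) * flat k (?g z)) \<in> bumps p rho"
     if "(%z. u z * flat k (?g z)) \<in> bumps p rho" "(%z. v z * flat k (?g z)) \<in> bumps p rho" for a b u v
     using bumps_lincomb[OF that, where a = a and b = b] by (simp add: algebra_simps)
   qed (auto intro: bumps_mono1 simp: bumps_zero)
   then show ?thesis by simp
  qed
  show ?thesis unfolding F_def using bumps_scale[OF bumps.add[OF 1 2], of c] .
 qed
 ultimately show ?case by blast
next
 case (add f g)
 then obtain F G where "\<forall>x. (f has_derivative F x) (at x)" "\<forall>h. (%x. F x h) \<in> bumps p rho"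
  "\<forall>x. (g has_derivative G x) (at x)" "\<forall>h. (%x. G x h) \<in> bumps p rho" by blast
 then show ?case
  by (intro exI[of _ "%x h. F x h + G x h"]) (auto intro!: has_derivative_add bumps.add)
qed

lemma bumps_partial_derivs: "f \<in> bumps p rho ==> partial_derivs vs f \<in> bumps p rho"
proof (induction vs)
 case (Cons v vs)
 then obtain F where F: "!!x. (partial_derivs vs f has_derivative F x) (at x)" "!!h. (%x. F x h) \<in> bumps p rho"
  using bumps_has_derivative by blast
 have "partial_derivs (v # vs) f = (%x. F x v)" using frechet_derivative_at[OF F(1)] by auto
 then show ?case using F(2) by simp
qed simp

lemma bumps_differentiable: "f \<in> bumps p rho ==> f differentiable (at x)"
 using bumps_has_derivative unfolding differentiable_def by blast

lemma bumps_continuous: "f \<in> bumps p rho ==> continuous_on S f"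
 by (meson bumps_differentiable continuous_at_imp_continuous_on differentiable_imp_continuous_within)

lemma bumps_C_infinity: "f \<in> bumps p rho ==> C_infinity f"
 unfolding C_infinity_def using bumps_partial_derivs bumps_differentiable by blast

lemma bumps_support: "f \<in> bumps p rho ==> 0 < rho ==> rho <= norm (x - p) ==> f x = 0"
proof (induction rule: bumps.induct)
 case (mono c es k)
 then have "rho\<^sup>2 <= (norm (x - p))\<^sup>2" by (intro power_mono) auto
 then show ?case by (simp add: flat_def)
qed simp

lemma bumps_test_function:
 assumes "f \<in> bumps p rho" "0 < rho" "cball p rho \<subseteq> U"
 shows "f \<in> test_functions U"
proof -
 have "{x. f x ~= 0} \<subseteq> cball p rho"
 proof
  fix x assume "x \<in> {x. f x ~= 0}"
  then have "\<not> rho <= norm (x - p)" using bumps_support[OF assms(1,2), of x] by auto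
  then show "x \<in> cball p rho" by (simp add: dist_norm norm_minus_commute)
 qed
 then have sub: "closure {x. f x ~= 0} \<subseteq> cball p rho" by (intro closure_minimal) auto
 have "bounded {x. f x ~= 0}" by (rule bounded_subset[OF bounded_cball \<open>{x. f x ~= 0} \<subseteq> cball p rho\<close>])
 then have "compact (closure {x. f x ~= 0})" by (rule compact_closure[THEN iffD2])
 then show ?thesis using bumps_C_infinity[OF assms(1)] sub assms(3) by (auto simp: test_functions_def)
qed

lemma bumps_schwartz:
 assumes f: "f \<in> bumps p rho" "0 < rho" shows "f \<in> schwartz_functions"
proof -
 have "bounded (range (%x. norm x ^ k * partial_derivs vs f x))" for vs k
 proof -
  note P = bumps_partial_derivs[OF f(1), of vs]
  have "range (%x. norm x ^ k * partial_derivs vs f x) \<subseteq> insert 0 ((%x. norm x ^ k * partial_derivs vs f x) ` cball p rho)"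
   using bumps_support[OF P f(2)] by (force simp: dist_norm norm_minus_commute)
  moreover have "bounded ((%x. norm x ^ k * partial_derivs vs f x) ` cball p rho)"
   by (intro compact_imp_bounded compact_continuous_image continuous_intros bumps_continuous[OF P]) simp
  ultimately show ?thesis using bounded_subset bounded_insert by metis
 qed
 then show ?thesis using bumps_C_infinity[OF f(1)] by (simp add: schwartz_functions_def)
qed

definition bump :: "'a::euclidean_space => real => 'a => real" where
 "bump p rho x = flat 0 (rho\<^sup>2 - (norm (x - p))\<^sup>2)"

lemma bump_in_bumps: "bump p rho \<in> bumps p rho"
 using bumps_mono1[of "[]" 0] by (simp add: bump_def[abs_def])

lemma bump_pos: "norm (x - p) < rho ==> 0 < bump p rho x"
 using power_strict_mono[of "norm (x - p)" rho 2] by (simp add: bump_def flat_def)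

subsection \<open>The fundamental lemma of the calculus of variations\<close>

text \<open>A bump times a polynomial is a test function, so \<open>g\<close> times a positive bump has vanishing moments.\<close>

theorem fundamental_lemma:
 fixes g :: "'a::euclidean_space => real"
 assumes U: "open U" and g: "g \<in> Borel"
  and loc: "!!p rho. cball p rho \<subseteq> U ==> L1 (%x. indicator (cball p rho) x * g x)"
  and orth: "!!phi. phi \<in> test_functions U ==> (LI x. g x * phi x) = 0"
 shows "ae x. x \<in> U \<longrightarrow> g x = 0"
proof -
 note [measurable] = g
 have ball: "ae x. x \<in> ball p rho \<longrightarrow> g x = 0" if rho: "rho > 0" "cball p rho \<subseteq> U" for p rho
 proof -
  have [measurable]: "bump p rho \<in> Borel"
   by (rule borel_measurable_continuous_onI[OF bumps_continuous[OF bump_in_bumps]])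
  define w where "w x = indicator (cball p rho) x * g x * bump p rho x" for x
  have bz: "bump p rho x = 0" if "x \<notin> cball p rho" for x
   using bumps_support[OF bump_in_bumps rho(1), of x] that by (simp add: dist_norm norm_minus_commute)
  have "ae x. w x = 0"
  proof (rule zero_AE_if_moments_zero[where zeta = "%x. x" and K = "cball p rho"])
   have "bounded (bump p rho ` cball p rho)"
    by (intro compact_imp_bounded compact_continuous_image bumps_continuous[OF bump_in_bumps]) simp
   then obtain M where M: "!!x. x \<in> cball p rho ==> norm (bump p rho x) <= M" unfolding bounded_iff by blast
   show "L1 w" unfolding w_def
    by (rule integrable_mult_bounded_on[OF loc[OF rho(2)], of "cball p rho" _ M]) (use M in auto)
   fix es
   have "(%x. w x * monomial es x) = (%x. g x * (monomial es x * flat 0 (rho\<^sup>2 - (norm (x - p))\<^sup>2)))"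
   proof
    fix x show "w x * monomial es x = g x * (monomial es x * flat 0 (rho\<^sup>2 - (norm (x - p))\<^sup>2))"
     using bz[of x] unfolding w_def bump_def by (cases "x \<in> cball p rho") auto
   qed
   then show "(LI x. w x * monomial es x) = 0"
    using orth[OF bumps_test_function[OF bumps_mono1 rho], of es 0] by (simp only:)
  qed (auto simp: w_def)
  then show ?thesis
  proof (rule AE_mp, intro AE_I2 impI)
   fix x assume "w x = 0" "x \<in> ball p rho"
   then show "g x = 0" using bump_pos[of x p rho] by (auto simp: w_def dist_norm norm_minus_commute)
  qed
 qed
 define \<B> where "\<B> = {ball p rho | p rho. rho > 0 \<and> cball p rho \<subseteq> U}"
 have "U \<subseteq> \<Union>\<B>"
 proof
  fix x assume "x \<in> U"
  then obtain e where "e > 0" "cball x e \<subseteq> U" using U open_contains_cball by blast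
  then have "ball x e \<in> \<B>" "x \<in> ball x e" by (auto simp: \<B>_def)
  then show "x \<in> \<Union>\<B>" by blast
 qed
 obtain \<B>' where \<B>': "\<B>' \<subseteq> \<B>" "countable \<B>'" "\<Union>\<B>' = \<Union>\<B>"
  using Lindelof[of \<B>] unfolding \<B>_def by auto
 have "ae x. \<forall>B\<in>\<B>'. x \<in> B \<longrightarrow> g x = 0"
  using \<B>'(2) by (rule AE_ball_countable[THEN iffD2]) (use \<B>'(1) ball in \<open>auto simp: \<B>_def\<close>)
 then show ?thesis by (rule AE_mp) (use \<open>U \<subseteq> \<Union>\<B>\<close> \<B>'(3) in \<open>auto intro!: AE_I2\<close>)
qed

subsection \<open>Elementary properties of test functions\<close>

lemma C_infinity_has_derivative:
 assumes "C_infinity f" "set vs \<subseteq> Basis"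
 shows "(partial_derivs vs f has_derivative (%h. \<Sum>b\<in>Basis. (h \<bullet> b) * partial_derivs (b # vs) f x)) (at x)"
proof -
 let ?D = "frechet_derivative (partial_derivs vs f) (at x)"
 have d: "(partial_derivs vs f has_derivative ?D) (at x)"
  using assms by (simp add: C_infinity_def frechet_derivative_works[symmetric])
 then have l: "linear ?D" by (rule has_derivative_linear)
 have "?D h = (\<Sum>b\<in>Basis. (h \<bullet> b) * partial_derivs (b # vs) f x)" for h
 proof -
  have "?D h = ?D (\<Sum>b\<in>Basis. (h \<bullet> b) *\<^sub>R b)" by (simp add: euclidean_representation)
  also have "... = (\<Sum>b\<in>Basis. (h \<bullet> b) *\<^sub>R ?D b)" by (simp add: linear_sum[OF l] linear_cmul[OF l])
  finally show ?thesis by simp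
 qed
 then have "?D = (%h. \<Sum>b\<in>Basis. (h \<bullet> b) * partial_derivs (b # vs) f x)" by (rule ext)
 then show ?thesis using d by simp
qed

lemma C_infinity_continuous: "C_infinity f ==> set vs \<subseteq> Basis ==> continuous_on S (partial_derivs vs f)"
 unfolding C_infinity_def
 by (meson continuous_at_imp_continuous_on differentiable_imp_continuous_within)

lemma C_infinity_borel: "C_infinity f ==> set vs \<subseteq> Basis ==> partial_derivs vs f \<in> Borel"
 by (intro borel_measurable_continuous_onI C_infinity_continuous)

lemma C_infinity_DERIV_line:
 assumes f: "C_infinity f" and vs: "set vs \<subseteq> Basis"
 shows "((%t. partial_derivs vs f (x + t *\<^sub>R h)) has_real_derivative
  (\<Sum>b\<in>Basis. (h \<bullet> b) * partial_derivs (b # vs) f (x + t *\<^sub>R h))) (at t)"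
proof -
 have "((%t. partial_derivs vs f (x + t *\<^sub>R h)) has_derivative
   (%s. \<Sum>b\<in>Basis. ((s *\<^sub>R h) \<bullet> b) * partial_derivs (b # vs) f (x + t *\<^sub>R h))) (at t)"
  by (rule has_derivative_compose[of "%t. x + t *\<^sub>R h" "%s. s *\<^sub>R h", OF _ C_infinity_has_derivative[OF f vs]])
   (auto intro!: derivative_eq_intros)
 moreover have "(%s. \<Sum>b\<in>Basis. ((s *\<^sub>R h) \<bullet> b) * partial_derivs (b # vs) f (x + t *\<^sub>R h))
  = (*) (\<Sum>b\<in>Basis. (h \<bullet> b) * partial_derivs (b # vs) f (x + t *\<^sub>R h))"
  by (rule ext) (simp add: sum_distrib_left mult_ac)
 ultimately show ?thesis by (simp add: has_field_derivative_def)
qed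

lemma test_functionD:
 assumes "phi \<in> test_functions U"
 shows "C_infinity phi" "continuous_on S phi" "phi \<in> Borel"
  "\<exists>K. compact K \<and> K \<subseteq> U \<and> (\<forall>x. x \<notin> K \<longrightarrow> phi x = 0)"
proof -
 show C: "C_infinity phi" using assms by (simp add: test_functions_def)
 show "continuous_on S phi" "phi \<in> Borel"
  using C_infinity_continuous[OF C, of "[]"] C_infinity_borel[OF C, of "[]"] by auto
 show "\<exists>K. compact K \<and> K \<subseteq> U \<and> (\<forall>x. x \<notin> K \<longrightarrow> phi x = 0)"
  using assms closure_subset[of "{x. phi x ~= 0}"] by (intro exI[of _ "closure {x. phi x ~= 0}"]) (auto simp: test_functions_def)
qed

lemma test_functions_mono: "U \<subseteq> V ==> phi \<in> test_functions U ==> phi \<in> test_functions V"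
 by (auto simp: test_functions_def)

lemma test_function_bounded:
 assumes phi: "phi \<in> test_functions U" obtains M where "!!x. \<bar>phi x\<bar> <= M"
proof -
 obtain K where K: "compact K" "!!x. x \<notin> K ==> phi x = 0" using test_functionD(4)[OF phi] by blast
 have "bounded (phi ` K)" by (rule compact_imp_bounded[OF compact_continuous_image[OF test_functionD(2)[OF phi] K(1)]])
 then obtain M where "!!x. x \<in> K ==> norm (phi x) <= M" unfolding bounded_iff by blast
 then have "\<bar>phi x\<bar> <= max 0 M" for x using K(2)[of x] by (cases "x \<in> K") (auto intro: le_max_iff_disj[THEN iffD2])
 then show ?thesis using that by blast
qed

lemma partial_derivs_support:
 assumes phi: "phi \<in> test_functions U" and x: "x \<notin> closure {x. phi x ~= 0}"
 shows "partial_derivs [b] phi x = 0"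
proof -
 have "(phi has_derivative (%_. 0)) (at x)"
 proof (rule has_derivative_transform_within_open[of "%_. 0"])
  show "open (- closure {x. phi x ~= 0})" by (rule open_Compl[OF closed_closure])
  show "0 = phi y" if "y \<in> - closure {x. phi x ~= 0}" for y
   using that closure_subset[of "{x. phi x ~= 0}"] by auto
 qed (use x in auto)
 then have "frechet_derivative phi (at x) = (%_. 0)" by (rule frechet_derivative_at[symmetric])
 then show ?thesis by simp
qed

lemma test_function_lipschitz:
 assumes phi: "phi \<in> test_functions U" obtains M where "M >= 0" "!!x h. \<bar>phi (x + h) - phi x\<bar> <= M * norm h"
proof -
 let ?K = "closure {x. phi x ~= 0}"
 have C: "C_infinity phi" and K: "compact ?K" using phi by (auto simp: test_functions_def)
 have "\<exists>M. \<forall>x. \<bar>partial_derivs [b] phi x\<bar> <= M" if b: "b \<in> Basis" for b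
 proof -
  have c: "continuous_on ?K (partial_derivs [b] phi)" by (rule C_infinity_continuous[OF C]) (use b in simp)
  have "bounded (partial_derivs [b] phi ` ?K)" by (rule compact_imp_bounded[OF compact_continuous_image[OF c K]])
  then obtain M where "!!x. x \<in> ?K ==> norm (partial_derivs [b] phi x) <= M" unfolding bounded_iff by blast
  then have "\<bar>partial_derivs [b] phi x\<bar> <= max 0 M" for x
   using partial_derivs_support[OF phi, of x b] by (cases "x \<in> ?K") (auto simp: le_max_iff_disj)
  then show ?thesis by blast
 qed
 then obtain M where M: "!!b x. b \<in> Basis ==> \<bar>partial_derivs [b] phi x\<bar> <= M b" by metis
 let ?M = "\<Sum>b\<in>Basis. M b"
 have M0: "0 <= M b" if "b \<in> Basis" for b using M[OF that, of undefined] by linarith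
 have "\<bar>phi (x + h) - phi x\<bar> <= ?M * norm h" for x h
 proof -
  have "\<exists>z>0. z < 1 \<and> phi (x + 1 *\<^sub>R h) - phi (x + 0 *\<^sub>R h) = (1 - 0) * (\<Sum>b\<in>Basis. (h \<bullet> b) * partial_derivs [b] phi (x + z *\<^sub>R h))"
   using C_infinity_DERIV_line[OF C, of "[]"] by (intro MVT2) auto
  then obtain z where z: "phi (x + h) - phi x = (\<Sum>b\<in>Basis. (h \<bullet> b) * partial_derivs [b] phi (x + z *\<^sub>R h))" by auto
  have "\<bar>phi (x + h) - phi x\<bar> <= (\<Sum>b\<in>Basis. \<bar>(h \<bullet> b) * partial_derivs [b] phi (x + z *\<^sub>R h)\<bar>)" unfolding z by (rule sum_abs)
  also have "... <= (\<Sum>b\<in>Basis. norm h * M b)"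
   by (intro sum_mono) (auto simp: abs_mult simp del: partial_derivs.simps intro!: mult_mono M Basis_le_norm)
  finally show ?thesis by (simp add: sum_distrib_left mult.commute)
 qed
 then show ?thesis using that[of ?M] M0 by (simp add: sum_nonneg)
qed

lemma test_function_integrable:
 assumes phi: "phi \<in> test_functions U" shows "L1 phi" "L2 phi"
proof -
 have [measurable]: "phi \<in> Borel" by (rule test_functionD(3)[OF phi])
 obtain K where K: "compact K" "!!x. x \<notin> K ==> phi x = 0" using test_functionD(4)[OF phi] by blast
 obtain M where M: "!!x. \<bar>phi x\<bar> <= M" using test_function_bounded[OF phi] by blast
 have [measurable]: "K \<in> sets borel" by (rule borel_compact[OF K(1)])
 have i: "L1 (indicator K :: 'a => real)" using emeasure_compact_finite[OF K(1)] by simp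
 have "L1 (%x. indicator K x * phi x)"
  by (rule integrable_mult_bounded_on[OF i, of K _ M]) (use M in auto)
 moreover have "indicator K x * phi x = phi x" for x using K(2)[of x] by (cases "x \<in> K") auto
 ultimately show int: "L1 phi" by simp
 have "L1 (%x. phi x * phi x)"
  by (rule integrable_mult_bounded_on[OF int, of UNIV _ M]) (use M in auto)
 then show "L2 phi" by (simp add: L2_def power2_eq_square)
qed

section \<open>Continuity of translations in the mean\<close>

text \<open>Translations are isometries, so the modulus of continuity is stable under small perturbations.\<close>

lemma translate_perturb:
 fixes f g :: "'a::euclidean_space => real"
 assumes f: "L2 f" and g: "L2 g"
 shows "sqint (%x. f (h + x) - f x) <= 2 * sqint (%x. g (h + x) - g x) + 8 * sqint (%x. f x - g x)"
proof -
 let ?d = "%x. f x - g x"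
 have d: "L2 ?d" by (rule L2_diff[OF f g])
 note dh = L2_translate[OF d, of h]
 have "sqint (%x. f (h + x) - f x) = sqint (%x. (g (h + x) - g x) - (?d x - ?d (h + x)))" by (simp add: algebra_simps)
 also have "... <= 2 * sqint (%x. g (h + x) - g x) + 2 * sqint (%x. ?d x - ?d (h + x))"
  by (rule sqint_diff_le[OF L2_diff[OF L2_translate[OF g] g] L2_diff[OF d dh]])
 finally show ?thesis using sqint_diff_le[OF d dh] sqint_translate[OF d, of h] by linarith
qed

lemma translation_continuous_test_function:
 fixes phi :: "'a::euclidean_space => real"
 assumes phi: "phi \<in> test_functions UNIV"
 shows "((%h. sqint (%x. phi (h + x) - phi x)) ---> 0) (at 0)"
proof -
 have [measurable]: "phi \<in> Borel" by (rule test_functionD(3)[OF phi])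
 obtain M where M: "M >= 0" "!!x h. \<bar>phi (x + h) - phi x\<bar> <= M * norm h" using test_function_lipschitz[OF phi] by metis
 obtain K where K: "compact K" "!!x. x \<notin> K ==> phi x = 0" using test_functionD(4)[OF phi] by blast
 obtain R where R: "!!x. x \<in> K ==> norm x <= R" using compact_imp_bounded[OF K(1)] by (auto simp: bounded_iff)
 let ?i = "indicator (cball (0::'a) (R + 1)) :: 'a => real"
 have i: "L2 ?i" using emeasure_lborel_cball_finite[of "0::'a" "R + 1"] by (intro L2_indicator_set) auto
 have "norm (sqint (%x. phi (h + x) - phi x)) <= (M * norm h)\<^sup>2 * sqint ?i" if h: "norm h < 1" for h
  unfolding real_norm_def abs_of_nonneg[OF sqint_nonneg]
 proof (rule sqint_le[OF _ i])
  fix x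
  show "norm (phi (h + x) - phi x) <= (M * norm h) * norm (?i x)"
  proof (cases "x \<in> cball 0 (R + 1)")
   case False
   then have x: "R + 1 < norm x" by simp
   have "norm x <= norm (h + x) + norm h" using norm_triangle_ineq4[of "h + x" h] by simp
   then have "h + x \<notin> K" "x \<notin> K" using R[of x] R[of "h + x"] x h by auto
   then show ?thesis by (simp add: K(2) M(1))
  qed (use M(2)[of x h] in \<open>simp add: add.commute\<close>)
 qed measurable
 then have ev: "\<forall>\<^sub>F h in at 0. norm (sqint (%x. phi (h + x) - phi x)) <= (M * norm h)\<^sup>2 * sqint ?i"
  unfolding eventually_at by (intro exI[of _ 1]) auto
 have "((%h::'a. (M * norm h)\<^sup>2 * sqint ?i) ---> (M * norm (0::'a))\<^sup>2 * sqint ?i) (at 0)" by (intro tendsto_intros)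
 then have "((%h::'a. (M * norm h)\<^sup>2 * sqint ?i) ---> 0) (at 0)" by simp
 with ev show ?thesis by (rule Lim_null_comparison)
qed

text \<open>The functions whose translates converge in the mean form a closed subspace of \<open>L\<^sup>2\<close>, which
 contains the test functions. The difference of \<open>f\<close> and its projection on this subspace is therefore
 orthogonal to all test functions, and vanishes.\<close>

lemma translation_continuous_real:
 fixes f :: "'a::euclidean_space => real"
 assumes f: "L2 f"
 shows "((%h. sqint (%x. f (h + x) - f x)) ---> 0) (at 0)"
proof -
 let ?c = "%f h. sqint (%x. f (h + x) - f x)"
 define V where "V = {f::'a => real. L2 f \<and> (?c f ---> 0) (at 0)}"
 have VL: "L2 v" if "v \<in> V" for v using that by (simp add: V_def)
 interpret semi_hilbert V inner2
 proof
  have "(%x. 0) \<in> V" by (simp add: V_def sqint_def)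
  then show "V ~= {}" by blast
  show "(%x. a * u x + b * v x) \<in> V" if u: "u \<in> V" and v: "v \<in> V" for u v a b
  proof -
   note L = VL[OF u] VL[OF v]
   have "?c (%x. a * u x + b * v x) h <= 2 * (a\<^sup>2 * ?c u h) + 2 * (b\<^sup>2 * ?c v h)" for h
    using sqint_add_le[OF L2_scaleR[OF L2_diff[OF L2_translate[OF L(1), of h] L(1)], of a] L2_scaleR[OF L2_diff[OF L2_translate[OF L(2), of h] L(2)], of b]]
    unfolding sqint_scaleR by (simp add: algebra_simps)
   moreover have "((%h. 2 * (a\<^sup>2 * ?c u h) + 2 * (b\<^sup>2 * ?c v h)) ---> 2 * (a\<^sup>2 * 0) + 2 * (b\<^sup>2 * 0)) (at 0)"
    using u v unfolding V_def by (intro tendsto_intros) auto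
   ultimately have "(?c (%x. a * u x + b * v x) ---> 0) (at 0)"
    by (intro Lim_null_comparison[of "?c (%x. a * u x + b * v x)" "%h. 2 * (a\<^sup>2 * ?c u h) + 2 * (b\<^sup>2 * ?c v h)"]) auto
   then show ?thesis using L2_add[OF L2_mult[OF L(1)] L2_mult[OF L(2)]] by (simp add: V_def)
  qed
  fix f :: "nat => 'a => real"
  assume fV: "!!n. f n \<in> V" and C: "!!e. 0 < e ==> \<exists>N. \<forall>m\<ge>N. \<forall>n\<ge>N. inner2 (%x. f m x - f n x) (%x. f m x - f n x) < e"
  obtain l where l: "L2 l" "(%n. sqint (%x. f n x - l x)) ----> 0"
   using L2_complete[OF VL[OF fV] C[unfolded inner2_self]] by blast
  have "(?c l ---> 0) (at 0)"
  proof (rule tendstoI)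
   fix e :: real assume e: "0 < e"
   then obtain n where n: "sqint (%x. f n x - l x) < e / 16"
    using order_tendstoD(2)[OF l(2), of "e / 16"] by (auto simp: eventually_sequentially)
   have "\<forall>\<^sub>F h in at 0. ?c (f n) h < e / 4" using fV e by (intro order_tendstoD(2)[of _ 0]) (auto simp: V_def)
   then show "\<forall>\<^sub>F h in at 0. dist (?c l h) 0 < e"
   proof eventually_elim
    case (elim h)
    have "?c l h < e"
     using translate_perturb[OF l(1) VL[OF fV[of n]], of h] elim n e unfolding sqint_commute[of "f n" l] by linarith
    then show ?case by (simp add: dist_norm)
   qed
  qed
  then show "\<exists>l\<in>V. (%n. inner2 (%x. f n x - l x) (%x. f n x - l x)) ----> 0"
   using l unfolding inner2_self by (intro bexI[of _ l]) (auto simp: V_def)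
 qed (auto intro: inner2_commute inner2_lincomb_left VL simp: inner2_self)
 have "\<exists>g\<in>V. \<forall>v\<in>V. inner2 f v = inner2 g v"
 proof (rule riesz_representation[where C="sqint f"])
  show "inner2 f (%x. a * u x + b * v x) = a * inner2 f u + b * inner2 f v" if "u \<in> V" "v \<in> V" for u v a b
   using inner2_lincomb_left[OF VL VL f, OF that] by (simp add: inner2_commute[of f])
  show "(inner2 f u)\<^sup>2 <= sqint f * inner2 u u" if "u \<in> V" for u
   using inner2_cauchy_schwarz[OF f VL[OF that]] by (simp add: inner2_self)
 qed
 then obtain g where g: "g \<in> V" "!!v. v \<in> V ==> inner2 f v = inner2 g v" by blast
 have d: "L2 (%x. f x - g x)" by (rule L2_diff[OF f VL[OF g(1)]])
 have "ae x. x \<in> UNIV \<longrightarrow> f x - g x = 0"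
 proof (rule fundamental_lemma[OF open_UNIV L2_borel[OF d]])
  show "L1 (%x. indicator (cball p rho) x * (f x - g x))" for p rho
   using emeasure_lborel_cball_finite[of p rho] by (intro L2_mult_integrable[OF L2_indicator_set d]) auto
  fix phi :: "'a => real" assume phi: "phi \<in> test_functions UNIV"
  have "phi \<in> V" using translation_continuous_test_function[OF phi] test_function_integrable(2)[OF phi] by (simp add: V_def)
  then show "(LI x. (f x - g x) * phi x) = 0"
   using inner2_diff_left[OF f VL[OF g(1)] VL, of phi] g(2) by (simp add: inner2_def)
 qed
 then have "sqint (%x. f x - g x) = 0" using sqint_eq_0_iff[OF d] by simp
 then have le: "?c f h <= 2 * ?c g h" for h using translate_perturb[OF f VL[OF g(1)], of h] by simp
 have "((%h. 2 * ?c g h) ---> 2 * 0) (at 0)" using g(1) unfolding V_def by (intro tendsto_intros) auto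
 then show ?thesis by (intro Lim_null_comparison[of "?c f" "%h. 2 * ?c g h"]) (use le in auto)
qed

lemma translation_continuous_L2:
 fixes f :: "'a::euclidean_space => 'b::euclidean_space"
 assumes f: "L2 f"
 shows "((%h. sqint (%x. f (h + x) - f x)) ---> 0) (at 0)"
proof -
 have comp: "L2 (%x. f x \<bullet> b)" if "b \<in> Basis" for b
  by (rule L2_dominated[where C=1, OF _ f]) (use L2_borel[OF f] that in \<open>auto intro: Basis_le_norm\<close>)
 have "sqint (%x. f (h + x) - f x) = (\<Sum>b\<in>Basis. sqint (%x. f (h + x) \<bullet> b - f x \<bullet> b))" for h
 proof -
  have "(norm (y::'b))\<^sup>2 = (\<Sum>b\<in>Basis. (y \<bullet> b)\<^sup>2)" for y
   unfolding power2_norm_eq_inner by (subst euclidean_inner) (simp add: power2_eq_square)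
  then show ?thesis unfolding sqint_def
   using L2_integrable[OF L2_diff[OF L2_translate[OF comp] comp]]
   by (subst L1_integral_sum[symmetric]) (auto simp: inner_diff_left)
 qed
 moreover have "((%h. \<Sum>b\<in>Basis. sqint (%x. f (h + x) \<bullet> b - f x \<bullet> b)) ---> (\<Sum>b\<in>(Basis::'b set). 0)) (at 0)"
  by (intro tendsto_sum translation_continuous_real comp)
 ultimately show ?thesis by simp
qed

section \<open>The Fourier transform of square integrable functions\<close>

lemma borel_measurable_cis [measurable (raw)]:
 "f \<in> borel_measurable M ==> (%x. cis (f x)) \<in> borel_measurable M"
 by (rule borel_measurable_continuous_on[of cis]) (auto intro: continuous_intros)

lemma borel_measurable_cnj [measurable (raw)]:
 "f \<in> borel_measurable M ==> (%x. cnj (f x)) \<in> borel_measurable M"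
 by (rule borel_measurable_continuous_on[of cnj]) (auto intro: continuous_intros)

definition cft :: "('a::euclidean_space => complex) => 'a => complex" where
 "cft u xi = (CLINT x|lborel. cis (- (x \<bullet> xi)) * u x)"

lemma integrable_cis_mult:
 assumes "L1 u" "f \<in> Borel"
 shows "L1 (%x::'a::euclidean_space. cis (f x) * u x)"
proof (rule L1_integrable_bound[OF assms(1)])
 have [measurable]: "u \<in> Borel" using assms(1) by auto
 note [measurable] = assms(2)
 show "(%x. cis (f x) * u x) \<in> borel_measurable lborel" by measurable
qed (simp add: norm_mult)

lemma cft_bound: "L1 u ==> cmod (cft u xi) <= (LI x. cmod (u x))"
 unfolding cft_def
 by (rule order_trans[OF integral_norm_bound]) (simp add: norm_mult)

lemma borel_measurable_cft [measurable]:
 assumes "L1 u" shows "cft u \<in> Borel"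
proof -
 have [measurable]: "u \<in> Borel" using assms by auto
 show ?thesis unfolding cft_def[abs_def]
  by (rule lborel.borel_measurable_lebesgue_integral) measurable
qed

lemma integrable_product_mult:
 fixes f :: "'a::euclidean_space => complex" and g :: "'b::euclidean_space => complex"
 assumes f: "L1 f" and g: "L1 g"
 shows "integrable (lborel2) (%(x, y). f x * g y)"
proof (rule lborel_pair.Fubini_integrable)
 have [measurable]: "f \<in> Borel" "g \<in> Borel" using f g by auto
 show "(%(x, y). f x * g y) \<in> borel_measurable (lborel2)" by measurable
 show "L1 (%x. LI y. norm (case (x, y) of (x, y) => f x * g y))"
  using f by (simp add: norm_mult)
 show "ae x. L1 (%y. case (x, y) of (x, y) => f x * g y)"
  using g by simp
qed

lemma multiplication_formula_L1:
 fixes u v :: "'a::euclidean_space => complex"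
 assumes u: "L1 u" and v: "L1 v"
 shows "(CLINT y|lborel. cft u y * v y) = (CLINT x|lborel. u x * cft v x)"
proof -
 have [measurable]: "u \<in> Borel" "v \<in> Borel" using u v by auto
 have int: "integrable (lborel2) (%(x, y). cis (- (x \<bullet> y)) * (u x * v y))"
 proof (rule L1_integrable_bound[OF integrable_product_mult[OF u v]])
  show "(%(x, y). cis (- (x \<bullet> y)) * (u x * v y)) \<in> borel_measurable (lborel2)" by measurable
 qed (auto simp: norm_mult)
 have "(CLINT y|lborel. cft u y * v y) = (CLINT y|lborel. CLINT x|lborel. cis (- (x \<bullet> y)) * (u x * v y))"
  unfolding cft_def by (simp add: mult.assoc flip: integral_mult_left_zero)
 also have "... = (CLINT x|lborel. CLINT y|lborel. cis (- (x \<bullet> y)) * (u x * v y))"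
  by (rule lborel_pair.Fubini_integral) (use int in simp)
 also have "... = (CLINT x|lborel. u x * cft v x)"
  unfolding cft_def by (simp add: inner_commute mult.left_commute flip: integral_mult_right_zero)
 finally show ?thesis .
qed

subsection \<open>Gaussians\<close>

lemma integrable_gaussian_real:
 fixes a :: real assumes "a > 0" shows "L1 (%x::real. exp (- a * x\<^sup>2))"
proof -
 have eq: "exp (- a * x\<^sup>2) = sqrt (pi / a) * normal_density 0 (1 / sqrt (2 * a)) x" for x
  unfolding normal_density_def using assms by (simp add: power_divide real_sqrt_divide field_simps)
 show ?thesis unfolding eq
  by (intro integrable_mult_right integrable_normal_density) (use assms in simp)
qed

lemma gaussian_fourier_real:
 fixes a t :: real assumes a: "a > 0"
 shows "(CLINT x|lborel. cis (- (x * t)) * cplx (exp (- a * x\<^sup>2)))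
  = cplx (sqrt (pi / a) * exp (- t\<^sup>2 / (4 * a)))"
proof -
 define sg where "sg = 1 / sqrt (2 * a)"
 have sg: "sg > 0" "sg\<^sup>2 = 1 / (2 * a)" using a by (auto simp: sg_def power_divide)
 have "(CLINT x|lborel. cis (- (x * t)) * cplx (exp (- a * x\<^sup>2)))
   = sg *\<^sub>R (CLINT y|lborel. cis (- (sg * y * t)) * cplx (exp (- a * (sg * y)\<^sup>2)))"
  using lborel_integral_real_affine[of sg "%x. cis (- (x * t)) * cplx (exp (- a * x\<^sup>2))" 0] sg by simp
 also have "(%y. cis (- (sg * y * t)) * cplx (exp (- a * (sg * y)\<^sup>2)))
  = (%y. cplx (sqrt (2 * pi)) * (std_normal_density y *\<^sub>R iexp ((- sg * t) * y)))"
 proof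
  fix y
  have "- a * (sg * y)\<^sup>2 = - y\<^sup>2 / 2" using sg(2) a by (simp add: power_mult_distrib)
  then show "cis (- (sg * y * t)) * cplx (exp (- a * (sg * y)\<^sup>2))
  = cplx (sqrt (2 * pi)) * (std_normal_density y *\<^sub>R iexp ((- sg * t) * y))"
   by (simp add: std_normal_density_def cis_conv_exp scaleR_conv_of_real mult_ac)
 qed
 also have "(CLINT y|lborel. cplx (sqrt (2 * pi)) * (std_normal_density y *\<^sub>R iexp ((- sg * t) * y)))
  = cplx (sqrt (2 * pi)) * char std_normal_distribution (- sg * t)"
  unfolding char_def integral_mult_right_zero by (subst integral_density) simp_all
 also have "char std_normal_distribution (- sg * t) = cplx (exp (- t\<^sup>2 / (4 * a)))"
  unfolding char_std_normal_distribution using sg(2) by (simp add: power_mult_distrib)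
 also have "sg *\<^sub>R (cplx (sqrt (2 * pi)) * cplx (exp (- t\<^sup>2 / (4 * a))))
  = cplx (sqrt (pi / a) * exp (- t\<^sup>2 / (4 * a)))"
 proof -
  have "sg * sqrt (2 * pi) = sqrt (pi / a)" unfolding sg_def using a by (simp add: real_sqrt_mult real_sqrt_divide)
  then show ?thesis by (simp add: scaleR_conv_of_real flip: of_real_mult mult.assoc)
 qed
 finally show ?thesis .
qed

lemma lborel_product:
 fixes f :: "'a::euclidean_space => real => complex"
 assumes f: "!!b. b \<in> Basis ==> L1 (f b)"
 shows lborel_product_integrable: "L1 (%x::'a. \<Prod>b\<in>Basis. f b (x \<bullet> b))"
  and lborel_product_integral: "(CLINT x|lborel. \<Prod>b\<in>Basis. f b (x \<bullet> b)) = (\<Prod>b\<in>Basis. CLINT x|lborel. f b x)"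
proof -
 interpret P: product_sigma_finite "%_::'a. lborel :: real measure" by standard
 have [measurable]: "f b \<in> Borel" if "b \<in> Basis" for b using f[OF that] by auto
 let ?T = "%y. \<Sum>b\<in>(Basis::'a set). y b *\<^sub>R b"
 have [measurable]: "?T \<in> (\<Pi>\<^sub>M b\<in>Basis. lborel) \<rightarrow>\<^sub>M borel" by measurable
 have F [measurable]: "(%x::'a. \<Prod>b\<in>Basis. f b (x \<bullet> b)) \<in> Borel" by measurable
 have eq: "(\<Prod>b\<in>Basis. f b (?T y \<bullet> b)) = (\<Prod>b\<in>Basis. f b (y b))" for y by (rule prod.cong) auto
 show "L1 (%x::'a. \<Prod>b\<in>Basis. f b (x \<bullet> b))"
  by (subst lborel_eq, subst integrable_distr_eq)
   (auto simp: eq intro!: P.product_integrable_prod f)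
 show "(CLINT x|lborel. \<Prod>b\<in>Basis. f b (x \<bullet> b)) = (\<Prod>b\<in>Basis. CLINT x|lborel. f b x)"
  by (subst lborel_eq, subst integral_distr)
   (auto simp: eq intro!: P.product_integral_prod f)
qed

lemma exp_norm_square_prod:
 "cplx (exp (- a * (norm (x::'a::euclidean_space))\<^sup>2)) = (\<Prod>b\<in>Basis. cplx (exp (- a * (x \<bullet> b)\<^sup>2)))"
proof -
 have "(norm x)\<^sup>2 = (\<Sum>b\<in>Basis. (x \<bullet> b)\<^sup>2)"
  unfolding power2_norm_eq_inner by (subst euclidean_inner) (simp add: power2_eq_square)
 then show ?thesis by (simp add: sum_distrib_left exp_sum flip: of_real_prod)
qed

lemma cis_inner_prod: "cis (- (x \<bullet> xi)) = (\<Prod>b\<in>Basis. cis (- ((x \<bullet> b) * (xi \<bullet> b))))" for x xi :: "'a::euclidean_space"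
proof -
 have "cis (- (x \<bullet> xi)) = exp (\<Sum>b\<in>Basis. \<i> * cplx (- ((x \<bullet> b) * (xi \<bullet> b))))"
  unfolding cis_conv_exp by (subst euclidean_inner) (simp add: sum_distrib_left sum_negf)
 then show ?thesis by (simp add: exp_sum cis_conv_exp)
qed

lemma integrable_gaussian_complex:
 "a > 0 ==> L1 (%x::'a::euclidean_space. cplx (exp (- a * (norm x)\<^sup>2)))"
 unfolding exp_norm_square_prod
 by (rule lborel_product_integrable) (rule integrable_of_real[OF integrable_gaussian_real])

lemma integrable_gaussian:
 "a > 0 ==> L1 (%x::'a::euclidean_space. exp (- a * (norm x)\<^sup>2))"
 using integrable_Re[OF integrable_gaussian_complex, of a] by simp

theorem gaussian_fourier:
 fixes xi :: "'a::euclidean_space" assumes a: "a > 0"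
 shows "cft (%x. cplx (exp (- a * (norm x)\<^sup>2))) xi
  = cplx (sqrt (pi / a) ^ DIM('a) * exp (- (norm xi)\<^sup>2 / (4 * a)))"
proof -
 have "cft (%x. cplx (exp (- a * (norm x)\<^sup>2))) xi
  = (CLINT x|lborel. \<Prod>b\<in>Basis. cis (- ((x \<bullet> b) * (xi \<bullet> b))) * cplx (exp (- a * (x \<bullet> b)\<^sup>2)))"
  unfolding cft_def exp_norm_square_prod cis_inner_prod prod.distrib ..
 also have "... = (\<Prod>b\<in>Basis. CLINT x|lborel. cis (- (x * (xi \<bullet> b))) * cplx (exp (- a * x\<^sup>2)))"
  by (rule lborel_product_integral[where f="%b x. cis (- (x * (xi \<bullet> b))) * cplx (exp (- a * x\<^sup>2))"],
    rule integrable_cis_mult[OF integrable_of_real[OF integrable_gaussian_real[OF a]]]) measurable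
 also have "... = (\<Prod>b\<in>(Basis::'a set). cplx (sqrt (pi / a)) * cplx (exp (- (1 / (4 * a)) * (xi \<bullet> b)\<^sup>2)))"
  by (rule prod.cong[OF refl]) (subst gaussian_fourier_real[OF a], simp)
 also have "... = cplx (sqrt (pi / a) ^ DIM('a) * exp (- (1 / (4 * a)) * (norm xi)\<^sup>2))"
  unfolding prod.distrib exp_norm_square_prod[symmetric] by simp
 finally show ?thesis by simp
qed

lemma gaussian_integral:
 assumes a: "a > 0"
 shows "(LI x. exp (- a * (norm (x::'a::euclidean_space))\<^sup>2)) = sqrt (pi / a) ^ DIM('a)"
proof -
 have "cplx (LI x. exp (- a * (norm (x::'a))\<^sup>2)) = cft (%x. cplx (exp (- a * (norm x)\<^sup>2))) (0::'a)"
  unfolding cft_def by simp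
 then show ?thesis unfolding gaussian_fourier[OF a] by (simp flip: of_real_power of_real_mult)
qed

lemma nn_integral_scale:
 fixes f :: "'a::euclidean_space => ennreal"
 assumes [measurable]: "f \<in> Borel" and c: "c > 0"
 shows "(NN x. f x) = ennreal (c ^ DIM('a)) * (NN x. f (c *\<^sub>R x))"
 by (subst lborel_affine[of c 0])
  (use c in \<open>simp_all add: nn_integral_density nn_integral_distr nn_integral_cmult\<close>)

lemma integral_scale:
 fixes f :: "'a::euclidean_space => 'b::{banach,second_countable_topology}"
 assumes [measurable]: "f \<in> Borel" and c: "c > 0"
 shows "(LI x. f x) = (c ^ DIM('a)) *\<^sub>R (LI x. f (c *\<^sub>R x))"
 by (subst lborel_affine[of c 0])
  (use c in \<open>simp_all add: integral_density integral_distr\<close>)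

subsection \<open>Plancherel\<close>

lemma cft_translate:
 assumes "u \<in> Borel"
 shows "cft (%x. u (h + x)) xi = cis (h \<bullet> xi) * cft u xi"
proof -
 note [measurable] = assms
 have "cft u xi = (CLINT x|lborel. cis (- ((h + x) \<bullet> xi)) * u (h + x))"
  unfolding cft_def by (rule integral_translate[symmetric]) measurable
 also have "... = (CLINT x|lborel. cis (- (h \<bullet> xi)) * (cis (- (x \<bullet> xi)) * u (h + x)))"
  by (simp add: inner_add_left mult.assoc[symmetric] cis_mult)
 also have "... = cis (- (h \<bullet> xi)) * cft (%x. u (h + x)) xi"
  by (simp only: cft_def integral_mult_right_zero)
 finally show ?thesis by (simp add: cis_mult flip: mult.assoc)
qed

text \<open>Its transform is the squared modulus of the transform of \<open>u\<close>.\<close>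

definition autocorrelation :: "('a::euclidean_space => complex) => 'a => complex" where
 "autocorrelation u h = (CLINT x|lborel. u (x + h) * cnj (u x))"

lemma
 fixes u :: "'a::euclidean_space => complex"
 assumes u: "L1 u"
 shows autocorrelation_integrable: "L1 (autocorrelation u)"
  and cft_autocorrelation: "cft (autocorrelation u) xi = cplx ((cmod (cft u xi))\<^sup>2)"
proof -
 have [measurable]: "u \<in> Borel" using u by auto
 have tr: "L1 (%h. u (x + h))" for x
  by (subst integrable_translate_iff) (use u in auto)
 have trn: "(LI h. cmod (u (x + h))) = (LI h. cmod (u h))" for x
  by (rule integral_translate) measurable
 have int: "integrable (lborel2) (%(x, h). u (x + h) * cnj (u x))"
 proof (rule lborel_pair.Fubini_integrable)
  show "(%(x, h). u (x + h) * cnj (u x)) \<in> borel_measurable (lborel2)" by measurable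
  show "L1 (%x. LI h. norm (case (x, h) of (x, h) => u (x + h) * cnj (u x)))"
   using u by (simp add: norm_mult trn)
  show "ae x. L1 (%h. case (x, h) of (x, h) => u (x + h) * cnj (u x))"
   using tr by simp
 qed
 show "L1 (autocorrelation u)"
  unfolding autocorrelation_def[abs_def] using lborel_pair.integrable_snd[OF int] by simp
 have "cft (autocorrelation u) xi = (CLINT h|lborel. CLINT x|lborel. cis (- (h \<bullet> xi)) * (u (x + h) * cnj (u x)))"
  unfolding cft_def autocorrelation_def by simp
 also have "... = (CLINT x|lborel. CLINT h|lborel. cis (- (h \<bullet> xi)) * (u (x + h) * cnj (u x)))"
 proof (rule lborel_pair.Fubini_integral)
  show "integrable (lborel2) (%(x, h). cis (- (h \<bullet> xi)) * (u (x + h) * cnj (u x)))"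
  proof (rule L1_integrable_bound[OF int])
   show "(%(x, h). cis (- (h \<bullet> xi)) * (u (x + h) * cnj (u x))) \<in> borel_measurable (lborel2)" by measurable
  qed (auto simp: norm_mult)
 qed
 also have "... = (CLINT x|lborel. cnj (u x) * cft (%h. u (x + h)) xi)"
  unfolding cft_def by (simp add: mult_ac flip: integral_mult_right_zero)
 also have "... = (CLINT x|lborel. cnj (cis (- (x \<bullet> xi)) * u x)) * cft u xi"
  unfolding cft_translate[OF \<open>u \<in> Borel\<close>] integral_mult_left_zero[symmetric]
  by (rule L1_integral_cong) (simp_all add: cis_cnj mult_ac)
 also have "(CLINT x|lborel. cnj (cis (- (x \<bullet> xi)) * u x)) = cnj (cft u xi)"
  unfolding cft_def by (rule L1_integral_cnj)
 also have "cnj (cft u xi) * cft u xi = cplx ((cmod (cft u xi))\<^sup>2)"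
  using complex_norm_square[of "cft u xi"] by (simp add: mult.commute)
 finally show "cft (autocorrelation u) xi = cplx ((cmod (cft u xi))\<^sup>2)" .
qed

lemma autocorrelation_0: "autocorrelation u 0 = cplx (sqint u)"
 by (simp only: autocorrelation_def sqint_def add_0_right complex_norm_square[symmetric] integral_complex_of_real)

lemma L2_cauchy_schwarz_complex:
 fixes u v :: "'a::euclidean_space => complex"
 assumes u: "L2 u" and v: "L2 v"
 shows "cmod (CLINT x|lborel. u x * v x) <= sqrt (sqint u) * sqrt (sqint v)"
  and "L1 (%x. u x * v x)"
proof -
 have [measurable]: "u \<in> Borel" "v \<in> Borel" using u v by (auto simp: L2_def)
 have L: "L2 (%x. cmod (u x))" "L2 (%x. cmod (v x))" using u v by (auto simp: L2_def)
 have int: "L1 (%x. cmod (u x) * cmod (v x))" by (rule L2_mult_integrable[OF L])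
 show "L1 (%x. u x * v x)"
  by (rule L1_integrable_bound[OF int]) (auto simp: norm_mult)
 have "cmod (CLINT x|lborel. u x * v x) <= inner2 (%x. cmod (u x)) (%x. cmod (v x))"
  unfolding inner2_def by (rule order_trans[OF integral_norm_bound]) (simp add: norm_mult)
 also have "... <= \<bar>inner2 (%x. cmod (u x)) (%x. cmod (v x))\<bar>" by simp
 also have "... <= sqrt (sqint u * sqint v)"
  using real_sqrt_le_mono[OF inner2_cauchy_schwarz[OF L]] by (simp add: sqint_def)
 finally show "cmod (CLINT x|lborel. u x * v x) <= sqrt (sqint u) * sqrt (sqint v)" by (simp add: real_sqrt_mult)
qed

lemma L2_cnj: "L2 (%x. cnj (u x))" "sqint (%x. cnj (u x)) = sqint u" if "L2 u" for u
proof -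
 have [measurable]: "u \<in> Borel" using that by (simp add: L2_def)
 show "L2 (%x. cnj (u x))" using that by (simp add: L2_def)
 show "sqint (%x. cnj (u x)) = sqint u" by (simp add: sqint_def)
qed

lemma autocorrelation_bound:
 assumes u: "L2 u" shows "cmod (autocorrelation u h) <= sqint u"
 using L2_cauchy_schwarz_complex(1)[OF L2_translate[OF u, of h] L2_cnj(1)[OF u]]
 by (simp add: autocorrelation_def L2_cnj[OF u] sqint_translate[OF u] add.commute[of _ h])

lemma autocorrelation_continuous_0:
 assumes u: "L2 u" shows "(autocorrelation u ---> autocorrelation u 0) (at 0)"
proof -
 have [measurable]: "u \<in> Borel" using u by (simp add: L2_def)
 have tr: "L2 (%x. u (h + x))" for h by (rule L2_translate[OF u])
 have "((%h. autocorrelation u h - autocorrelation u 0) ---> 0) (at 0)"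
 proof (rule Lim_null_comparison)
  have "cmod (autocorrelation u h - autocorrelation u 0) <= sqrt (sqint (%x. u (h + x) - u x)) * sqrt (sqint u)" for h
  proof -
   have "autocorrelation u h - autocorrelation u 0 = (CLINT x|lborel. (u (h + x) - u x) * cnj (u x))"
    unfolding autocorrelation_def using L2_cauchy_schwarz_complex(2)[OF tr L2_cnj(1)[OF u], of h]
     L2_cauchy_schwarz_complex(2)[OF u L2_cnj(1)[OF u]]
    by (subst L1_integral_diff[symmetric]) (auto simp: left_diff_distrib add.commute)
   then show ?thesis
    using L2_cauchy_schwarz_complex(1)[OF L2_diff[OF tr u] L2_cnj(1)[OF u], of h] by (simp add: L2_cnj u)
  qed
  then show "\<forall>\<^sub>F h in at 0. norm (autocorrelation u h - autocorrelation u 0)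
    <= sqrt (sqint (%x. u (h + x) - u x)) * sqrt (sqint u)" by simp
  show "((%h. sqrt (sqint (%x. u (h + x) - u x)) * sqrt (sqint u)) ---> 0) (at 0)"
   using tendsto_mult_right[OF tendsto_real_sqrt[OF translation_continuous_L2[OF u]], of "sqrt (sqint u)"] by simp
 qed
 then show ?thesis by (simp add: LIM_zero_iff)
qed

text \<open>Weighted by a narrow Gaussian, the squared transform integrates to a Gaussian mean of the autocorrelation, which is continuous at \<open>0\<close> because translations are continuous in the mean.\<close>

theorem plancherel_L1_L2:
 fixes u :: "'a::euclidean_space => complex"
 assumes u1: "L1 u" and u2: "L2 u"
 shows "L2 (cft u)" and "sqint (cft u) = (2 * pi) ^ DIM('a) * sqint u"
proof -
 have [measurable]: "u \<in> Borel" using u1 by auto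
 note [measurable] = borel_measurable_cft[OF u1] borel_measurable_integrable[OF autocorrelation_integrable[OF u1], simplified]
 define a where "a m = 1 / (real m + 1)\<^sup>2" for m
 define r where "r m = (LI xi. (cmod (cft u xi))\<^sup>2 * exp (- a m * (norm xi)\<^sup>2))" for m
 have a: "a m > 0" for m by (simp add: a_def)
 define K where "K = (LI x. cmod (u x))"
 have int: "L1 (%xi. (cmod (cft u xi))\<^sup>2 * exp (- a m * (norm xi)\<^sup>2))" for m
 proof (rule L1_integrable_bound[OF integrable_mult_right[OF integrable_gaussian[OF a], of "K\<^sup>2" m]])
  have "(cmod (cft u xi))\<^sup>2 <= K\<^sup>2" for xi
   unfolding K_def by (intro power_mono cft_bound u1) simp
  then show "ae xi. norm ((cmod (cft u xi))\<^sup>2 * exp (- a m * (norm xi)\<^sup>2)) <= norm (K\<^sup>2 * exp (- a m * (norm xi)\<^sup>2))"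
   by simp
 qed measurable
 have r: "cplx (r m) = cplx ((2 * sqrt pi) ^ DIM('a))
   * (CLINT k|lborel. autocorrelation u ((2 * sqrt (a m)) *\<^sub>R k) * cplx (exp (- 1 * (norm k)\<^sup>2)))" for m
 proof -
  have "cplx (r m) = (CLINT xi|lborel. cft (autocorrelation u) xi * cplx (exp (- a m * (norm xi)\<^sup>2)))"
   unfolding r_def cft_autocorrelation[OF u1] by (subst integral_complex_of_real[symmetric]) simp
  also have "... = (CLINT h|lborel. autocorrelation u h
    * cplx (sqrt (pi / a m) ^ DIM('a) * exp (- (norm h)\<^sup>2 / (4 * a m))))"
   unfolding multiplication_formula_L1[OF autocorrelation_integrable[OF u1] integrable_gaussian_complex[OF a]]
    gaussian_fourier[OF a] ..
  also have "... = ((2 * sqrt (a m)) ^ DIM('a)) *\<^sub>R (CLINT k|lborel. autocorrelation u ((2 * sqrt (a m)) *\<^sub>R k)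
    * cplx (sqrt (pi / a m) ^ DIM('a) * exp (- (norm ((2 * sqrt (a m)) *\<^sub>R k))\<^sup>2 / (4 * a m))))"
   by (rule integral_scale) (use a[of m] in auto)
  also have "... = ((2 * sqrt (a m)) ^ DIM('a)) *\<^sub>R (cplx (sqrt (pi / a m) ^ DIM('a)) *
   (CLINT k|lborel. autocorrelation u ((2 * sqrt (a m)) *\<^sub>R k) * cplx (exp (- 1 * (norm k)\<^sup>2))))"
   using a[of m] by (simp add: power_mult_distrib mult_ac flip: integral_mult_right_zero)
  also have "... = cplx ((2 * sqrt (a m)) ^ DIM('a) * sqrt (pi / a m) ^ DIM('a)) *
   (CLINT k|lborel. autocorrelation u ((2 * sqrt (a m)) *\<^sub>R k) * cplx (exp (- 1 * (norm k)\<^sup>2)))"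
   by (simp add: scaleR_conv_of_real)
  also have "(2 * sqrt (a m)) ^ DIM('a) * sqrt (pi / a m) ^ DIM('a) = (2 * sqrt pi) ^ DIM('a)"
  proof -
   have "2 * sqrt (a m) * sqrt (pi / a m) = 2 * sqrt pi" using a[of m] by (simp add: real_sqrt_divide)
   then show ?thesis by (simp only: power_mult_distrib[symmetric])
  qed
  finally show ?thesis .
 qed
 have lim: "(%m. CLINT k|lborel. autocorrelation u ((2 * sqrt (a m)) *\<^sub>R k) * cplx (exp (- 1 * (norm k)\<^sup>2)))
   ----> (CLINT k|lborel. autocorrelation u 0 * cplx (exp (- 1 * (norm (k::'a))\<^sup>2)))"
 proof (rule integral_dominated_convergence)
  show "L1 (%k::'a. sqint u * exp (- 1 * (norm k)\<^sup>2))"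
   by (rule integrable_mult_right[OF integrable_gaussian]) simp
  show "ae k. norm (autocorrelation u ((2 * sqrt (a m)) *\<^sub>R k) * cplx (exp (- 1 * (norm k)\<^sup>2)))
   <= sqint u * exp (- 1 * (norm k)\<^sup>2)" for m
   by (auto simp: norm_mult intro!: mult_right_mono autocorrelation_bound u2)
  show "ae k. (%m. autocorrelation u ((2 * sqrt (a m)) *\<^sub>R k) * cplx (exp (- 1 * (norm k)\<^sup>2)))
   ----> autocorrelation u 0 * cplx (exp (- 1 * (norm k)\<^sup>2))"
  proof (rule AE_I2, rule tendsto_mult[OF _ tendsto_const])
   fix k :: 'a
   have "(%m. 1 / (real m + 1)) ----> 0"
    using LIMSEQ_inverse_real_of_nat by (simp add: inverse_eq_divide add.commute)
   then have "(%m. (2 * (1 / (real m + 1))) *\<^sub>R k) ----> (2 * 0) *\<^sub>R k" by (intro tendsto_intros)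
   moreover have "sqrt (a m) = 1 / (real m + 1)" for m by (simp add: a_def real_sqrt_divide)
   ultimately have "(%m. (2 * sqrt (a m)) *\<^sub>R k) ----> 0" by simp
   moreover have "isCont (autocorrelation u) 0"
    using autocorrelation_continuous_0[OF u2] by (simp add: isCont_def)
   ultimately show "(%m. autocorrelation u ((2 * sqrt (a m)) *\<^sub>R k)) ----> autocorrelation u 0"
    by (rule isCont_tendsto_compose[rotated])
  qed
 qed measurable
 have int0: "(CLINT k|lborel. autocorrelation u 0 * cplx (exp (- 1 * (norm (k::'a))\<^sup>2)))
  = cplx (sqint u * sqrt pi ^ DIM('a))"
  using gaussian_integral[of 1, where 'a='a] by (simp add: autocorrelation_0)
 have const: "(2 * sqrt pi) ^ DIM('a) * (sqint u * sqrt pi ^ DIM('a)) = (2 * pi) ^ DIM('a) * sqint u"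
 proof -
  have "2 * pi = 2 * sqrt pi * sqrt pi" by simp
  then have "(2 * pi) ^ DIM('a) = (2 * sqrt pi) ^ DIM('a) * sqrt pi ^ DIM('a)" by (metis power_mult_distrib)
  then show ?thesis by (simp only: mult_ac)
 qed
 have "(%m. cplx (r m)) ----> cplx ((2 * sqrt pi) ^ DIM('a))
   * (CLINT k|lborel. autocorrelation u 0 * cplx (exp (- 1 * (norm (k::'a))\<^sup>2)))"
  unfolding r by (rule tendsto_mult_left[OF lim])
 then have r_lim: "r ----> (2 * pi) ^ DIM('a) * sqint u"
  unfolding int0 of_real_mult[symmetric] const by (simp only: tendsto_of_real_iff)
 have "(%m. NN xi. ennreal ((cmod (cft u xi))\<^sup>2 * exp (- a m * (norm xi)\<^sup>2)))
   ----> (NN xi. ennreal ((cmod (cft u xi))\<^sup>2))"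
 proof (rule nn_integral_LIMSEQ)
  have "a (Suc m) <= a m" for m unfolding a_def by (intro divide_left_mono power_mono) auto
  then show "incseq (%m xi. ennreal ((cmod (cft u xi))\<^sup>2 * exp (- a m * (norm xi)\<^sup>2)))"
   by (intro incseq_SucI le_funI ennreal_leI mult_left_mono iffD2[OF exp_le_cancel_iff] mult_right_mono) simp_all
  fix xi :: 'a
  have "(%m. (1 / (real m + 1))\<^sup>2) ----> 0\<^sup>2"
   by (intro tendsto_power) (use LIMSEQ_inverse_real_of_nat in \<open>simp add: inverse_eq_divide add.commute\<close>)
  then have "a ----> 0" unfolding a_def[abs_def] by (simp add: power_divide)
  then have "(%m. ennreal ((cmod (cft u xi))\<^sup>2 * exp (- a m * (norm xi)\<^sup>2))) ----> ennreal ((cmod (cft u xi))\<^sup>2 * exp (- 0 * (norm xi)\<^sup>2))"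
   by (intro tendsto_intros tendsto_ennrealI)
  then show "(%m. ennreal ((cmod (cft u xi))\<^sup>2 * exp (- a m * (norm xi)\<^sup>2))) ----> ennreal ((cmod (cft u xi))\<^sup>2)" by simp
 qed measurable
 moreover have "(NN xi. ennreal ((cmod (cft u xi))\<^sup>2 * exp (- a m * (norm xi)\<^sup>2))) = ennreal (r m)" for m
  unfolding r_def by (rule nn_integral_eq_integral[OF int]) simp
 ultimately have nn: "(NN xi. ennreal ((cmod (cft u xi))\<^sup>2)) = ennreal ((2 * pi) ^ DIM('a) * sqint u)"
  using LIMSEQ_unique[OF _ tendsto_ennrealI[OF r_lim]] by simp
 show L: "L2 (cft u)" unfolding L2_iff_nn using nn by (simp add: borel_measurable_cft u1)
 show "sqint (cft u) = (2 * pi) ^ DIM('a) * sqint u"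
  using nn unfolding nn_sqint[OF L] by simp
qed

definition plancherel_const :: "'a::euclidean_space itself => real" where
 "plancherel_const _ = (2 * pi) ^ DIM('a)"

lemma plancherel_const_pos [simp]: "0 < plancherel_const T" "0 <= plancherel_const T" "plancherel_const T ~= 0"
 by (simp_all add: plancherel_const_def)

definition truncate :: "real => ('a::euclidean_space => complex) => 'a => complex" where
 "truncate R u x = indicator (cball 0 R) x *\<^sub>R u x"

text \<open>Complex version of \<open>has_fourier\<close>, needed because transforms are transformed again in the inversion formula.\<close>

definition has_cft :: "('a::euclidean_space => complex) => ('a => complex) => bool" where
 "has_cft u g \<longleftrightarrow> L2 u \<and> L2 g \<and> ((%R. sqint (%xi. g xi - cft (truncate R u) xi)) ---> 0) at_top"

lemma borel_measurable_truncate [measurable]: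
 "u \<in> Borel ==> truncate R u \<in> Borel"
 unfolding truncate_def[abs_def] by (intro borel_measurable_scaleR borel_measurable_indicator) auto

lemma L2_truncate:
 assumes u: "L2 u" shows "L2 (truncate R u)" "L1 (truncate R u)"
proof -
 have [measurable]: "u \<in> Borel" using u by (simp add: L2_def)
 show "L2 (truncate R u)"
  by (rule L2_dominated[OF _ u, of _ 1]) (auto simp: truncate_def indicator_def)
 have "L1 (%x. indicator (cball (0::'a) R) x + (cmod (u x))\<^sup>2)"
  using u emeasure_lborel_cball_finite[of "0::'a" R] by (intro L1_integrable_add) (auto simp: L2_def)
 then show "L1 (truncate R u)"
 proof (rule L1_integrable_bound)
  have "t <= 1 + t\<^sup>2" for t :: real using zero_le_power2[of "t - 1/2"] by (simp add: power2_eq_square algebra_simps)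
  then show "ae x. norm (truncate R u x) <= norm (indicator (cball 0 R) x + (cmod (u x))\<^sup>2)"
   by (auto simp: truncate_def indicator_def)
 qed measurable
qed

lemma truncate_tendsto:
 assumes u: "L2 u" shows "((%R. sqint (%x. u x - truncate R u x)) ---> 0) at_top"
proof -
 have [measurable]: "u \<in> Borel" using u by (simp add: L2_def)
 have "((%R. LI x. (cmod (u x - truncate R u x))\<^sup>2) ---> (LINT x|(lborel::'a measure). 0)) at_top"
 proof (rule integral_dominated_convergence_at_top[where w="%x. (cmod (u x))\<^sup>2"])
  show "ae x. ((%R. (cmod (u x - truncate R u x))\<^sup>2) ---> 0) at_top"
  proof (rule AE_I2, rule tendsto_eventually)
   fix x :: 'a
   show "\<forall>\<^sub>F R in at_top. (cmod (u x - truncate R u x))\<^sup>2 = 0"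
    using eventually_ge_at_top[of "norm x"] by eventually_elim (simp add: truncate_def)
  qed
  show "\<forall>\<^sub>F R in at_top. ae x. norm ((cmod (u x - truncate R u x))\<^sup>2) <= (cmod (u x))\<^sup>2"
   by (auto simp: truncate_def indicator_def)
  show "(%x. (cmod (u x - truncate R u x))\<^sup>2) \<in> borel_measurable lborel" for R
   by measurable
 qed (use u in \<open>auto simp: L2_def\<close>)
 then show ?thesis by (simp add: sqint_def)
qed

lemma cft_diff:
 assumes "L1 u" "L1 v"
 shows "cft (%x. u x - v x) xi = cft u xi - cft v xi"
 unfolding cft_def using integrable_cis_mult[OF assms(1)] integrable_cis_mult[OF assms(2)]
 by (simp add: right_diff_distrib)

lemma cft_lincomb:
 assumes "L1 u" "L1 v"
 shows "cft (%x. a * u x + b * v x) xi = a * cft u xi + b * cft v xi"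
proof -
 have "cft (%x. a * u x + b * v x) xi
  = (CLINT x|lborel. a * (cis (- (x \<bullet> xi)) * u x) + b * (cis (- (x \<bullet> xi)) * v x))"
  unfolding cft_def by (simp add: algebra_simps)
 then show ?thesis
  using integrable_cis_mult[OF assms(1)] integrable_cis_mult[OF assms(2)] by (simp add: cft_def)
qed

lemma plancherel_diff:
 fixes u v :: "'a::euclidean_space => complex"
 assumes "L1 u" "L2 u" "L1 v" "L2 v"
 shows "sqint (%xi. cft u xi - cft v xi) = plancherel_const TYPE('a) * sqint (%x. u x - v x)"
proof -
 have "cft (%x. u x - v x) = (%xi. cft u xi - cft v xi)" by (rule ext) (rule cft_diff[OF assms(1,3)])
 then show ?thesis
  using plancherel_L1_L2(2)[OF L1_integrable_diff[OF assms(1,3)] L2_diff[OF assms(2,4)]]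
  by (simp add: plancherel_const_def)
qed

lemma has_cft_approx:
 fixes u v :: "'a::euclidean_space => complex"
 assumes g: "has_cft u g" and v: "L1 v" "L2 v"
 shows "sqint (%xi. g xi - cft v xi) <= 4 * plancherel_const TYPE('a) * sqint (%x. u x - v x)"
proof -
 have u: "L2 u" and g2: "L2 g" using g by (auto simp: has_cft_def)
 let ?c = "plancherel_const TYPE('a)"
 have T: "L2 (truncate R u)" "L1 (truncate R u)" for R by (rule L2_truncate[OF u])+
 have le: "sqint (%xi. g xi - cft v xi) <= 2 * sqint (%xi. g xi - cft (truncate R u) xi)
   + 4 * ?c * sqint (%x. u x - truncate R u x) + 4 * ?c * sqint (%x. u x - v x)" for R
 proof -
  have "sqint (%xi. g xi - cft v xi) <= 2 * sqint (%xi. g xi - cft (truncate R u) xi)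
   + 2 * sqint (%xi. cft (truncate R u) xi - cft v xi)"
   by (rule sqint_triangle[OF g2 plancherel_L1_L2(1)[OF T(2,1)] plancherel_L1_L2(1)[OF v]])
  also have "sqint (%xi. cft (truncate R u) xi - cft v xi) = ?c * sqint (%x. truncate R u x - v x)"
   by (rule plancherel_diff[OF T(2,1) v])
  also have "... <= ?c * (2 * sqint (%x. truncate R u x - u x) + 2 * sqint (%x. u x - v x))"
   by (intro mult_left_mono sqint_triangle T u v) simp
  finally show ?thesis using sqint_commute[of "truncate R u" u] by (simp add: algebra_simps)
 qed
 have "((%R. 2 * sqint (%xi. g xi - cft (truncate R u) xi)
   + 4 * ?c * sqint (%x. u x - truncate R u x) + 4 * ?c * sqint (%x. u x - v x))
   ---> 2 * 0 + 4 * ?c * 0 + 4 * ?c * sqint (%x. u x - v x)) at_top"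
  using g by (intro tendsto_intros truncate_tendsto u) (auto simp: has_cft_def)
 then have "sqint (%xi. g xi - cft v xi) <= 2 * 0 + 4 * ?c * 0 + 4 * ?c * sqint (%x. u x - v x)"
  by (rule tendsto_lowerbound[OF _ always_eventually]) (use le in auto)
 then show ?thesis by simp
qed

lemma has_cft_exists:
 fixes u :: "'a::euclidean_space => complex"
 assumes u: "L2 u" shows "\<exists>g. has_cft u g"
proof -
 let ?c = "plancherel_const TYPE('a)"
 have T: "L2 (truncate R u)" "L1 (truncate R u)" for R by (rule L2_truncate[OF u])+
 let ?f = "%n::nat. cft (truncate (real n) u)"
 have f: "L2 (cft (truncate R u))" for R by (rule plancherel_L1_L2(1)[OF T(2,1)])
 have tr: "sqint (%xi. cft (truncate R u) xi - cft (truncate R' u) xi)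
   <= 2 * ?c * sqint (%x. u x - truncate R u x) + 2 * ?c * sqint (%x. u x - truncate R' u x)" for R R'
 proof -
  have "sqint (%x. truncate R u x - truncate R' u x) <= 2 * sqint (%x. truncate R u x - u x) + 2 * sqint (%x. u x - truncate R' u x)"
   by (intro sqint_triangle T u)
  then have "?c * sqint (%x. truncate R u x - truncate R' u x)
    <= ?c * (2 * sqint (%x. u x - truncate R u x) + 2 * sqint (%x. u x - truncate R' u x))"
   by (intro mult_left_mono) (simp_all add: sqint_commute[of u])
  then show ?thesis unfolding plancherel_diff[OF T(2,1) T(2,1)] by (simp add: algebra_simps)
 qed
 have lim: "((%R. 2 * ?c * sqint (%x. u x - truncate R u x)) ---> 0) at_top"
  using tendsto_mult_left[OF truncate_tendsto[OF u], of "2 * ?c"] by simp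
 have "\<exists>l r. L2 l \<and> strict_mono r \<and> (%n. sqint (%x. ?f n x - l x)) ----> 0 \<and>
     (ae x. (%k::nat. ?f (r k) x) ----> l x)"
 proof (rule L2_complete[of ?f, OF f])
  fix e :: real assume "0 < e"
  then have "\<forall>\<^sub>F R in at_top. 2 * ?c * sqint (%x. u x - truncate R u x) < e / 2"
   using lim by (intro order_tendstoD(2)[of _ 0]) auto
  then obtain R0 where R0: "!!R. R >= R0 ==> 2 * ?c * sqint (%x. u x - truncate R u x) < e / 2"
   unfolding eventually_at_top_linorder by blast
  obtain N where N: "real N >= R0" using real_arch_simple by blast
  show "\<exists>N. \<forall>m\<ge>N. \<forall>n\<ge>N. sqint (%x. ?f m x - ?f n x) < e"
  proof (intro exI allI impI)
   fix m n assume "N <= m" "N <= n"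
   then have "real m >= R0" "real n >= R0" using N by linarith+
   then show "sqint (%x. ?f m x - ?f n x) < e" using tr[of "real m" "real n"] R0[of "real m"] R0[of "real n"] by linarith
  qed
 qed
 then obtain g where g: "L2 g" "(%n. sqint (%x. ?f n x - g x)) ----> 0" by blast
 have bound: "sqint (%xi. g xi - cft (truncate R u) xi) <= 4 * ?c * sqint (%x. u x - truncate R u x)" for R
 proof -
  have "sqint (%xi. g xi - cft (truncate R u) xi) <= 2 * sqint (%x. ?f n x - g x) +
   2 * (2 * ?c * sqint (%x. u x - truncate (real n) u x) + 2 * ?c * sqint (%x. u x - truncate R u x))" for n
   using sqint_triangle[OF g(1) f f, of R "real n"] tr[of "real n" R] sqint_commute[of g "?f n"]
   by (simp add: algebra_simps)
  moreover have "(%n. 2 * sqint (%x. ?f n x - g x) +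
   2 * (2 * ?c * sqint (%x. u x - truncate (real n) u x) + 2 * ?c * sqint (%x. u x - truncate R u x)))
   ----> 2 * 0 + 2 * (0 + 2 * ?c * sqint (%x. u x - truncate R u x))"
   by (intro tendsto_intros g filterlim_compose[OF lim] filterlim_real_sequentially)
  ultimately have "sqint (%xi. g xi - cft (truncate R u) xi) <= 2 * 0 + 2 * (0 + 2 * ?c * sqint (%x. u x - truncate R u x))"
   by (intro LIMSEQ_le_const) auto
  then show ?thesis by simp
 qed
 have "((%R. sqint (%xi. g xi - cft (truncate R u) xi)) ---> 0) at_top"
 proof (rule Lim_null_comparison)
  show "\<forall>\<^sub>F R in at_top. norm (sqint (%xi. g xi - cft (truncate R u) xi)) <= 2 * (2 * ?c * sqint (%x. u x - truncate R u x))"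
   by (rule always_eventually) (use bound in \<open>simp add: mult.assoc\<close>)
  show "((%R. 2 * (2 * ?c * sqint (%x. u x - truncate R u x))) ---> 0) at_top"
   using tendsto_mult_left[OF lim, of 2] by simp
 qed
 then show ?thesis using u g(1) by (auto simp: has_cft_def)
qed

lemma has_cft_L2: "has_cft u g ==> L2 u" "has_cft u g ==> L2 g"
 by (auto simp: has_cft_def)

lemma has_cft_AE_cong:
 assumes "has_cft u g" "h \<in> Borel" "ae xi. g xi = h xi"
 shows "has_cft u h"
proof -
 have h: "L2 h" using L2_AE_cong[OF has_cft_L2(2)] assms by blast
 have T: "L2 (cft (truncate R u))" for R
  by (intro plancherel_L1_L2(1) L2_truncate has_cft_L2[OF assms(1)])
 have "sqint (%xi. h xi - cft (truncate R u) xi) = sqint (%xi. g xi - cft (truncate R u) xi)" for R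
  by (rule sqint_AE_cong) (use assms L2_borel[OF L2_diff[OF h T]] L2_borel[OF L2_diff[OF has_cft_L2(2)[OF assms(1)] T]] in auto)
 then show ?thesis using assms(1) h by (simp add: has_cft_def)
qed

lemma sqint_diff_0_imp_AE_eq: "L2 f ==> L2 g ==> sqint (%x. f x - g x) = 0 ==> ae x. f x = g x"
 using sqint_eq_0_iff[OF L2_diff[of f g]] by auto

text \<open>
 The transform does not depend on the approximation by balls: any square integrable limit of
 integrable functions will do.
\<close>

theorem has_cftI:
 fixes u :: "'a::euclidean_space => complex"
 assumes u: "L2 u" and g: "L2 g"
  and un: "!!n. L1 (un n)" "!!n. L2 (un n)"
  and lim: "((%n. sqint (%x. u x - un n x)) ---> 0) F" "((%n. sqint (%xi. g xi - cft (un n) xi)) ---> 0) F"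
  and F: "F ~= bot"
 shows "has_cft u g"
proof -
 let ?c = "plancherel_const TYPE('a)"
 obtain g0 where g0: "has_cft u g0" using has_cft_exists[OF u] by blast
 have "sqint (%xi. g xi - g0 xi) <= 2 * sqint (%xi. g xi - cft (un n) xi) + 8 * ?c * sqint (%x. u x - un n x)" for n
  using sqint_triangle[OF g plancherel_L1_L2(1)[OF un] has_cft_L2(2)[OF g0], of n]
   has_cft_approx[OF g0 un, of n] sqint_commute[of g0 "cft (un n)"] by linarith
 moreover have "((%n. 2 * sqint (%xi. g xi - cft (un n) xi) + 8 * ?c * sqint (%x. u x - un n x)) ---> 2 * 0 + 8 * ?c * 0) F"
  by (intro tendsto_intros lim)
 ultimately have "sqint (%xi. g xi - g0 xi) <= 2 * 0 + 8 * ?c * 0"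
  by (intro tendsto_lowerbound[OF _ _ F]) auto
 then have "sqint (%xi. g xi - g0 xi) = 0" using sqint_nonneg[of "%xi. g xi - g0 xi"] by simp
 then have "ae xi. g0 xi = g xi"
  using sqint_diff_0_imp_AE_eq[OF g has_cft_L2(2)[OF g0]] by auto
 then show ?thesis by (rule has_cft_AE_cong[OF g0 L2_borel[OF g]])
qed

lemma has_cft_integrable: "L1 u ==> L2 u ==> has_cft u (cft u)"
 by (rule has_cftI[where un="%_::nat. u" and F=sequentially]) (auto simp: plancherel_L1_L2 sqint_def)

lemma plancherel:
 fixes u :: "'a::euclidean_space => complex"
 assumes g: "has_cft u g" shows "sqint g = plancherel_const TYPE('a) * sqint u"
proof (rule tendsto_unique)
 have T: "L2 (truncate R u)" "L1 (truncate R u)" for R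
  by (rule L2_truncate[OF has_cft_L2(1)[OF g]])+
 show "((%R. sqint (cft (truncate R u))) ---> sqint g) at_top"
  using g by (intro sqint_tendsto plancherel_L1_L2 T) (auto simp: has_cft_def sqint_commute[of g])
 have "((%R. sqint (truncate R u)) ---> sqint u) at_top"
  using truncate_tendsto[OF has_cft_L2(1)[OF g]] has_cft_L2[OF g]
  by (intro sqint_tendsto T) (auto simp: sqint_commute[of u])
 then show "((%R. sqint (cft (truncate R u))) ---> plancherel_const TYPE('a) * sqint u) at_top"
  unfolding plancherel_L1_L2(2)[OF T(2,1)] plancherel_const_def by (rule tendsto_mult_left)
qed simp

lemma has_cft_lincomb:
 fixes u v :: "'a::euclidean_space => complex" and a b :: real
 assumes u: "has_cft u g" and v: "has_cft v h"
 shows "has_cft (%x. cplx a * u x + cplx b * v x)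
     (%xi. cplx a * g xi + cplx b * h xi)"
proof (rule has_cftI[where un="%R x. cplx a * truncate R u x + cplx b * truncate R v x" and F=at_top])
 note L = has_cft_L2[OF u] has_cft_L2[OF v]
 have T: "L2 (truncate R u)" "L1 (truncate R u)" "L2 (truncate R v)" "L1 (truncate R v)" for R
  by (intro L2_truncate L)+
 have lc: "L2 (%x. cplx a * p x + cplx b * q x)" if "L2 p" "L2 q" for p q :: "'a => complex"
  using L2_add[OF L2_scaleR[OF that(1), of a] L2_scaleR[OF that(2), of b]] by (simp add: scaleR_conv_of_real)
 have lcd: "sqint (%x. (cplx a * p x + cplx b * q x) - (cplx a * p' x + cplx b * q' x))
  <= 2 * a\<^sup>2 * sqint (%x. p x - p' x) + 2 * b\<^sup>2 * sqint (%x. q x - q' x)"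
  if "L2 p" "L2 q" "L2 p'" "L2 q'" for p q p' q' :: "'a => complex"
  using sqint_add_le[OF L2_scaleR[OF L2_diff[OF that(1,3)], of a] L2_scaleR[OF L2_diff[OF that(2,4)], of b]]
  unfolding sqint_scaleR by (simp add: scaleR_conv_of_real algebra_simps)
 show "L2 (%x. cplx a * u x + cplx b * v x)" "L2 (%xi. cplx a * g xi + cplx b * h xi)"
  by (intro lc L)+
 show "L1 (%x. cplx a * truncate R u x + cplx b * truncate R v x)" for R
  using T by simp
 show "L2 (%x. cplx a * truncate R u x + cplx b * truncate R v x)" for R by (intro lc T)
 have conv: "((%R. sqint (%x. (cplx a * p x + cplx b * q x) - (cplx a * p' R x + cplx b * q' R x))) ---> 0) at_top"
  if "L2 p" "L2 q" "!!R. L2 (p' R)" "!!R. L2 (q' R)" and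
   "((%R. sqint (%x. p x - p' R x)) ---> 0) at_top" "((%R. sqint (%x. q x - q' R x)) ---> 0) at_top"
  for p q :: "'a => complex" and p' q' :: "real => 'a => complex"
 proof (rule Lim_null_comparison)
  show "\<forall>\<^sub>F R in at_top. norm (sqint (%x. (cplx a * p x + cplx b * q x) - (cplx a * p' R x + cplx b * q' R x)))
   <= 2 * a\<^sup>2 * sqint (%x. p x - p' R x) + 2 * b\<^sup>2 * sqint (%x. q x - q' R x)"
   using lcd[OF that(1-4)] by simp
  have "((%R. 2 * a\<^sup>2 * sqint (%x. p x - p' R x) + 2 * b\<^sup>2 * sqint (%x. q x - q' R x)) ---> 2 * a\<^sup>2 * 0 + 2 * b\<^sup>2 * 0) at_top"
   by (intro tendsto_intros that)
  then show "((%R. 2 * a\<^sup>2 * sqint (%x. p x - p' R x) + 2 * b\<^sup>2 * sqint (%x. q x - q' R x)) ---> 0) at_top" by simp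
 qed
 show "((%R. sqint (%x. cplx a * u x + cplx b * v x - (cplx a * truncate R u x + cplx b * truncate R v x))) ---> 0) at_top"
  by (intro conv L T truncate_tendsto)
 show "((%R. sqint (%xi. cplx a * g xi + cplx b * h xi - cft (%x. cplx a * truncate R u x + cplx b * truncate R v x) xi)) ---> 0) at_top"
  unfolding cft_lincomb[OF T(2,4)]
  using u v by (intro conv L plancherel_L1_L2(1) T) (auto simp: has_cft_def)
qed simp

lemma has_cft_unique:
 fixes u v :: "'a::euclidean_space => complex"
 assumes u: "has_cft u g" and v: "has_cft v h" and eq: "ae x. u x = v x"
 shows "ae xi. g xi = h xi"
proof (rule sqint_diff_0_imp_AE_eq)
 have "sqint (%x. u x - v x) = sqint (%x::'a. (0::complex))"
  by (rule sqint_AE_cong) (use L2_borel[OF L2_diff[OF has_cft_L2(1)[OF u] has_cft_L2(1)[OF v]]] eq in auto)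
 then show "sqint (%xi. g xi - h xi) = 0"
  using plancherel[OF has_cft_lincomb[OF u v, of 1 "-1"]] by (simp add: sqint_def)
qed (use has_cft_L2 u v in auto)

lemma has_cft_AE_cong_left:
 assumes "has_cft u g" "v \<in> Borel" "ae x. u x = v x"
 shows "has_cft v g"
proof -
 have "L2 v" using L2_AE_cong[OF has_cft_L2(1)] assms by blast
 then obtain h where h: "has_cft v h" using has_cft_exists by blast
 have "ae xi. h xi = g xi" using has_cft_unique[OF assms(1) h assms(3)] by auto
 then show ?thesis by (rule has_cft_AE_cong[OF h L2_borel[OF has_cft_L2(2)[OF assms(1)]]])
qed

lemma has_cft_limit:
 fixes u :: "'a::euclidean_space => complex"
 assumes un: "!!n::nat. has_cft (un n) (gn n)" and L: "L2 u" "L2 g"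
  and lim: "(%n. sqint (%x. un n x - u x)) ----> 0" "(%n. sqint (%x. gn n x - g x)) ----> 0"
 shows "has_cft u g"
proof -
 let ?c = "plancherel_const TYPE('a)"
 obtain g0 where g0: "has_cft u g0" using has_cft_exists[OF L(1)] by blast
 note L' = has_cft_L2[OF un] has_cft_L2[OF g0]
 have "sqint (%xi. g xi - g0 xi) <= 2 * sqint (%x. gn n x - g x) + 2 * ?c * sqint (%x. un n x - u x)" for n
 proof -
  have "sqint (%xi. gn n xi - g0 xi) = ?c * sqint (%x. un n x - u x)"
   using plancherel[OF has_cft_lincomb[OF un g0, of 1 n "-1"]] by simp
  then show ?thesis
   using sqint_triangle[OF L(2) L'(2) L'(4), of n] sqint_commute[of g "gn n"] by simp
 qed
 moreover have "(%n. 2 * sqint (%x. gn n x - g x) + 2 * ?c * sqint (%x. un n x - u x)) ----> 2 * 0 + 2 * ?c * 0"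
  by (intro tendsto_intros lim)
 ultimately have "sqint (%xi. g xi - g0 xi) <= 2 * 0 + 2 * ?c * 0"
  by (intro LIMSEQ_le_const) auto
 then have "sqint (%xi. g xi - g0 xi) = 0" using sqint_nonneg[of "%xi. g xi - g0 xi"] by simp
 then have "ae xi. g0 xi = g xi"
  using sqint_diff_0_imp_AE_eq[OF L(2) L'(4)] by auto
 then show ?thesis by (rule has_cft_AE_cong[OF g0 L2_borel[OF L(2)]])
qed

lemma parseval:
 fixes u v :: "'a::euclidean_space => complex"
 assumes u: "has_cft u g" and v: "has_cft v h"
 shows "inner2 g h = plancherel_const TYPE('a) * inner2 u v"
proof -
 have "sqint (%x. g x + h x) = plancherel_const TYPE('a) * sqint (%x. u x + v x)"
  using plancherel[OF has_cft_lincomb[OF u v, of 1 1]] by simp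
 then show ?thesis
  unfolding sqint_add[OF has_cft_L2(2)[OF u] has_cft_L2(2)[OF v]] sqint_add[OF has_cft_L2(1)[OF u] has_cft_L2(1)[OF v]]
   plancherel[OF u] plancherel[OF v] by (simp add: algebra_simps)
qed

lemma has_cft_translate:
 fixes u :: "'a::euclidean_space => complex"
 assumes u: "has_cft u g"
 shows "has_cft (%x. u (h + x)) (%xi. cis (h \<bullet> xi) * g xi)"
proof (rule has_cftI[where un="%R x. truncate R u (h + x)" and F=at_top])
 note L = has_cft_L2[OF u]
 have [measurable]: "u \<in> Borel" "g \<in> Borel" using L by (auto simp: L2_def)
 have T: "L2 (truncate R u)" "L1 (truncate R u)" for R by (intro L2_truncate L)+
 have [measurable]: "truncate R u \<in> Borel" for R using T(1) by (simp add: L2_def)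
 show "L2 (%x. u (h + x))" "L2 (%x. truncate R u (h + x))" for R by (intro L2_translate L T)+
 show "L2 (%xi. cis (h \<bullet> xi) * g xi)" by (rule L2_dominated[OF _ L(2), of _ 1]) (auto simp: norm_mult)
 show "L1 (%x. truncate R u (h + x))" for R by (subst integrable_translate_iff) (use T in auto)
 show "((%R. sqint (%x. u (h + x) - truncate R u (h + x))) ---> 0) at_top"
  using truncate_tendsto[OF L(1)] unfolding sqint_translate[OF L2_diff[OF L(1) T(1)], of h] .
 have "sqint (%xi. cis (h \<bullet> xi) * g xi - cft (%x. truncate R u (h + x)) xi) = sqint (%xi. g xi - cft (truncate R u) xi)" for R
  unfolding sqint_def by (subst cft_translate) (auto simp: norm_mult simp flip: right_diff_distrib)
 then show "((%R. sqint (%xi. cis (h \<bullet> xi) * g xi - cft (%x. truncate R u (h + x)) xi)) ---> 0) at_top"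
  using u by (simp add: has_cft_def)
qed simp

subsection \<open>Inversion\<close>

lemma complex_product_inner: "Re (a * b) = a \<bullet> cnj b"
 by (simp add: inner_complex_def)

lemma nn_integral_uminus:
 fixes f :: "'a::euclidean_space => ennreal"
 assumes [measurable]: "f \<in> Borel"
 shows "(NN x. f (- x)) = (NN x. f x)"
 by (subst (2) lborel_affine[of "-1" 0]) (simp_all add: nn_integral_density nn_integral_distr)

lemma distr_uminus: "distr lborel borel uminus = (lborel :: 'a::euclidean_space measure)"
 using lborel_affine[of "-1" "0::'a"] by (simp add: density_1 one_ennreal_def[symmetric])

lemma L2_uminus:
 assumes f: "L2 f" shows "L2 (%x. f (- x))" "sqint (%x. f (- x)) = sqint f"
proof -
 have [measurable]: "f \<in> Borel" using f by (simp add: L2_def)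
 have [measurable]: "(%x. f (- x)) \<in> Borel" by measurable
 have "(NN x. ennreal ((norm (f (- x)))\<^sup>2)) = ennreal (sqint f)"
  using nn_integral_uminus[of "%x. ennreal ((norm (f x))\<^sup>2)"] nn_sqint[OF f] by simp
 then show L: "L2 (%x. f (- x))" by (simp add: L2_iff_nn)
 show "sqint (%x. f (- x)) = sqint f" using nn_sqint[OF L] \<open>_ = ennreal (sqint f)\<close> by simp
qed

lemma cft_cnj_uminus:
 shows "cft (%x. cnj (u x)) xi = cnj (cft u (- xi))"
 unfolding cft_def L1_integral_cnj[symmetric] by (simp add: cis_cnj)

lemma has_cft_cnj:
 fixes u :: "'a::euclidean_space => complex"
 assumes u: "has_cft u g"
 shows "has_cft (%x. cnj (u x)) (%xi. cnj (g (- xi)))"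
proof (rule has_cftI[where un="%R x. cnj (truncate R u x)" and F=at_top])
 note L = has_cft_L2[OF u]
 have T: "L2 (truncate R u)" "L1 (truncate R u)" for R by (intro L2_truncate L)+
 show "L2 (%x. cnj (u x))" "L2 (%x. cnj (truncate R u x))" "L2 (%xi. cnj (g (- xi)))" for R
  by (intro L2_cnj L T L2_uminus)+
 show "L1 (%x. cnj (truncate R u x))" for R using T by simp
 have "sqint (%x. cnj (u x) - cnj (truncate R u x)) = sqint (%x. u x - truncate R u x)" for R
  using L2_cnj(2)[OF L2_diff[OF L(1) T(1)], of R] by simp
 then show "((%R. sqint (%x. cnj (u x) - cnj (truncate R u x))) ---> 0) at_top"
  using truncate_tendsto[OF L(1)] by simp
 have "sqint (%xi. cnj (g (- xi)) - cft (%x. cnj (truncate R u x)) xi) = sqint (%xi. g xi - cft (truncate R u) xi)" for R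
 proof -
  have D: "L2 (%xi. g xi - cft (truncate R u) xi)" by (intro L2_diff L plancherel_L1_L2 T)
  show ?thesis using L2_cnj(2)[OF L2_uminus(1)[OF D]] L2_uminus(2)[OF D] by (simp add: cft_cnj_uminus)
 qed
 then show "((%R. sqint (%xi. cnj (g (- xi)) - cft (%x. cnj (truncate R u x)) xi)) ---> 0) at_top"
  using u by (simp add: has_cft_def)
qed simp

lemma has_cft_multiplication_formula:
 fixes u v :: "'a::euclidean_space => complex"
 assumes u: "has_cft u g" and v: "has_cft v h"
 shows "inner2 g (%x. cnj (v x)) = inner2 u (%x. cnj (h x))"
proof -
 note L = has_cft_L2[OF u] has_cft_L2[OF v]
 have T: "L2 (truncate R u)" "L1 (truncate R u)" "L2 (truncate R v)" "L1 (truncate R v)" for R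
  by (intro L2_truncate L)+
 have eq: "inner2 (cft (truncate R u)) (%x. cnj (truncate R' v x)) = inner2 (truncate R u) (%x. cnj (cft (truncate R' v) x))" for R R'
 proof -
  have Re_int: "inner2 p (%x. cnj (q x)) = Re (CLINT x|lborel. p x * q x)" if "L2 p" "L2 q" for p q :: "'a => complex"
   unfolding inner2_def using L2_cauchy_schwarz_complex(2)[OF that]
   by (simp only: complex_product_inner[symmetric] integral_Re)
  show ?thesis
   using multiplication_formula_L1[OF T(2) T(4), of R R'] by (simp add: Re_int T plancherel_L1_L2(1)[OF T(2,1)] plancherel_L1_L2(1)[OF T(4,3)])
 qed
 have A: "inner2 g (%x. cnj (truncate R' v x)) = inner2 u (%x. cnj (cft (truncate R' v) x))" for R'
 proof (rule tendsto_unique)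
  show "((%R. inner2 (cft (truncate R u)) (%x. cnj (truncate R' v x))) ---> inner2 g (%x. cnj (truncate R' v x))) at_top"
   using u by (intro inner2_tendsto plancherel_L1_L2(1) T L L2_cnj) (auto simp: has_cft_def sqint_commute[of g])
  show "((%R. inner2 (cft (truncate R u)) (%x. cnj (truncate R' v x))) ---> inner2 u (%x. cnj (cft (truncate R' v) x))) at_top"
   unfolding eq using truncate_tendsto[OF L(1)] by (intro inner2_tendsto plancherel_L1_L2(1) T L L2_cnj) (auto simp: sqint_commute[of u])
 qed simp
 have C: "sqint (%x. cnj (p x) - cnj (q x)) = sqint (%x. p x - q x)" if "L2 p" "L2 q" for p q :: "'a => complex"
  using L2_cnj(2)[OF L2_diff[OF that]] by simp
 show ?thesis
 proof (rule tendsto_unique)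
  show "((%R. inner2 (%x. cnj (truncate R v x)) g) ---> inner2 g (%x. cnj (v x))) at_top"
   unfolding inner2_commute[of g] using truncate_tendsto[OF L(3)]
   by (intro inner2_tendsto L2_cnj T L) (simp add: C T L sqint_commute[of v])
  show "((%R. inner2 (%x. cnj (truncate R v x)) g) ---> inner2 u (%x. cnj (h x))) at_top"
   unfolding inner2_commute[of _ g] A unfolding inner2_commute[of u] using v
   by (intro inner2_tendsto L2_cnj plancherel_L1_L2(1) T L) (simp add: C plancherel_L1_L2(1) T L has_cft_def sqint_commute[of h])
 qed simp
qed

text \<open>
 With \<open>u\<close> the candidate for the inverse transform of \<open>g\<close>, both \<open>sqint\<close> of the transform of \<open>u\<close> and
 its inner product with \<open>g\<close> equal \<open>sqint g\<close>, so the transform of \<open>u\<close> is \<open>g\<close>.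
\<close>

theorem fourier_inversion:
 fixes g :: "'a::euclidean_space => complex"
 assumes g: "L2 g"
 shows "\<exists>u. has_cft u g"
proof -
 let ?c = "plancherel_const TYPE('a)"
 have c: "?c > 0" by simp
 obtain G where G: "has_cft g G" using has_cft_exists[OF g] by blast
 define u where "u x = cplx (1 / ?c) * G (- x)" for x
 have u_eq: "u = (%x. (1 / ?c) *\<^sub>R G (- x))" by (simp add: u_def fun_eq_iff scaleR_conv_of_real)
 have LG: "L2 G" by (rule has_cft_L2(2)[OF G])
 have Lu: "L2 u" unfolding u_eq by (intro L2_scaleR L2_uminus LG)
 have su: "sqint u = (1 / ?c)\<^sup>2 * (?c * sqint g)"
  unfolding u_eq sqint_scaleR L2_uminus(2)[OF LG] plancherel[OF G] ..
 obtain k where k: "has_cft u k" using has_cft_exists[OF Lu] by blast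
 have sk: "sqint k = sqint g" unfolding plancherel[OF k] su using c by (simp add: power2_eq_square)
 have "inner2 k g = sqint g"
 proof -
  have "inner2 k (%x. cnj (cnj (g x))) = inner2 u (%x. cnj (cnj (G (- x))))"
   by (rule has_cft_multiplication_formula[OF k has_cft_cnj[OF G]])
  also have "... = inner2 u (%x. ?c *\<^sub>R u x)" by (simp add: u_eq)
  also have "... = ?c * sqint u" using inner2_scaleR_left[of ?c u u] by (simp add: inner2_commute inner2_self)
  also have "... = sqint g" unfolding su using c by (simp add: power2_eq_square)
  finally show ?thesis by simp
 qed
 then have "sqint (%x. k x - g x) = 0"
  using sqint_diff[OF has_cft_L2(2)[OF k] g] sk by simp
 then have "ae x. k x = g x" by (rule sqint_diff_0_imp_AE_eq[OF has_cft_L2(2)[OF k] g])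
 then show ?thesis using has_cft_AE_cong[OF k L2_borel[OF g]] by blast
qed

lemma has_cft_injective:
 assumes "has_cft u g" "has_cft v h" "ae xi. g xi = h xi"
 shows "ae x. u x = v (x::'a::euclidean_space)"
proof (rule sqint_diff_0_imp_AE_eq)
 have "sqint (%x. g x - h x) = sqint (%x::'a. (0::complex))"
  by (rule sqint_AE_cong) (use L2_borel[OF L2_diff[OF has_cft_L2(2)[OF assms(1)] has_cft_L2(2)[OF assms(2)]]] assms in auto)
 then show "sqint (%x. u x - v x) = 0"
  using plancherel[OF has_cft_lincomb[OF assms(1,2), of 1 "-1"]] by (simp add: sqint_def)
qed (use has_cft_L2 assms in auto)

subsection \<open>Real functions\<close>

lemma has_fourier_iff:
 fixes u :: "'a::euclidean_space => real"
 shows "has_fourier u g \<longleftrightarrow> has_cft (%x. cplx (u x)) g"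
proof -
 have "L2 u \<longleftrightarrow> L2 (%x. cplx (u x))"
 proof -
  have "u \<in> Borel" if "(%x. cplx (u x)) \<in> Borel"
   using measurable_compose[OF that borel_measurable_Re] by simp
  moreover have "(%x. cplx (u x)) \<in> Borel" if "u \<in> Borel"
   using that by measurable
  ultimately show ?thesis unfolding L2_def norm_of_real real_norm_def by blast
 qed
 moreover have tr: "fourier_integral (%x. indicator (cball 0 R) x * u x) = cft (truncate R (%x. cplx (u x)))" for R
  unfolding fourier_integral_def cft_def truncate_def fun_eq_iff by (simp add: scaleR_conv_of_real indicator_def)
 moreover have "((%R. NN xi. ennreal ((cmod (g xi - cft (truncate R (%x. cplx (u x))) xi))\<^sup>2)) ---> 0) at_top
  \<longleftrightarrow> ((%R. sqint (%xi. g xi - cft (truncate R (%x. cplx (u x))) xi)) ---> 0) at_top"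
  if "L2 (%x. cplx (u x))" "L2 g"
 proof -
  have "L2 (%xi. g xi - cft (truncate R (%x. cplx (u x))) xi)" for R
   using that by (intro L2_diff plancherel_L1_L2 L2_truncate)
  then show ?thesis
   using tendsto_ennreal_iff[of "%R. sqint (%xi. g xi - cft (truncate R (%x. cplx (u x))) xi)" at_top 0] by (simp add: nn_sqint)
 qed
 ultimately show ?thesis unfolding has_fourier_def has_cft_def L2_iff_square_integrable[symmetric] by auto
qed

lemma L2_of_real_iff:
 fixes u :: "'a::euclidean_space => real"
 shows "L2 (%x. cplx (u x)) \<longleftrightarrow> L2 u"
proof -
 have "u \<in> Borel" if "(%x. cplx (u x)) \<in> Borel"
  using measurable_compose[OF that borel_measurable_Re] by simp
 moreover have "(%x. cplx (u x)) \<in> Borel" if "u \<in> Borel"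
  using that by measurable
 ultimately show ?thesis unfolding L2_def norm_of_real real_norm_def by blast
qed

lemma has_fourier_fourier:
 assumes "L2 u" shows "has_fourier u (fourier u)"
proof -
 have "\<exists>g. has_fourier u g"
  using has_cft_exists[of "%x. cplx (u x)"] assms by (simp add: has_fourier_iff L2_of_real_iff)
 then show ?thesis unfolding fourier_def by (rule someI_ex)
qed

lemma has_fourier_L2: "has_fourier u g ==> L2 u" "has_fourier u g ==> L2 g"
 by (auto simp: has_fourier_iff L2_of_real_iff dest: has_cft_L2)

lemma L2_fourier: "L2 u ==> L2 (fourier u)"
 using has_fourier_L2(2)[OF has_fourier_fourier] .

lemma fourier_unique: "has_fourier u g ==> ae xi. fourier u xi = g xi"
 using has_cft_unique[of "%x. cplx (u x)" "fourier u" "%x. cplx (u x)" g]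
  has_fourier_fourier[OF has_fourier_L2(1)] by (auto simp: has_fourier_iff)

lemma fourier_AE_cong:
 "L2 u ==> L2 v ==> ae x. u x = v x ==> ae xi. fourier u xi = fourier v xi"
 using has_cft_unique[of "%x. cplx (u x)" "fourier u" "%x. cplx (v x)" "fourier v"]
  has_fourier_fourier[of u] has_fourier_fourier[of v] by (auto simp: has_fourier_iff)

lemma fourier_hermitian:
 assumes "has_fourier u g" shows "ae xi. g (- xi) = cnj (g xi)"
proof -
 have c: "has_cft (%x. cplx (u x)) g" using assms by (simp add: has_fourier_iff)
 have "ae xi. cnj (g (- xi)) = g xi"
  using has_cft_unique[OF has_cft_cnj[OF c] c] by simp
 then show ?thesis by (rule AE_mp) (auto intro!: AE_I2 dest: arg_cong[of _ _ cnj])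
qed

lemma inverse_fourier_real:
 fixes g :: "'a::euclidean_space => complex"
 assumes g: "L2 g" and h: "ae xi. g (- xi) = cnj (g xi)"
 shows "\<exists>u. has_fourier u g"
proof -
 obtain w where w: "has_cft w g" using fourier_inversion[OF g] by blast
 have [measurable]: "w \<in> Borel" using has_cft_L2(1)[OF w] by (simp add: L2_def)
 have "ae x. w x = cnj (w x)"
  by (rule has_cft_injective[OF w has_cft_cnj[OF w]], rule AE_mp[OF h]) (auto intro!: AE_I2)
 then have "ae x. w x = cplx (Re (w x))"
  by (rule AE_mp) (auto intro!: AE_I2 simp: complex_eq_iff)
 then have "has_cft (%x. cplx (Re (w x))) g"
  by (intro has_cft_AE_cong_left[OF w]) auto
 then show ?thesis by (auto simp: has_fourier_iff)
qed

lemma has_fourier_lincomb: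
 assumes "has_fourier u g" "has_fourier v h"
 shows "has_fourier (%x. a * u x + b * v x) (%xi. cplx a * g xi + cplx b * h xi)"
 using has_cft_lincomb[of "%x. cplx (u x)" g "%x. cplx (v x)" h a b] assms
 by (simp add: has_fourier_iff)

lemma has_fourier_limit:
 fixes u :: "'a::euclidean_space => real"
 assumes un: "!!n::nat. has_fourier (un n) (gn n)" and L: "L2 u" "L2 g"
  and lim: "(%n. sqint (%x. un n x - u x)) ----> 0" "(%n. sqint (%x. gn n x - g x)) ----> 0"
 shows "has_fourier u g"
proof -
 have "sqint (%x. cplx (un n x) - cplx (u x)) = sqint (%x. un n x - u x)" for n
  by (simp add: sqint_def flip: of_real_diff)
 then show ?thesis
  using has_cft_limit[of "%n x. cplx (un n x)" gn "%x. cplx (u x)" g] assms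
  by (simp add: has_fourier_iff L2_of_real_iff)
qed

lemma parseval_real:
 fixes u v :: "'a::euclidean_space => real"
 assumes "has_fourier u g" "has_fourier v h"
 shows "inner2 g h = plancherel_const TYPE('a) * inner2 u v"
 using parseval[of "%x. cplx (u x)" g "%x. cplx (v x)" h] assms
 by (simp add: has_fourier_iff inner2_def inner_complex_def)

lemma plancherel_real:
 fixes u :: "'a::euclidean_space => real"
 assumes "has_fourier u g"
 shows "sqint g = plancherel_const TYPE('a) * sqint u"
 using parseval_real[OF assms assms] by (simp add: inner2_self)

lemma has_fourier_translate_diff:
 assumes "has_fourier u g"
 shows "has_fourier (%x. u (h + x) - u x) (%xi. (cis (h \<bullet> xi) - 1) * g xi)"
proof -
 have c: "has_cft (%x. cplx (u x)) g" using assms by (simp add: has_fourier_iff)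
 show ?thesis using has_cft_lincomb[OF has_cft_translate[OF c, of h] c, of 1 "-1"]
  by (simp add: has_fourier_iff left_diff_distrib)
qed

subsection \<open>Homogeneous weights\<close>

definition weighted :: "real => ('a::euclidean_space => real) => 'a => complex" where
 "weighted a u xi = (norm xi powr a) *\<^sub>R fourier u xi"

text \<open>For \<open>a > 0\<close> the Sobolev space, with the homogeneous weight that the fractional Laplacian uses.\<close>

definition in_H :: "real => ('a::euclidean_space => real) => bool" where
 "in_H a u \<longleftrightarrow> L2 u \<and> L2 (weighted a u)"

lemma in_H_L2: "in_H a u ==> L2 u" "in_H a u ==> L2 (weighted a u)"
 by (auto simp: in_H_def)

lemma borel_measurable_weighted: "L2 u ==> weighted a u \<in> Borel"
 unfolding weighted_def[abs_def] using L2_borel[OF L2_fourier, of u] by measurable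

lemma powr_le_one_plus: "0 <= (x::real) ==> 0 <= s ==> s <= t ==> x powr s <= 1 + x powr t"
proof (cases "x <= 1")
 case True
 assume "0 <= x" "0 <= s"
 then have "x powr s <= 1 powr s" using True by (intro powr_mono2) auto
 then show ?thesis by (simp add: add_increasing2)
next
 case False
 assume "s <= t"
 then have "x powr s <= x powr t" using False by (intro powr_mono) auto
 then show ?thesis by simp
qed

lemma in_H_mono:
 assumes u: "in_H t u" and st: "0 <= s" "s <= t"
 shows "in_H s u"
proof -
 note L = in_H_L2[OF u]
 have "L2 (%xi. fourier u xi + weighted t u xi)" by (intro L2_add L2_fourier L)
 then have "L2 (weighted s u)"
 proof (rule L2_dominated[OF borel_measurable_weighted[OF L(1)], where C = 1])
  fix xi
  have "fourier u xi + weighted t u xi = (1 + norm xi powr t) *\<^sub>R fourier u xi"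
   by (simp add: weighted_def scaleR_left_distrib)
  then show "norm (weighted s u xi) <= 1 * norm (fourier u xi + weighted t u xi)"
   using powr_le_one_plus[OF norm_ge_zero st, of xi] by (simp add: weighted_def mult_right_mono)
 qed
 then show ?thesis using L by (simp add: in_H_def)
qed

lemma sobolev_iff_in_H:
 fixes u :: "'a::euclidean_space => real"
 assumes t: "0 < t" shows "u \<in> sobolev t \<longleftrightarrow> in_H t u"
proof -
 have swf: "sobolev_weighted_fourier t u xi = ((1 + (norm xi)\<^sup>2) powr (t / 2)) *\<^sub>R fourier u xi" for xi
  by (simp add: sobolev_weighted_fourier_def)
 have p: "((norm xi)\<^sup>2) powr (t / 2) = norm xi powr t" for xi :: 'a
  by (cases "xi = 0") (simp_all add: powr_powr flip: powr_numeral)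
 have le1: "norm xi powr t <= (1 + (norm xi)\<^sup>2) powr (t / 2)" for xi :: 'a
  unfolding p[symmetric] by (rule powr_mono2) (use t in auto)
 have le2: "(1 + (norm xi)\<^sup>2) powr (t / 2) <= 2 powr (t / 2) * (1 + norm xi powr t)" for xi :: 'a
 proof (cases "norm xi <= 1")
  case True
  then have "(norm xi)\<^sup>2 <= 1" by (simp add: power_le_one)
  then have "(1 + (norm xi)\<^sup>2) powr (t / 2) <= 2 powr (t / 2)" by (intro powr_mono2) (use t in auto)
  also have "... <= 2 powr (t / 2) * (1 + norm xi powr t)" by simp
  finally show ?thesis .
 next
  case False
  then have "1 <= (norm xi)\<^sup>2" by (simp add: one_le_power)
  then have "(1 + (norm xi)\<^sup>2) powr (t / 2) <= (2 * (norm xi)\<^sup>2) powr (t / 2)" by (intro powr_mono2) (use t in auto)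
  also have "... = 2 powr (t / 2) * norm xi powr t" by (simp add: powr_mult p)
  also have "... <= 2 powr (t / 2) * (1 + norm xi powr t)" by simp
  finally show ?thesis .
 qed
 show ?thesis
 proof
  assume "u \<in> sobolev t"
  then have L: "L2 u" "L2 (sobolev_weighted_fourier t u)"
   by (auto simp: sobolev_def L2_iff_square_integrable)
  have "L2 (weighted t u)"
   by (rule L2_dominated[OF borel_measurable_weighted[OF L(1)] L(2), where C = 1])
    (auto simp: weighted_def swf intro!: mult_right_mono le1)
  then show "in_H t u" using L by (simp add: in_H_def)
 next
  assume "in_H t u"
  note L = in_H_L2[OF this]
  have m: "sobolev_weighted_fourier t u \<in> Borel"
   unfolding swf[abs_def] using L2_borel[OF L2_fourier[OF L(1)]] by measurable
  have "L2 (%xi. fourier u xi + weighted t u xi)" by (intro L2_add L2_fourier L)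
  then have "L2 (sobolev_weighted_fourier t u)"
  proof (rule L2_dominated[OF m, where C = "2 powr (t / 2)"])
   fix xi
   have "fourier u xi + weighted t u xi = (1 + norm xi powr t) *\<^sub>R fourier u xi"
    by (simp add: weighted_def scaleR_left_distrib)
   then show "norm (sobolev_weighted_fourier t u xi) <= 2 powr (t / 2) * norm (fourier u xi + weighted t u xi)"
    using mult_right_mono[OF le2, of "norm (fourier u xi)" xi] by (simp add: swf mult.assoc)
  qed
  then show "u \<in> sobolev t" using L by (simp add: sobolev_def L2_iff_square_integrable)
 qed
qed

lemma weighted_lincomb_AE:
 assumes "L2 u" "L2 v"
 shows "ae xi. weighted t (%x. a * u x + b * v x) xi = a *\<^sub>R weighted t u xi + b *\<^sub>R weighted t v xi"
 using fourier_unique[OF has_fourier_lincomb[OF has_fourier_fourier[OF assms(1)] has_fourier_fourier[OF assms(2)]], of a b]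
 by (rule AE_mp) (auto intro!: AE_I2 simp: weighted_def scaleR_right_distrib scaleR_conv_of_real algebra_simps)

lemma L2_lincomb: "L2 u ==> L2 v ==> L2 (%x. a *\<^sub>R u x + b *\<^sub>R v x)"
 by (intro L2_add L2_scaleR)

lemma in_H_lincomb:
 assumes u: "in_H t u" and v: "in_H t v" shows "in_H t (%x. a * u x + b * v x)"
proof -
 have L: "L2 (%x. a * u x + b * v x)"
  using L2_lincomb[OF in_H_L2(1)[OF u] in_H_L2(1)[OF v], of a b] by simp
 have "L2 (weighted t (%x. a * u x + b * v x))"
  by (rule L2_AE_cong[OF L2_lincomb[OF in_H_L2(2)[OF u] in_H_L2(2)[OF v], of a b] borel_measurable_weighted[OF L]])
   (rule AE_symmetric[OF weighted_lincomb_AE[OF in_H_L2(1)[OF u] in_H_L2(1)[OF v]]])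
 then show ?thesis using L by (simp add: in_H_def)
qed

lemma in_H_diff: "in_H t u ==> in_H t v ==> in_H t (%x. u x - v x)"
 using in_H_lincomb[of t u v 1 "-1"] by simp

lemma in_H_add: "in_H t u ==> in_H t v ==> in_H t (%x. u x + v x)"
 using in_H_lincomb[of t u v 1 1] by simp

lemma in_H_AE_cong:
 assumes u: "in_H t u" and v: "v \<in> Borel" "ae x. u x = v x"
 shows "in_H t v" "ae xi. weighted t u xi = weighted t v xi"
proof -
 have L: "L2 v" by (rule L2_AE_cong[OF in_H_L2(1)[OF u] v])
 show eq: "ae xi. weighted t u xi = weighted t v xi"
  using fourier_AE_cong[OF in_H_L2(1)[OF u] L v(2)] by (rule AE_mp) (auto intro!: AE_I2 simp: weighted_def)
 have "L2 (weighted t v)"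
  by (rule L2_AE_cong[OF in_H_L2(2)[OF u] borel_measurable_weighted[OF L] eq])
 then show "in_H t v" using L by (simp add: in_H_def)
qed

lemma has_fourier_frac_laplacian:
 assumes u: "in_H (2 * a) u"
 shows "has_fourier (frac_laplacian a u) (weighted (2 * a) u)"
proof -
 have "ae xi. fourier u (- xi) = cnj (fourier u xi)"
  by (rule fourier_hermitian[OF has_fourier_fourier[OF in_H_L2(1)[OF u]]])
 then have "ae xi. weighted (2 * a) u (- xi) = cnj (weighted (2 * a) u xi)"
  by (rule AE_mp) (auto intro!: AE_I2 simp: weighted_def)
 then have "\<exists>g. has_fourier g (weighted (2 * a) u)" by (rule inverse_fourier_real[OF in_H_L2(2)[OF u]])
 then show ?thesis unfolding frac_laplacian_def weighted_def[abs_def] by (rule someI_ex)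
qed

lemma L2_frac_laplacian: "in_H (2 * a) u ==> L2 (frac_laplacian a u)"
 using has_fourier_L2(1)[OF has_fourier_frac_laplacian] .

lemma frac_laplacian_lincomb:
 assumes u: "in_H (2 * t) u" and v: "in_H (2 * t) v"
 shows "ae x. frac_laplacian t (%x. a * u x + b * v x) x = a * frac_laplacian t u x + b * frac_laplacian t v x"
proof -
 note w = in_H_lincomb[OF u v, of a b]
 have 1: "has_cft (%x. cplx (frac_laplacian t (%x. a * u x + b * v x) x))
   (weighted (2 * t) (%x. a * u x + b * v x))"
  using has_fourier_frac_laplacian[OF w] by (simp only: has_fourier_iff)
 have 2: "has_cft (%x. cplx (a * frac_laplacian t u x + b * frac_laplacian t v x))
   (%xi. a *\<^sub>R weighted (2 * t) u xi + b *\<^sub>R weighted (2 * t) v xi)"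
  using has_fourier_lincomb[OF has_fourier_frac_laplacian[OF u] has_fourier_frac_laplacian[OF v], of a b]
  by (simp only: has_fourier_iff scaleR_conv_of_real)
 show ?thesis
  using has_cft_injective[OF 1 2 weighted_lincomb_AE[OF in_H_L2(1)[OF u] in_H_L2(1)[OF v]]]
  by (simp only: of_real_eq_iff)
qed

lemma frac_laplacian_unique:
 assumes u: "in_H (2 * a) u" and g: "has_fourier g h" and eq: "ae xi. h xi = weighted (2 * a) u xi"
 shows "ae x. frac_laplacian a u x = g x"
proof -
 have 1: "has_cft (%x. cplx (frac_laplacian a u x)) (weighted (2 * a) u)"
  using has_fourier_frac_laplacian[OF u] by (simp only: has_fourier_iff)
 have 2: "has_cft (%x. cplx (g x)) h" using g by (simp only: has_fourier_iff)
 show ?thesis using has_cft_injective[OF 1 2 AE_symmetric[OF eq]] by (simp only: of_real_eq_iff)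
qed

definition energy :: "real => ('a::euclidean_space => real) => ('a => real) => real" where
 "energy a u v = inner2 (weighted a u) (weighted a v)"

lemma energy_self: "energy a u u = sqint (weighted a u)"
 by (simp add: energy_def inner2_self)

lemma energy_commute: "energy a u v = energy a v u"
 by (simp add: energy_def inner2_commute)

lemma energy_lincomb:
 assumes u: "in_H t u" and v: "in_H t v" and w: "in_H t w"
 shows "energy t (%x. a * u x + b * v x) w = a * energy t u w + b * energy t v w"
proof -
 have "energy t (%x. a * u x + b * v x) w = inner2 (%xi. a *\<^sub>R weighted t u xi + b *\<^sub>R weighted t v xi) (weighted t w)"
  unfolding energy_def
  by (rule inner2_AE_cong[OF L2_borel[OF in_H_L2(2)[OF in_H_lincomb[OF u v]]]
     L2_borel[OF L2_lincomb[OF in_H_L2(2)[OF u] in_H_L2(2)[OF v]]] L2_borel[OF in_H_L2(2)[OF w]]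
     weighted_lincomb_AE[OF in_H_L2(1)[OF u] in_H_L2(1)[OF v]]])
 also have "... = a * energy t u w + b * energy t v w"
  unfolding energy_def by (subst inner2_add_left) (simp_all add: inner2_scaleR_left L2_scaleR in_H_L2 u v w)
 finally show ?thesis .
qed

lemma frac_laplacian_inner:
 fixes u v :: "'a::euclidean_space => real"
 assumes u: "in_H (2 * a) u" and v: "in_H (2 * a) v"
 shows "inner2 (frac_laplacian a u) (frac_laplacian a v) = energy (2 * a) u v / plancherel_const TYPE('a)"
 using parseval_real[OF has_fourier_frac_laplacian[OF u] has_fourier_frac_laplacian[OF v]]
 by (simp add: energy_def field_simps)

lemma frac_laplacian_inner_right:
 fixes u v :: "'a::euclidean_space => real"
 assumes u: "in_H (2 * a) u" and v: "L2 v" and a: "0 < a"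
 shows "inner2 (frac_laplacian a u) v = energy a u v / plancherel_const TYPE('a)"
proof -
 have "weighted (2 * a) u xi \<bullet> fourier v xi = weighted a u xi \<bullet> weighted a v xi" for xi
  by (simp add: weighted_def flip: powr_add mult.assoc)
 then have "inner2 (weighted (2 * a) u) (fourier v) = energy a u v" by (simp add: energy_def inner2_def)
 then show ?thesis
  using parseval_real[OF has_fourier_frac_laplacian[OF u] has_fourier_fourier[OF v]] by (simp add: field_simps)
qed

lemma sqint_frac_laplacian:
 fixes u :: "'a::euclidean_space => real"
 assumes u: "in_H (2 * a) u"
 shows "sqint (frac_laplacian a u) = sqint (weighted (2 * a) u) / plancherel_const TYPE('a)"
 using frac_laplacian_inner[OF u u] by (simp add: inner2_self energy_self)

section \<open>The Gagliardo form\<close>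

lemma gamma_scaled:
 fixes s r :: real
 assumes s: "0 < s" and r: "0 < r"
 shows "(NN tau. ennreal (indicator {0<..} tau * tau powr (s - 1) * exp (- tau * r))) = ennreal (Gamma s * r powr (- s))"
proof -
 have "ennreal (Gamma s) = (NN t. ennreal (indicator {0..} t * t powr (s - 1) / exp t))"
  by (rule Gamma_conv_nn_integral_real[OF s])
 also have "... = (NN t. ennreal (indicator {0<..} t * t powr (s - 1) / exp t))"
  by (rule nn_integral_cong_AE, rule AE_mp[OF AE_lborel_singleton[of 0]]) (auto simp: indicator_def)
 also have "... = ennreal \<bar>r\<bar> * (NN tau. ennreal (indicator {0<..} (0 + r * tau) * (0 + r * tau) powr (s - 1) / exp (0 + r * tau)))"
  by (rule nn_integral_real_affine) (use r in auto)
 also have "... = ennreal r * (NN tau. ennreal (r powr (s - 1)) * ennreal (indicator {0<..} tau * tau powr (s - 1) * exp (- tau * r)))"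
 proof -
  have "ennreal (indicator {0<..} (0 + r * tau) * (0 + r * tau) powr (s - 1) / exp (0 + r * tau))
   = ennreal (r powr (s - 1)) * ennreal (indicator {0<..} tau * tau powr (s - 1) * exp (- tau * r))" for tau
   using r by (cases "tau > 0") (auto simp: powr_mult exp_minus divide_inverse mult_ac zero_less_mult_iff simp flip: ennreal_mult)
  then show ?thesis using r by simp
 qed
 also have "... = ennreal (r powr s) * (NN tau. ennreal (indicator {0<..} tau * tau powr (s - 1) * exp (- tau * r)))"
 proof -
  have "r * r powr (s - 1) = r powr s" using r powr_add[of r 1 "s - 1"] by simp
  then show ?thesis
   by (subst nn_integral_cmult) (use r in \<open>auto simp: mult.assoc[symmetric] simp flip: ennreal_mult\<close>)
 qed
 finally have e: "ennreal (Gamma s) = ennreal (r powr s) * (NN tau. ennreal (indicator {0<..} tau * tau powr (s - 1) * exp (- tau * r)))" .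
 have "ennreal (Gamma s * r powr (- s)) = ennreal (r powr (- s)) * ennreal (Gamma s)"
  using Gamma_real_pos[OF s] by (simp add: mult.commute flip: ennreal_mult)
 also have "... = (NN tau. ennreal (indicator {0<..} tau * tau powr (s - 1) * exp (- tau * r)))"
  unfolding e using r by (simp add: mult.assoc[symmetric] powr_minus flip: ennreal_mult)
 finally show ?thesis ..
qed

lemma cis_minus_one_square: "(cmod (cis x - 1))\<^sup>2 = 2 - 2 * cos x"
proof -
 have "(cmod (cis x - 1))\<^sup>2 = (cos x - 1)\<^sup>2 + (sin x)\<^sup>2" by (simp add: cmod_power2)
 also have "... = 2 - 2 * cos x" using sin_cos_squared_add[of x] by (simp add: power2_eq_square algebra_simps)
 finally show ?thesis .
qed

lemma cis_minus_one_le: "cmod (cis x - 1) <= \<bar>x\<bar>"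
proof -
 have "cos x = 1 - 2 * (sin (x / 2))\<^sup>2" using cos_double_sin[of "x / 2"] by simp
 then have "(cmod (cis x - 1))\<^sup>2 = (2 * sin (x / 2))\<^sup>2"
  unfolding cis_minus_one_square power_mult_distrib by simp
 then have "cmod (cis x - 1) = \<bar>2 * sin (x / 2)\<bar>"
  by (metis abs_norm_cancel power2_eq_iff_nonneg abs_ge_zero power2_abs norm_ge_zero)
 also have "... <= \<bar>x\<bar>" using abs_sin_x_le_abs_x[of "x / 2"] by (simp add: abs_mult)
 finally show ?thesis .
qed

lemma gaussian_difference:
 fixes xi :: "'a::euclidean_space"
 assumes tau: "0 < tau"
 shows "(NN h. ennreal ((cmod (cis (h \<bullet> xi) - 1))\<^sup>2 * exp (- tau * (norm h)\<^sup>2)))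
  = ennreal (2 * sqrt (pi / tau) ^ DIM('a) * (1 - exp (- (norm xi)\<^sup>2 / (4 * tau))))"
proof -
 let ?g = "%h::'a. exp (- tau * (norm h)\<^sup>2)"
 have i1: "L1 ?g" by (rule integrable_gaussian[OF tau])
 have ic: "L1 (%h. cis (- (h \<bullet> xi)) * cplx (?g h))"
  by (rule integrable_cis_mult[OF integrable_gaussian_complex[OF tau]]) measurable
 have re: "Re (cis (- (h \<bullet> xi)) * cplx (?g h)) = cos (h \<bullet> xi) * ?g h" for h by simp
 have i2: "L1 (%h. cos (h \<bullet> xi) * ?g h)" using integrable_Re[OF ic] unfolding re .
 have v2: "(LI h. cos (h \<bullet> xi) * ?g h) = sqrt (pi / tau) ^ DIM('a) * exp (- (norm xi)\<^sup>2 / (4 * tau))"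
  using integral_Re[OF ic] gaussian_fourier[OF tau, of xi] unfolding re cft_def by simp
 have eq: "(cmod (cis (h \<bullet> xi) - 1))\<^sup>2 * ?g h = 2 * ?g h - 2 * (cos (h \<bullet> xi) * ?g h)" for h
  unfolding cis_minus_one_square by (simp add: algebra_simps)
 have i3: "L1 (%h. (cmod (cis (h \<bullet> xi) - 1))\<^sup>2 * ?g h)" unfolding eq using i1 i2 by simp
 have "(NN h. ennreal ((cmod (cis (h \<bullet> xi) - 1))\<^sup>2 * ?g h)) = ennreal (LI h. (cmod (cis (h \<bullet> xi) - 1))\<^sup>2 * ?g h)"
  by (rule nn_integral_eq_integral[OF i3]) simp
 also have "(LI h. (cmod (cis (h \<bullet> xi) - 1))\<^sup>2 * ?g h)
   = 2 * (LI h. ?g h) - 2 * (LI h. cos (h \<bullet> xi) * ?g h)"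
  unfolding eq using i1 i2 by simp
 also have "... = 2 * sqrt (pi / tau) ^ DIM('a) * (1 - exp (- (norm xi)\<^sup>2 / (4 * tau)))"
  unfolding gaussian_integral[OF tau] v2 by (simp add: algebra_simps)
 finally show ?thesis .
qed

text \<open>Balls of radius \<open>r k\<close> cover the support, and the contributions form a geometric series.\<close>

lemma powr_kernel_shells:
 fixes g :: "'a::euclidean_space => real"
 assumes q: "0 <= q" "q < 1" and r: "!!k. 0 <= r k" and c: "!!k::nat. 0 <= c k" "!!k. c k * r k ^ DIM('a) <= C * q ^ k"
  and S: "!!h. h \<in> S ==> \<exists>k. norm h <= r k \<and> g h <= c k"
 shows "(NN h. ennreal (indicator S h * g h)) < \<infinity>"
proof -
 let ?V = "unit_ball_vol (real DIM('a))"
 have "0 <= c 0 * r 0 ^ DIM('a)" using c(1) r by simp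
 then have C: "0 <= C" using c(2)[of 0] by simp
 have "ennreal (indicator S h * g h) <= (\<Sum>k. ennreal (c k) * indicator (cball 0 (r k)) h)" for h
 proof (cases "h \<in> S")
  case True
  then obtain k where k: "norm h <= r k" "g h <= c k" using S by blast
  have "ennreal (indicator S h * g h) <= (\<Sum>k\<in>{k}. ennreal (c k) * indicator (cball 0 (r k)) h)"
   using k True by (simp add: ennreal_leI)
  also have "... <= (\<Sum>k. ennreal (c k) * indicator (cball 0 (r k)) h)" by (rule sum_le_suminf) auto
  finally show ?thesis .
 qed simp
 then have "(NN h. ennreal (indicator S h * g h)) <= (NN h. (\<Sum>k. ennreal (c k) * indicator (cball (0::'a) (r k)) h))"
  by (intro nn_integral_mono)
 also have "... = (\<Sum>k. NN h. ennreal (c k) * indicator (cball (0::'a) (r k)) h)"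
  by (intro nn_integral_suminf borel_measurable_times_ennreal borel_measurable_const borel_measurable_indicator) auto
 also have "... = (\<Sum>k. ennreal (?V * (c k * r k ^ DIM('a))))"
  using r c(1) by (intro suminf_cong) (simp add: nn_integral_cmult_indicator emeasure_cball mult_ac flip: ennreal_mult)
 also have "... <= (\<Sum>k. ennreal (?V * (C * q ^ k)))" by (intro suminf_le ennreal_leI mult_left_mono c) auto
 also have "... = ennreal (\<Sum>k. ?V * (C * q ^ k))"
  using q C by (intro suminf_ennreal2 summable_mult summable_geometric) auto
 finally show ?thesis by (simp add: order.strict_trans1)
qed

lemma kernel_integrable:
 fixes a :: real assumes a: "0 < a" "a < 1"
 shows "(NN h. ennreal (min 1 ((norm h)\<^sup>2) / norm (h::'a::euclidean_space) powr (real DIM('a) + 2 * a))) < \<infinity>"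
proof -
 let ?n = "real DIM('a)" let ?beta = "?n + 2 * a"
 let ?g = "%h::'a. min 1 ((norm h)\<^sup>2) / norm h powr ?beta"
 have pw: "(2 powr x) ^ DIM('a) = 2 powr (x * ?n)" "(2 powr x) ^ k = 2 powr (x * real k)" for x k
  by (simp_all add: powr_powr flip: powr_realpow)
 have q1: "2 powr (2 * a - 2) < 1" "2 powr (- 2 * a) < 1"
  using a powr_less_mono[of "2 * a - 2" 0 2] powr_less_mono[of "- 2 * a" 0 2] by auto
 have small: "(NN h. ennreal (indicator (ball 0 1 - {0}) h * ?g h)) < \<infinity>"
 proof (rule powr_kernel_shells[where q="2 powr (2 * a - 2)" and r="%k. 2 powr (- real k)" and c="%k. 2 powr (- 2 * real k + (real k + 1) * ?beta)" and C="2 powr ?beta"])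
  show "2 powr (- 2 * real k + (real k + 1) * ?beta) * (2 powr (- real k)) ^ DIM('a) <= 2 powr ?beta * (2 powr (2 * a - 2)) ^ k" for k
   unfolding pw powr_add[symmetric] by (simp add: algebra_simps)
  fix h :: 'a assume h: "h \<in> ball 0 1 - {0}"
  define k where "k = nat \<lfloor>- log 2 (norm h)\<rfloor>"
  have h': "0 < norm h" "norm h < 1" using h by auto
  have "log 2 (norm h) <= 0" using h' by simp
  then have k: "real k <= - log 2 (norm h)" "- log 2 (norm h) <= real k + 1" unfolding k_def by linarith+
  have e: "norm h = 2 powr (log 2 (norm h))" using h' by simp
  have up: "norm h <= 2 powr (- real k)" by (subst e, rule powr_mono) (use k in auto)
  have "2 powr (- (real k + 1)) <= norm h" by (subst e, rule powr_mono) (use k in auto)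
  then have "(2 powr (- (real k + 1))) powr ?beta <= norm h powr ?beta" using a by (intro powr_mono2) auto
  then have low: "2 powr (- (real k + 1) * ?beta) <= norm h powr ?beta" by (simp only: powr_powr)
  have "(norm h)\<^sup>2 <= (2 powr (- real k))\<^sup>2" using up h' by (intro power_mono) auto
  then have "?g h <= 2 powr (- real k * 2) / 2 powr (- (real k + 1) * ?beta)"
   using low h' unfolding pw(2) by (intro frac_le) auto
  also have "... = 2 powr (- 2 * real k + (real k + 1) * ?beta)" by (simp add: algebra_simps flip: powr_diff)
  finally show "\<exists>k. norm h <= 2 powr (- real k) \<and> ?g h <= 2 powr (- 2 * real k + (real k + 1) * ?beta)" using up by blast
 qed (use q1 in auto)
 have large: "(NN h. ennreal (indicator (- ball 0 1) h * ?g h)) < \<infinity>"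
 proof (rule powr_kernel_shells[where q="2 powr (- 2 * a)" and r="%k. 2 powr (real k + 1)" and c="%k. 2 powr (- real k * ?beta)" and C="2 powr ?n"])
  show "2 powr (- real k * ?beta) * (2 powr (real k + 1)) ^ DIM('a) <= 2 powr ?n * (2 powr (- 2 * a)) ^ k" for k
   unfolding pw powr_add[symmetric] by (simp add: algebra_simps)
  fix h :: 'a assume h: "h \<in> - ball 0 1"
  define k where "k = nat \<lfloor>log 2 (norm h)\<rfloor>"
  have h': "1 <= norm h" "0 < norm h" using h by auto
  have "0 <= log 2 (norm h)" using h' by (subst zero_le_log_cancel_iff) auto
  then have k: "real k <= log 2 (norm h)" "log 2 (norm h) <= real k + 1" unfolding k_def by linarith+
  have e: "norm h = 2 powr (log 2 (norm h))" using h' by simp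
  have up: "norm h <= 2 powr (real k + 1)" by (subst e, rule powr_mono) (use k in auto)
  have "2 powr (real k) <= norm h" by (subst e, rule powr_mono) (use k in auto)
  then have "(2 powr (real k)) powr ?beta <= norm h powr ?beta" using a by (intro powr_mono2) auto
  then have low: "2 powr (real k * ?beta) <= norm h powr ?beta" by (simp only: powr_powr)
  have "?g h <= 1 / 2 powr (real k * ?beta)" using low h' by (intro frac_le) auto
  also have "... = 2 powr (- real k * ?beta)" by (simp add: powr_minus_divide)
  finally show "\<exists>k. norm h <= 2 powr (real k + 1) \<and> ?g h <= 2 powr (- real k * ?beta)" using up by blast
 qed (use q1 in auto)
 have split: "ennreal (?g h) = ennreal (indicator (ball 0 1 - {0}) h * ?g h) + ennreal (indicator (- ball 0 1) h * ?g h)" for h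
  by (auto simp: indicator_def)
 have m: "(%h. ennreal (indicator S h * ?g h)) \<in> borel_measurable lborel" if [measurable]: "S \<in> sets borel" for S :: "'a set"
  by measurable
 have "(NN h. ennreal (?g h)) = (NN h. ennreal (indicator (ball 0 1 - {0}) h * ?g h)) + (NN h. ennreal (indicator (- ball 0 1) h * ?g h))"
  unfolding split by (rule nn_integral_add[OF m m]) auto
 then show ?thesis using small large by simp
qed

lemma subordination_integral_pos:
 fixes a :: real
 shows "(NN sg. ennreal (indicator {0<..} sg * sg powr (a - 1) * (1 - exp (- 1 / (4 * sg))))) ~= 0"
proof
 assume "(NN sg. ennreal (indicator {0<..} sg * sg powr (a - 1) * (1 - exp (- 1 / (4 * sg))))) = 0"
 then have "ae sg. ennreal (indicator {0<..} sg * sg powr (a - 1) * (1 - exp (- 1 / (4 * sg)))) = 0"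
  by (subst (asm) nn_integral_0_iff_AE) auto
 then have "ae sg. sg \<notin> {0<..<1::real}"
 proof (rule AE_mp, intro AE_I2 impI)
  fix sg :: real assume z: "ennreal (indicator {0<..} sg * sg powr (a - 1) * (1 - exp (- 1 / (4 * sg)))) = 0"
  show "sg \<notin> {0<..<1}"
  proof
   assume "sg \<in> {0<..<1}"
   then have "0 < indicator {0<..} sg * sg powr (a - 1) * (1 - exp (- 1 / (4 * sg)))" by simp
   then show False using z by (simp add: ennreal_eq_0_iff)
  qed
 qed
 then have "{0<..<1::real} \<in> null_sets lborel" by (subst AE_iff_null_sets) auto
 then show False by (simp add: null_sets_def)
qed

text \<open>Subordination writes the kernel as a superposition of Gaussians in \<open>h\<close>, whose transforms are explicit; scaling the parameter produces the power of \<open>norm xi\<close>.\<close>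

theorem levy_symbol_ex:
 fixes a :: real assumes a: "0 < a" "a < 1"
 shows "\<exists>C>0. \<forall>xi::'a::euclidean_space.
  (NN h. ennreal ((cmod (cis (h \<bullet> xi) - 1))\<^sup>2 / norm h powr (real DIM('a) + 2 * a))) = ennreal (C * norm xi powr (2 * a))"
proof -
 define s where "s = (real DIM('a) + 2 * a) / 2"
 have s: "s > 0" using a by (simp add: s_def)
 define J where "J = (NN sg. ennreal (indicator {0<..} sg * sg powr (a - 1) * (1 - exp (- 1 / (4 * sg)))))"
 define P where "P = 2 * pi powr (real DIM('a) / 2)"
 have P: "P > 0" by (simp add: P_def)
 have G: "Gamma s > 0" by (rule Gamma_real_pos[OF s])
 have scaling: "ennreal (Gamma s) * (NN h. ennreal ((cmod (cis (h \<bullet> xi) - 1))\<^sup>2 / norm h powr (real DIM('a) + 2 * a)))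
   = ennreal P * (ennreal (norm xi powr (2 * a)) * J)" (is "_ * ?M = _") if "xi ~= 0" for xi :: 'a
 proof -
  have False: "xi ~= 0" by (rule that)
  let ?c = "%h. (cmod (cis (h \<bullet> xi) - 1))\<^sup>2"
  let ?t = "%tau. indicator {0<..} tau * tau powr (s - 1)"
  have "ennreal (Gamma s) * ?M = (NN h. ennreal (Gamma s) * ennreal (?c h / norm h powr (real DIM('a) + 2 * a)))"
   by (rule nn_integral_cmult[symmetric]) measurable
  also have "... = (NN h. (NN tau. ennreal (?c h) * ennreal (?t tau * exp (- tau * (norm h)\<^sup>2))))"
  proof (rule nn_integral_cong_AE, rule AE_mp[OF AE_lborel_singleton[of "0::'a"]], intro AE_I2 impI)
   fix h :: 'a assume h: "h ~= 0"
   have "((norm h)\<^sup>2) powr (- s) = (norm h powr 2) powr (- s)" using h by (simp add: powr_numeral)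
   also have "... = norm h powr (- (real DIM('a) + 2 * a))"
   proof -
    have "2 * - s = - (real DIM('a) + 2 * a)" unfolding s_def by (simp add: field_simps)
    then show ?thesis unfolding powr_powr by (rule arg_cong)
   qed
   finally have p: "((norm h)\<^sup>2) powr (- s) = 1 / norm h powr (real DIM('a) + 2 * a)"
    by (simp only: powr_minus inverse_eq_divide)
   have "(NN tau. ennreal (?c h) * ennreal (?t tau * exp (- tau * (norm h)\<^sup>2))) = ennreal (?c h) * ennreal (Gamma s * ((norm h)\<^sup>2) powr (- s))"
    by (subst nn_integral_cmult) (use gamma_scaled[OF s, of "(norm h)\<^sup>2"] h in auto)
   also have "... = ennreal (Gamma s) * ennreal (?c h / norm h powr (real DIM('a) + 2 * a))"
    unfolding p using G by (simp add: mult_ac flip: ennreal_mult)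
   finally show "ennreal (Gamma s) * ennreal (?c h / norm h powr (real DIM('a) + 2 * a))
    = (NN tau. ennreal (?c h) * ennreal (?t tau * exp (- tau * (norm h)\<^sup>2)))" ..
  qed
  also have "... = (NN tau. (NN h. ennreal (?c h) * ennreal (?t tau * exp (- tau * (norm h)\<^sup>2))))"
   by (rule lborel_pair.Fubini') measurable
  also have "... = (NN tau. ennreal P * ennreal (indicator {0<..} tau * tau powr (a - 1) * (1 - exp (- (norm xi)\<^sup>2 / (4 * tau)))))"
  proof (rule nn_integral_cong)
   fix tau :: real
   show "(NN h. ennreal (?c h) * ennreal (?t tau * exp (- tau * (norm h)\<^sup>2)))
    = ennreal P * ennreal (indicator {0<..} tau * tau powr (a - 1) * (1 - exp (- (norm xi)\<^sup>2 / (4 * tau))))"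
   proof (cases "tau > 0")
    case True
    have "(NN h. ennreal (?c h) * ennreal (?t tau * exp (- tau * (norm h)\<^sup>2)))
     = (NN h. ennreal (tau powr (s - 1)) * ennreal (?c h * exp (- tau * (norm h)\<^sup>2)))"
     using True by (intro nn_integral_cong) (simp add: mult_ac flip: ennreal_mult)
    also have "... = ennreal (tau powr (s - 1)) * ennreal (2 * sqrt (pi / tau) ^ DIM('a) * (1 - exp (- (norm xi)\<^sup>2 / (4 * tau))))"
     by (subst nn_integral_cmult) (simp_all only: gaussian_difference[OF True], measurable)
    also have "... = ennreal (tau powr (s - 1) * (2 * sqrt (pi / tau) ^ DIM('a)) * (1 - exp (- (norm xi)\<^sup>2 / (4 * tau))))"
     using True by (simp add: mult.assoc flip: ennreal_mult)
    also have "tau powr (s - 1) * (2 * sqrt (pi / tau) ^ DIM('a)) = P * tau powr (a - 1)"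
    proof -
     have "sqrt (pi / tau) ^ DIM('a) = ((pi / tau) powr (1/2)) powr (real DIM('a))"
      using True by (simp add: powr_realpow powr_half_sqrt)
     also have "... = pi powr (real DIM('a) / 2) * tau powr (- (real DIM('a) / 2))"
      using True by (simp only: powr_powr powr_minus_divide) (simp add: powr_divide)
     finally have "tau powr (s - 1) * (2 * sqrt (pi / tau) ^ DIM('a)) = P * (tau powr (s - 1) * tau powr (- (real DIM('a) / 2)))"
      by (simp add: P_def)
     also have "tau powr (s - 1) * tau powr (- (real DIM('a) / 2)) = tau powr (a - 1)"
      unfolding powr_add[symmetric] by (simp add: s_def add_divide_distrib)
     finally show ?thesis .
    qed
    finally show ?thesis using True P by (simp add: mult.assoc flip: ennreal_mult)
   qed simp
  qed
  also have "... = ennreal P * (NN tau. ennreal (indicator {0<..} tau * tau powr (a - 1) * (1 - exp (- (norm xi)\<^sup>2 / (4 * tau)))))"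
   by (rule nn_integral_cmult) measurable
  also have "(NN tau. ennreal (indicator {0<..} tau * tau powr (a - 1) * (1 - exp (- (norm xi)\<^sup>2 / (4 * tau)))))
   = ennreal (norm xi powr (2 * a)) * J"
  proof -
   let ?r = "(norm xi)\<^sup>2"
   have r: "?r > 0" using False by simp
   have "(NN tau. ennreal (indicator {0<..} tau * tau powr (a - 1) * (1 - exp (- ?r / (4 * tau)))))
    = ennreal \<bar>?r\<bar> * (NN sg. ennreal (indicator {0<..} (0 + ?r * sg) * (0 + ?r * sg) powr (a - 1) * (1 - exp (- ?r / (4 * (0 + ?r * sg))))))"
    by (rule nn_integral_real_affine) (use r in auto)
   also have "... = ennreal ?r * (NN sg. ennreal (?r powr (a - 1)) * ennreal (indicator {0<..} sg * sg powr (a - 1) * (1 - exp (- 1 / (4 * sg)))))"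
   proof -
    have "ennreal (indicator {0<..} (0 + ?r * sg) * (0 + ?r * sg) powr (a - 1) * (1 - exp (- ?r / (4 * (0 + ?r * sg)))))
     = ennreal (?r powr (a - 1)) * ennreal (indicator {0<..} sg * sg powr (a - 1) * (1 - exp (- 1 / (4 * sg))))" for sg
    proof (cases "sg > 0")
     case True
     have "- ?r / (4 * (0 + ?r * sg)) = - 1 / (4 * sg)" using r True by (simp add: field_simps)
     then show ?thesis using True r
      by (simp only: powr_mult add_0) (simp add: powr_mult zero_less_mult_iff mult.assoc flip: ennreal_mult)
    next
     case neg: False
     then have "\<not> 0 < ?r * sg" using r by (simp add: zero_less_mult_iff not_less)
     then show ?thesis using neg by simp
    qed
    then show ?thesis using r by simp
   qed
   also have "... = ennreal (?r * ?r powr (a - 1)) * J"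
    unfolding J_def by (subst nn_integral_cmult) (use r in \<open>auto simp: ennreal_mult mult.assoc\<close>)
   also have "?r * ?r powr (a - 1) = ?r powr a" using r powr_add[of ?r 1 "a - 1"] by simp
   also have "?r powr a = norm xi powr (2 * a)"
    using False powr_powr[of "norm xi" 2 a] by (simp add: powr_numeral)
   finally show ?thesis .
  qed
  finally show ?thesis .
 qed
 have "J < \<infinity>"
 proof -
  obtain e :: 'a where e: "e \<in> Basis" using nonempty_Basis by blast
  have "(cmod (cis (h \<bullet> e) - 1))\<^sup>2 <= 4 * min 1 ((norm h)\<^sup>2)" for h :: 'a
  proof -
   have "cmod (cis (h \<bullet> e) - 1) <= norm h"
    using cis_minus_one_le[of "h \<bullet> e"] Cauchy_Schwarz_ineq2[of h e] e by simp
   moreover have "cmod (cis (h \<bullet> e) - 1) <= 2" using norm_triangle_ineq4[of "cis (h \<bullet> e)" 1] by simp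
   ultimately have le: "(cmod (cis (h \<bullet> e) - 1))\<^sup>2 <= (norm h)\<^sup>2" "(cmod (cis (h \<bullet> e) - 1))\<^sup>2 <= 2\<^sup>2"
    by (intro power_mono; simp)+
   show ?thesis
   proof (cases "1 <= (norm h)\<^sup>2")
    case False
    then have "min 1 ((norm h)\<^sup>2) = (norm h)\<^sup>2" by simp
    then show ?thesis using le(1) zero_le_power2[of "norm h"] by linarith
   qed (use le(2) in \<open>simp add: min_def\<close>)
  qed
  then have le: "(cmod (cis (h \<bullet> e) - 1))\<^sup>2 / norm h powr (real DIM('a) + 2 * a) <= 4 * (min 1 ((norm h)\<^sup>2) / norm h powr (real DIM('a) + 2 * a))" for h :: 'a
   using divide_right_mono[of "(cmod (cis (h \<bullet> e) - 1))\<^sup>2" _ "norm h powr (real DIM('a) + 2 * a)"] by simp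
  have "(NN h. ennreal ((cmod (cis (h \<bullet> e) - 1))\<^sup>2 / norm h powr (real DIM('a) + 2 * a)))
   <= (NN h. ennreal 4 * ennreal (min 1 ((norm (h::'a))\<^sup>2) / norm h powr (real DIM('a) + 2 * a)))"
   by (intro nn_integral_mono) (simp only: ennreal_leI[OF le] ennreal_mult'[symmetric] zero_le_numeral)
  also have "... < \<infinity>"
   using kernel_integrable[OF a, where 'a='a] by (subst nn_integral_cmult) (auto simp: ennreal_mult_less_top)
  finally have "ennreal (Gamma s) * (NN h. ennreal ((cmod (cis (h \<bullet> e) - 1))\<^sup>2 / norm h powr (real DIM('a) + 2 * a))) < \<infinity>"
   by (simp add: ennreal_mult_less_top)
  then have "ennreal P * J < \<infinity>" unfolding scaling[OF nonzero_Basis[OF e]] using e by simp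
  then show ?thesis using P by (auto simp: ennreal_mult_less_top)
 qed
 then obtain j where j: "J = ennreal j" "j > 0"
  using subordination_integral_pos[of a] unfolding J_def[symmetric] by (cases J) (auto simp: less_le)
 define C where "C = P * j / Gamma s"
 have C: "C > 0" using P j G by (simp add: C_def)
 have "(NN h. ennreal ((cmod (cis (h \<bullet> xi) - 1))\<^sup>2 / norm h powr (real DIM('a) + 2 * a))) = ennreal (C * norm xi powr (2 * a))"
  (is "?M = _") for xi :: 'a
 proof (cases "xi = 0")
  case False
  have "?M = ennreal (1 / Gamma s) * (ennreal (Gamma s) * ?M)"
   using G by (simp add: mult.assoc[symmetric] flip: ennreal_mult)
  also have "... = ennreal (C * norm xi powr (2 * a))"
   unfolding scaling[OF False] j(1) C_def using G P j(2) by (simp add: mult_ac flip: ennreal_mult)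
  finally show ?thesis .
 qed simp
 then show ?thesis using C by blast
qed

text \<open>The constant of the Levy-Khintchine formula for \<open>norm xi powr (2 a)\<close>.\<close>

definition levy_const :: "'a::euclidean_space itself => real => real" where
 "levy_const T a = (SOME C. C > 0 \<and> (\<forall>xi::'a.
  (NN h. ennreal ((cmod (cis (h \<bullet> xi) - 1))\<^sup>2 / norm h powr (real DIM('a) + 2 * a))) = ennreal (C * norm xi powr (2 * a))))"

lemma
 fixes a :: real assumes a: "0 < a" "a < 1"
 shows levy_const_pos: "levy_const TYPE('a::euclidean_space) a > 0"
  and levy_symbol: "!!xi::'a. (NN h. ennreal ((cmod (cis (h \<bullet> xi) - 1))\<^sup>2 / norm h powr (real DIM('a) + 2 * a)))
    = ennreal (levy_const TYPE('a) a * norm xi powr (2 * a))"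
proof -
 let ?P = "%C. C > 0 \<and> (\<forall>xi::'a.
  (NN h. ennreal ((cmod (cis (h \<bullet> xi) - 1))\<^sup>2 / norm h powr (real DIM('a) + 2 * a))) = ennreal (C * norm xi powr (2 * a)))"
 have "\<exists>C. ?P C" using levy_symbol_ex[OF a, where 'a='a] by blast
 then have "?P (levy_const TYPE('a) a)" unfolding levy_const_def by (rule someI_ex)
 then show "levy_const TYPE('a) a > 0" "!!xi::'a. (NN h. ennreal ((cmod (cis (h \<bullet> xi) - 1))\<^sup>2 / norm h powr (real DIM('a) + 2 * a)))
    = ennreal (levy_const TYPE('a) a * norm xi powr (2 * a))" by blast+
qed

lemma kernel_tail:
 fixes a :: real assumes a: "0 < a" "a < 1"
 obtains T where "T >= 0" "!!d. 0 < d ==>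
  (NN h. ennreal (indicator {h. d <= norm h} h / norm (h::'a::euclidean_space) powr (real DIM('a) + 2 * a))) = ennreal (T * d powr (- (2 * a)))"
proof -
 let ?k = "%h::'a. norm h powr (real DIM('a) + 2 * a)"
 let ?I = "%d::real. (NN h. ennreal (indicator {h. d <= norm h} h / ?k h))"
 have "?I 1 <= (NN h. ennreal (min 1 ((norm h)\<^sup>2) / ?k h))"
 proof (intro nn_integral_mono ennreal_leI divide_right_mono)
  fix h :: 'a show "indicator {h. 1 <= norm h} h <= min 1 ((norm h)\<^sup>2)"
   by (auto simp: indicator_def one_le_power)
 qed simp
 also have "... < \<infinity>" by (rule kernel_integrable[OF a])
 finally obtain T where T: "?I 1 = ennreal T" "T >= 0" by (cases "?I 1") auto
 have "?I d = ennreal (T * d powr (- (2 * a)))" if d: "0 < d" for d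
 proof -
  have "?I d = ennreal (d ^ DIM('a)) * (NN h. ennreal (indicator {h. d <= norm h} (d *\<^sub>R h) / ?k (d *\<^sub>R h)))"
   by (rule nn_integral_scale[OF _ d]) measurable
  also have "(NN h. ennreal (indicator {h. d <= norm h} (d *\<^sub>R h) / ?k (d *\<^sub>R h)))
   = (NN h. ennreal (1 / d powr (real DIM('a) + 2 * a)) * ennreal (indicator {h. 1 <= norm h} h / ?k h))"
   using d by (intro nn_integral_cong) (auto simp: powr_mult indicator_def simp flip: ennreal_mult)
  also have "... = ennreal (1 / d powr (real DIM('a) + 2 * a)) * ?I 1"
   by (rule nn_integral_cmult) measurable
  also have "ennreal (d ^ DIM('a)) * (ennreal (1 / d powr (real DIM('a) + 2 * a)) * ?I 1) = ennreal (d ^ DIM('a) * (1 / d powr (real DIM('a) + 2 * a)) * T)"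
   unfolding T(1) using d T(2) by (simp add: mult.assoc flip: ennreal_mult)
  also have "d ^ DIM('a) * (1 / d powr (real DIM('a) + 2 * a)) * T = T * d powr (- (2 * a))"
   using d by (simp add: powr_add powr_realpow powr_minus divide_inverse)
  finally show ?thesis .
 qed
 then show ?thesis using that T(2) by blast
qed

subsection \<open>The energy as a double integral\<close>

text \<open>For fixed \<open>h\<close> Plancherel turns the mean square of \<open>u (h + x) - u x\<close> into the weight \<open>\<bar>cis (h \<bullet> xi) - 1\<bar>\<^sup>2\<close>; integrating over \<open>h\<close> gives the symbol.\<close>

theorem gagliardo_identity:
 fixes u :: "'a::euclidean_space => real"
 assumes u: "L2 u" and a: "0 < a" "a < 1"
 shows "(NN x. NN y. ennreal ((u x - u y)\<^sup>2 / norm (x - y) powr (real DIM('a) + 2 * a)))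
  = ennreal (levy_const TYPE('a) a / plancherel_const TYPE('a)) * (NN xi. ennreal ((cmod (weighted a u xi))\<^sup>2))"
proof -
 let ?k = "%h::'a. norm h powr (real DIM('a) + 2 * a)"
 let ?c = "plancherel_const TYPE('a)" and ?C = "levy_const TYPE('a) a"
 have C: "?C > 0" by (rule levy_const_pos[OF a])
 have [measurable]: "u \<in> Borel" using u by (rule L2_borel)
 have [measurable]: "fourier u \<in> Borel" by (rule L2_borel[OF L2_fourier[OF u]])
 have "(NN x. NN y. ennreal ((u x - u y)\<^sup>2 / ?k (x - y)))
  = (NN x. NN h. ennreal ((u (x + h) - u x)\<^sup>2 / ?k h))"
 proof (rule nn_integral_cong)
  fix x :: 'a
  have "(NN y. ennreal ((u x - u y)\<^sup>2 / ?k (x - y))) = (NN h. ennreal ((u x - u (x + h))\<^sup>2 / ?k (x - (x + h))))"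
   by (rule nn_integral_translate[symmetric]) measurable
  then show "(NN y. ennreal ((u x - u y)\<^sup>2 / ?k (x - y))) = (NN h. ennreal ((u (x + h) - u x)\<^sup>2 / ?k h))"
   by (simp add: power2_commute)
 qed
 also have "... = (NN h. NN x. ennreal ((u (x + h) - u x)\<^sup>2 / ?k h))"
  by (rule lborel_pair.Fubini'[symmetric]) measurable
 also have "... = (NN h. NN xi. ennreal (1 / ?c) * ennreal ((cmod (cis (h \<bullet> xi) - 1))\<^sup>2 / ?k h * (cmod (fourier u xi))\<^sup>2))"
 proof (rule nn_integral_cong)
  fix h :: 'a
  let ?d = "%x. u (h + x) - u x" and ?g = "%xi. (cis (h \<bullet> xi) - 1) * fourier u xi"
  have F: "has_fourier ?d ?g" by (rule has_fourier_translate_diff[OF has_fourier_fourier[OF u]])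
  have "(NN x. ennreal ((u (x + h) - u x)\<^sup>2 / ?k h)) = (NN x. ennreal (1 / ?k h) * ennreal ((norm (?d x))\<^sup>2))"
   by (intro nn_integral_cong) (simp add: add.commute flip: ennreal_mult)
  also have "... = ennreal (1 / ?k h) * ennreal (sqint ?d)"
   by (subst nn_integral_cmult) (simp_all only: nn_sqint[OF has_fourier_L2(1)[OF F]], measurable)
  also have "sqint ?d = 1 / ?c * sqint ?g" unfolding plancherel_real[OF F] by simp
  also have "ennreal (1 / ?k h) * ennreal (1 / ?c * sqint ?g) = ennreal (1 / ?c * (1 / ?k h)) * ennreal (sqint ?g)"
   by (simp add: mult_ac flip: ennreal_mult)
  also have "... = (NN xi. ennreal (1 / ?c * (1 / ?k h)) * ennreal ((norm (?g xi))\<^sup>2))"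
   unfolding nn_sqint[OF has_fourier_L2(2)[OF F], symmetric] by (rule nn_integral_cmult[symmetric]) measurable
  finally show "(NN x. ennreal ((u (x + h) - u x)\<^sup>2 / ?k h))
   = (NN xi. ennreal (1 / ?c) * ennreal ((cmod (cis (h \<bullet> xi) - 1))\<^sup>2 / ?k h * (cmod (fourier u xi))\<^sup>2))"
   by (simp add: norm_mult power_mult_distrib mult_ac flip: ennreal_mult)
 qed
 also have "... = (NN xi. NN h. ennreal (1 / ?c) * ennreal ((cmod (cis (h \<bullet> xi) - 1))\<^sup>2 / ?k h * (cmod (fourier u xi))\<^sup>2))"
  by (rule lborel_pair.Fubini') measurable
 also have "... = (NN xi. ennreal (?C / ?c) * ennreal ((cmod (weighted a u xi))\<^sup>2))"
 proof (rule nn_integral_cong)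
  fix xi :: 'a
  have "(NN h. ennreal (1 / ?c) * ennreal ((cmod (cis (h \<bullet> xi) - 1))\<^sup>2 / ?k h * (cmod (fourier u xi))\<^sup>2))
   = (NN h. ennreal (1 / ?c * (cmod (fourier u xi))\<^sup>2) * ennreal ((cmod (cis (h \<bullet> xi) - 1))\<^sup>2 / ?k h))"
   by (intro nn_integral_cong) (simp add: mult_ac flip: ennreal_mult)
  also have "... = ennreal (1 / ?c * (cmod (fourier u xi))\<^sup>2) * ennreal (?C * norm xi powr (2 * a))"
   by (subst nn_integral_cmult) (simp_all only: levy_symbol[OF a], measurable)
  also have "... = ennreal (?C / ?c * (norm xi powr (2 * a) * (cmod (fourier u xi))\<^sup>2))"
   using C by (simp add: mult_ac flip: ennreal_mult)
  also have "norm xi powr (2 * a) * (cmod (fourier u xi))\<^sup>2 = (cmod (weighted a u xi))\<^sup>2"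
   using powr_add[of "norm xi" a a] by (simp add: weighted_def power_mult_distrib power2_eq_square)
  finally show "(NN h. ennreal (1 / ?c) * ennreal ((cmod (cis (h \<bullet> xi) - 1))\<^sup>2 / ?k h * (cmod (fourier u xi))\<^sup>2))
   = ennreal (?C / ?c) * ennreal ((cmod (weighted a u xi))\<^sup>2)"
   using C by (simp flip: ennreal_mult)
 qed
 also have "... = ennreal (?C / ?c) * (NN xi. ennreal ((cmod (weighted a u xi))\<^sup>2))"
  using borel_measurable_weighted[OF u, of a] by (intro nn_integral_cmult) measurable
 finally show ?thesis .
qed

definition gagliardo :: "real => ('a::euclidean_space => real) => ('a => real) => 'a \<times> 'a => real" where
 "gagliardo a u v = (%(x, y). (u x - u y) * (v x - v y) / norm (x - y) powr (real DIM('a) + 2 * a))"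

lemma borel_measurable_gagliardo [measurable]:
 assumes [measurable]: "u \<in> Borel" "v \<in> Borel"
 shows "gagliardo a u v \<in> borel_measurable (lborel2)"
 unfolding gagliardo_def by measurable

lemma gagliardo_square:
 fixes u :: "'a::euclidean_space => real"
 assumes u: "in_H a u" and a: "0 < a" "a < 1"
 shows "integrable (lborel2) (gagliardo a u u)"
  and "(LINT z|(lborel2). gagliardo a u u z) = levy_const TYPE('a) a / plancherel_const TYPE('a) * energy a u u"
proof -
 have [measurable]: "u \<in> Borel" by (rule L2_borel[OF in_H_L2(1)[OF u]])
 have nn: "0 <= gagliardo a u u z" for z by (cases z) (simp add: gagliardo_def)
 have "(\<integral>\<^sup>+z. ennreal (gagliardo a u u z) \<partial>(lborel2)) = (NN x. NN y. ennreal (gagliardo a u u (x, y)))"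
  by (rule lborel.nn_integral_fst[symmetric]) measurable
 also have "... = ennreal (levy_const TYPE('a) a / plancherel_const TYPE('a) * energy a u u)"
  using gagliardo_identity[OF in_H_L2(1)[OF u] a] levy_const_pos[OF a, where 'a='a]
  unfolding nn_sqint[OF in_H_L2(2)[OF u]] energy_self
  by (simp add: gagliardo_def power2_eq_square flip: ennreal_mult)
 finally have I: "(\<integral>\<^sup>+z. ennreal (gagliardo a u u z) \<partial>(lborel2)) = ennreal (levy_const TYPE('a) a / plancherel_const TYPE('a) * energy a u u)" .
 show int: "integrable (lborel2) (gagliardo a u u)"
  by (rule integrableI_nonneg) (use I nn in auto)
 have "0 <= levy_const TYPE('a) a / plancherel_const TYPE('a) * energy a u u"
  using levy_const_pos[OF a, where 'a='a] by (simp add: energy_self)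
 then show "(LINT z|(lborel2). gagliardo a u u z) = levy_const TYPE('a) a / plancherel_const TYPE('a) * energy a u u"
  using nn_integral_eq_integral[OF int] nn I by (simp add: integral_nonneg_AE)
qed

theorem gagliardo_energy:
 fixes u :: "'a::euclidean_space => real"
 assumes u: "in_H a u" and v: "in_H a v" and a: "0 < a" "a < 1"
 shows "integrable (lborel2) (gagliardo a u v)"
  and "(LINT z|(lborel2). gagliardo a u v z) = levy_const TYPE('a) a / plancherel_const TYPE('a) * energy a u v"
proof -
 let ?p = "%x. u x + v x" and ?m = "%x. u x - v x"
 have p: "in_H a ?p" and m: "in_H a ?m" by (rule in_H_add[OF u v], rule in_H_diff[OF u v])
 have eq: "gagliardo a u v = (%z. (gagliardo a ?p ?p z - gagliardo a ?m ?m z) / 4)"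
 proof
  fix z :: "'a \<times> 'a"
  obtain x y where z: "z = (x, y)" by (cases z)
  have e: "A * B / k = ((A + B) * (A + B) / k - (A - B) * (A - B) / k) / 4" for A B k :: real
  proof -
   have "(A + B) * (A + B) - (A - B) * (A - B) = 4 * (A * B)" by (simp add: algebra_simps)
   then show ?thesis by (simp flip: diff_divide_distrib)
  qed
  have eqs: "u x + v x - (u y + v y) = (u x - u y) + (v x - v y)" "u x - v x - (u y - v y) = (u x - u y) - (v x - v y)"
   by simp_all
  show "gagliardo a u v z = (gagliardo a ?p ?p z - gagliardo a ?m ?m z) / 4"
   unfolding z gagliardo_def prod.case eqs by (rule e)
 qed
 note ip = gagliardo_square[OF p a] and im = gagliardo_square[OF m a]
 show "integrable (lborel2) (gagliardo a u v)" unfolding eq using ip im by simp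
 have "energy a ?p ?p = energy a u u + 2 * energy a u v + energy a v v"
  using energy_lincomb[OF u v p, of 1 1] energy_lincomb[OF u v u, of 1 1] energy_lincomb[OF u v v, of 1 1]
  by (simp add: energy_commute[of a u ?p] energy_commute[of a v ?p] energy_commute[of a v u])
 moreover have "energy a ?m ?m = energy a u u - 2 * energy a u v + energy a v v"
  using energy_lincomb[OF u v m, of 1 "-1"] energy_lincomb[OF u v u, of 1 "-1"] energy_lincomb[OF u v v, of 1 "-1"]
  by (simp add: energy_commute[of a u ?m] energy_commute[of a v ?m] energy_commute[of a v u])
 ultimately have "energy a ?p ?p - energy a ?m ?m = 4 * energy a u v" by simp
 moreover have "(LINT z|(lborel2). gagliardo a u v z) = levy_const TYPE('a) a / plancherel_const TYPE('a) * (energy a ?p ?p - energy a ?m ?m) / 4"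
  unfolding eq using ip im by (simp add: right_diff_distrib)
 ultimately show "(LINT z|(lborel2). gagliardo a u v z) = levy_const TYPE('a) a / plancherel_const TYPE('a) * energy a u v"
  by simp
qed

lemma in_H_iff_gagliardo:
 fixes u :: "'a::euclidean_space => real"
 assumes u: "L2 u" and a: "0 < a" "a < 1"
  and fin: "(NN x. NN y. ennreal ((u x - u y)\<^sup>2 / norm (x - y) powr (real DIM('a) + 2 * a))) < \<infinity>"
 shows "in_H a u"
proof -
 let ?q = "levy_const TYPE('a) a / plancherel_const TYPE('a)"
 have q: "?q > 0" using levy_const_pos[OF a, where 'a='a] by simp
 have "(NN xi. ennreal ((cmod (weighted a u xi))\<^sup>2)) < \<infinity>"
  using fin unfolding gagliardo_identity[OF u a] using q
  by (auto simp: ennreal_mult_less_top ennreal_eq_0_iff)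
 then show ?thesis using u borel_measurable_weighted[OF u] by (simp add: in_H_def L2_iff_nn)
qed

section \<open>The constant of the fractional Laplacian\<close>

lemma integral_uminus:
 fixes p :: "'a::euclidean_space => real"
 assumes p: "L1 p"
 shows "L1 (%h. p (- h))" "(LI h. p (- h)) = (LI h. p h)"
proof -
 have m: "p \<in> Borel" using p by auto
 have "integrable (distr lborel borel uminus) p" unfolding distr_uminus by (rule p)
 then show "L1 (%h. p (- h))" by (subst (asm) integrable_distr_eq) (use m in auto)
 have "(LINT h|distr lborel borel uminus. p h) = (LI h. p (- h))" by (rule integral_distr) (use m in auto)
 then show "(LI h. p (- h)) = (LI h. p h)" unfolding distr_uminus by (rule sym)
qed

text \<open>An integrable majorant whose constant part at the origin makes it insensitive to shifts by at most \<open>1\<close>.\<close>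

definition decay :: "'a::euclidean_space => real" where
 "decay x = indicator (cball 0 2) x + indicator {x. 2 <= norm x} x / norm x powr (real DIM('a) + 1)"

lemma decay_nonneg: "0 <= decay x"
 by (simp add: decay_def)

lemma decay_le: "decay (x::'a::euclidean_space) <= 2"
proof -
 have "indicator {x. 2 <= norm x} x / norm x powr (real DIM('a) + 1) <= (1::real)"
 proof (cases "2 <= norm x")
  case True
  then have "1 <= norm x powr (real DIM('a) + 1)" by (intro ge_one_powr_ge_zero) auto
  moreover have "0 < norm x powr (real DIM('a) + 1)" using calculation by linarith
  ultimately show ?thesis using True by (simp add: divide_le_eq)
 qed simp
 moreover have "indicator (cball 0 2) x <= (1::real)" by (simp add: indicator_def)
 ultimately show ?thesis unfolding decay_def by linarith
qed

lemma kernel_tail_integrable: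
 fixes a :: real assumes a: "0 < a" "a < 1" and d: "0 < d"
 shows "L1 (%h. indicator {h. d <= norm h} h / norm (h::'a::euclidean_space) powr (real DIM('a) + 2 * a))"
proof -
 obtain T where "!!d. 0 < d ==>
  (NN h. ennreal (indicator {h. d <= norm h} h / norm (h::'a) powr (real DIM('a) + 2 * a))) = ennreal (T * d powr (- (2 * a)))"
  by (rule kernel_tail[OF a, where 'a='a]) blast
 from this[OF d] show ?thesis by (intro integrableI_nonneg) auto
qed

lemma kernel_min_integrable:
 fixes a :: real assumes a: "0 < a" "a < 1"
 shows "L1 (%h. min 1 ((norm h)\<^sup>2) / norm (h::'a::euclidean_space) powr (real DIM('a) + 2 * a))"
 by (rule integrableI_nonneg) (use kernel_integrable[OF a, where 'a='a] in auto)

lemma decay_integrable: "L1 (decay :: 'a::euclidean_space => real)"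
proof -
 have "L1 (%h::'a. indicator {h. 2 <= norm h} h / norm h powr (real DIM('a) + 1))"
  using kernel_tail_integrable[of "1/2" 2, where 'a='a] by simp
 moreover have "L1 (indicator (cball (0::'a) 2) :: 'a => real)"
  using emeasure_lborel_cball_finite[of "0::'a" 2] by simp
 ultimately show ?thesis unfolding decay_def[abs_def] by (rule L1_integrable_add[rotated])
qed

lemma schwartz_decay:
 fixes u :: "'a::euclidean_space => real"
 assumes u: "u \<in> schwartz_functions" and vs: "set vs \<subseteq> Basis"
 shows "\<exists>C\<ge>0. \<forall>x z. norm (z - x) <= 1 \<longrightarrow> \<bar>partial_derivs vs u z\<bar> <= C * decay x"
proof -
 let ?D = "partial_derivs vs u" and ?N = "DIM('a) + 1"
 have "bounded (range (%x. norm x ^ k * ?D x))" for k using u vs by (auto simp: schwartz_functions_def)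
 then have "\<exists>C. \<forall>x. \<bar>norm x ^ k * ?D x\<bar> <= C" for k by (auto simp: bounded_iff)
 then obtain C where C: "!!k x. \<bar>norm x ^ k * ?D x\<bar> <= C k" by metis
 have C0: "0 <= C k" for k using C[where k=k, of undefined] by linarith
 let ?C = "C 0 + C ?N * 2 ^ ?N"
 have "\<bar>?D z\<bar> <= ?C * decay x" if "norm (z - x) <= 1" for x z
 proof (cases "norm x <= 2")
  case True
  then have "1 <= decay x" by (simp add: decay_def)
  have "\<bar>?D z\<bar> <= C 0" using C[where k=0, of z] by simp
  also have "... <= ?C * 1" using C0 by simp
  also have "... <= ?C * decay x" using \<open>1 <= decay x\<close> C0 by (intro mult_left_mono add_nonneg_nonneg mult_nonneg_nonneg) auto
  finally show ?thesis .
 next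
  case False
  then have x: "norm x > 2" by simp
  have "norm x <= norm z + norm (z - x)" by (metis norm_minus_commute norm_triangle_sub)
  then have z: "norm x / 2 <= norm z" using that x by linarith
  have "(norm x / 2) ^ ?N * \<bar>?D z\<bar> <= norm z ^ ?N * \<bar>?D z\<bar>" using z by (intro mult_right_mono power_mono) auto
  also have "... <= C ?N" using C[where k="?N", of z] by (simp add: abs_mult)
  finally have "norm x ^ ?N / 2 ^ ?N * \<bar>?D z\<bar> <= C ?N" unfolding power_divide .
  moreover have "e <= c * t / p" if "p / t * e <= c" "0 < p" "0 < t" for p t e c :: real
   using that by (simp add: field_simps)
  moreover have "0 < norm x ^ ?N" by (rule zero_less_power) (use x in linarith)
  moreover have "(0::real) < 2 ^ ?N" by simp
  ultimately have "\<bar>?D z\<bar> <= C ?N * 2 ^ ?N / norm x ^ ?N" by blast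
  moreover have "0 < norm x" using x by linarith
  then have "norm x ^ ?N = norm x powr (real DIM('a) + 1)" by (simp add: powr_add powr_realpow)
  moreover have "C ?N * 2 ^ ?N / norm x powr (real DIM('a) + 1) = C ?N * 2 ^ ?N * decay x" using x by (simp add: decay_def)
  moreover have "C ?N * 2 ^ ?N * decay x <= ?C * decay x" using C0 decay_nonneg by (intro mult_right_mono) auto
  ultimately show ?thesis by simp
 qed
 moreover have "?C >= 0" using C0 by (intro add_nonneg_nonneg mult_nonneg_nonneg) auto
 ultimately show ?thesis by blast
qed

definition second_difference :: "('a::euclidean_space => real) => 'a => 'a => real" where
 "second_difference u x h = 2 * u x - u (x + h) - u (x - h)"

lemma second_difference_small:
 fixes u :: "'a::euclidean_space => real"
 assumes u: "u \<in> schwartz_functions"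
 shows "\<exists>C\<ge>0. \<forall>x h. norm h <= 1 \<longrightarrow> \<bar>second_difference u x h\<bar> <= C * (norm h)\<^sup>2 * decay x"
proof -
 have CI: "C_infinity u" using u by (simp add: schwartz_functions_def)
 have ex: "\<exists>C\<ge>0. \<forall>x z. norm (z - x) <= 1 \<longrightarrow> \<bar>partial_derivs [c, b] u z\<bar> <= C * decay x" if "b \<in> Basis" "c \<in> Basis" for b c
  by (rule schwartz_decay[OF u]) (use that in auto)
 define C where "C b c = (SOME C. C >= 0 \<and> (\<forall>x z. norm (z - x) <= 1 \<longrightarrow> \<bar>partial_derivs [c, b] u z\<bar> <= C * decay x))" for b c
 have C: "0 <= C b c \<and> (\<forall>x z. norm (z - x) <= 1 \<longrightarrow> \<bar>partial_derivs [c, b] u z\<bar> <= C b c * decay x)"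
  if "b \<in> Basis" "c \<in> Basis" for b c
  unfolding C_def using ex[OF that] by (rule someI_ex)
 let ?C = "2 * (\<Sum>b\<in>Basis. \<Sum>c\<in>Basis. C b c)"
 have "\<bar>second_difference u x h\<bar> <= ?C * (norm h)\<^sup>2 * decay x" if h: "norm h <= 1" for x h
 proof -
  define D where "D b t = partial_derivs [b] u (x + t *\<^sub>R h)" for b t
  let ?g = "%t. u (x + t *\<^sub>R h) + u (x + t *\<^sub>R (- h))"
  have "\<exists>z>0. z < 1 \<and> ?g 1 - ?g 0 = (1 - 0) * (\<Sum>b\<in>Basis. (h \<bullet> b) * (D b z - D b (- z)))"
  proof (rule MVT2)
   fix t :: real assume "0 <= t" "t <= 1"
   have "(?g has_real_derivative (\<Sum>b\<in>Basis. (h \<bullet> b) * partial_derivs [b] u (x + t *\<^sub>R h))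
    + (\<Sum>b\<in>Basis. ((- h) \<bullet> b) * partial_derivs [b] u (x + t *\<^sub>R (- h)))) (at t)"
    using C_infinity_DERIV_line[OF CI, of "[]"] by (intro DERIV_add) (simp_all only: partial_derivs.simps(1) list.set empty_subsetI)
   moreover have "(\<Sum>b\<in>Basis. (h \<bullet> b) * partial_derivs [b] u (x + t *\<^sub>R h))
    + (\<Sum>b\<in>Basis. ((- h) \<bullet> b) * partial_derivs [b] u (x + t *\<^sub>R (- h))) = (\<Sum>b\<in>Basis. (h \<bullet> b) * (D b t - D b (- t)))"
    by (simp add: D_def sum.distrib[symmetric] algebra_simps sum_subtractf sum_negf del: partial_derivs.simps)
   ultimately show "(?g has_real_derivative (\<Sum>b\<in>Basis. (h \<bullet> b) * (D b t - D b (- t)))) (at t)" by simp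
  qed simp
  then obtain z where z: "0 < z" "z < 1" "?g 1 - ?g 0 = (\<Sum>b\<in>Basis. (h \<bullet> b) * (D b z - D b (- z)))" by auto
  have Db: "\<bar>D b z - D b (- z)\<bar> <= 2 * (\<Sum>c\<in>Basis. norm h * (C b c * decay x))" if b: "b \<in> Basis" for b
  proof -
   have "\<exists>s>- z. s < z \<and> D b z - D b (- z) = (z - (- z)) * (\<Sum>c\<in>Basis. (h \<bullet> c) * partial_derivs [c, b] u (x + s *\<^sub>R h))"
    unfolding D_def using z b by (intro MVT2 C_infinity_DERIV_line[OF CI, of "[b]"]) auto
   then obtain s where s: "- z < s" "s < z" "D b z - D b (- z) = (z - (- z)) * (\<Sum>c\<in>Basis. (h \<bullet> c) * partial_derivs [c, b] u (x + s *\<^sub>R h))"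
    by blast
   have "norm (s *\<^sub>R h) <= 1 * 1" unfolding norm_scaleR using s z h by (intro mult_mono) auto
   then have n: "norm (x + s *\<^sub>R h - x) <= 1" by simp
   have "\<bar>\<Sum>c\<in>Basis. (h \<bullet> c) * partial_derivs [c, b] u (x + s *\<^sub>R h)\<bar> <= (\<Sum>c\<in>Basis. \<bar>(h \<bullet> c) * partial_derivs [c, b] u (x + s *\<^sub>R h)\<bar>)"
    by (rule sum_abs)
   also have "... <= (\<Sum>c\<in>Basis. norm h * (C b c * decay x))"
    using C[OF b] n by (intro sum_mono) (auto simp: abs_mult simp del: partial_derivs.simps intro!: mult_mono Basis_le_norm)
   finally have "\<bar>\<Sum>c\<in>Basis. (h \<bullet> c) * partial_derivs [c, b] u (x + s *\<^sub>R h)\<bar> <= (\<Sum>c\<in>Basis. norm h * (C b c * decay x))" .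
   then show ?thesis unfolding s(3) abs_mult using z by (intro mult_mono) auto
  qed
  have "\<bar>second_difference u x h\<bar> = \<bar>?g 1 - ?g 0\<bar>" by (simp add: second_difference_def)
  also have "... <= (\<Sum>b\<in>Basis. \<bar>(h \<bullet> b) * (D b z - D b (- z))\<bar>)" unfolding z(3) by (rule sum_abs)
  also have "... <= (\<Sum>b\<in>Basis. norm h * (2 * (\<Sum>c\<in>Basis. norm h * (C b c * decay x))))"
   unfolding abs_mult by (intro sum_mono mult_mono Db Basis_le_norm) auto
  also have "... = ?C * (norm h)\<^sup>2 * decay x"
   by (simp add: sum_distrib_left sum_distrib_right power2_eq_square mult_ac)
  finally show ?thesis .
 qed
 moreover have "?C >= 0" using C by (auto intro!: mult_nonneg_nonneg sum_nonneg)
 ultimately show ?thesis by blast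
qed

context
 fixes u :: "'a::euclidean_space => real" and a :: real
 assumes u: "u \<in> schwartz_functions" and a: "0 < a" "a < 1"
begin

lemma schwartz_borel [measurable]: "u \<in> Borel"
 using u C_infinity_borel[of u "[]"] by (simp add: schwartz_functions_def)

lemma schwartz_bounds: "\<exists>C\<ge>0. \<forall>x. \<bar>u x\<bar> <= C * decay x"
proof -
 obtain C where C: "C >= 0" "!!x z. norm (z - x) <= 1 ==> \<bar>u z\<bar> <= C * decay x"
  using schwartz_decay[OF u, of "[]"] by auto
 have "\<bar>u x\<bar> <= C * decay x" for x by (rule C(2)) simp
 then show ?thesis using C(1) by blast
qed

lemma schwartz_integrable: "L1 u" "L2 u"
proof -
 obtain C where C: "C >= 0" "!!x. \<bar>u x\<bar> <= C * decay x" using schwartz_bounds by blast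
 show i: "L1 u"
  by (rule L1_integrable_bound[OF integrable_mult_right[OF decay_integrable, of C]])
   (use C in \<open>auto simp: abs_mult decay_nonneg\<close>)
 have "\<bar>u x\<bar> <= C * 2" for x using C(2)[of x] mult_left_mono[OF decay_le C(1), of x] by linarith
 then have "L1 (%x. u x * u x)" by (intro integrable_mult_bounded_on[OF i, of UNIV]) auto
 then show "L2 u" by (simp add: L2_def power2_eq_square)
qed

lemma second_difference_borel [measurable]:
 "(%(x, h). second_difference u x h) \<in> borel_measurable (borel \<Otimes>\<^sub>M borel)"
 unfolding second_difference_def by measurable

lemma second_difference_bound:
 "\<exists>C\<ge>0. (\<forall>x h. \<bar>second_difference u x h\<bar> <= C * min 1 ((norm h)\<^sup>2)) \<and>
  (\<forall>h. (NN x. ennreal \<bar>second_difference u x h\<bar>) <= ennreal (C * min 1 ((norm h)\<^sup>2)))"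
proof -
 obtain C where C: "C >= 0" "!!x. \<bar>u x\<bar> <= C * decay x" using schwartz_bounds by blast
 have uC: "\<bar>u x\<bar> <= 2 * C" for x using C(2)[of x] mult_left_mono[OF decay_le C(1), of x] by linarith
 obtain C' where C': "C' >= 0" "!!x h. norm h <= 1 ==> \<bar>second_difference u x h\<bar> <= C' * (norm h)\<^sup>2 * decay x"
  using second_difference_small[OF u] by blast
 define W where "W = (LI x. decay (x::'a))"
 have W: "W >= 0" "(NN x. ennreal (decay (x::'a))) = ennreal W"
  unfolding W_def by (auto simp: decay_nonneg intro!: nn_integral_eq_integral decay_integrable integral_nonneg_AE)
 define V where "V = (LI x. \<bar>u x\<bar>)"
 have V: "V >= 0" "(NN x. ennreal \<bar>u x\<bar>) = ennreal V"
  unfolding V_def using schwartz_integrable(1) by (auto intro!: nn_integral_eq_integral)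
 define K where "K = 8 * C + 2 * C' + 4 * V + C' * W"
 have K: "K >= 0" "8 * C <= K" "2 * C' <= K" "4 * V <= K" "C' * W <= K" using C C' V W by (auto simp: K_def)
 have one: "\<bar>second_difference u x h\<bar> <= \<bar>u x\<bar> + \<bar>u x\<bar> + \<bar>u (x + h)\<bar> + \<bar>u (x - h)\<bar>" for x h
  unfolding second_difference_def by linarith
 have 1: "\<bar>second_difference u x h\<bar> <= K * min 1 ((norm h)\<^sup>2)" for x h
 proof (cases "norm h <= 1")
  case True
  have m: "min 1 ((norm h)\<^sup>2) = (norm h)\<^sup>2" using True by (intro min_absorb2 power_le_one) auto
  have "C' * (norm h)\<^sup>2 * decay x <= C' * (norm h)\<^sup>2 * 2" using C'(1) decay_le by (intro mult_left_mono) auto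
  also have "... = (2 * C') * (norm h)\<^sup>2" by simp
  also have "... <= K * (norm h)\<^sup>2" by (rule mult_right_mono[OF K(3)]) simp
  finally show ?thesis using C'(2)[OF True, of x] unfolding m by linarith
 next
  case False
  then have m: "min 1 ((norm h)\<^sup>2) = 1" by (intro min_absorb1 one_le_power) auto
  show ?thesis using one[of x h] uC[of x] uC[of "x + h"] uC[of "x - h"] K(2) unfolding m by linarith
 qed
 have 2: "(NN x. ennreal \<bar>second_difference u x h\<bar>) <= ennreal (K * min 1 ((norm h)\<^sup>2))" for h
 proof (cases "norm h <= 1")
  case True
  have m: "min 1 ((norm h)\<^sup>2) = (norm h)\<^sup>2" using True by (intro min_absorb2 power_le_one) auto
  have "(NN x. ennreal \<bar>second_difference u x h\<bar>) <= (NN x. ennreal (C' * (norm h)\<^sup>2) * ennreal (decay (x::'a)))"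
  proof (rule nn_integral_mono)
   fix x
   have "ennreal \<bar>second_difference u x h\<bar> <= ennreal (C' * (norm h)\<^sup>2 * decay x)" by (rule ennreal_leI[OF C'(2)[OF True]])
   then show "ennreal \<bar>second_difference u x h\<bar> <= ennreal (C' * (norm h)\<^sup>2) * ennreal (decay x)"
    using C'(1) decay_nonneg[of x] by (simp add: ennreal_mult)
  qed
  also have "... = ennreal (C' * (norm h)\<^sup>2) * ennreal W"
   using borel_measurable_integrable[OF decay_integrable[where 'a='a]] by (subst nn_integral_cmult) (auto simp: W(2))
  also have "... = ennreal ((C' * W) * (norm h)\<^sup>2)" using C'(1) W(1) by (simp add: mult_ac flip: ennreal_mult)
  also have "... <= ennreal (K * (norm h)\<^sup>2)" using K(5) by (intro ennreal_leI mult_right_mono) auto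
  finally show ?thesis unfolding m .
 next
  case False
  then have m: "min 1 ((norm h)\<^sup>2) = 1" by (intro min_absorb1 one_le_power) auto
  have t: "(NN x. ennreal \<bar>u (x + y)\<bar>) = ennreal V" for y
   using nn_integral_translate[of "%x. ennreal \<bar>u x\<bar>" y] V(2) by (simp add: add.commute)
  have t': "(NN x. ennreal \<bar>u (x - h)\<bar>) = ennreal V" using t[of "- h"] by simp
  have "(NN x. ennreal \<bar>second_difference u x h\<bar>)
   <= (NN x. ennreal \<bar>u x\<bar> + ennreal \<bar>u x\<bar> + ennreal \<bar>u (x + h)\<bar> + ennreal \<bar>u (x - h)\<bar>)"
  proof (rule nn_integral_mono)
   fix x show "ennreal \<bar>second_difference u x h\<bar> <= ennreal \<bar>u x\<bar> + ennreal \<bar>u x\<bar> + ennreal \<bar>u (x + h)\<bar> + ennreal \<bar>u (x - h)\<bar>"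
    using ennreal_leI[OF one[of x h]] by (simp only: ennreal_plus abs_ge_zero add_nonneg_nonneg)
  qed
  also have "... = ennreal V + ennreal V + ennreal V + ennreal V"
   by (simp add: nn_integral_add V(2) t t')
  also have "... = ennreal (4 * V)" using V(1) by (simp flip: ennreal_plus)
  also have "... <= ennreal (K * 1)" using K(4) by (intro ennreal_leI) simp
  finally show ?thesis unfolding m .
 qed
 show ?thesis using K(1) 1 2 by blast
qed

text \<open>The principal value as an absolutely convergent integral: the second difference cancels the odd part.\<close>

definition singular_integral :: "'a => real" where
 "singular_integral x = (LI h. second_difference u x h / norm h powr (real DIM('a) + 2 * a)) / 2"

lemma second_difference_kernel_integrable:
 "L1 (%h. second_difference u x h / norm h powr (real DIM('a) + 2 * a))"
 "integrable (lborel2) (%(x, h). second_difference u x h / norm h powr (real DIM('a) + 2 * a))"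
proof -
 obtain C where C: "C >= 0" "!!x h. \<bar>second_difference u x h\<bar> <= C * min 1 ((norm h)\<^sup>2)"
  "!!h. (NN x. ennreal \<bar>second_difference u x h\<bar>) <= ennreal (C * min 1 ((norm h)\<^sup>2))"
  using second_difference_bound by blast
 let ?k = "%h::'a. norm h powr (real DIM('a) + 2 * a)"
 have ik: "L1 (%h::'a. min 1 ((norm h)\<^sup>2) / ?k h)"
  by (rule kernel_min_integrable[OF a])
 show "L1 (%h. second_difference u x h / ?k h)"
  by (rule L1_integrable_bound[OF integrable_mult_right[OF ik, of C]])
   (use C in \<open>auto simp: abs_mult second_difference_def intro!: divide_right_mono\<close>)
 have nC: "(NN h. ennreal (C * (min 1 ((norm h)\<^sup>2) / ?k h))) < \<infinity>"
 proof -
  have "(NN h. ennreal (C * (min 1 ((norm h)\<^sup>2) / ?k h))) = ennreal (LI h. C * (min 1 ((norm h)\<^sup>2) / ?k h))"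
   by (rule nn_integral_eq_integral[OF integrable_mult_right[OF ik]]) (use C in auto)
  then show ?thesis by simp
 qed
 show "integrable (lborel2) (%(x, h). second_difference u x h / ?k h)"
  unfolding integrable_iff_bounded
 proof
  show "(%(x, h). second_difference u x h / ?k h) \<in> borel_measurable (lborel2)"
   unfolding second_difference_def by measurable
  have "(\<integral>\<^sup>+z. ennreal (norm (case z of (x, h) => second_difference u x h / ?k h)) \<partial>(lborel2))
   = (NN h. NN x. ennreal (norm (second_difference u x h / ?k h)))"
   by (subst lborel_pair.nn_integral_snd[symmetric]) (auto simp: second_difference_def)
  also have "... <= (NN h. ennreal (C * (min 1 ((norm h)\<^sup>2) / ?k h)))"
  proof (rule nn_integral_mono)
   fix h :: 'a
   have "(NN x. ennreal (norm (second_difference u x h / ?k h)))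
    = (NN x. ennreal (1 / ?k h) * ennreal \<bar>second_difference u x h\<bar>)"
    by (intro nn_integral_cong) (simp add: abs_mult flip: ennreal_mult)
   also have "... = ennreal (1 / ?k h) * (NN x. ennreal \<bar>second_difference u x h\<bar>)"
    by (rule nn_integral_cmult) (unfold second_difference_def, measurable)
   also have "... <= ennreal (1 / ?k h) * ennreal (C * min 1 ((norm h)\<^sup>2))" by (intro mult_left_mono C) simp
   also have "... = ennreal (C * (min 1 ((norm h)\<^sup>2) / ?k h))" using C(1) by (simp add: mult_ac flip: ennreal_mult)
   finally show "(NN x. ennreal (norm (second_difference u x h / ?k h))) <= ennreal (C * (min 1 ((norm h)\<^sup>2) / ?k h))" .
  qed
  also note nC
  finally show "(\<integral>\<^sup>+z. ennreal (norm (case z of (x, h) => second_difference u x h / ?k h)) \<partial>(lborel2)) < \<infinity>" .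
 qed
qed

lemma singular_integral_integrable: "L1 singular_integral" "L2 singular_integral"
proof -
 show i: "L1 singular_integral"
  unfolding singular_integral_def[abs_def]
  by (rule integrable_divide[OF lborel_pair.integrable_fst'[OF second_difference_kernel_integrable(2), unfolded prod.case]])
 obtain C where C: "C >= 0" "!!x h. \<bar>second_difference u x h\<bar> <= C * min 1 ((norm h)\<^sup>2)"
  "!!h. (NN x. ennreal \<bar>second_difference u x h\<bar>) <= ennreal (C * min 1 ((norm h)\<^sup>2))"
  using second_difference_bound by blast
 let ?k = "%h::'a. norm h powr (real DIM('a) + 2 * a)"
 have ik: "L1 (%h::'a. min 1 ((norm h)\<^sup>2) / ?k h)"
  by (rule kernel_min_integrable[OF a])
 have b: "\<bar>singular_integral x\<bar> <= (LI h. C * (min 1 ((norm (h::'a))\<^sup>2) / ?k h)) / 2" for x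
 proof -
  have "\<bar>LI h. second_difference u x h / ?k h\<bar> <= (LI h. \<bar>second_difference u x h / ?k h\<bar>)"
   by (rule integral_abs_bound)
  also have "... <= (LI h. C * (min 1 ((norm h)\<^sup>2) / ?k h))"
  proof (rule integral_mono)
   show "\<bar>second_difference u x h / ?k h\<bar> <= C * (min 1 ((norm h)\<^sup>2) / ?k h)" for h
    using divide_right_mono[OF C(2)[of x h], of "?k h"] by simp
   show "L1 (%h. \<bar>second_difference u x h / ?k h\<bar>)"
    by (rule integrable_abs[OF second_difference_kernel_integrable(1)])
   show "L1 (%h. C * (min 1 ((norm h)\<^sup>2) / ?k h))" by (rule integrable_mult_right[OF ik])
  qed
  finally show ?thesis by (simp add: singular_integral_def)
 qed
 have "L1 (%x. singular_integral x * singular_integral x)"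
  by (rule integrable_mult_bounded_on[OF i, of UNIV _ "(LI h. C * (min 1 ((norm (h::'a))\<^sup>2) / ?k h)) / 2"]) (use i b in auto)
 then show "L2 singular_integral" using i by (auto simp: L2_def power2_eq_square)
qed

lemma cft_singular_integral:
 "cft (%x. cplx (singular_integral x)) xi
  = cplx (levy_const TYPE('a) a / 2 * norm xi powr (2 * a)) * cft (%x. cplx (u x)) xi"
proof -
 let ?k = "%h::'a. norm h powr (real DIM('a) + 2 * a)"
 let ?u = "%x. cplx (u x)" and ?C = "levy_const TYPE('a) a"
 have C: "?C > 0" by (rule levy_const_pos[OF a])
 let ?f = "%x h. cis (- (x \<bullet> xi)) * cplx (second_difference u x h / ?k h)"
 have int: "integrable (lborel2) (%(x, h). ?f x h)"
 proof (rule L1_integrable_bound[OF second_difference_kernel_integrable(2)])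
  show "(%(x, h). ?f x h) \<in> borel_measurable (lborel2)" unfolding second_difference_def by measurable
  show "AE z in lborel2. norm (case z of (x, h) => ?f x h)
    <= norm (case z of (x, h) => second_difference u x h / ?k h)"
   by (rule AE_I2) (auto simp: norm_mult norm_divide)
 qed
 have iu: "L1 ?u" using schwartz_integrable(1) by simp
 have cd: "cft (%x. cplx (second_difference u x h)) xi = cplx ((cmod (cis (h \<bullet> xi) - 1))\<^sup>2) * cft ?u xi" for h
 proof -
  have tr: "L1 (%x. ?u (h + x))" for h by (subst integrable_translate_iff) (use iu in auto)
  have "cft (%x. cplx (second_difference u x h)) xi = cft (%x. (2 * ?u x + (- 1) * ?u (h + x)) - ?u (- h + x)) xi"
   by (rule arg_cong[of _ _ "%f. cft f xi"]) (simp add: second_difference_def fun_eq_iff add.commute)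
  also have "... = cft (%x. 2 * ?u x + (- 1) * ?u (h + x)) xi - cft (%x. ?u (- h + x)) xi"
   by (rule cft_diff) (intro L1_integrable_add integrable_mult_right iu tr)+
  also have "... = (2 * cft ?u xi + (- 1) * cft (%x. ?u (h + x)) xi) - cft (%x. ?u (- h + x)) xi"
   unfolding cft_lincomb[OF iu tr] ..
  also have "... = (2 - (cis (h \<bullet> xi) + cis (- (h \<bullet> xi)))) * cft ?u xi"
   by (subst (1 2) cft_translate) (auto simp: algebra_simps)
  also have "2 - (cis (h \<bullet> xi) + cis (- (h \<bullet> xi))) = cplx ((cmod (cis (h \<bullet> xi) - 1))\<^sup>2)"
   unfolding cis_minus_one_square by (simp add: complex_eq_iff)
  finally show ?thesis .
 qed
 have "cft (%x. cplx (singular_integral x)) xi = (CLINT x|lborel. CLINT h|lborel. ?f x h) / 2"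
 proof -
  have "cis (- (x \<bullet> xi)) * cplx (singular_integral x) = (CLINT h|lborel. ?f x h) / 2" for x
   unfolding singular_integral_def by (simp only: integral_mult_right_zero integral_complex_of_real) simp
  then show ?thesis unfolding cft_def by (simp only: integral_divide_zero)
 qed
 also have "(CLINT x|lborel. CLINT h|lborel. ?f x h) = (CLINT h|lborel. CLINT x|lborel. ?f x h)"
  by (rule lborel_pair.Fubini_integral[symmetric]) (use int in simp)
 also have "... = (CLINT h|lborel. cplx ((cmod (cis (h \<bullet> xi) - 1))\<^sup>2 / ?k h) * cft ?u xi)"
 proof (rule L1_integral_cong[OF refl])
  fix h
  have "(CLINT x|lborel. ?f x h) = cft (%x. cplx (second_difference u x h)) xi / cplx (?k h)"
   unfolding cft_def by simp
  then show "(CLINT x|lborel. ?f x h) = cplx ((cmod (cis (h \<bullet> xi) - 1))\<^sup>2 / ?k h) * cft ?u xi"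
   unfolding cd by simp
 qed
 also have "... = cplx (LI h. (cmod (cis (h \<bullet> xi) - 1))\<^sup>2 / ?k h) * cft ?u xi"
  by (simp only: integral_mult_left_zero integral_complex_of_real)
 also have "(LI h. (cmod (cis (h \<bullet> xi) - 1))\<^sup>2 / ?k h) = ?C * norm xi powr (2 * a)"
  using levy_symbol[OF a, of xi] C by (subst integral_eq_nn_integral) auto
 finally show ?thesis by simp
qed

lemma schwartz_frac_laplacian:
 "in_H (2 * a) u" "ae x. frac_laplacian a u x = 2 / levy_const TYPE('a) a * singular_integral x"
 "has_fourier singular_integral (%xi. cplx (levy_const TYPE('a) a / 2 * norm xi powr (2 * a)) * cft (%x. cplx (u x)) xi)"
proof -
 let ?C = "levy_const TYPE('a) a" and ?u = "%x. cplx (u x)"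
 have C: "?C > 0" by (rule levy_const_pos[OF a])
 have Fu: "has_fourier u (cft ?u)"
  using has_cft_integrable[of ?u] schwartz_integrable by (simp add: has_fourier_iff L2_of_real_iff)
 show FI: "has_fourier singular_integral (%xi. cplx (?C / 2 * norm xi powr (2 * a)) * cft ?u xi)"
  using has_cft_integrable[of "%x. cplx (singular_integral x)"] singular_integral_integrable
  unfolding cft_singular_integral[abs_def] by (simp add: has_fourier_iff L2_of_real_iff cft_singular_integral[abs_def])
 have F2: "has_fourier (%x. 2 / ?C * singular_integral x) (%xi. (norm xi powr (2 * a)) *\<^sub>R cft ?u xi)"
  using has_fourier_lincomb[OF FI FI, of "2 / ?C" 0] C by (simp add: scaleR_conv_of_real)
 have eq: "ae xi. (norm xi powr (2 * a)) *\<^sub>R cft ?u xi = weighted (2 * a) u xi"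
  using fourier_unique[OF Fu] by (rule AE_mp) (auto intro!: AE_I2 simp: weighted_def)
 have "L2 (weighted (2 * a) u)"
  by (rule L2_AE_cong[OF has_fourier_L2(2)[OF F2] borel_measurable_weighted[OF schwartz_integrable(2)] eq])
 then show H: "in_H (2 * a) u" using schwartz_integrable(2) by (simp add: in_H_def)
 show "ae x. frac_laplacian a u x = 2 / ?C * singular_integral x"
  by (rule frac_laplacian_unique[OF H F2 eq])
qed

lemma principal_value_eq:
 assumes eps: "0 < eps"
 shows "(LINT y:{y. eps < dist x y}|lborel. (u x - u y) / norm (x - y) powr (real DIM('a) + 2 * a))
  = (LI h. indicator {h. eps < norm h} h * (second_difference u x h / norm h powr (real DIM('a) + 2 * a))) / 2"
proof -
 let ?k = "%h::'a. norm h powr (real DIM('a) + 2 * a)"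
 let ?p = "%h. indicator {h. eps < norm h} h * ((u x - u (x + h)) / ?k h)"
 obtain C where C: "C >= 0" "!!x. \<bar>u x\<bar> <= C * decay x" using schwartz_bounds by blast
 have uC: "\<bar>u x\<bar> <= 2 * C" for x using C(2)[of x] mult_left_mono[OF decay_le C(1), of x] by linarith
 have ik: "L1 (%h::'a. indicator {h. eps <= norm h} h / ?k h)"
  by (rule kernel_tail_integrable[OF a eps])
 have ip: "L1 ?p"
 proof (rule L1_integrable_bound[OF integrable_mult_right[OF ik, of "4 * C"]])
  show "ae h. norm (?p h) <= norm (4 * C * (indicator {h. eps <= norm h} h / ?k h))"
  proof (rule AE_I2)
   fix h
   have "\<bar>u x - u (x + h)\<bar> <= 4 * C" using uC[of x] uC[of "x + h"] by linarith
   then have "\<bar>u x - u (x + h)\<bar> / ?k h <= 4 * C / ?k h" by (rule divide_right_mono) simp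
   then show "norm (?p h) <= norm (4 * C * (indicator {h. eps <= norm h} h / ?k h))"
    using C(1) by (auto simp: indicator_def abs_mult)
  qed
 qed measurable
 have "(LINT y:{y. eps < dist x y}|lborel. (u x - u y) / ?k (x - y)) = (LI y. indicator {y. eps < dist x y} y * ((u x - u y) / ?k (x - y)))"
  by (simp add: set_lebesgue_integral_def)
 also have "... = (LI h. indicator {y. eps < dist x y} (x + h) * ((u x - u (x + h)) / ?k (x - (x + h))))"
  by (rule integral_translate[symmetric]) measurable
 also have "... = (LI h. ?p h)"
  by (rule L1_integral_cong) (auto simp: indicator_def dist_norm)
 finally have 1: "(LINT y:{y. eps < dist x y}|lborel. (u x - u y) / ?k (x - y)) = (LI h. ?p h)" .
 note ium = integral_uminus(1)[OF ip] and um = integral_uminus(2)[OF ip]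
 have "(LI h. indicator {h. eps < norm h} h * (second_difference u x h / ?k h)) = (LI h. ?p h + ?p (- h))"
  by (rule L1_integral_cong) (auto simp: indicator_def second_difference_def simp flip: add_divide_distrib)
 also have "... = 2 * (LI h. ?p h)" using ip ium um by simp
 finally show ?thesis using 1 by simp
qed

lemma principal_value_tendsto:
 "((%eps. LINT y:{y. eps < dist x y}|lborel. (u x - u y) / norm (x - y) powr (real DIM('a) + 2 * a)) ---> singular_integral x) (at_right 0)"
proof (rule tendsto_at_right_sequentially[of 0 1])
 let ?k = "%h::'a. norm h powr (real DIM('a) + 2 * a)"
 fix S :: "nat => real" assume S: "!!n. 0 < S n" "S ----> 0"
 have "(%n. LI h. indicator {h. S n < norm h} h * (second_difference u x h / ?k h)) ----> (LI h. second_difference u x h / ?k h)"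
 proof (rule integral_dominated_convergence[OF _ _ integrable_norm[OF second_difference_kernel_integrable(1)[of x]]])
  show "ae h. (%n. indicator {h. S n < norm h} h * (second_difference u x h / ?k h)) ----> second_difference u x h / ?k h"
  proof (rule AE_I2)
   fix h :: 'a
   show "(%n. indicator {h. S n < norm h} h * (second_difference u x h / ?k h)) ----> second_difference u x h / ?k h"
   proof (cases "h = 0")
    case False
    then have "\<forall>\<^sub>F n in sequentially. S n < norm h" using S(2) by (intro order_tendstoD) auto
    then have "\<forall>\<^sub>F n in sequentially. indicator {h. S n < norm h} h * (second_difference u x h / ?k h) = second_difference u x h / ?k h"
     by (rule eventually_mono) simp
    then show ?thesis by (rule tendsto_eventually)
   qed (simp add: second_difference_def)
  qed
  show "ae h. norm (indicator {h. S n < norm h} h * (second_difference u x h / ?k h)) <= norm (second_difference u x h / ?k h)" for n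
   by (auto simp: indicator_def)
 qed (unfold second_difference_def, measurable)
 from tendsto_divide[OF this tendsto_const[of 2]]
 show "(%n. LINT y:{y. S n < dist x y}|lborel. (u x - u y) / ?k (x - y)) ----> singular_integral x"
  unfolding principal_value_eq[OF S(1)] singular_integral_def by simp
qed simp

end

text \<open>The principal value has Fourier multiplier \<open>levy_const / 2\<close> times the symbol. The constant is unique because a bump has nonzero fractional Laplacian.\<close>

theorem frac_constant_eq:
 assumes a: "0 < a" "a < 1"
 shows "frac_constant TYPE('a::euclidean_space) a = 2 / levy_const TYPE('a) a"
 unfolding frac_constant_def
proof (rule the_equality)
 let ?C = "levy_const TYPE('a) a"
 have C: "?C > 0" by (rule levy_const_pos[OF a])
 let ?PV = "%u x eps. LINT y:{y. eps < dist x y}|lborel. (u x - u y) / norm (x - y) powr (real DIM('a) + 2 * a)"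
 have lim: "ae x. ((%eps. c * ?PV u x eps) ---> c * (?C / 2) * frac_laplacian a u x) (at_right 0)"
  if u: "u \<in> schwartz_functions" for u :: "'a => real" and c
  using schwartz_frac_laplacian(2)[OF u a]
 proof (rule AE_mp, intro AE_I2 impI)
  fix x assume e: "frac_laplacian a u x = 2 / ?C * singular_integral u a x"
  have eq: "c * (?C / 2) * frac_laplacian a u x = c * singular_integral u a x" unfolding e using C by simp
  show "((%eps. c * ?PV u x eps) ---> c * (?C / 2) * frac_laplacian a u x) (at_right 0)"
   unfolding eq by (rule tendsto_mult_left[OF principal_value_tendsto[OF u a, of x]])
 qed
 show "0 < 2 / ?C \<and> (\<forall>u\<in>(schwartz_functions :: ('a => real) set). ae x. ((%eps. 2 / ?C * ?PV u x eps) ---> frac_laplacian a u x) (at_right 0))"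
 proof (intro conjI ballI)
  show "0 < 2 / ?C" using C by simp
  fix u :: "'a => real" assume u: "u \<in> schwartz_functions"
  show "ae x. ((%eps. 2 / ?C * ?PV u x eps) ---> frac_laplacian a u x) (at_right 0)"
   using lim[OF u, of "2 / ?C"] C by simp
 qed
 fix c assume c: "0 < c \<and> (\<forall>u\<in>(schwartz_functions :: ('a => real) set). ae x. ((%eps. c * ?PV u x eps) ---> frac_laplacian a u x) (at_right 0))"
 show "c = 2 / ?C"
 proof (rule ccontr)
  assume ne: "c ~= 2 / ?C"
  let ?b = "bump (0::'a) 1"
  have b: "?b \<in> schwartz_functions" by (rule bumps_schwartz[OF bump_in_bumps]) simp
  note H = schwartz_frac_laplacian(1)[OF b a]
  have "ae x. ((%eps. c * ?PV ?b x eps) ---> frac_laplacian a ?b x) (at_right 0)" using c b by blast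
  with lim[OF b, of c] have "ae x. frac_laplacian a ?b x = 0"
  proof (rule AE_mp[OF AE_conjI], intro AE_I2 impI, elim conjE)
   fix x assume "((%eps. c * ?PV ?b x eps) ---> c * (?C / 2) * frac_laplacian a ?b x) (at_right 0)"
    "((%eps. c * ?PV ?b x eps) ---> frac_laplacian a ?b x) (at_right 0)"
   then have "c * (?C / 2) * frac_laplacian a ?b x = frac_laplacian a ?b x"
    by (rule tendsto_unique[rotated]) simp
   then have "(c * (?C / 2) - 1) * frac_laplacian a ?b x = 0" by (simp add: left_diff_distrib)
   moreover have "c * (?C / 2) - 1 ~= 0" using ne C by (simp add: field_simps)
   ultimately show "frac_laplacian a ?b x = 0" by simp
  qed
  then have "sqint (frac_laplacian a ?b) = 0" using sqint_eq_0_iff[OF L2_frac_laplacian[OF H]] by simp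
  then have "sqint (weighted (2 * a) ?b) = 0" unfolding sqint_frac_laplacian[OF H] by simp
  then have "ae xi. weighted (2 * a) ?b xi = 0" using sqint_eq_0_iff[OF in_H_L2(2)[OF H]] by simp
  then have "ae xi. fourier ?b xi = 0"
   using AE_lborel_singleton[of "0::'a"]
  proof eventually_elim
   case (elim xi)
   then have "norm xi powr (2 * a) ~= 0" by simp
   with elim(1) show ?case unfolding weighted_def by simp
  qed
  then have "sqint (fourier ?b) = 0" using sqint_eq_0_iff[OF L2_fourier[OF in_H_L2(1)[OF H]]] by simp
  then have "sqint ?b = 0" using plancherel_real[OF has_fourier_fourier[OF in_H_L2(1)[OF H]]] by simp
  then have "ae x. ?b x = 0" using sqint_eq_0_iff[OF in_H_L2(1)[OF H]] by simp
  then have "ae x. x \<notin> ball (0::'a) 1"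
  proof eventually_elim
   case (elim x)
   then show ?case using bump_pos[of x "0::'a" 1] by fastforce
  qed
  then have "ball (0::'a) 1 \<in> null_sets lborel" by (subst AE_iff_null_sets) auto
  then show False using open_not_negligible[of "ball (0::'a) 1"] by (auto simp: negligible_iff_null_sets null_sets_completionI)
 qed
qed

corollary frac_constant_pos: "0 < a ==> a < 1 ==> 0 < frac_constant TYPE('a::euclidean_space) a"
 by (simp add: frac_constant_eq levy_const_pos)

section \<open>Lipschitz domains and Hardy's inequality\<close>

locale lipschitz_domain =
 fixes Om :: "'a::euclidean_space set"
 assumes domain: "bounded_lipschitz_domain Om"
begin

lemma open_domain: "open Om" and bounded_domain: "bounded Om" and domain_nonempty: "Om ~= {}"
 using domain by (auto simp: bounded_lipschitz_domain_def)

lemma borel_domain [measurable]: "Om \<in> sets borel" using open_domain by simp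

lemma boundary_chart:
 assumes "p \<in> frontier Om"
 shows "\<exists>r>0. \<exists>e L gam. norm e = 1 \<and> L-lipschitz_on {y. y \<bullet> e = 0} gam \<and>
  (\<forall>x\<in>ball p r. x \<in> Om \<longleftrightarrow> gam (x - (x \<bullet> e) *\<^sub>R e) < x \<bullet> e)"
proof -
 obtain r e L gam where *: "0 < r" "norm e = 1" "L-lipschitz_on {y. y \<bullet> e = 0} gam"
  "Om \<inter> ball p r = {x \<in> ball p r. gam (x - (x \<bullet> e) *\<^sub>R e) < x \<bullet> e}"
  using domain assms unfolding bounded_lipschitz_domain_def by blast
 have "\<forall>x\<in>ball p r. x \<in> Om \<longleftrightarrow> gam (x - (x \<bullet> e) *\<^sub>R e) < x \<bullet> e" using *(4) by blast
 with *(1-3) show ?thesis by blast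
qed

text \<open>Locally the boundary is a Lipschitz graph over a hyperplane.\<close>

lemma negligible_frontier: "negligible (frontier Om)"
proof (subst locally_negligible_alt, rule ballI)
 fix p assume p: "p \<in> frontier Om"
 obtain r e L gam where r: "0 < r" and e: "norm e = 1" and L: "L-lipschitz_on {y. y \<bullet> e = 0} gam"
  and chart: "!!x. x \<in> ball p r ==> x \<in> Om \<longleftrightarrow> gam (x - (x \<bullet> e) *\<^sub>R e) < x \<bullet> e" using boundary_chart[OF p] by blast
 have ee: "e \<bullet> e = 1" using e by (simp add: norm_eq_1)
 let ?H = "{y. y \<bullet> e = 0}" and ?g = "%y. y + gam y *\<^sub>R e"
 have inH: "x - (x \<bullet> e) *\<^sub>R e \<in> ?H" for x using ee by (simp add: inner_diff_left)
 have cont: "continuous_on UNIV (%x. gam (x - (x \<bullet> e) *\<^sub>R e))"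
  by (rule continuous_on_compose2[OF lipschitz_on_continuous_on[OF L]]) (use inH in \<open>auto intro!: continuous_intros\<close>)
 have below: "open {x. x \<bullet> e < gam (x - (x \<bullet> e) *\<^sub>R e)}"
  using cont by (intro open_Collect_less) (auto intro!: continuous_intros)
 have "frontier Om \<inter> ball p r \<subseteq> ?g ` ?H"
 proof
  fix x assume x: "x \<in> frontier Om \<inter> ball p r"
  have "x \<notin> Om" using x open_domain by (simp add: frontier_def interior_open)
  then have 1: "x \<bullet> e <= gam (x - (x \<bullet> e) *\<^sub>R e)" using chart[of x] x by auto
  have "\<not> x \<bullet> e < gam (x - (x \<bullet> e) *\<^sub>R e)"
  proof
   assume lt: "x \<bullet> e < gam (x - (x \<bullet> e) *\<^sub>R e)"
   let ?N = "{x. x \<bullet> e < gam (x - (x \<bullet> e) *\<^sub>R e)} \<inter> ball p r"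
   have "open ?N" using below by auto
   moreover have "?N \<inter> Om = {}" using chart by force
   ultimately have "?N \<inter> closure Om = {}" by (simp add: open_Int_closure_eq_empty)
   then show False using x lt by (auto simp: frontier_def)
  qed
  then have "x = ?g (x - (x \<bullet> e) *\<^sub>R e)" using 1 by simp
  then show "x \<in> ?g ` ?H" using inH by blast
 qed
 moreover have "negligible (?g ` ?H)"
 proof (rule negligible_locally_Lipschitz_image)
  have "e ~= 0" using e by auto
  then show "negligible ?H" using negligible_hyperplane[of e 0] by (simp add: inner_commute)
  fix x assume x: "x \<in> ?H"
  have "norm (?g y - ?g x) <= (1 + L) * norm (y - x)" if "y \<in> ?H" for y
  proof -
   have "norm (?g y - ?g x) = norm ((y - x) + (gam y - gam x) *\<^sub>R e)" by (simp add: algebra_simps)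
   also have "... <= norm (y - x) + \<bar>gam y - gam x\<bar>" using norm_triangle_ineq[of "y - x" "(gam y - gam x) *\<^sub>R e"] e by simp
   also have "\<bar>gam y - gam x\<bar> <= L * norm (y - x)" using lipschitz_onD[OF L that x] by (simp add: dist_norm)
   finally show ?thesis by (simp add: algebra_simps)
  qed
  then show "\<exists>T B. open T \<and> x \<in> T \<and> (\<forall>y\<in>?H \<inter> T. norm (?g y - ?g x) <= B * norm (y - x))"
   by (intro exI[of _ UNIV] exI[of _ "1 + L"]) auto
 qed simp
 ultimately have "negligible (frontier Om \<inter> ball p r)" by (rule negligible_subset[rotated])
 then show "\<exists>U. openin (top_of_set (frontier Om)) U \<and> p \<in> U \<and> negligible U"
  using p r by (intro exI[of _ "frontier Om \<inter> ball p r"]) auto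
qed

lemma AE_not_frontier: "ae x. x \<notin> frontier Om"
 using negligible_frontier by (intro AE_not_in) (simp add: negligible_iff_null_sets null_sets_completion_iff)

lemma AE_exterior_iff: "(AE x\<in>exterior Om in lborel. P x) \<longleftrightarrow> (ae x. x \<notin> Om \<longrightarrow> P x)"
proof
 assume "AE x\<in>exterior Om in lborel. P x"
 with AE_not_frontier show "ae x. x \<notin> Om \<longrightarrow> P x"
  by eventually_elim (use open_domain in \<open>auto simp: exterior_def frontier_def interior_open\<close>)
next
 assume "ae x. x \<notin> Om \<longrightarrow> P x"
 then show "AE x\<in>exterior Om in lborel. P x"
  by eventually_elim (use closure_subset in \<open>auto simp: exterior_def\<close>)
qed

definition depth :: "'a => real" where "depth x = infdist x (- Om)"

lemma complement_nonempty: "- Om ~= {}"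
 using bounded_domain not_bounded_UNIV by (metis Compl_eq_Diff_UNIV Diff_eq_empty_iff bounded_subset)

lemma nearest_complement_point:
 obtains z where "z \<notin> Om" "depth x = norm (x - z)"
 using infdist_attains_inf[of "- Om" x] complement_nonempty open_domain
 by (auto simp: closed_def depth_def dist_norm)

lemma depth_le: "y \<notin> Om ==> depth x <= norm (x - y)"
 unfolding depth_def dist_norm[symmetric] by (rule infdist_le) simp

lemma depth_pos: "x \<in> Om ==> 0 < depth x"
 by (metis nearest_complement_point zero_less_norm_iff right_minus_eq)

lemma depth_compact_pos:
 assumes K: "compact K" "K \<subseteq> Om"
 shows "\<exists>delta>0. \<forall>x\<in>K. delta <= depth x"
proof (cases "K = {}")
 case False
 have "continuous_on K depth" unfolding depth_def[abs_def] by (intro continuous_intros)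
 from continuous_attains_inf[OF K(1) False this] show ?thesis using depth_pos K(2) by blast
qed (auto intro: exI[of _ 1])

lemma exterior_cone_local:
 assumes p: "p \<in> frontier Om"
 shows "\<exists>r>0. \<exists>eta>0. \<forall>x\<in>ball p r. \<exists>z. norm (x - z) <= 2 * depth x \<and> ball z (eta * depth x) \<subseteq> - Om"
proof -
 obtain r e L gam where r: "0 < r" and e: "norm e = 1" and L: "L-lipschitz_on {y. y \<bullet> e = 0} gam"
  and chart: "!!x. x \<in> ball p r ==> x \<in> Om \<longleftrightarrow> gam (x - (x \<bullet> e) *\<^sub>R e) < x \<bullet> e" using boundary_chart[OF p] by blast
 have ee: "e \<bullet> e = 1" using e by (simp add: norm_eq_1)
 have pn: "p \<notin> Om" using p open_domain by (simp add: frontier_def interior_open)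
 have L0: "0 <= L" using lipschitz_on_nonneg[OF L] .
 define eta where "eta = 1 / (1 + L)"
 have eta: "0 < eta" "eta <= 1" "eta * (1 + L) = 1" using L0 by (auto simp: eta_def)
 have "\<exists>z. norm (x - z) <= 2 * depth x \<and> ball z (eta * depth x) \<subseteq> - Om" if x: "x \<in> ball p (r / 4)" for x
 proof -
  obtain z where z: "z \<notin> Om" "depth x = norm (x - z)" using nearest_complement_point[of x] by metis
  let ?d = "depth x"
  have d: "0 <= ?d" "?d < r / 4" using z(2) depth_le[OF pn, of x] x by (auto simp: dist_norm norm_minus_commute)
  have zp: "norm (z - p) < r / 2"
   using norm_triangle_ineq[of "z - x" "x - p"] z(2) d x by (simp add: dist_norm norm_minus_commute)
  have "ball (z - ?d *\<^sub>R e) (eta * ?d) \<subseteq> - Om"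
  proof
   fix y assume y: "y \<in> ball (z - ?d *\<^sub>R e) (eta * ?d)"
   define w where "w = y - (z - ?d *\<^sub>R e)"
   have yw: "y = z - ?d *\<^sub>R e + w" by (simp add: w_def)
   have w: "norm w < eta * ?d" using y by (simp add: w_def dist_norm norm_minus_commute)
   have etad: "eta * ?d <= ?d" using eta(2) d(1) by (simp add: mult_left_le_one_le eta(1) less_imp_le)
   have "norm (y - p) <= norm (z - p) + norm (w - ?d *\<^sub>R e)"
    using norm_triangle_ineq[of "z - p" "w - ?d *\<^sub>R e"] by (simp add: yw algebra_simps)
   also have "norm (w - ?d *\<^sub>R e) <= norm w + ?d" using norm_triangle_ineq4[of w "?d *\<^sub>R e"] e d by simp
   finally have yb: "y \<in> ball p r" using zp w etad d by (simp add: dist_norm norm_minus_commute)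
   have zb: "z \<in> ball p r" using zp r by (simp add: dist_norm norm_minus_commute)
   let ?\<pi> = "%x. x - (x \<bullet> e) *\<^sub>R e"
   have H: "?\<pi> y \<in> {y. y \<bullet> e = 0}" "?\<pi> z \<in> {y. y \<bullet> e = 0}" using ee by (auto simp: inner_diff_left)
   have ye: "y \<bullet> e = z \<bullet> e - ?d + w \<bullet> e" using ee by (simp add: yw inner_diff_left inner_add_left)
   have "?\<pi> y - ?\<pi> z = ?\<pi> w" unfolding ye by (simp add: yw algebra_simps)
   moreover have "norm (?\<pi> w) <= norm w"
   proof -
    have "(norm (?\<pi> w))\<^sup>2 = (norm w)\<^sup>2 - (w \<bullet> e)\<^sup>2"
     unfolding power2_norm_eq_inner inner_diff_left inner_diff_right inner_scaleR_left inner_scaleR_right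
      inner_commute[of e w] ee by algebra
    then have "(norm (?\<pi> w))\<^sup>2 <= (norm w)\<^sup>2" using zero_le_power2[of "w \<bullet> e"] by linarith
    then show ?thesis by (rule power2_le_imp_le) (rule norm_ge_zero)
   qed
   ultimately have "\<bar>gam (?\<pi> y) - gam (?\<pi> z)\<bar> <= L * norm w"
    using lipschitz_onD[OF L H] mult_left_mono[OF _ L0, of "norm (?\<pi> w)" "norm w"] by (simp add: dist_norm)
   moreover have "L * norm w <= L * (eta * ?d)" using w L0 by (intro mult_left_mono) auto
   moreover have "w \<bullet> e <= norm w" using norm_cauchy_schwarz[of w e] e by simp
   moreover have "z \<bullet> e <= gam (?\<pi> z)" using chart[OF zb] z(1) by simp
   moreover have "eta * ?d + L * (eta * ?d) = ?d"
   proof -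
    have "eta * ?d + L * (eta * ?d) = (eta * (1 + L)) * ?d" by (simp add: algebra_simps)
    then show ?thesis unfolding eta(3) by simp
   qed
   ultimately have "y \<bullet> e <= gam (?\<pi> y)" using w unfolding ye by linarith
   then show "y \<in> - Om" using chart[OF yb] by simp
  qed
  moreover have "norm (x - (z - ?d *\<^sub>R e)) <= 2 * ?d"
   using norm_triangle_ineq[of "x - z" "?d *\<^sub>R e"] z(2) e d by (simp add: algebra_simps)
  ultimately show ?thesis by blast
 qed
 then show ?thesis using r eta(1) by (intro exI[of _ "r / 4"] conjI exI[of _ eta]) auto
qed

text \<open>A ball of radius comparable to the distance to the boundary lies outside the domain: this is
 the only consequence of the Lipschitz condition, besides the boundary being a null set.\<close>

lemma exterior_cone:
 "\<exists>r>0. \<exists>eta>0. \<forall>x\<in>Om. depth x < r \<longrightarrow> (\<exists>z. norm (x - z) <= 2 * depth x \<and> ball z (eta * depth x) \<subseteq> - Om)"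
proof -
 obtain r eta where reta: "!!p. p \<in> frontier Om ==> 0 < r p \<and> 0 < eta p \<and> (\<forall>x\<in>ball p (r p).
   \<exists>z. norm (x - z) <= 2 * depth x \<and> ball z (eta p * depth x) \<subseteq> - Om)"
  using exterior_cone_local by (metis (no_types, lifting))
 have cf: "compact (frontier Om)" using bounded_domain by (rule compact_frontier_bounded)
 have "frontier Om \<subseteq> (\<Union>p\<in>frontier Om. ball p (r p / 2))" using reta by fastforce
 from compactE_image[OF cf _ this] obtain C where C: "C \<subseteq> frontier Om" "finite C" "frontier Om \<subseteq> (\<Union>p\<in>C. ball p (r p / 2))"
  by auto
 define r0 where "r0 = Min (insert 1 ((%p. r p / 2) ` C))"
 define eta0 where "eta0 = Min (insert 1 (eta ` C))"
 have r0: "0 < r0" "!!p. p \<in> C ==> r0 <= r p / 2"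
 proof -
  show "0 < r0" unfolding r0_def using C reta by auto
  show "r0 <= r p / 2" if "p \<in> C" for p unfolding r0_def by (rule Min_le) (use C that in auto)
 qed
 have eta0: "0 < eta0" "!!p. p \<in> C ==> eta0 <= eta p"
 proof -
  show "0 < eta0" unfolding eta0_def using C reta by auto
  show "eta0 <= eta p" if "p \<in> C" for p unfolding eta0_def by (rule Min_le) (use C that in auto)
 qed
 have "\<exists>z. norm (x - z) <= 2 * depth x \<and> ball z (eta0 * depth x) \<subseteq> - Om" if x: "x \<in> Om" "depth x < r0" for x
 proof -
  have sub: "ball x (depth x) \<subseteq> Om" using depth_le[of _ x] by (force simp: dist_norm)
  obtain z where z: "z \<notin> Om" "depth x = norm (x - z)" using nearest_complement_point[of x] by metis
  have "z \<in> closure (ball x (depth x))" using z depth_pos[OF x(1)] by (simp add: dist_norm)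
  then have "z \<in> frontier Om" using closure_mono[OF sub] z(1) open_domain by (auto simp: frontier_def interior_open)
  then obtain p where p: "p \<in> C" "z \<in> ball p (r p / 2)" using C(3) by blast
  have "norm (p - x) <= norm (p - z) + norm (z - x)" using norm_triangle_ineq[of "p - z" "z - x"] by simp
  then have "x \<in> ball p (r p)" using p r0(2)[OF p(1)] z(2) x(2) by (simp add: dist_norm norm_minus_commute)
  then obtain z' where z': "norm (x - z') <= 2 * depth x" "ball z' (eta p * depth x) \<subseteq> - Om"
   using reta p(1) C(1) by blast
  have "ball z' (eta0 * depth x) \<subseteq> ball z' (eta p * depth x)"
   using eta0(2)[OF p(1)] depth_pos[OF x(1)] by (intro subset_ball mult_right_mono) auto
  then show ?thesis using z' by blast
 qed
 then show ?thesis using r0(1) eta0(1) by blast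
qed

text \<open>The density of the nonlocal interaction of a point of the domain with the complement.\<close>

definition killing :: "real => 'a => real" where
 "killing beta x = (LI y. indicator (- Om) y / norm (x - y) powr (real DIM('a) + beta))"

lemma killing_nonneg: "0 <= killing beta x"
 unfolding killing_def by (intro integral_nonneg_AE) auto

lemma borel_measurable_killing [measurable]: "killing beta \<in> Borel"
proof -
 have "(%x. LI y. indicator (- Om) y / norm (x - y) powr (real DIM('a) + beta)) \<in> borel_measurable lborel"
  by measurable
 then show ?thesis unfolding killing_def[abs_def] by simp
qed

lemma killing_integrable:
 assumes beta: "0 < beta" "beta < 2" and x: "x \<in> Om"
 shows "L1 (%y. indicator (- Om) y / norm (x - y) powr (real DIM('a) + beta))"
proof -
 have "L1 (%h. indicator {h. depth x <= norm h} h / norm (h::'a) powr (real DIM('a) + 2 * (beta / 2)))"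
  by (rule kernel_tail_integrable) (use beta depth_pos[OF x] in auto)
 then have i: "L1 (%h. indicator {h. depth x <= norm h} (- x + h) / norm (- x + h) powr (real DIM('a) + beta))"
  by (subst integrable_translate_iff[of _ "- x"]) auto
 have "depth x <= norm (- x + y)" if "y \<notin> Om" for y
  using depth_le[OF that, of x] by (simp add: norm_minus_commute)
 then show ?thesis
  by (intro L1_integrable_bound[OF i _ AE_I2])
   (auto simp: indicator_def norm_minus_commute)
qed

lemma nn_killing:
 assumes beta: "0 < beta" "beta < 2" and x: "x \<in> Om"
 shows "(NN y. ennreal (indicator (- Om) y / norm (x - y) powr (real DIM('a) + beta))) = ennreal (killing beta x)"
 unfolding killing_def by (rule nn_integral_eq_integral[OF killing_integrable[OF assms]]) auto

lemma killing_le: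
 assumes beta: "0 < beta" "beta < 2"
 shows "\<exists>T\<ge>0. \<forall>x\<in>Om. killing beta x <= T * depth x powr (- beta)"
proof -
 obtain T where T: "T >= 0" "!!d. d > 0 ==> (NN h. ennreal (indicator {h. d <= norm h} h / norm (h::'a) powr (real DIM('a) + 2 * (beta / 2)))) = ennreal (T * d powr (- (2 * (beta / 2))))"
  using kernel_tail[where 'a='a, of "beta / 2"] beta by auto
 have "killing beta x <= T * depth x powr (- beta)" if x: "x \<in> Om" for x
 proof -
  have "ennreal (killing beta x) = (NN y. ennreal (indicator (- Om) y / norm (x - y) powr (real DIM('a) + beta)))"
   by (rule nn_killing[OF beta x, symmetric])
  also have "... <= (NN y. ennreal (indicator {h. depth x <= norm h} (- x + y) / norm (- x + y) powr (real DIM('a) + beta)))"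
   by (intro nn_integral_mono ennreal_leI) (auto simp: indicator_def norm_minus_commute dest: depth_le[of _ x])
  also have "... = (NN y. ennreal (indicator {h. depth x <= norm h} y / norm (y::'a) powr (real DIM('a) + beta)))"
   by (rule nn_integral_translate) measurable
  also have "... = ennreal (T * depth x powr (- beta))" using T(2)[OF depth_pos[OF x]] by simp
  finally show ?thesis using T(1) by (simp add: ennreal_le_iff)
 qed
 then show ?thesis using T(1) by blast
qed

lemma killing_ge:
 assumes beta: "0 < beta" "beta < 2"
 shows "\<exists>r>0. \<exists>c>0. \<forall>x\<in>Om. depth x < r \<longrightarrow> c * depth x powr (- beta) <= killing beta x"
proof -
 let ?n = "real DIM('a)"
 obtain r eta where r: "0 < r" and eta: "0 < eta" and cone: "!!x. x \<in> Om ==> depth x < r ==>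
   \<exists>z. norm (x - z) <= 2 * depth x \<and> ball z (eta * depth x) \<subseteq> - Om"
  using exterior_cone by metis
 define V where "V = unit_ball_vol ?n"
 have V: "V > 0" by (simp add: V_def)
 define c where "c = V * eta ^ DIM('a) / (2 + eta) powr (?n + beta)"
 have c: "c > 0" using V eta by (simp add: c_def)
 have "c * depth x powr (- beta) <= killing beta x" if x: "x \<in> Om" "depth x < r" for x
 proof -
  let ?d = "depth x"
  have d: "?d > 0" by (rule depth_pos[OF x(1)])
  obtain z where z: "norm (x - z) <= 2 * ?d" "ball z (eta * ?d) \<subseteq> - Om" using cone[OF x] by blast
  have mz: "emeasure lborel (ball z (eta * ?d)) = ennreal (V * (eta * ?d) ^ DIM('a))"
   using emeasure_ball[of "eta * ?d" z] eta d by (simp add: V_def)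
  have e0: "1 / ((2 + eta) * ?d) powr (?n + beta) >= 0" by simp
  have "c * ?d powr (- beta) = 1 / ((2 + eta) * ?d) powr (?n + beta) * (V * (eta * ?d) ^ DIM('a))"
  proof -
   have "?d powr (?n + beta) = ?d ^ DIM('a) * ?d powr beta" using d by (simp add: powr_add powr_realpow)
   then show ?thesis using eta d unfolding c_def
    by (simp add: powr_mult powr_minus power_mult_distrib divide_simps)
  qed
  then have "ennreal (c * ?d powr (- beta)) = ennreal (1 / ((2 + eta) * ?d) powr (?n + beta)) * emeasure lborel (ball z (eta * ?d))"
   unfolding mz by (simp only: ennreal_mult'[OF e0])
  also have "... = (NN y. ennreal (1 / ((2 + eta) * ?d) powr (?n + beta)) * indicator (ball z (eta * ?d)) y)"
   by (subst nn_integral_cmult_indicator) auto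
  also have "... <= (NN y. ennreal (indicator (- Om) y / norm (x - y) powr (?n + beta)))"
  proof (rule nn_integral_mono)
   fix y
   show "ennreal (1 / ((2 + eta) * ?d) powr (?n + beta)) * indicator (ball z (eta * ?d)) y <= ennreal (indicator (- Om) y / norm (x - y) powr (?n + beta))"
   proof (cases "y \<in> ball z (eta * ?d)")
    case True
    then have yn: "y \<notin> Om" using z(2) by blast
    have "norm (x - y) <= norm (x - z) + norm (z - y)" using norm_triangle_ineq[of "x - z" "z - y"] by simp
    then have le: "norm (x - y) <= (2 + eta) * ?d" using z(1) True by (simp add: dist_norm algebra_simps)
    have "0 < norm (x - y)" using yn x(1) by auto
    then have "1 / ((2 + eta) * ?d) powr (?n + beta) <= 1 / norm (x - y) powr (?n + beta)"
     using le beta eta d by (intro divide_left_mono powr_mono2 mult_pos_pos) auto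
    then show ?thesis using True yn by (simp add: ennreal_leI)
   qed simp
  qed
  also have "... = ennreal (killing beta x)" by (rule nn_killing[OF beta x(1)])
  finally show ?thesis by (simp add: ennreal_le_iff killing_nonneg)
 qed
 then show ?thesis using r c by blast
qed

text \<open>\<open>killing s\<close> is at most \<open>depth powr (- s)\<close>, while \<open>killing (2 t)\<close> is at least \<open>depth powr (- 2 t)\<close> near the boundary, up to constants; and \<open>s < t\<close>.\<close>

lemma killing_square_le:
 assumes st: "0 < s" "s < t" "t < 1"
 shows "\<exists>A\<ge>0. \<forall>x\<in>Om. (killing s x)\<^sup>2 <= A * (1 + killing (2 * t) x)"
proof -
 obtain T where T: "T >= 0" "!!x. x \<in> Om ==> killing s x <= T * depth x powr (- s)" using killing_le[of s] st by auto
 obtain r c where r: "r > 0" and c: "c > 0" and low: "!!x. x \<in> Om ==> depth x < r ==> c * depth x powr (- (2 * t)) <= killing (2 * t) x"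
  using killing_ge[of "2 * t"] st by auto
 let ?r = "min r 1"
 define A where "A = T\<^sup>2 * ?r powr (- (2 * s)) + T\<^sup>2 / c"
 have A: "0 <= A" "T\<^sup>2 * ?r powr (- (2 * s)) <= A" "T\<^sup>2 / c <= A" using c by (auto simp: A_def)
 have "(killing s x)\<^sup>2 <= A * (1 + killing (2 * t) x)" if x: "x \<in> Om" for x
 proof -
  have d: "0 < depth x" by (rule depth_pos[OF x])
  have "(killing s x)\<^sup>2 <= (T * depth x powr (- s))\<^sup>2" by (rule power_mono[OF T(2)[OF x] killing_nonneg])
  also have "... = T\<^sup>2 * (depth x powr (- s) * depth x powr (- s))" by (simp add: power2_eq_square mult_ac)
  also have "depth x powr (- s) * depth x powr (- s) = depth x powr (- (2 * s))"
   by (simp flip: powr_add)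
  finally have k: "(killing s x)\<^sup>2 <= T\<^sup>2 * depth x powr (- (2 * s))" .
  show ?thesis
  proof (cases "depth x < ?r")
   case True
   have "depth x powr (- (2 * s)) <= depth x powr (- (2 * t))" using True d st by (intro powr_mono') auto
   then have "T\<^sup>2 * depth x powr (- (2 * s)) <= T\<^sup>2 * depth x powr (- (2 * t))" by (intro mult_left_mono) auto
   also have "... = (T\<^sup>2 / c) * (c * depth x powr (- (2 * t)))" using c by simp
   also have "... <= (T\<^sup>2 / c) * killing (2 * t) x" using low[OF x] True c by (intro mult_left_mono) auto
   also have "... <= A * killing (2 * t) x" by (rule mult_right_mono[OF A(3) killing_nonneg])
   finally show ?thesis using k A(1) by (simp add: distrib_left)
  next
   case False
   then have "depth x powr (- (2 * s)) <= ?r powr (- (2 * s))" using r st by (intro powr_mono2') auto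
   then have "T\<^sup>2 * depth x powr (- (2 * s)) <= T\<^sup>2 * ?r powr (- (2 * s))" by (intro mult_left_mono) auto
   moreover have "0 <= A * killing (2 * t) x" using A(1) killing_nonneg by simp
   ultimately show ?thesis using k A(2) by (simp add: distrib_left)
  qed
 qed
 then show ?thesis using A(1) by blast
qed

lemma killing_bounded_on_compact:
 assumes K: "compact K" "K \<subseteq> Om" and beta: "0 < beta" "beta < 2"
 shows "\<exists>M\<ge>0. \<forall>x\<in>K. killing beta x <= M"
proof -
 obtain T where T: "T >= 0" "!!x. x \<in> Om ==> killing beta x <= T * depth x powr (- beta)" using killing_le[OF beta] by auto
 obtain delta where delta: "delta > 0" "!!x. x \<in> K ==> delta <= depth x" using depth_compact_pos[OF K] by auto
 have "killing beta x <= T * delta powr (- beta)" if "x \<in> K" for x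
 proof -
  have "depth x powr (- beta) <= delta powr (- beta)" using delta that beta by (intro powr_mono2') auto
  then show ?thesis using T(2)[of x] that K(2) mult_left_mono[OF _ T(1)] by fastforce
 qed
 then show ?thesis using T(1) by (intro exI[of _ "T * delta powr (- beta)"]) auto
qed

text \<open>The space \<open>\<tilde>H\<^sup>t(Om)\<close>, realised by functions that vanish outside the domain.\<close>

definition H0 :: "real => ('a => real) set" where
 "H0 t = {u. in_H t u \<and> (\<forall>x. x \<notin> Om \<longrightarrow> u x = 0)}"

lemma H0_D: "u \<in> H0 t ==> in_H t u" "u \<in> H0 t ==> x \<notin> Om ==> u x = 0"
 by (auto simp: H0_def)

lemma H0_lincomb: "u \<in> H0 t ==> v \<in> H0 t ==> (%x. a * u x + b * v x) \<in> H0 t"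
 by (auto simp: H0_def in_H_lincomb)

text \<open>As \<open>u\<close> vanishes off the domain, the Gagliardo integral over pairs of an inner and an outer point is the integral of \<open>u\<^sup>2\<close> against the killing density.\<close>

lemma hardy:
 assumes u: "u \<in> H0 t" and t: "0 < t" "t < 1"
 shows "(NN x. ennreal (indicator Om x * (u x)\<^sup>2 * killing (2 * t) x)) < \<infinity>"
proof -
 let ?n = "real DIM('a)"
 have uH: "in_H t u" by (rule H0_D(1)[OF u])
 then have [measurable]: "u \<in> Borel" by (intro L2_borel in_H_L2)
 have "(NN x. ennreal (indicator Om x * (u x)\<^sup>2 * killing (2 * t) x)) \<le>
  (NN x. NN y. ennreal (gagliardo t u u (x, y)))"
 proof (rule nn_integral_mono)
  fix x
  show "ennreal (indicator Om x * (u x)\<^sup>2 * killing (2 * t) x) <= (NN y. ennreal (gagliardo t u u (x, y)))"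
  proof (cases "x \<in> Om")
   case True
   have "ennreal (indicator Om x * (u x)\<^sup>2 * killing (2 * t) x) = ennreal ((u x)\<^sup>2) * (NN y. ennreal (indicator (- Om) y / norm (x - y) powr (?n + 2 * t)))"
    using True t by (simp add: nn_killing ennreal_mult killing_nonneg)
   also have "... = (NN y. ennreal ((u x)\<^sup>2) * ennreal (indicator (- Om) y / norm (x - y) powr (?n + 2 * t)))"
    by (rule nn_integral_cmult[symmetric]) measurable
   also have "... <= (NN y. ennreal (gagliardo t u u (x, y)))"
   proof (rule nn_integral_mono)
    fix y
    show "ennreal ((u x)\<^sup>2) * ennreal (indicator (- Om) y / norm (x - y) powr (?n + 2 * t)) <= ennreal (gagliardo t u u (x, y))"
     using H0_D(2)[OF u, of y] by (cases "y \<in> Om") (auto simp: gagliardo_def power2_eq_square simp flip: ennreal_mult)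
   qed
   finally show ?thesis .
  qed simp
 qed
 also have "... = (\<integral>\<^sup>+z. ennreal (gagliardo t u u z) \<partial>(lborel2))"
  by (rule lborel.nn_integral_fst) measurable
 also have "... = ennreal (LINT z|(lborel2). gagliardo t u u z)"
  using gagliardo_square(1)[OF uH t] by (rule nn_integral_eq_integral) (auto simp: gagliardo_def)
 also have "... < \<infinity>" by simp
 finally show ?thesis .
qed

lemma L2_killing:
 assumes u: "u \<in> H0 t" and st: "0 < s" "s < t" "t < 1"
 shows "L2 (%x. indicator Om x * (killing s x * u x))"
proof -
 have uH: "in_H t u" by (rule H0_D(1)[OF u])
 then have uL: "L2 u" and [measurable]: "u \<in> Borel" by (auto intro: L2_borel in_H_L2)
 obtain A where A: "A >= 0" "!!x. x \<in> Om ==> (killing s x)\<^sup>2 <= A * (1 + killing (2 * t) x)" using killing_square_le[OF st] by auto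
 have "(NN x. ennreal ((norm (indicator Om x * (killing s x * u x)))\<^sup>2))
  <= (NN x. ennreal A * ennreal ((norm (u x))\<^sup>2) + ennreal A * ennreal (indicator Om x * (u x)\<^sup>2 * killing (2 * t) x))"
 proof (rule nn_integral_mono)
  fix x
  have "(norm (indicator Om x * (killing s x * u x)))\<^sup>2 <= A * (u x)\<^sup>2 + A * (indicator Om x * (u x)\<^sup>2 * killing (2 * t) x)"
  proof (cases "x \<in> Om")
   case True
   have "(killing s x)\<^sup>2 * (u x)\<^sup>2 <= (A * (1 + killing (2 * t) x)) * (u x)\<^sup>2" by (rule mult_right_mono[OF A(2)[OF True]]) simp
   then show ?thesis using True by (simp add: power_mult_distrib algebra_simps)
  qed (use A(1) in simp)
  moreover have "0 <= indicator Om x * (u x)\<^sup>2 * killing (2 * t) x" by (intro mult_nonneg_nonneg killing_nonneg) auto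
  ultimately show "ennreal ((norm (indicator Om x * (killing s x * u x)))\<^sup>2) \<le>
   ennreal A * ennreal ((norm (u x))\<^sup>2) + ennreal A * ennreal (indicator Om x * (u x)\<^sup>2 * killing (2 * t) x)"
   using A(1) by (simp only: ennreal_mult[symmetric] ennreal_plus[symmetric] ennreal_leI real_norm_def power2_abs
     zero_le_power2 mult_nonneg_nonneg)
 qed
 also have "... = ennreal A * (NN x. ennreal ((norm (u x))\<^sup>2)) + ennreal A * (NN x. ennreal (indicator Om x * (u x)\<^sup>2 * killing (2 * t) x))"
  by (subst nn_integral_add) (auto simp: nn_integral_cmult)
 also have "... < \<infinity>"
  using hardy[OF u] st uL by (auto simp: L2_iff_nn ennreal_mult_less_top)
 finally show ?thesis unfolding L2_iff_nn by simp
qed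

end

text \<open>The Gagliardo integral is finite since a Lipschitz function of compact support has mean square increments of order \<open>min 1 (norm h)\<^sup>2\<close>.\<close>

lemma test_function_in_H:
 fixes phi :: "'a::euclidean_space => real"
 assumes phi: "phi \<in> test_functions U" and t: "0 < t" "t < 1"
 shows "in_H t phi"
proof (rule in_H_iff_gagliardo[OF test_function_integrable(2)[OF phi] t])
 let ?k = "%h::'a. norm h powr (real DIM('a) + 2 * t)"
 have [measurable]: "phi \<in> Borel" by (rule test_functionD(3)[OF phi])
 obtain M where M: "M >= 0" "!!x h. \<bar>phi (x + h) - phi x\<bar> <= M * norm h" using test_function_lipschitz[OF phi] by metis
 obtain M' where M': "!!x. \<bar>phi x\<bar> <= M'" using test_function_bounded[OF phi] by metis
 obtain K where K: "compact K" "!!x. x \<notin> K ==> phi x = 0" using test_functionD(4)[OF phi] by blast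
 have [measurable]: "K \<in> sets borel" using K(1) by (simp add: borel_compact)
 define C where "C = M\<^sup>2 + (2 * M')\<^sup>2"
 have M'0: "0 <= M'" using M'[of 0] by linarith
 have C: "0 <= C" "(phi (x + h) - phi x)\<^sup>2 <= C * min 1 ((norm h)\<^sup>2)" for x h
 proof -
  show "0 <= C" by (simp add: C_def)
  have "(phi (x + h) - phi x)\<^sup>2 <= (M * norm h)\<^sup>2" using power_mono[OF M(2) abs_ge_zero, of x h 2] by simp
  then have 1: "(phi (x + h) - phi x)\<^sup>2 <= M\<^sup>2 * (norm h)\<^sup>2" by (simp only: power_mult_distrib)
  have "\<bar>phi (x + h) - phi x\<bar> <= 2 * M'" using M'[of x] M'[of "x + h"] by linarith
  from power_mono[OF this abs_ge_zero, of 2] have 2: "(phi (x + h) - phi x)\<^sup>2 <= (2 * M')\<^sup>2" by simp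
  show "(phi (x + h) - phi x)\<^sup>2 <= C * min 1 ((norm h)\<^sup>2)"
  proof (cases "(norm h)\<^sup>2 <= 1")
   case True
   have "M\<^sup>2 * (norm h)\<^sup>2 <= C * (norm h)\<^sup>2" by (rule mult_right_mono) (auto simp: C_def)
   then show ?thesis using 1 True by (simp add: min_def)
  next
   case False
   then show ?thesis using 2 by (simp add: C_def min_def add_increasing)
  qed
 qed
 have "(NN x. NN y. ennreal ((phi x - phi y)\<^sup>2 / ?k (x - y)))
  = (NN x. NN h. ennreal ((phi x - phi (x + h))\<^sup>2 / ?k (x - (x + h))))"
  by (intro nn_integral_cong nn_integral_translate[symmetric]) measurable
 also have "... = (NN h. NN x. ennreal ((phi (x + h) - phi x)\<^sup>2 / ?k h))"
  by (subst lborel_pair.Fubini') (auto simp: power2_commute)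
 also have "... <= (NN h. ennreal (2 * measure lborel K * C) * ennreal (min 1 ((norm h)\<^sup>2) / ?k h))"
 proof (rule nn_integral_mono)
  fix h :: 'a
  have eK: "emeasure lborel K = ennreal (measure lborel K)"
   by (rule emeasure_eq_ennreal_measure) (use emeasure_compact_finite[OF K(1)] in auto)
  have "(NN x. ennreal ((phi (x + h) - phi x)\<^sup>2 / ?k h))
   <= (NN x. ennreal (C * min 1 ((norm h)\<^sup>2) / ?k h) * (indicator K (h + x) + indicator K x))"
  proof (rule nn_integral_mono)
   fix x
   have le: "ennreal ((phi (x + h) - phi x)\<^sup>2 / ?k h) <= ennreal (C * min 1 ((norm h)\<^sup>2) / ?k h)"
    by (intro ennreal_leI divide_right_mono C) simp
   show "ennreal ((phi (x + h) - phi x)\<^sup>2 / ?k h) <= ennreal (C * min 1 ((norm h)\<^sup>2) / ?k h) * (indicator K (h + x) + indicator K x)"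
   proof (cases "x \<in> K \<or> h + x \<in> K")
    case True
    then have "(1::ennreal) <= indicator K (h + x) + indicator K x" by (auto simp: indicator_def)
    from mult_mono[OF le this] show ?thesis by simp
   next
    case False
    then show ?thesis using K(2)[of x] K(2)[of "h + x"] by (simp add: add.commute)
   qed
  qed
  also have "... = ennreal (C * min 1 ((norm h)\<^sup>2) / ?k h) * (emeasure lborel K + emeasure lborel K)"
   using nn_integral_translate[of "indicator K" h]
   by (subst nn_integral_cmult) (auto simp: nn_integral_add)
  also have "... = ennreal (2 * measure lborel K * C) * ennreal (min 1 ((norm h)\<^sup>2) / ?k h)"
   unfolding eK using C(1) by (simp add: mult_ac flip: ennreal_mult ennreal_plus)
  finally show "(NN x. ennreal ((phi (x + h) - phi x)\<^sup>2 / ?k h))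
   <= ennreal (2 * measure lborel K * C) * ennreal (min 1 ((norm h)\<^sup>2) / ?k h)" .
 qed
 also have "... < \<infinity>"
  using kernel_integrable[OF t, where 'a='a] by (subst nn_integral_cmult) (auto simp: ennreal_mult_less_top)
 finally show "(NN x. NN y. ennreal ((phi x - phi y)\<^sup>2 / ?k (x - y))) < \<infinity>" .
qed

lemma (in lipschitz_domain) test_function_H0:
 assumes phi: "phi \<in> test_functions Om" and t: "0 < t" "t < 1"
 shows "phi \<in> H0 t"
 using test_function_in_H[OF phi t] test_functionD(4)[OF phi] by (auto simp: H0_def)

section \<open>Nonlocal interaction of disjoint supports\<close>

lemma partial_derivs_zero_on_open:
 assumes V: "open V" and zero: "!!x. x \<in> V ==> phi x = 0" and x: "x \<in> V"
 shows "partial_derivs vs phi x = 0"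
 using x
proof (induction vs arbitrary: x)
 case (Cons v vs)
 have "(partial_derivs vs phi has_derivative (%_. 0)) (at x)"
  by (rule has_derivative_transform_within_open[of "%_. 0", OF _ V Cons.prems]) (auto simp: Cons.IH)
 then have "frechet_derivative (partial_derivs vs phi) (at x) = (%_. 0)" by (rule frechet_derivative_at[symmetric])
 then show ?case by simp
qed (simp add: zero)

lemma test_function_schwartz:
 fixes phi :: "'a::euclidean_space => real"
 assumes phi: "phi \<in> test_functions U" shows "phi \<in> schwartz_functions"
proof -
 obtain K where K: "compact K" "!!x. x \<notin> K ==> phi x = 0" using test_functionD(4)[OF phi] by blast
 have "bounded (range (%x. norm x ^ k * partial_derivs vs phi x))" if vs: "set vs \<subseteq> Basis" for vs k
 proof -
  have "compact ((%x. norm x ^ k * partial_derivs vs phi x) ` K)"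
   by (intro compact_continuous_image K continuous_intros C_infinity_continuous test_functionD(1)[OF phi] vs)
  then have b: "bounded (insert 0 ((%x. norm x ^ k * partial_derivs vs phi x) ` K))" using compact_imp_bounded by auto
  have "open (- K)" using K(1) by (simp add: compact_imp_closed open_Compl)
  then have "partial_derivs vs phi x = 0" if "x \<notin> K" for x
   using partial_derivs_zero_on_open[of "- K" phi x vs] K(2) that by simp
  then have "range (%x. norm x ^ k * partial_derivs vs phi x) \<subseteq> insert 0 ((%x. norm x ^ k * partial_derivs vs phi x) ` K)"
   by (force simp: image_iff)
  then show ?thesis by (rule bounded_subset[OF b])
 qed
 then show ?thesis using test_functionD(1)[OF phi] by (simp add: schwartz_functions_def)
qed

lemma integrable_potential:
 fixes w :: "'a::euclidean_space => real"
 assumes w: "L1 w" and K: "compact K" and w0: "!!y. y \<notin> K ==> w y = 0" and x: "x \<notin> K"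
 shows "L1 (%y. w y / norm (x - y) powr beta)"
 using integrable_kernel[OF w K w0 x continuous_on_riesz borel_measurable_riesz, of beta] by (simp add: riesz_eq)

text \<open>Off the support the second difference reduces to the two shifted terms, which contribute equally.\<close>

lemma frac_laplacian_off_support:
 fixes phi :: "'a::euclidean_space => real"
 assumes phi: "phi \<in> test_functions U" and K: "compact K" "!!x. x \<notin> K ==> phi x = 0" and a: "0 < a" "a < 1"
 shows "ae x. x \<notin> K \<longrightarrow>
  frac_laplacian a phi x = - frac_constant TYPE('a) a * (LI y. phi y / norm (x - y) powr (real DIM('a) + 2 * a))"
 using schwartz_frac_laplacian(2)[OF test_function_schwartz[OF phi] a]
proof eventually_elim
 case (elim x)
 have [measurable]: "phi \<in> Borel" by (rule test_functionD(3)[OF phi])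
 let ?k = "%h::'a. norm h powr (real DIM('a) + 2 * a)"
 have "singular_integral phi a x = - (LI y. phi y / ?k (x - y))" if x: "x \<notin> K"
 proof -
  let ?p = "%h. phi (x + h) / ?k h"
  have "L1 (%h. phi (x + h) / ?k (x - (x + h)))"
   using integrable_potential[OF test_function_integrable(1)[OF phi] K x, of "real DIM('a) + 2 * a"]
   by (subst integrable_translate_iff[where f="%y. phi y / ?k (x - y)"]) auto
  then have ip: "L1 ?p" by simp
  have "(LI h. phi (x + h) / ?k (x - (x + h))) = (LI y. phi y / ?k (x - y))"
   by (rule integral_translate) measurable
  then have p: "(LI h. ?p h) = (LI y. phi y / ?k (x - y))" by simp
  note ium = integral_uminus(1)[OF ip] and um = integral_uminus(2)[OF ip]
  have "singular_integral phi a x = (LI h. - (?p h + ?p (- h))) / 2"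
   unfolding singular_integral_def[OF test_function_schwartz[OF phi] a] second_difference_def K(2)[OF x]
   by (simp add: diff_divide_distrib)
  also have "... = - (LI y. phi y / ?k (x - y))"
   unfolding integral_minus L1_integral_add[OF ip ium] um p by simp
  finally show ?thesis .
 qed
 then show ?case unfolding elim by (simp add: frac_constant_eq[OF a])
qed

text \<open>The double integral form of the energy only sees pairs with one point in each support.\<close>

lemma nonlocal_pairing:
 fixes f v :: "'a::euclidean_space => real"
 assumes f: "in_H t f" and v: "in_H t v" and t: "0 < t" "t < 1"
  and disjoint: "!!x. x \<notin> A ==> f x = 0" "!!x. x \<in> A ==> v x = 0" and A: "A \<in> sets borel"
 shows "L1 (%x. f x * (LI y. v y / norm (x - y) powr (real DIM('a) + 2 * t)))"
  and "inner2 (\<Lambda> t f) (\<Lambda> t v)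
   = - frac_constant TYPE('a) t * (LI x. f x * (LI y. v y / norm (x - y) powr (real DIM('a) + 2 * t)))"
proof -
 let ?k = "%h::'a. norm h powr (real DIM('a) + 2 * t)"
 let ?H = "%(x, y). f x * v y / ?k (x - y)"
 note [measurable] = A
 have [measurable]: "f \<in> Borel" "v \<in> Borel"
  using f v by (auto intro: L2_borel in_H_L2)
 note G = gagliardo_energy[OF f v t]
 have HG: "?H (x, y) = - (indicator A x * indicator (- A) y * gagliardo t f v (x, y))" for x y
  using disjoint(1)[of x] disjoint(1)[of y] disjoint(2)[of x] disjoint(2)[of y]
  by (cases "x \<in> A"; cases "y \<in> A") (simp_all add: gagliardo_def)
 have iH: "integrable (lborel2) ?H"
 proof (rule L1_integrable_bound[OF G(1) _ AE_I2])
  show "norm (?H z) <= norm (gagliardo t f v z)" for z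
   using HG[of "fst z" "snd z"] by (auto simp: indicator_def split: prod.splits)
 qed measurable
 have inner: "(LI y. ?H (x, y)) = f x * (LI y. v y / ?k (x - y))" for x
  by (simp flip: integral_mult_right_zero)
 show "L1 (%x. f x * (LI y. v y / ?k (x - y)))"
  using lborel_pair.integrable_fst'[OF iH] unfolding inner .
 have LH: "(LINT z|(lborel2). ?H z) = (LI x. f x * (LI y. v y / ?k (x - y)))"
  using lborel_pair.integral_fst'[OF iH] unfolding inner by simp
 have iH': "integrable (lborel2) (%(x, y). ?H (y, x))"
  by (rule lborel_pair.integrable_product_swap[OF iH])
 have LH': "(LINT z|(lborel2). (case z of (x, y) => ?H (y, x))) = (LINT z|(lborel2). ?H z)"
  by (rule lborel_pair.integral_product_swap) measurable
 have "gagliardo t f v z = - (?H z + (case z of (x, y) => ?H (y, x)))" for z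
 proof -
  obtain x y where z: "z = (x, y)" by (cases z)
  have "f x * v x = 0" "f y * v y = 0" using disjoint by (metis mult_eq_0_iff)+
  then have "(f x - f y) * (v x - v y) = - (f x * v y + f y * v x)"
   by (simp only: left_diff_distrib right_diff_distrib)
  then show ?thesis unfolding z gagliardo_def prod.case norm_minus_commute[of y x] by (simp only: minus_divide_left[symmetric] add_divide_distrib)
 qed
 then have "(LINT z|(lborel2). gagliardo t f v z) = - (2 * (LINT z|(lborel2). ?H z))"
  using iH iH' LH' by (simp del: prod.case add: L1_integral_add)
 then have "levy_const TYPE('a) t * (energy t f v / plancherel_const TYPE('a)) = - (2 * (LINT z|(lborel2). ?H z))"
  using G(2) by simp
 then have "energy t f v / plancherel_const TYPE('a) = - frac_constant TYPE('a) t * (LINT z|(lborel2). ?H z)"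
  using levy_const_pos[OF t, where 'a='a] unfolding frac_constant_eq[OF t] by (simp add: field_simps)
 then show "inner2 (\<Lambda> t f) (\<Lambda> t v)
   = - frac_constant TYPE('a) t * (LI x. f x * (LI y. v y / ?k (x - y)))"
  unfolding LH using frac_laplacian_inner[of "t / 2" f v] f v by simp
qed

section \<open>The regional fractional Laplacian\<close>

lemma square_integrable_on_iff_L2:
 fixes f :: "'a::euclidean_space => real"
 shows "square_integrable_on A f \<longleftrightarrow> L2 (%x. indicator A x * f x)"
proof -
 have "indicator A x *\<^sub>R (norm (f x))\<^sup>2 = (norm (indicator A x * f x))\<^sup>2" for x by (auto simp: indicator_def)
 then show ?thesis
  unfolding square_integrable_on_def L2_def set_borel_measurable_def set_integrable_def by simp
qed

lemma regional_form_cong: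
 assumes "!!x. x \<in> Om ==> u x = v x"
 shows "regional_form Om a u = regional_form Om a v"
proof
 fix w
 have "indicator Om x *\<^sub>R (LINT y:Om|lborel. (u x - u y) * (w x - w y) / norm (x - y) powr (real DIM('a) + 2 * a))
  = indicator Om x *\<^sub>R (LINT y:Om|lborel. (v x - v y) * (w x - w y) / norm (x - y) powr (real DIM('a) + 2 * a))" for x
 proof (cases "x \<in> Om")
  case True
  have "(LINT y:Om|lborel. (u x - u y) * (w x - w y) / norm (x - y) powr (real DIM('a) + 2 * a))
   = (LINT y:Om|lborel. (v x - v y) * (w x - w y) / norm (x - y) powr (real DIM('a) + 2 * a))"
   unfolding set_lebesgue_integral_def
   by (rule L1_integral_cong) (use assms True in \<open>auto simp: indicator_def\<close>)
  then show ?thesis by simp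
 qed simp
 then show "regional_form Om a u w = regional_form Om a v w"
  unfolding regional_form_def by (subst (1 3) set_lebesgue_integral_def) (simp only:)
qed

lemma regional_frac_laplacian_cong:
 "(!!x. x \<in> Om ==> u x = v x) ==> regional_frac_laplacian Om a u = regional_frac_laplacian Om a v"
 unfolding regional_frac_laplacian_def by (subst regional_form_cong[of Om u v]) auto

context lipschitz_domain
begin

text \<open>The explicit representative in \<open>L\<^sup>2\<close> of the regional Laplacian of order \<open>s\<close> on functions that vanish off the domain.\<close>

definition regional :: "real => ('a => real) => 'a => real" where
 "regional s u x = indicator Om x * (\<Lambda> s u x - frac_constant TYPE('a) (s / 2) * (killing s x * u x))"

lemma regional_off [simp]: "x \<notin> Om ==> regional s u x = 0"
 by (simp add: regional_def)

context
 fixes s t :: real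
 assumes st: "0 < s" "s < t" "t < 1"
begin

lemma H0_in_H: "u \<in> H0 t ==> 0 <= r ==> r <= t ==> in_H r u"
 using in_H_mono H0_D(1) by blast

lemma H0_L2: "u \<in> H0 t ==> L2 u"
 using H0_D(1) in_H_L2(1) by blast

lemma L2_laplacian: "u \<in> H0 t ==> L2 (\<Lambda> s u)"
 using H0_in_H[of u s] st by (intro L2_frac_laplacian) auto

lemma L2_indicator: "L2 (w::'a => real) ==> A \<in> sets borel ==> L2 (%x. indicator A x * w x)"
 by (rule L2_dominated[where C=1 and g=w]) (auto simp: indicator_def)

lemma regional_split:
 "regional s u = (%x. indicator Om x * \<Lambda> s u x
   - frac_constant TYPE('a) (s / 2) * (indicator Om x * (killing s x * u x)))"
 by (auto simp: regional_def algebra_simps)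

lemma L2_regional: "u \<in> H0 t ==> L2 (regional s u)"
 unfolding regional_split by (intro L2_diff L2_mult L2_indicator L2_laplacian L2_killing[OF _ st]) auto

lemma regional_lincomb:
 assumes u: "u \<in> H0 t" and v: "v \<in> H0 t"
 shows "ae x. regional s (%x. a * u x + b * v x) x = a * regional s u x + b * regional s v x"
proof -
 have "in_H (2 * (s / 2)) u" "in_H (2 * (s / 2)) v" using H0_in_H[OF u] H0_in_H[OF v] st by auto
 from frac_laplacian_lincomb[OF this, of a b] show ?thesis
  by eventually_elim (simp add: regional_def algebra_simps)
qed

text \<open>Over the whole space the double integral is the Fourier energy; the part of it that is not
 over \<open>Om \<times> Om\<close> is a multiplication by the killing density.\<close>

lemma regional_form_eq:
 assumes u: "u \<in> H0 t" and v: "v \<in> H0 t"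
 shows "regional_form Om (s / 2) u v = inner2 (regional s u) v"
proof -
 let ?a = "s / 2"
 let ?k = "%h::'a. norm h powr (real DIM('a) + 2 * ?a)"
 let ?G = "gagliardo ?a u v" and ?C = "frac_constant TYPE('a) ?a" and ?l = "levy_const TYPE('a) ?a"
 have a: "0 < ?a" "?a < 1" using st by auto
 have ua: "in_H ?a u" and va: "in_H ?a v" and us: "in_H (2 * ?a) u" using H0_in_H[OF u] H0_in_H[OF v] st by auto
 have uL: "L2 u" and vL: "L2 v" using u v by (auto intro: H0_L2)
 have [measurable]: "u \<in> Borel" "v \<in> Borel" using uL vL by auto
 note G = gagliardo_energy[OF ua va a]
 define P where "P S T = (%z::'a \<times> 'a. indicator S (fst z) * indicator T (snd z) * ?G z)" for S T :: "'a set"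
 have iP: "integrable (lborel2) (P S T)" if [measurable]: "S \<in> sets borel" "T \<in> sets borel" for S T
  by (rule L1_integrable_bound[OF G(1) _ AE_I2])
   (use that in \<open>auto simp: P_def indicator_def\<close>)
 have cO: "- Om \<in> sets borel" by simp
 have Gsplit: "?G z = P Om Om z + P Om (- Om) z + P (- Om) Om z" for z
  using H0_D(2)[OF u, of "fst z"] H0_D(2)[OF u, of "snd z"] H0_D(2)[OF v, of "fst z"] H0_D(2)[OF v, of "snd z"]
  by (cases z; cases "fst z \<in> Om"; cases "snd z \<in> Om") (simp_all add: P_def gagliardo_def)
 have sum: "integral\<^sup>L (lborel2) ?G
  = integral\<^sup>L (lborel2) (P Om Om) + integral\<^sup>L (lborel2) (P Om (- Om)) + integral\<^sup>L (lborel2) (P (- Om) Om)"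
 proof -
  have "integral\<^sup>L (lborel2) ?G = (LINT z|(lborel2). P Om Om z + P Om (- Om) z + P (- Om) Om z)"
   by (rule L1_integral_cong[OF refl Gsplit])
  then show ?thesis using iP[OF borel_domain borel_domain] iP[OF borel_domain cO] iP[OF cO borel_domain] by simp
 qed
 have swap: "integral\<^sup>L (lborel2) (P (- Om) Om) = integral\<^sup>L (lborel2) (P Om (- Om))"
 proof -
  have "(LINT z|(lborel2). (case z of (x, y) => P Om (- Om) (y, x))) = integral\<^sup>L (lborel2) (P Om (- Om))"
   by (rule lborel_pair.integral_product_swap) (use iP[OF borel_domain cO] in auto)
  moreover have "(%z. case z of (x, y) => P Om (- Om) (y, x)) = P (- Om) Om"
   by (auto simp: P_def gagliardo_def norm_minus_commute fun_eq_iff algebra_simps)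
  ultimately show ?thesis by simp
 qed
 have mixed: "integral\<^sup>L (lborel2) (P Om (- Om)) = inner2 (%x. indicator Om x * (killing s x * u x)) v"
 proof -
  have "(LI y. P Om (- Om) (x, y)) = (indicator Om x * (killing s x * u x)) * v x" for x
  proof (cases "x \<in> Om")
   case True
   have "(LI y. P Om (- Om) (x, y)) = (LI y. (u x * v x) * (indicator (- Om) y / ?k (x - y)))"
   proof (rule L1_integral_cong[OF refl])
    fix y show "P Om (- Om) (x, y) = (u x * v x) * (indicator (- Om) y / ?k (x - y))"
     using True H0_D(2)[OF u, of y] H0_D(2)[OF v, of y]
     by (cases "y \<in> Om") (simp_all add: P_def gagliardo_def)
   qed
   also have "... = u x * v x * killing s x" unfolding integral_mult_right_zero killing_def by simp
   finally show ?thesis using True by simp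
  qed (simp add: P_def)
  then show ?thesis
   using lborel_pair.integral_fst'[OF iP[OF borel_domain cO]] unfolding inner2_def by simp
 qed
 have inside: "integral\<^sup>L (lborel2) (P Om Om) = (LINT x:Om|lborel. LINT y:Om|lborel. (u x - u y) * (v x - v y) / ?k (x - y))"
 proof -
  have "(LI y. P Om Om (x, y)) = indicator Om x *\<^sub>R (LINT y:Om|lborel. (u x - u y) * (v x - v y) / ?k (x - y))" for x
   unfolding set_lebesgue_integral_def P_def gagliardo_def by (simp flip: integral_mult_right_zero)
    (simp add: mult.assoc)
  then show ?thesis
   using lborel_pair.integral_fst'[OF iP[OF borel_domain borel_domain]] by (simp add: set_lebesgue_integral_def)
 qed
 have "inner2 (regional s u) v = inner2 (%x. indicator Om x * frac_laplacian ?a u x) v - ?C * inner2 (%x. indicator Om x * (killing s x * u x)) v"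
  unfolding regional_split
  using inner2_lincomb_left[OF L2_indicator[OF L2_laplacian[OF u] borel_domain] L2_killing[OF u st] vL, of 1 "- ?C"] by simp
 also have "inner2 (%x. indicator Om x * frac_laplacian ?a u x) v = inner2 (frac_laplacian ?a u) v"
  unfolding inner2_def by (rule L1_integral_cong) (use H0_D(2)[OF v] in \<open>auto simp: indicator_def\<close>)
 also have "... = energy ?a u v / plancherel_const TYPE('a)"
  by (rule frac_laplacian_inner_right[OF us vL a(1)])
 finally have "inner2 (regional s u) v = energy ?a u v / plancherel_const TYPE('a) - ?C * inner2 (%x. indicator Om x * (killing s x * u x)) v" .
 moreover have "regional_form Om ?a u v = ?C / 2 * (?l * (energy ?a u v / plancherel_const TYPE('a)) - 2 * inner2 (%x. indicator Om x * (killing s x * u x)) v)"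
  unfolding regional_form_def inside[symmetric] using sum swap mixed G(2) by simp
 moreover have "?C / 2 * ?l = 1" using levy_const_pos[OF a, where 'a='a] by (simp add: frac_constant_eq[OF a])
 ultimately show ?thesis by (simp add: right_diff_distrib flip: mult.assoc)
qed

theorem regional_frac_laplacian_AE:
 assumes u: "u \<in> H0 t"
 shows "L2 (%x. indicator Om x * regional_frac_laplacian Om (s / 2) u x)"
  and "ae x. indicator Om x * regional_frac_laplacian Om (s / 2) u x = regional s u x"
proof -
 let ?P = "%g. square_integrable_on Om g \<and> (\<forall>v\<in>test_functions Om. (LINT x:Om|lborel. g x * v x) = regional_form Om (s / 2) u v)"
 have t: "0 < t" using st by simp
 have ind: "(%x. indicator Om x * regional s u x) = regional s u"
  by (rule ext) (auto simp: regional_def indicator_def)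
 have "?P (regional s u)"
 proof (intro conjI ballI)
  show "square_integrable_on Om (regional s u)" unfolding square_integrable_on_iff_L2 ind by (rule L2_regional[OF u])
  fix v assume v: "v \<in> test_functions Om"
  have "(LINT x:Om|lborel. regional s u x * v x) = inner2 (regional s u) v"
   unfolding set_lebesgue_integral_def inner2_def
   by (rule L1_integral_cong) (auto simp: indicator_def)
  then show "(LINT x:Om|lborel. regional s u x * v x) = regional_form Om (s / 2) u v"
   using regional_form_eq[OF u test_function_H0[OF v t st(3)]] by simp
 qed
 then have "\<exists>g. ?P g" by blast
 then have R: "?P (regional_frac_laplacian Om (s / 2) u)" unfolding regional_frac_laplacian_def by (rule someI_ex)
 let ?R = "%x. indicator Om x * regional_frac_laplacian Om (s / 2) u x"
 show RL: "L2 ?R" using R by (simp add: square_integrable_on_iff_L2)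
 define d where "d = (%x. ?R x - regional s u x)"
 have dL: "L2 d" unfolding d_def by (rule L2_diff[OF RL L2_regional[OF u]])
 have "ae x. x \<in> Om \<longrightarrow> d x = 0"
 proof (rule fundamental_lemma[OF open_domain L2_borel[OF dL]])
  fix p :: 'a and rho
  show "L1 (%x. indicator (cball p rho) x * d x)"
   using emeasure_lborel_cball_finite[of p rho] by (intro L2_mult_integrable[OF L2_indicator_set dL]) auto
 next
  fix v assume v: "v \<in> test_functions Om"
  have vH: "v \<in> H0 t" by (rule test_function_H0[OF v t st(3)])
  have "inner2 d v = inner2 ?R v - inner2 (regional s u) v"
   unfolding d_def by (rule inner2_diff_left[OF RL L2_regional[OF u] H0_L2[OF vH]])
  also have "inner2 ?R v = (LINT x:Om|lborel. regional_frac_laplacian Om (s / 2) u x * v x)"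
   unfolding inner2_def set_lebesgue_integral_def by (simp add: mult.assoc)
  also have "... = inner2 (regional s u) v" using R v regional_form_eq[OF u vH] by simp
  finally show "(LI x. d x * v x) = 0" by (simp add: inner2_def)
 qed
 then show "ae x. ?R x = regional s u x" by eventually_elim (auto simp: d_def indicator_def)
qed

lemma regional_off_support:
 assumes phi: "phi \<in> test_functions Om" and K: "compact K" "!!x. x \<notin> K ==> phi x = 0"
 shows "ae x. x \<in> Om - K \<longrightarrow>
  regional s phi x = - frac_constant TYPE('a) (s / 2) * (LI y. phi y / norm (x - y) powr (real DIM('a) + s))"
proof -
 have "0 < s / 2" "s / 2 < 1" using st by auto
 note off = frac_laplacian_off_support[OF phi K(1) _ this]
 have "ae x. x \<notin> K \<longrightarrow> \<Lambda> s phi x = - frac_constant TYPE('a) (s / 2) * (LI y. phi y / norm (x - y) powr (real DIM('a) + s))"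
  using off K(2) by simp
 then show ?thesis
 proof eventually_elim
  case (elim x)
  then show ?case using K(2)[of x] by (auto simp: regional_def)
 qed
qed

end

end

section \<open>The Hilbert space of the exterior value problem\<close>

text \<open>Uniformly bounded support makes the Fourier transforms equicontinuous.\<close>

lemma cft_lipschitz:
 fixes u :: "'a::euclidean_space => complex"
 assumes u: "L1 u" and supp: "!!x. R < norm x ==> u x = 0"
 shows "cmod (cft u xi - cft u eta) <= R * norm (xi - eta) * (LI x. cmod (u x))"
proof -
 have "cft u xi - cft u eta = (CLINT x|lborel. cis (- (x \<bullet> xi)) * u x - cis (- (x \<bullet> eta)) * u x)"
  unfolding cft_def using integrable_cis_mult[OF u] by simp
 also have "cmod ... <= (LI x. R * norm (xi - eta) * cmod (u x))"
 proof (rule order_trans[OF integral_norm_bound integral_mono])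
  show "L1 (%x. cmod (cis (- (x \<bullet> xi)) * u x - cis (- (x \<bullet> eta)) * u x))"
   using integrable_cis_mult[OF u] by (intro integrable_norm) simp
  show "L1 (%x. R * norm (xi - eta) * cmod (u x))" using u by simp
  fix x
  have "cis (- (x \<bullet> xi)) * u x - cis (- (x \<bullet> eta)) * u x = cis (- (x \<bullet> eta)) * ((cis (- (x \<bullet> (xi - eta))) - 1) * u x)"
   by (simp add: algebra_simps inner_diff_right cis_mult)
  then have "cmod (cis (- (x \<bullet> xi)) * u x - cis (- (x \<bullet> eta)) * u x) = cmod (cis (- (x \<bullet> (xi - eta))) - 1) * cmod (u x)"
   by (simp add: norm_mult)
  also have "... <= R * norm (xi - eta) * cmod (u x)"
  proof (cases "R < norm x")
   case False
   have "cmod (cis (- (x \<bullet> (xi - eta))) - 1) <= \<bar>x \<bullet> (xi - eta)\<bar>" using cis_minus_one_le[of "- (x \<bullet> (xi - eta))"] by simp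
   also have "... <= norm x * norm (xi - eta)" by (rule Cauchy_Schwarz_ineq2)
   also have "... <= R * norm (xi - eta)" using False by (intro mult_right_mono) auto
   finally show ?thesis by (rule mult_right_mono) simp
  qed (simp add: supp)
  finally show "cmod (cis (- (x \<bullet> xi)) * u x - cis (- (x \<bullet> eta)) * u x) <= R * norm (xi - eta) * cmod (u x)" .
 qed
 finally show ?thesis by simp
qed

lemma sqint_weighted_diff:
 fixes u v :: "'a::euclidean_space => real"
 assumes u: "in_H t u" and v: "in_H t v"
 shows "sqint (%xi. weighted t u xi - weighted t v xi)
  = plancherel_const TYPE('a) * sqint (\<Lambda> t (%x. u x - v x))"
proof -
 have uv: "in_H (2 * (t / 2)) (%x. u x - v x)" using in_H_diff[OF u v] by simp
 have "sqint (weighted t (%x. u x - v x)) = sqint (%xi. weighted t u xi - weighted t v xi)"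
  by (rule sqint_AE_cong)
   (use weighted_lincomb_AE[OF in_H_L2(1)[OF u] in_H_L2(1)[OF v], of t 1 "-1"] uv u v in \<open>auto dest!: in_H_L2(2)\<close>)
 then show ?thesis using sqint_frac_laplacian[OF uv] by simp
qed

lemma has_fourier_diff:
 assumes "has_fourier u g" "has_fourier v h"
 shows "has_fourier (%x. u x - v x) (%xi. g xi - h xi)"
 using has_fourier_lincomb[OF assms, of 1 "-1"] by simp

lemma in_H_complete:
 fixes f :: "nat => 'a::euclidean_space => real"
 assumes f: "!!n. in_H t (f n)"
  and C1: "!!e. 0 < e ==> \<exists>N. \<forall>m\<ge>N. \<forall>n\<ge>N. sqint (%x. f m x - f n x) < e"
  and C2: "!!e. 0 < e ==> \<exists>N. \<forall>m\<ge>N. \<forall>n\<ge>N. sqint (\<Lambda> t (%x. f m x - f n x)) < e"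
 shows "\<exists>l. in_H t l \<and> (%n. sqint (%x. f n x - l x)) ----> 0 \<and>
  (%n. sqint (\<Lambda> t (%x. f n x - l x))) ----> 0 \<and>
  (\<exists>r::nat => nat. ae x. (%k. f (r k) x) ----> l x)"
proof -
 let ?p = "plancherel_const TYPE('a)"
 have p: "?p > 0" by simp
 have fL: "L2 (f n)" and wL: "L2 (weighted t (f n))" for n using in_H_L2[OF f] by auto
 obtain l r where l: "L2 l" "(%n. sqint (%x. f n x - l x)) ----> 0" "ae x. (%k::nat. f (r k) x) ----> l x"
  using L2_complete[OF fL C1] by blast
 have "\<exists>N. \<forall>m\<ge>N. \<forall>n\<ge>N. sqint (%x. weighted t (f m) x - weighted t (f n) x) < e" if e: "0 < e" for e
 proof -
  obtain N where "!!m n. N <= m ==> N <= n ==> sqint (\<Lambda> t (%x. f m x - f n x)) < e / ?p"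
   using C2[of "e / ?p"] p e by auto
  then show ?thesis unfolding sqint_weighted_diff[OF f f] using p by (auto simp: field_simps intro!: exI[of _ N])
 qed
 from L2_complete[OF wL this] obtain g r1 where g: "L2 g" "(%n. sqint (%x. weighted t (f n) x - g x)) ----> 0"
  "strict_mono r1" "ae x. (%k::nat. weighted t (f (r1 k)) x) ----> g x" by blast
 have "\<exists>N. \<forall>m\<ge>N. \<forall>n\<ge>N. sqint (%x. fourier (f (r1 m)) x - fourier (f (r1 n)) x) < e" if e: "0 < e" for e
 proof -
  obtain N where N: "!!m n. N <= m ==> N <= n ==> sqint (%x. f m x - f n x) < e / ?p"
   using C1[of "e / ?p"] p e by auto
  have "sqint (%x. fourier (f (r1 m)) x - fourier (f (r1 n)) x) < e" if "N <= m" "N <= n" for m n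
  proof -
   have "sqint (%x. fourier (f (r1 m)) x - fourier (f (r1 n)) x) = ?p * sqint (%x. f (r1 m) x - f (r1 n) x)"
    by (rule plancherel_real[OF has_fourier_diff[OF has_fourier_fourier[OF fL] has_fourier_fourier[OF fL]]])
   then show ?thesis using N[of "r1 m" "r1 n"] that seq_suble[OF g(3), of m] seq_suble[OF g(3), of n] p
    by (simp add: field_simps)
  qed
  then show ?thesis by blast
 qed
 from L2_complete[OF L2_fourier[OF fL] this] obtain h r2 where h: "L2 h"
  "(%n. sqint (%x. fourier (f (r1 n)) x - h x)) ----> 0" "strict_mono r2"
  "ae x. (%k::nat. fourier (f (r1 (r2 k))) x) ----> h x" by blast
 have lim: "(%n. sqint (%x. f (r1 n) x - l x)) ----> 0"
  using LIMSEQ_subseq_LIMSEQ[OF l(2) g(3)] by (simp add: o_def)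
 have Fl: "has_fourier l h" by (rule has_fourier_limit[OF has_fourier_fourier[OF fL] l(1) h(1) lim h(2)])
 have gl: "ae xi. g xi = weighted t l xi"
  using g(4) h(4) fourier_unique[OF Fl]
 proof eventually_elim
  case (elim xi)
  have "(%k. weighted t (f (r1 (r2 k))) xi) ----> weighted t l xi"
   unfolding weighted_def elim(3) by (intro tendsto_intros elim(2))
  moreover have "(%k. weighted t (f (r1 (r2 k))) xi) ----> g xi"
   using LIMSEQ_subseq_LIMSEQ[OF elim(1) h(3)] by (simp add: o_def)
  ultimately show ?case by (rule LIMSEQ_unique[rotated])
 qed
 have lH: "in_H t l" unfolding in_H_def using l(1) L2_AE_cong[OF g(1) borel_measurable_weighted[OF l(1)] gl] by blast
 have "sqint (%x. weighted t (f n) x - g x) = ?p * sqint (\<Lambda> t (%x. f n x - l x))" for n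
 proof -
  have "sqint (%x. weighted t (f n) x - g x) = sqint (%x. weighted t (f n) x - weighted t l x)"
   by (rule sqint_AE_cong) (use gl L2_borel[OF L2_diff[OF wL g(1)]] L2_borel[OF L2_diff[OF wL in_H_L2(2)[OF lH]]] in auto)
  then show ?thesis using sqint_weighted_diff[OF f lH] by simp
 qed
 then have "(%n. ?p * sqint (\<Lambda> t (%x. f n x - l x))) ----> 0" using g(2) by simp
 from tendsto_mult[OF tendsto_const[of "1 / ?p"] this]
 have "(%n. sqint (\<Lambda> t (%x. f n x - l x))) ----> 0" using p by simp
 then show ?thesis using lH l by blast
qed

definition sobolev_ip :: "real => ('a::euclidean_space => real) => ('a => real) => real" where
 "sobolev_ip t u v = inner2 u v + inner2 (\<Lambda> t u) (\<Lambda> t v)"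

definition low_frequency :: "real => ('a::euclidean_space => real) => real" where
 "low_frequency N u = sqint (%xi. indicator (cball 0 N) xi *\<^sub>R fourier u xi)"

lemma sobolev_ip_self: "sobolev_ip t u u = sqint u + sqint (\<Lambda> t u)"
 by (simp add: sobolev_ip_def inner2_self)

lemma sobolev_ip_lincomb:
 assumes u: "in_H t u" and v: "in_H t v" and w: "in_H t w"
 shows "sobolev_ip t (%x. a * u x + b * v x) w = a * sobolev_ip t u w + b * sobolev_ip t v w"
  and "inner2 (\<Lambda> t (%x. a * u x + b * v x)) (\<Lambda> t w)
   = a * inner2 (\<Lambda> t u) (\<Lambda> t w) + b * inner2 (\<Lambda> t v) (\<Lambda> t w)"
proof -
 have H: "in_H (2 * (t / 2)) u" "in_H (2 * (t / 2)) v" "in_H (2 * (t / 2)) w" "in_H (2 * (t / 2)) (%x. a * u x + b * v x)"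
  using u v w in_H_lincomb[OF u v] by auto
 note L = H[THEN L2_frac_laplacian]
 have "inner2 (\<Lambda> t (%x. a * u x + b * v x)) (\<Lambda> t w)
  = inner2 (%x. a * \<Lambda> t u x + b * \<Lambda> t v x) (\<Lambda> t w)"
  by (rule inner2_AE_cong) (use L L2_add[OF L2_mult[OF L(1)] L2_mult[OF L(2)]] frac_laplacian_lincomb[OF H(1,2)] in \<open>auto dest: L2_borel\<close>)
 also have "... = a * inner2 (\<Lambda> t u) (\<Lambda> t w) + b * inner2 (\<Lambda> t v) (\<Lambda> t w)"
  by (rule inner2_lincomb_left[OF L(1-3)])
 finally show *: "inner2 (\<Lambda> t (%x. a * u x + b * v x)) (\<Lambda> t w)
   = a * inner2 (\<Lambda> t u) (\<Lambda> t w) + b * inner2 (\<Lambda> t v) (\<Lambda> t w)" .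
 show "sobolev_ip t (%x. a * u x + b * v x) w = a * sobolev_ip t u w + b * sobolev_ip t v w"
  unfolding sobolev_ip_def * inner2_lincomb_left[OF in_H_L2(1)[OF u] in_H_L2(1)[OF v] in_H_L2(1)[OF w]]
  by (simp add: algebra_simps)
qed

lemma L2_compact_support_integrable:
 fixes u :: "'a::euclidean_space => real"
 assumes u: "L2 u" and B: "bounded B" and u0: "!!x. x \<notin> B ==> u x = 0"
 shows "L1 u" "B \<subseteq> cball 0 R ==> (LI x. \<bar>u x\<bar>) <= measure lborel (cball (0::'a) R) + sqint u"
proof -
 have *: "L1 u \<and> (LI x. \<bar>u x\<bar>) <= measure lborel (cball (0::'a) R) + sqint u" if R: "B \<subseteq> cball 0 R" for R
 proof -
  have c: "L1 (indicator (cball (0::'a) R) :: 'a => real)"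
   using emeasure_lborel_cball_finite[of "0::'a" R] by (intro integrable_real_indicator) auto
  have ib: "L1 (%x. indicator (cball 0 R) x + (norm (u x))\<^sup>2)"
   by (rule L1_integrable_add[OF c L2_integrable[OF u]])
  have le: "\<bar>u x\<bar> <= indicator (cball 0 R) x + (norm (u x))\<^sup>2" for x
  proof (cases "x \<in> cball 0 R")
   case True
   have "0 <= (\<bar>u x\<bar> - 1)\<^sup>2" by simp
   then have "2 * \<bar>u x\<bar> <= 1 + (norm (u x))\<^sup>2" by (simp add: power2_diff)
   then have "\<bar>u x\<bar> <= 1 + (norm (u x))\<^sup>2" by linarith
   then show ?thesis using True by simp
  next
   case False
   then have "u x = 0" using R by (intro u0) blast
   then show ?thesis by simp
  qed
  have i: "L1 u"
   by (rule L1_integrable_bound[OF ib]) (use L2_borel[OF u] in \<open>auto intro!: AE_I2 order_trans[OF le]\<close>)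
  have "(LI x. \<bar>u x\<bar>) <= (LI x. indicator (cball 0 R) x + (norm (u x))\<^sup>2)"
   by (rule integral_mono[OF integrable_abs[OF i] ib le])
  then show ?thesis using i L1_integral_add[OF c L2_integrable[OF u]] by (simp add: sqint_def)
 qed
 obtain r where "!!x. x \<in> B ==> norm x <= r" using B by (auto simp: bounded_iff)
 then have "B \<subseteq> cball 0 r" by auto
 then show "L1 u" using * by blast
 show "B \<subseteq> cball 0 R ==> (LI x. \<bar>u x\<bar>) <= measure lborel (cball (0::'a) R) + sqint u" using * by blast
qed

lemma sobolev_ip_AE_zero:
 fixes u :: "'a::euclidean_space => real"
 assumes u: "in_H t u" and ae: "ae x. u x = 0"
 shows "sobolev_ip t u u = 0"
proof -
 note L = in_H_L2[OF u]
 have 0: "sqint u = 0" using sqint_eq_0_iff[OF L(1)] ae by simp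
 then have "sqint (fourier u) = 0" using plancherel_real[OF has_fourier_fourier[OF L(1)]] by simp
 then have "ae xi. fourier u xi = 0" using sqint_eq_0_iff[OF L2_fourier[OF L(1)]] by simp
 then have "ae xi. weighted t u xi = 0" by eventually_elim (simp add: weighted_def)
 then have "sqint (weighted t u) = 0" using sqint_eq_0_iff[OF L(2)] by simp
 then have "sqint (\<Lambda> t u) = 0" using sqint_frac_laplacian[of "t / 2" u] u by simp
 then show ?thesis using 0 by (simp add: sobolev_ip_self)
qed

context lipschitz_domain
begin

lemma H0_AE_limit:
 assumes l: "in_H t l" and f: "!!n. f n \<in> H0 t" and lim: "ae x. (%k. f (r k) x) ----> l x"
 shows "\<exists>l'\<in>H0 t. ae x. l x = l' x"
proof
 have AE: "ae x. l x = indicator Om x * l x"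
  using lim
 proof eventually_elim
  case (elim x)
  show ?case
  proof (cases "x \<in> Om")
   case False
   then have "(%k. f (r k) x) = (%k. 0)" using H0_D(2)[OF f] by auto
   then have "l x = 0" using elim by (simp add: LIMSEQ_const_iff)
   then show ?thesis by simp
  qed simp
 qed
 have [measurable]: "l \<in> Borel" using l by (auto intro: L2_borel in_H_L2)
 have "in_H t (%x. indicator Om x * l x)" by (rule in_H_AE_cong(1)[OF l _ AE]) measurable
 then show "(%x. indicator Om x * l x) \<in> H0 t" by (simp add: H0_def)
 show "ae x. l x = indicator Om x * l x" by (rule AE)
qed

lemma frac_laplacian_AE_cong:
 assumes u: "in_H t u" and v: "v \<in> Borel" "ae x. u x = v x"
 shows "ae x. \<Lambda> t u x = \<Lambda> t v x"
proof (rule frac_laplacian_unique)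
 have vH: "in_H (2 * (t / 2)) v" using in_H_AE_cong(1)[OF u v] by simp
 show "in_H (2 * (t / 2)) u" using u by simp
 show "has_fourier (\<Lambda> t v) (weighted (2 * (t / 2)) v)" by (rule has_fourier_frac_laplacian[OF vH])
 show "ae xi. weighted (2 * (t / 2)) v xi = weighted (2 * (t / 2)) u xi"
  using in_H_AE_cong(2)[OF u v] by eventually_elim simp
qed

lemma semi_hilbert_H0: "semi_hilbert (H0 t) (sobolev_ip t)"
proof
 have "in_H t (%x::'a. 0)"
 proof -
  have "has_fourier (%x::'a. 0::real) (%xi. 0)"
   using has_fourier_lincomb[OF has_fourier_fourier[OF L2_zero] has_fourier_fourier[OF L2_zero], of 0 0] by simp
  from fourier_unique[OF this] have "ae xi. weighted t (%x::'a. 0) xi = 0"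
   by eventually_elim (simp add: weighted_def)
  then have "L2 (weighted t (%x::'a. 0))"
   by (intro L2_AE_cong[OF L2_zero borel_measurable_weighted[OF L2_zero]]) (simp add: AE_symmetric)
  then show ?thesis by (simp add: in_H_def)
 qed
 then have "(%x. 0) \<in> H0 t" by (simp add: H0_def)
 then show "H0 t ~= {}" by blast
next
 fix f :: "nat => 'a => real"
 assume f: "!!n. f n \<in> H0 t" and C: "!!e. 0 < e ==> \<exists>N. \<forall>m\<ge>N. \<forall>n\<ge>N. sobolev_ip t (%x. f m x - f n x) (%x. f m x - f n x) < e"
 have fH: "in_H t (f n)" for n by (rule H0_D(1)[OF f])
 have C1: "\<exists>N. \<forall>m\<ge>N. \<forall>n\<ge>N. sqint (%x. f m x - f n x) < e"
  and C2: "\<exists>N. \<forall>m\<ge>N. \<forall>n\<ge>N. sqint (\<Lambda> t (%x. f m x - f n x)) < e" if "0 < e" for e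
  using C[OF that] unfolding sobolev_ip_self
  by (meson sqint_nonneg add_le_same_cancel1 add_le_same_cancel2 le_add_same_cancel1 le_add_same_cancel2 le_less_trans)+
 obtain l r where l: "in_H t l" "(%n. sqint (%x. f n x - l x)) ----> 0"
  "(%n. sqint (\<Lambda> t (%x. f n x - l x))) ----> 0" "ae x. (%k. f (r k) x) ----> l x"
  using in_H_complete[OF fH C1 C2] by blast
 obtain l' where l': "l' \<in> H0 t" "ae x. l x = l' x" using H0_AE_limit[of t l f r] l(1,4) f by blast
 have eq: "sobolev_ip t (%x. f n x - l' x) (%x. f n x - l' x) = sqint (%x. f n x - l x) + sqint (\<Lambda> t (%x. f n x - l x))" for n
 proof -
  have d: "in_H t (%x. f n x - l x)" "in_H t (%x. f n x - l' x)" using fH l(1) H0_D(1)[OF l'(1)] by (auto intro: in_H_diff)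
  then have d2: "in_H (2 * (t / 2)) (%x. f n x - l x)" "in_H (2 * (t / 2)) (%x. f n x - l' x)" by auto
  have b: "(%x. f n x - l x) \<in> Borel" "(%x. f n x - l' x) \<in> Borel"
   using d by (auto dest!: in_H_L2(1) L2_borel)
  have ae: "ae x. f n x - l x = f n x - l' x" using l'(2) by eventually_elim simp
  have "sqint (%x. f n x - l x) = sqint (%x. f n x - l' x)" by (rule sqint_AE_cong[OF b ae])
  moreover have "sqint (\<Lambda> t (%x. f n x - l x)) = sqint (\<Lambda> t (%x. f n x - l' x))"
   by (rule sqint_AE_cong[OF L2_borel[OF L2_frac_laplacian[OF d2(1)]] L2_borel[OF L2_frac_laplacian[OF d2(2)]]
      frac_laplacian_AE_cong[OF d(1) b(2) ae]])
  ultimately show ?thesis unfolding sobolev_ip_self by simp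
 qed
 have "(%n. sobolev_ip t (%x. f n x - l' x) (%x. f n x - l' x)) ----> 0"
  unfolding eq using tendsto_add[OF l(2,3)] by simp
 then show "\<exists>l\<in>H0 t. (%n. sobolev_ip t (%x. f n x - l x) (%x. f n x - l x)) ----> 0" using l'(1) by blast
next
 show "sobolev_ip t u v = sobolev_ip t v u" for u v :: "'a => real"
  unfolding sobolev_ip_def by (simp only: inner2_commute)
qed (auto simp: H0_lincomb H0_D sobolev_ip_lincomb(1) sobolev_ip_self)

text \<open>Compactness of the low frequency part: functions supported in \<open>Om\<close> and bounded in \<open>L\<^sup>2\<close> have
 equicontinuous Fourier transforms.\<close>

lemma low_frequency_compact:
 assumes f: "!!n::nat. f n \<in> H0 t" and bound: "!!n. sqint (f n) <= 1"
 shows "\<exists>r::nat => nat. strict_mono r \<and> (\<forall>e>0. \<exists>n0. \<forall>i\<ge>n0. \<forall>j\<ge>n0. low_frequency N (%x. f (r i) x - f (r j) x) < e)"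
proof -
 obtain R where R: "R > 0" "!!x. x \<in> Om ==> norm x <= R" using bounded_domain by (auto simp: bounded_pos)
 have fL: "L2 (f n)" for n using H0_D(1)[OF f] by (rule in_H_L2(1))
 have [measurable]: "f n \<in> Borel" for n using fL by auto
 have off: "f n x = 0" if "x \<notin> cball 0 R" for n x using that R(2) H0_D(2)[OF f] by force
 define L where "L = measure lborel (cball (0::'a) R) + 1"
 have if1: "L1 (f n)" and L1: "(LI x. \<bar>f n x\<bar>) <= L" for n
 proof -
  show "L1 (f n)" by (rule L2_compact_support_integrable(1)[OF fL bounded_cball off])
  have "(LI x. \<bar>f n x\<bar>) <= measure lborel (cball (0::'a) R) + sqint (f n)"
   by (rule L2_compact_support_integrable(2)[OF fL bounded_cball off order_refl])
  then show "(LI x. \<bar>f n x\<bar>) <= L" using bound[of n] by (simp add: L_def)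
 qed
 have L0: "0 <= L" by (simp add: L_def)
 let ?u = "%n x. cplx (f n x)"
 have iu: "L1 (?u n)" for n using if1 by simp
 have F: "has_fourier (f n) (cft (?u n))" for n
  using has_cft_integrable[OF iu] fL by (simp add: has_fourier_iff L2_of_real_iff)
 have b: "cmod (cft (?u n) xi) <= L" for n xi using cft_bound[OF iu, of n xi] L1[of n] by simp
 have lip: "cmod (cft (?u n) xi - cft (?u n) eta) <= R * L * norm (xi - eta)" for n xi eta
 proof -
  have "cmod (cft (?u n) xi - cft (?u n) eta) <= R * norm (xi - eta) * (LI x. cmod (?u n x))"
   by (rule cft_lipschitz[OF iu]) (use off in auto)
  also have "... <= R * norm (xi - eta) * L" using L1[of n] R(1) by (intro mult_left_mono) auto
  finally show ?thesis by (simp add: mult_ac)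
 qed
 have "\<exists>g k. strict_mono (k::nat => nat) \<and> (\<forall>e>0. \<exists>n0. \<forall>n x. n >= n0 \<and> x \<in> cball 0 N \<longrightarrow> cmod (cft (?u (k n)) x - g x) < e)"
 proof (rule Arzela_Ascoli[of "cball (0::'a) N" "%n. cft (?u n)" L])
  show "compact (cball (0::'a) N)" by simp
  show "cmod (cft (?u n) x) <= L" for n x by (rule b)
  fix x :: 'a and e :: real assume e: "0 < e"
  have "cmod (cft (?u n) x - cft (?u n) y) < e" if "norm (x - y) < e / (R * L + 1)" for n y
  proof -
   have "cmod (cft (?u n) x - cft (?u n) y) <= (R * L) * norm (x - y)" by (rule lip)
   also have "... <= (R * L + 1) * norm (x - y)" by (intro mult_right_mono) auto
   also have "... < e" using that R(1) L0 by (simp add: field_simps add_pos_nonneg)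
   finally show ?thesis .
  qed
  moreover have "0 < e / (R * L + 1)" using e R(1) L0 by (simp add: add_nonneg_pos)
  ultimately show "\<exists>d>0. \<forall>n y. y \<in> cball 0 N \<and> norm (x - y) < d \<longrightarrow> cmod (cft (?u n) x - cft (?u n) y) < e" by blast
 qed blast
 then obtain g k where k: "strict_mono (k::nat => nat)"
  and g: "!!e. 0 < e ==> \<exists>n0. \<forall>n x. n >= n0 \<and> x \<in> cball 0 N \<longrightarrow> cmod (cft (?u (k n)) x - g x) < e" by blast
 have "\<exists>n0. \<forall>i\<ge>n0. \<forall>j\<ge>n0. low_frequency N (%x. f (k i) x - f (k j) x) < e" if e: "0 < e" for e
 proof -
  let ?V = "measure lborel (cball (0::'a) N)"
  define delta where "delta = sqrt (e / (?V + 1)) / 2"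
  have delta: "0 < delta" "(2 * delta)\<^sup>2 * ?V < e"
  proof -
   show "0 < delta" using e by (simp add: delta_def add_nonneg_pos)
   have "0 <= e / (?V + 1)" using e by simp
   then have "(2 * delta)\<^sup>2 = e / (?V + 1)" by (simp add: delta_def)
   then have "(2 * delta)\<^sup>2 * ?V = e * (?V / (?V + 1))" by simp
   also have "... < e * 1" using e by (intro mult_strict_left_mono) (auto simp: add_nonneg_pos)
   finally show "(2 * delta)\<^sup>2 * ?V < e" by simp
  qed
  obtain n0 where n0: "!!n x. n >= n0 ==> x \<in> cball 0 N ==> cmod (cft (?u (k n)) x - g x) < delta" using g[OF delta(1)] by blast
  have "low_frequency N (%x. f (k i) x - f (k j) x) < e" if ij: "i >= n0" "j >= n0" for i j
  proof -
   let ?d = "%xi. cft (?u (k i)) xi - cft (?u (k j)) xi"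
   have Fd: "has_fourier (%x. f (k i) x - f (k j) x) ?d" by (rule has_fourier_diff[OF F F])
   have dL: "L2 ?d" by (rule has_fourier_L2(2)[OF Fd])
   have "low_frequency N (%x. f (k i) x - f (k j) x) = sqint (%xi. indicator (cball 0 N) xi *\<^sub>R ?d xi)"
    unfolding low_frequency_def
   proof (rule sqint_AE_cong)
    show "(%xi. indicator (cball 0 N) xi *\<^sub>R fourier (%x. f (k i) x - f (k j) x) xi) \<in> Borel"
     by (intro borel_measurable_scaleR borel_measurable_indicator L2_borel[OF L2_fourier[OF has_fourier_L2(1)[OF Fd]]]) auto
    show "(%xi. indicator (cball 0 N) xi *\<^sub>R ?d xi) \<in> Borel"
     by (intro borel_measurable_scaleR borel_measurable_indicator L2_borel[OF dL]) auto
   qed (use fourier_unique[OF Fd] in auto)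
   also have "... <= (LI xi. (2 * delta)\<^sup>2 * indicator (cball (0::'a) N) xi)"
    unfolding sqint_def
   proof (rule integral_mono)
    show "L1 (%xi. (norm (indicator (cball 0 N) xi *\<^sub>R ?d xi))\<^sup>2)"
     by (rule L2_integrable[OF L2_dominated[where C=1, OF _ dL]])
      (auto intro!: borel_measurable_scaleR borel_measurable_indicator L2_borel[OF dL] simp: indicator_def)
    show "L1 (%xi. (2 * delta)\<^sup>2 * indicator (cball (0::'a) N) xi)"
     using emeasure_lborel_cball_finite[of "0::'a" N] by (intro integrable_mult_right integrable_real_indicator) auto
    fix xi :: 'a
    show "(norm (indicator (cball 0 N) xi *\<^sub>R ?d xi))\<^sup>2 <= (2 * delta)\<^sup>2 * indicator (cball 0 N) xi"
    proof (cases "xi \<in> cball 0 N")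
     case True
     have "cmod (?d xi) <= cmod (cft (?u (k i)) xi - g xi) + cmod (cft (?u (k j)) xi - g xi)"
      using norm_triangle_ineq4[of "cft (?u (k i)) xi - g xi" "cft (?u (k j)) xi - g xi"] by simp
     then have "cmod (?d xi) <= 2 * delta" using n0[OF ij(1) True] n0[OF ij(2) True] by linarith
     from power_mono[OF this norm_ge_zero, of 2] show ?thesis using True by simp
    qed simp
   qed
   also have "... = (2 * delta)\<^sup>2 * ?V" by simp
   finally show ?thesis using delta(2) by linarith
  qed
  then show ?thesis by blast
 qed
 then show ?thesis using k by blast
qed

end

section \<open>Solvability\<close>

text \<open>The higher power wins for large \<open>r\<close>; the indicator absorbs the rest.\<close>

lemma frequency_split:
 fixes s t A :: real
 assumes st: "0 < s" "s < t" and A: "0 <= A"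
 shows "\<exists>N D. 0 <= D \<and> (\<forall>r\<ge>0. A * ((r powr s)\<^sup>2 + 1) <= (r powr t)\<^sup>2 / 2 - 1 / 2 + D * (if r <= N then 1 else 0))"
proof -
 define N where "N = max 1 ((4 * A + 2) powr (1 / (2 * (t - s))))"
 define D where "D = A * ((N powr s)\<^sup>2 + 1) + 1 / 2"
 have N: "1 <= N" by (simp add: N_def)
 have D: "0 <= D" using A by (simp add: D_def)
 have "A * ((r powr s)\<^sup>2 + 1) <= (r powr t)\<^sup>2 / 2 - 1 / 2 + D * (if r <= N then 1 else 0)" if r: "0 <= r" for r
 proof (cases "r <= N")
  case True
  have "(r powr s)\<^sup>2 <= (N powr s)\<^sup>2" using r True st by (intro power_mono powr_mono2) auto
  then have "A * ((r powr s)\<^sup>2 + 1) <= A * ((N powr s)\<^sup>2 + 1)" using A by (intro mult_left_mono) auto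
  moreover have "0 <= (r powr t)\<^sup>2 / 2" by simp
  ultimately have "A * ((r powr s)\<^sup>2 + 1) <= (r powr t)\<^sup>2 / 2 - 1 / 2 + (A * ((N powr s)\<^sup>2 + 1) + 1 / 2)" by linarith
  then show ?thesis using True unfolding D_def by (simp only: if_True mult_1_right)
 next
  case False
  then have r1: "1 < r" using N by linarith
  have "4 * A + 2 = ((4 * A + 2) powr (1 / (2 * (t - s)))) powr (2 * (t - s))"
   using A st by (simp add: powr_powr)
  also have "... <= r powr (2 * (t - s))"
   using False st by (intro powr_mono2) (auto simp: N_def)
  finally have big: "4 * A + 2 <= r powr (2 * (t - s))" .
  have sq: "(r powr x)\<^sup>2 = r powr (2 * x)" for x by (simp add: power2_eq_square flip: powr_add)
  have one: "1 <= r powr (2 * s)" using r1 st by (intro ge_one_powr_ge_zero) auto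
  have "(4 * A + 2) * r powr (2 * s) <= r powr (2 * (t - s)) * r powr (2 * s)" by (rule mult_right_mono[OF big]) simp
  also have "... = r powr (2 * t)" by (simp flip: powr_add add: algebra_simps)
  finally have "4 * (A * r powr (2 * s)) + 2 * r powr (2 * s) <= r powr (2 * t)" by (simp add: algebra_simps)
  moreover have "A * 1 <= A * r powr (2 * s)" by (rule mult_left_mono[OF one A])
  ultimately show ?thesis using False one unfolding sq by (simp add: distrib_left)
 qed
 then show ?thesis using D by blast
qed

text \<open>Interpolation: lower order terms are absorbed up to a low frequency part.\<close>

lemma lower_order_absorption:
 fixes s t A :: real
 assumes st: "0 < s" "s < t" and A: "0 <= A"
 shows "\<exists>N D. 0 <= D \<and> (\<forall>u::'a::euclidean_space => real. in_H t u \<longrightarrow>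
  A * (sqint (\<Lambda> s u) + sqint u) <= sqint (\<Lambda> t u) / 2 - sqint u / 2 + D * low_frequency N u)"
proof -
 let ?p = "plancherel_const TYPE('a)"
 have p: "?p > 0" by simp
 obtain N D where D: "0 <= D" and ND: "!!r. 0 <= r ==> A * ((r powr s)\<^sup>2 + 1) <= (r powr t)\<^sup>2 / 2 - 1 / 2 + D * (if r <= N then 1 else 0)"
  using frequency_split[OF st A] by blast
 have "A * (sqint (\<Lambda> s u) + sqint u) <= sqint (\<Lambda> t u) / 2 - sqint u / 2 + D / ?p * low_frequency N u"
  if u: "in_H t u" for u :: "'a => real"
 proof -
  have us: "in_H s u" using in_H_mono[OF u, of s] st by simp
  have FL: "L2 (fourier u)" by (rule L2_fourier[OF in_H_L2(1)[OF u]])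
  have ls: "L2 (%xi. indicator (cball 0 N) xi *\<^sub>R fourier u xi)"
   by (rule L2_dominated[where C=1, OF _ FL])
    (auto intro!: borel_measurable_scaleR borel_measurable_indicator L2_borel[OF FL] simp: indicator_def)
  have i: "L1 (%xi. (norm (fourier u xi))\<^sup>2)" "L1 (%xi. (norm (weighted s u xi))\<^sup>2)"
   "L1 (%xi. (norm (weighted t u xi))\<^sup>2)" "L1 (%xi. (norm (indicator (cball 0 N) xi *\<^sub>R fourier u xi))\<^sup>2)"
   by (rule L2_integrable[OF FL] L2_integrable[OF in_H_L2(2)[OF us]] L2_integrable[OF in_H_L2(2)[OF u]] L2_integrable[OF ls])+
  have "(LI xi. A * ((norm (weighted s u xi))\<^sup>2 + (norm (fourier u xi))\<^sup>2))
   <= (LI xi. (norm (weighted t u xi))\<^sup>2 / 2 - (norm (fourier u xi))\<^sup>2 / 2 + D * (norm (indicator (cball 0 N) xi *\<^sub>R fourier u xi))\<^sup>2)"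
  proof (rule integral_mono)
   fix xi :: 'a
   have "(A * ((norm xi powr s)\<^sup>2 + 1)) * (norm (fourier u xi))\<^sup>2
    <= ((norm xi powr t)\<^sup>2 / 2 - 1 / 2 + D * (if norm xi <= N then 1 else 0)) * (norm (fourier u xi))\<^sup>2"
    by (rule mult_right_mono[OF ND]) auto
   then have "A * ((norm xi powr s)\<^sup>2 * (norm (fourier u xi))\<^sup>2 + (norm (fourier u xi))\<^sup>2)
    <= (norm xi powr t)\<^sup>2 * (norm (fourier u xi))\<^sup>2 / 2 - (norm (fourier u xi))\<^sup>2 / 2 + D * ((if norm xi <= N then 1 else 0) * (norm (fourier u xi))\<^sup>2)"
    by (simp only: distrib_left distrib_right left_diff_distrib mult_1_left mult_1_right mult.assoc times_divide_eq_left)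
   moreover have "(if norm xi <= N then 1 else 0) * (norm (fourier u xi))\<^sup>2 = (norm (indicator (cball 0 N) xi *\<^sub>R fourier u xi))\<^sup>2"
    by (auto simp: indicator_def)
   moreover have "(norm (weighted r u xi))\<^sup>2 = (norm xi powr r)\<^sup>2 * (norm (fourier u xi))\<^sup>2" for r
    unfolding weighted_def norm_scaleR power_mult_distrib by simp
   ultimately show "A * ((norm (weighted s u xi))\<^sup>2 + (norm (fourier u xi))\<^sup>2)
    <= (norm (weighted t u xi))\<^sup>2 / 2 - (norm (fourier u xi))\<^sup>2 / 2 + D * (norm (indicator (cball 0 N) xi *\<^sub>R fourier u xi))\<^sup>2"
    by (simp only:)
  qed (use i in simp_all)
  then have main: "A * (sqint (weighted s u) + sqint (fourier u)) <= sqint (weighted t u) / 2 - sqint (fourier u) / 2 + D * low_frequency N u"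
   unfolding sqint_def low_frequency_def using i by simp
  have e: "sqint (weighted s u) = ?p * sqint (\<Lambda> s u)" "sqint (weighted t u) = ?p * sqint (\<Lambda> t u)"
   "sqint (fourier u) = ?p * sqint u"
   using sqint_frac_laplacian[of "s / 2" u] sqint_frac_laplacian[of "t / 2" u] u us
    plancherel_real[OF has_fourier_fourier[OF in_H_L2(1)[OF u]]] by auto
  have "?p * (A * (sqint (\<Lambda> s u) + sqint u)) <= ?p * (sqint (\<Lambda> t u) / 2 - sqint u / 2 + D / ?p * low_frequency N u)"
   using main unfolding e using p by (simp add: algebra_simps)
  then show ?thesis using p by (simp only: mult_le_cancel_left_pos)
 qed
 then show ?thesis using D p by (intro exI[of _ N] exI[of _ "D / ?p"]) auto
qed

lemma low_frequency_le:
 fixes u :: "'a::euclidean_space => real"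
 assumes "L2 u" shows "low_frequency N u <= plancherel_const TYPE('a) * sqint u"
proof -
 have FL: "L2 (fourier u)" by (rule L2_fourier[OF assms])
 have "low_frequency N u <= 1\<^sup>2 * sqint (fourier u)" unfolding low_frequency_def
  by (rule sqint_le[OF _ FL])
   (auto intro!: borel_measurable_scaleR borel_measurable_indicator L2_borel[OF FL] simp: indicator_def)
 then show ?thesis using plancherel_real[OF has_fourier_fourier[OF assms]] by simp
qed

context lipschitz_domain
begin

text \<open>The form of the equation; \<open>b\<close> and \<open>q\<close> are representatives of the coefficients that vanish off \<open>K\<close>.\<close>

definition form :: "real => real => ('a => real) => ('a => real) => ('a => real) => ('a => real) => real" where
 "form s t b q u v = inner2 (\<Lambda> t u) (\<Lambda> t v)
  + inner2 (regional s u) (%x. b x * regional s v x) + inner2 u (%x. q x * v x)"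

end

locale schrodinger = lipschitz_domain Om for Om :: "'a::euclidean_space set" +
 fixes s t :: real and b q :: "'a => real" and M :: real and K :: "'a set"
 assumes st: "0 < s" "s < t" "t < 1"
  and K: "compact K" "K \<subseteq> Om" and M: "0 <= M"
  and b: "b \<in> Borel" "!!x. \<bar>b x\<bar> <= M" "!!x. x \<notin> K ==> b x = 0"
  and q: "q \<in> Borel" "!!x. \<bar>q x\<bar> <= M" "!!x. x \<notin> K ==> q x = 0"
begin

lemma borel_K [measurable]: "K \<in> sets borel" using K(1) by (rule borel_compact)

lemma L2_coeff:
 assumes "c \<in> Borel" "!!x. \<bar>c x\<bar> <= M" "L2 (w :: 'a => real)"
 shows "L2 (%x. c x * w x)"
 by (rule L2_dominated[where C=M, OF _ assms(3)]) (use assms in \<open>auto simp: abs_mult mult_right_mono\<close>)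

lemma H0_laplacian: "u \<in> H0 t ==> L2 (\<Lambda> t u)"
 by (rule L2_frac_laplacian) (use H0_D(1) in auto)

lemmas regional_L2 = L2_regional[OF st]
lemmas zero_L2 = H0_L2[OF st]

lemma L2_on_K: "L2 (w :: 'a => real) ==> L2 (%x. indicator K x * w x)"
 by (rule L2_dominated[where C=1 and g=w]) (auto simp: indicator_def)

lemma form_lincomb:
 assumes u: "u \<in> H0 t" and v: "v \<in> H0 t" and w: "w \<in> H0 t"
 shows "form s t b q (%x. a * u x + c * v x) w = a * form s t b q u w + c * form s t b q v w"
proof -
 let ?uv = "%x. a * u x + c * v x"
 have uv: "?uv \<in> H0 t" by (rule H0_lincomb[OF u v])
 note R = regional_L2[OF u] regional_L2[OF v] regional_L2[OF w] regional_L2[OF uv]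
 have bR: "L2 (%x. b x * regional s w x)" by (rule L2_coeff[OF b(1,2) R(3)])
 have qw: "L2 (%x. q x * w x)" by (rule L2_coeff[OF q(1,2) zero_L2[OF w]])
 have "inner2 (regional s ?uv) (%x. b x * regional s w x) = inner2 (%x. a * regional s u x + c * regional s v x) (%x. b x * regional s w x)"
  by (rule inner2_AE_cong[OF L2_borel[OF R(4)] L2_borel[OF L2_add[OF L2_mult[OF R(1)] L2_mult[OF R(2)]]] L2_borel[OF bR] regional_lincomb[OF st u v]])
 also have "... = a * inner2 (regional s u) (%x. b x * regional s w x) + c * inner2 (regional s v) (%x. b x * regional s w x)"
  by (rule inner2_lincomb_left[OF R(1,2) bR])
 finally have 2: "inner2 (regional s ?uv) (%x. b x * regional s w x) = a * inner2 (regional s u) (%x. b x * regional s w x) + c * inner2 (regional s v) (%x. b x * regional s w x)" .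
 show ?thesis
  unfolding form_def 2 sobolev_ip_lincomb(2)[OF H0_D(1)[OF u] H0_D(1)[OF v] H0_D(1)[OF w]]
   inner2_lincomb_left[OF zero_L2[OF u] zero_L2[OF v] qw] by (simp add: algebra_simps)
qed

lemma form_commute: "form s t b q u v = form s t b q v u"
 by (simp add: form_def inner2_def mult_ac)

text \<open>On \<open>K\<close> the killing density is bounded, so only the fractional Laplacian of order \<open>s\<close> matters.\<close>

lemma regional_on_K_bound:
 "\<exists>C\<ge>0. \<forall>u\<in>H0 t. sqint (%x. indicator K x * regional s u x) <= C * (sqint (\<Lambda> s u) + sqint u)"
proof -
 obtain k where k: "k >= 0" "!!x. x \<in> K ==> killing s x <= k"
  using killing_bounded_on_compact[OF K, of s] st by auto
 let ?c = "frac_constant TYPE('a) (s / 2)"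
 define C where "C = 2 + 2 * (\<bar>?c\<bar> * k)\<^sup>2"
 have C: "0 <= C" "2 <= C" "2 * (\<bar>?c\<bar> * k)\<^sup>2 <= C" by (auto simp: C_def)
 have "sqint (%x. indicator K x * regional s u x) <= C * (sqint (\<Lambda> s u) + sqint u)" if u: "u \<in> H0 t" for u
 proof -
  have L: "L2 (\<Lambda> s u)" "L2 u" using L2_laplacian[OF st u] zero_L2[OF u] by auto
  note [measurable] = L[THEN L2_borel]
  let ?f = "%x. indicator K x * \<Lambda> s u x" and ?g = "%x. indicator K x * (?c * (killing s x * u x))"
  have gle: "norm (?g x) <= (\<bar>?c\<bar> * k) * norm (u x)" for x
   using k killing_nonneg[of s x] by (auto simp: indicator_def abs_mult mult.assoc intro!: mult_left_mono mult_right_mono)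
  have gL: "L2 ?g" by (rule L2_dominated[OF _ L(2) gle]) measurable
  have "(%x. indicator K x * regional s u x) = (%x. ?f x - ?g x)" using K(2)
   by (intro ext) (auto simp: regional_def indicator_def)
  then have "sqint (%x. indicator K x * regional s u x) <= 2 * sqint ?f + 2 * sqint ?g"
   using sqint_diff_le[OF L2_on_K[OF L(1)] gL] by simp
  also have "sqint ?f <= 1\<^sup>2 * sqint (\<Lambda> s u)" by (rule sqint_le[OF _ L(1)]) (auto simp: indicator_def)
  also have "sqint ?g <= (\<bar>?c\<bar> * k)\<^sup>2 * sqint u" by (rule sqint_le[OF L2_borel[OF gL] L(2) gle])
  finally have "sqint (%x. indicator K x * regional s u x) <= 2 * sqint (\<Lambda> s u) + (2 * (\<bar>?c\<bar> * k)\<^sup>2) * sqint u" by simp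
  also have "... <= C * sqint (\<Lambda> s u) + C * sqint u" by (intro add_mono mult_right_mono C) auto
  finally show ?thesis by (simp add: distrib_left)
 qed
 then show ?thesis using C(1) by blast
qed

lemma regional_on_K_ip_bound:
 "\<exists>C\<ge>0. \<forall>u\<in>H0 t. sqint (%x. indicator K x * regional s u x) <= C * sobolev_ip t u u"
proof -
 let ?p = "plancherel_const TYPE('a)"
 obtain C where C: "C >= 0" "!!u. u \<in> H0 t ==> sqint (%x. indicator K x * regional s u x) <= C * (sqint (\<Lambda> s u) + sqint u)"
  using regional_on_K_bound by blast
 obtain N D where D: "0 <= D" and ND: "!!u::'a => real. in_H t u ==>
  1 * (sqint (\<Lambda> s u) + sqint u) <= sqint (\<Lambda> t u) / 2 - sqint u / 2 + D * low_frequency N u"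
  using lower_order_absorption[OF st(1,2), of 1] by auto
 have p: "?p > 0" by simp
 have "sqint (%x. indicator K x * regional s u x) <= (C * (1 + D * ?p)) * sobolev_ip t u u" if u: "u \<in> H0 t" for u
 proof -
  have "D * low_frequency N u <= D * (?p * sqint u)" by (rule mult_left_mono[OF low_frequency_le[OF zero_L2[OF u]] D])
  have "sqint (\<Lambda> s u) + sqint u <= sqint (\<Lambda> t u) + sqint u + D * (?p * sqint u) + D * (?p * sqint (\<Lambda> t u))"
  proof -
   have "S + U <= T + U + P + Q" if "L <= P" "0 <= T" "0 <= U" "0 <= Q" "S + U <= T / 2 - U / 2 + L" for S T U L P Q :: real
    using that by linarith
   from this[OF _ _ _ _ ND[OF H0_D(1)[OF u], unfolded mult_1_left]] show ?thesis
    using \<open>D * low_frequency N u <= D * (?p * sqint u)\<close> D p by simp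
  qed
  also have "... = (1 + D * ?p) * sobolev_ip t u u" by (simp add: sobolev_ip_self algebra_simps)
  finally have "C * (sqint (\<Lambda> s u) + sqint u) <= C * ((1 + D * ?p) * sobolev_ip t u u)" by (rule mult_left_mono[OF _ C(1)])
  then show ?thesis using C(2)[OF u] by (simp add: mult.assoc)
 qed
 moreover have "0 <= C * (1 + D * ?p)" using C(1) D p by auto
 ultimately show ?thesis by blast
qed

lemma regional_term_bound:
 assumes u: "u \<in> H0 t" and v: "v \<in> H0 t"
 shows "(inner2 (regional s u) (%x. b x * regional s v x))\<^sup>2
  <= (M\<^sup>2 * sqint (%x. indicator K x * regional s u x)) * sqint (%x. indicator K x * regional s v x)"
proof -
 note R = regional_L2[OF u] regional_L2[OF v]
 note KR = R[THEN L2_on_K]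
 have bR: "L2 (%x. b x * regional s u x)" by (rule L2_coeff[OF b(1,2) R(1)])
 have "inner2 (regional s u) (%x. b x * regional s v x) = inner2 (%x. b x * regional s u x) (%x. indicator K x * regional s v x)"
  unfolding inner2_def by (rule L1_integral_cong) (use b(3) in \<open>auto simp: indicator_def\<close>)
 then have "(inner2 (regional s u) (%x. b x * regional s v x))\<^sup>2 <= sqint (%x. b x * regional s u x) * sqint (%x. indicator K x * regional s v x)"
  using inner2_cauchy_schwarz[OF bR KR(2)] by simp
 also have "... <= (M\<^sup>2 * sqint (%x. indicator K x * regional s u x)) * sqint (%x. indicator K x * regional s v x)"
 proof (intro mult_right_mono sqint_le[OF L2_borel[OF bR] KR(1)])
  show "norm (b x * regional s u x) <= M * norm (indicator K x * regional s u x)" for x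
   using b(2)[of x] b(3)[of x] by (cases "x \<in> K") (auto simp: abs_mult mult_right_mono)
 qed simp
 finally show ?thesis .
qed

lemma potential_term_bound:
 assumes u: "u \<in> H0 t" and v: "v \<in> H0 t"
 shows "(inner2 u (%x. q x * v x))\<^sup>2 <= sqint u * (M\<^sup>2 * sqint v)"
proof -
 have qL: "L2 (%x. q x * v x)" by (rule L2_coeff[OF q(1,2) zero_L2[OF v]])
 have "sqint (%x. q x * v x) <= M\<^sup>2 * sqint v"
  by (rule sqint_le[OF L2_borel[OF qL] zero_L2[OF v]]) (use q(2) in \<open>auto simp: abs_mult mult_right_mono\<close>)
 then show ?thesis using order_trans[OF inner2_cauchy_schwarz[OF zero_L2[OF u] qL] mult_left_mono[of _ _ "sqint u"]] by simp
qed

lemma form_bounded: "\<exists>B. \<forall>u\<in>H0 t. \<forall>v\<in>H0 t. (form s t b q u v)\<^sup>2 <= B * sobolev_ip t u u * sobolev_ip t v v"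
proof -
 obtain C where C: "C >= 0" "!!u. u \<in> H0 t ==> sqint (%x. indicator K x * regional s u x) <= C * sobolev_ip t u u"
  using regional_on_K_ip_bound by blast
 have "(form s t b q u v)\<^sup>2 <= (3 * (1 + M\<^sup>2 * C * C + M\<^sup>2)) * sobolev_ip t u u * sobolev_ip t v v" if u: "u \<in> H0 t" and v: "v \<in> H0 t" for u v
 proof -
  let ?U = "sobolev_ip t u u" and ?V = "sobolev_ip t v v"
  let ?x = "inner2 (\<Lambda> t u) (\<Lambda> t v)" and ?y = "inner2 (regional s u) (%x. b x * regional s v x)" and ?z = "inner2 u (%x. q x * v x)"
  have U: "sqint u <= ?U" "sqint (\<Lambda> t u) <= ?U" "0 <= ?U" and V: "sqint v <= ?V" "sqint (\<Lambda> t v) <= ?V" "0 <= ?V"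
   by (auto simp: sobolev_ip_self)
  have 1: "?x\<^sup>2 <= ?U * ?V"
   by (rule order_trans[OF inner2_cauchy_schwarz[OF H0_laplacian[OF u] H0_laplacian[OF v]]]) (intro mult_mono U V, auto)
  have "?y\<^sup>2 <= (M\<^sup>2 * sqint (%x. indicator K x * regional s u x)) * sqint (%x. indicator K x * regional s v x)" by (rule regional_term_bound[OF u v])
  also have "... <= (M\<^sup>2 * (C * ?U)) * (C * ?V)" using C U V by (intro mult_mono mult_left_mono C u v mult_nonneg_nonneg) auto
  finally have 2: "?y\<^sup>2 <= (M\<^sup>2 * C * C) * (?U * ?V)" by (simp add: mult_ac)
  have "?z\<^sup>2 <= sqint u * (M\<^sup>2 * sqint v)" by (rule potential_term_bound[OF u v])
  also have "... <= ?U * (M\<^sup>2 * ?V)" using U V by (intro mult_mono mult_left_mono) auto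
  finally have 3: "?z\<^sup>2 <= M\<^sup>2 * (?U * ?V)" by (simp add: mult_ac)
  have "(form s t b q u v)\<^sup>2 <= 3 * (?x\<^sup>2 + ?y\<^sup>2 + ?z\<^sup>2)"
  proof -
   have "0 <= (?x - ?y)\<^sup>2 + (?y - ?z)\<^sup>2 + (?x - ?z)\<^sup>2" by simp
   then show ?thesis unfolding form_def by (simp add: power2_eq_square algebra_simps)
  qed
  also have "... <= 3 * (?U * ?V + (M\<^sup>2 * C * C) * (?U * ?V) + M\<^sup>2 * (?U * ?V))" using 1 2 3 by simp
  also have "... = (3 * (1 + M\<^sup>2 * C * C + M\<^sup>2)) * ?U * ?V" by (simp add: algebra_simps)
  finally show ?thesis .
 qed
 then show ?thesis by blast
qed

lemma abs_le_if_square_le: "(x::real)\<^sup>2 <= y\<^sup>2 ==> 0 <= y ==> \<bar>x\<bar> <= y"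
 using abs_le_square_iff[of x y] by simp

text \<open>The terms with coefficients are of order \<open>s < t\<close> and are absorbed by interpolation.\<close>

lemma form_garding: "\<exists>N D. \<forall>u\<in>H0 t. 1 / 2 * sobolev_ip t u u <= \<bar>form s t b q u u\<bar> + D * low_frequency N u"
proof -
 obtain C where C: "C >= 0" "!!u. u \<in> H0 t ==> sqint (%x. indicator K x * regional s u x) <= C * (sqint (\<Lambda> s u) + sqint u)"
  using regional_on_K_bound by blast
 have A: "0 <= M * C + M" using M C(1) by simp
 obtain N D where ND: "!!u::'a => real. in_H t u ==>
  (M * C + M) * (sqint (\<Lambda> s u) + sqint u) <= sqint (\<Lambda> t u) / 2 - sqint u / 2 + D * low_frequency N u"
  using lower_order_absorption[OF st(1,2) A] by blast
 have "1 / 2 * sobolev_ip t u u <= \<bar>form s t b q u u\<bar> + D * low_frequency N u" if u: "u \<in> H0 t" for u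
 proof -
  let ?S = "sqint (\<Lambda> s u)" and ?k = "sqint (%x. indicator K x * regional s u x)"
  have y: "\<bar>inner2 (regional s u) (%x. b x * regional s u x)\<bar> <= M * ?k"
   by (rule abs_le_if_square_le) (use regional_term_bound[OF u u] M in \<open>auto simp: power2_eq_square mult_ac\<close>)
  have k: "M * ?k <= M * (C * (?S + sqint u))" by (rule mult_left_mono[OF C(2)[OF u] M])
  have z: "\<bar>inner2 u (%x. q x * u x)\<bar> <= M * sqint u"
   by (rule abs_le_if_square_le) (use potential_term_bound[OF u u] M in \<open>auto simp: power2_eq_square mult_ac\<close>)
  have e: "(M * C + M) * (?S + sqint u) = M * (C * (?S + sqint u)) + M * sqint u + M * ?S" by (simp add: algebra_simps)
  have p: "0 <= M * ?S" using M by simp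
  have f: "form s t b q u u = sqint (\<Lambda> t u) + inner2 (regional s u) (%x. b x * regional s u x) + inner2 u (%x. q x * u x)"
   by (simp add: form_def inner2_self)
  have "1 / 2 * U + 1 / 2 * T <= \<bar>F\<bar> + L"
   if "\<bar>y\<bar> <= mk" "mk <= mc" "\<bar>z\<bar> <= mu" "A = mc + mu + ms" "0 <= ms" "A <= T / 2 - U / 2 + L" "F = T + y + z"
   for U T F L y z mk mc mu ms A :: real using that by linarith
  from this[OF y k z e p ND[OF H0_D(1)[OF u]] f] show ?thesis unfolding sobolev_ip_self distrib_left .
 qed
 then show ?thesis by blast
qed

theorem fredholm:
 assumes unique: "!!u. u \<in> H0 t ==> (!!v. v \<in> H0 t ==> form s t b q u v = 0) ==> ae x. u x = 0"
  and F_lin: "!!u v a c. u \<in> H0 t ==> v \<in> H0 t ==> F (%x. a * u x + c * v x) = a * F u + c * F v"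
  and F_bound: "!!u. u \<in> H0 t ==> (F u)\<^sup>2 <= C * sobolev_ip t u u"
 shows "\<exists>v\<in>H0 t. \<forall>w\<in>H0 t. form s t b q v w = F w"
proof -
 obtain B where B: "!!u v. u \<in> H0 t ==> v \<in> H0 t ==> (form s t b q u v)\<^sup>2 <= B * sobolev_ip t u u * sobolev_ip t v v"
  using form_bounded by blast
 obtain N D where ND: "!!u. u \<in> H0 t ==> 1 / 2 * sobolev_ip t u u <= \<bar>form s t b q u u\<bar> + D * low_frequency N u"
  using form_garding by blast
 interpret H: semi_hilbert "H0 t" "sobolev_ip t" by (rule semi_hilbert_H0)
 interpret symmetric_garding_form "H0 t" "sobolev_ip t" "form s t b q" "%u. max D 1 * low_frequency N u" B "1 / 2"
 proof
  show "form s t b q (%x. a * u x + c * v x) w = a * form s t b q u w + c * form s t b q v w"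
   if "u \<in> H0 t" "v \<in> H0 t" "w \<in> H0 t" for u v w a c by (rule form_lincomb[OF that])
  show "form s t b q u v = form s t b q v u" for u v by (rule form_commute)
  show "(form s t b q u v)\<^sup>2 <= B * sobolev_ip t u u * sobolev_ip t v v" if "u \<in> H0 t" "v \<in> H0 t" for u v by (rule B[OF that])
  show "(0::real) < 1 / 2" by simp
  show "1 / 2 * sobolev_ip t u u <= \<bar>form s t b q u u\<bar> + max D 1 * low_frequency N u" if "u \<in> H0 t" for u
  proof -
   have "D * low_frequency N u <= max D 1 * low_frequency N u" by (rule mult_right_mono) (auto simp: low_frequency_def)
   then show ?thesis using ND[OF that] by linarith
  qed
  fix f :: "nat => 'a => real" assume f: "!!n. f n \<in> H0 t" "!!n. sobolev_ip t (f n) (f n) <= 1"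
  have "sqint (f n) <= 1" for n using f(2)[of n] unfolding sobolev_ip_self using sqint_nonneg[of "\<Lambda> t (f n)"] by linarith
  from low_frequency_compact[of f, OF f(1) this, of N] obtain r :: "nat => nat" where
   r0: "strict_mono r \<and> (\<forall>e>0. \<exists>n0. \<forall>i\<ge>n0. \<forall>j\<ge>n0. low_frequency N (%x. f (r i) x - f (r j) x) < e)" by (rule exE)
  note r = conjunct1[OF r0] conjunct2[OF r0, rule_format]
  have "\<exists>n0. \<forall>i\<ge>n0. \<forall>j\<ge>n0. max D 1 * low_frequency N (%x. f (r i) x - f (r j) x) < e" if e: "e > 0" for e
  proof -
   have m: "max D 1 > 0" by simp
   obtain n0 where n0: "!!i j. n0 <= i ==> n0 <= j ==> low_frequency N (%x. f (r i) x - f (r j) x) < e / max D 1" using r(2)[OF divide_pos_pos[OF e m]] by blast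
   have "max D 1 * low_frequency N (%x. f (r i) x - f (r j) x) < e" if "n0 <= i" "n0 <= j" for i j
    using n0[OF that] unfolding pos_less_divide_eq[OF m] by (subst mult.commute)
   then show ?thesis by blast
  qed
  then show "\<exists>r::nat => nat. strict_mono r \<and> (\<forall>e>0. \<exists>n0. \<forall>i\<ge>n0. \<forall>j\<ge>n0. max D 1 * low_frequency N (%x. f (r i) x - f (r j) x) < e)"
   using r(1) by (intro exI[of _ r] conjI allI impI)
 next
  fix u assume u: "u \<in> H0 t" and z: "!!v. v \<in> H0 t ==> form s t b q u v = 0"
  have ae: "ae x. u x = 0" by (rule unique[OF u z])
  show "sobolev_ip t u u = 0" by (rule sobolev_ip_AE_zero[OF H0_D(1)[OF u] ae])
 qed
 show ?thesis by (rule solvable[OF F_lin F_bound])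
qed

end

section \<open>Riesz potentials\<close>

lemma potential_continuous:
 fixes w :: "'a::euclidean_space => real"
 assumes w: "L1 w" and K: "compact K" and w0: "!!y. y \<notin> K ==> w y = 0" and beta: "0 <= beta"
 shows "continuous_on (- K) (%x. LI y. w y / norm (x - y) powr beta)"
proof (rule continuous_at_imp_continuous_on, rule ballI)
 fix x assume x: "x \<in> - K"
 let ?P = "%x. LI y. w y / norm (x - y) powr beta"
 have [measurable]: "w \<in> Borel" using w by auto
 have "open (- K)" using K by (simp add: compact_imp_closed open_Compl)
 then obtain d where d: "d > 0" "ball x d \<subseteq> - K" using x by (meson openE)
 have far: "d / 2 <= norm (z - y)" if "z \<in> ball x (d / 2)" "y \<in> K" for z y
 proof -
  have "y \<notin> ball x d" using d(2) that(2) by blast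
  then have "d <= norm (x - y)" by (simp add: dist_norm)
  also have "... <= norm (x - z) + norm (z - y)" using norm_triangle_ineq[of "x - z" "z - y"] by simp
  finally show ?thesis using that(1) by (simp add: dist_norm)
 qed
 have "continuous_on (ball x (d / 2)) ?P"
 proof (rule continuous_on_sequentiallyI)
  fix u a assume u: "\<forall>n. u n \<in> ball x (d / 2)" and a: "a \<in> ball x (d / 2)" and lim: "u ----> a"
  show "(%n. ?P (u n)) ----> ?P a"
  proof (rule integral_dominated_convergence[where w="%y. \<bar>w y\<bar> / (d / 2) powr beta"])
   show "L1 (%y. \<bar>w y\<bar> / (d / 2) powr beta)" using w by simp
   show "ae y. (%n. w y / norm (u n - y) powr beta) ----> w y / norm (a - y) powr beta"
   proof (rule AE_I2)
    fix y
    show "(%n. w y / norm (u n - y) powr beta) ----> w y / norm (a - y) powr beta"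
    proof (cases "y \<in> K")
     case True
     have "norm (a - y) ~= 0" using far[OF a True] d(1) by linarith
     then show ?thesis by (intro tendsto_intros lim) auto
    qed (simp add: w0)
   qed
   show "ae y. norm (w y / norm (u n - y) powr beta) <= \<bar>w y\<bar> / (d / 2) powr beta" for n
   proof (rule AE_I2)
    fix y
    show "norm (w y / norm (u n - y) powr beta) <= \<bar>w y\<bar> / (d / 2) powr beta"
    proof (cases "y \<in> K")
     case True
     have f: "d / 2 <= norm (u n - y)" using far[OF _ True, of "u n"] u by blast
     then have "(d / 2) powr beta <= norm (u n - y) powr beta" using d(1) beta by (intro powr_mono2) auto
     moreover have "0 < (d / 2) powr beta" using d(1) by simp
     ultimately have "\<bar>w y\<bar> / norm (u n - y) powr beta <= \<bar>w y\<bar> / (d / 2) powr beta"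
      by (intro divide_left_mono mult_pos_pos) auto
     then show ?thesis by simp
    qed (simp add: w0)
   qed
  qed measurable
 qed
 then show "isCont ?P x" using d(1) by (simp add: continuous_on_eq_continuous_at)
qed

lemma AE_zero_imp_zero_on_open:
 fixes f :: "'a::euclidean_space => real"
 assumes U: "open U" and f: "continuous_on U f" and ae: "ae x. x \<in> U \<longrightarrow> f x = 0" and x: "x \<in> U"
 shows "f x = 0"
proof (rule ccontr)
 assume nz: "f x ~= 0"
 have op: "open (U \<inter> f -` (- {0}))" by (rule continuous_open_preimage[OF f U]) auto
 have "negligible (U \<inter> f -` (- {0}))"
 proof -
  have "ae x. x \<notin> U \<inter> f -` (- {0})" using ae by eventually_elim auto
  then have "U \<inter> f -` (- {0}) \<in> null_sets lborel" using op by (subst AE_iff_null_sets) auto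
  then show ?thesis by (simp add: negligible_iff_null_sets null_sets_completionI)
 qed
 then have "U \<inter> f -` (- {0}) = {}" using open_not_negligible op by blast
 then show False using x nz by blast
qed

lemma riesz_unique_continuation_AE:
 fixes w :: "'a::euclidean_space => real"
 assumes w: "L1 w" and K: "compact K" and w0: "!!y. y \<notin> K ==> w y = 0"
  and U: "open U" "U ~= {}" "U \<inter> K = {}" and beta: "beta >= real DIM('a)"
  and zero: "ae x. x \<in> U \<longrightarrow> (LI y. w y / norm (x - y) powr beta) = 0"
 shows "ae y. w y = 0"
proof (rule riesz_unique_continuation[OF w K w0 U beta])
 have "0 <= beta" using beta by (meson of_nat_0_le_iff order_trans)
 from potential_continuous[OF w K w0 this] have "continuous_on U (%x. LI y. w y / norm (x - y) powr beta)"
  using U(3) by (auto elim: continuous_on_subset)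
 from AE_zero_imp_zero_on_open[OF U(1) this zero]
 show "(LI y. w y / norm (x - y) powr beta) = 0" if "x \<in> U" for x using that .
qed

text \<open>Fubini; the kernel is bounded because the supports have positive distance.\<close>

lemma potential_symmetric:
 fixes g h :: "'a::euclidean_space => real"
 assumes g: "L1 g" "compact K" "!!x. x \<notin> K ==> g x = 0"
  and h: "L1 h" "compact K'" "!!x. x \<notin> K' ==> h x = 0"
  and disj: "K \<inter> K' = {}" and beta: "0 <= beta"
 shows "(LI x. g x * (LI y. h y / norm (x - y) powr beta)) = (LI y. h y * (LI x. g x / norm (y - x) powr beta))"
proof -
 have [measurable]: "g \<in> Borel" "h \<in> Borel" using g h by auto
 have "\<exists>delta>0. \<forall>x\<in>K. \<forall>y\<in>K'. delta <= dist x y"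
 proof (cases "K = {} \<or> K' = {}")
  case False
  then show ?thesis
   using setdist_gt_0_compact_closed[OF g(2) compact_imp_closed[OF h(2)]] disj
   by (intro exI[of _ "setdist K K'"]) (auto intro: setdist_le_dist)
 qed (auto intro: exI[of _ 1])
 then obtain delta where delta: "delta > 0" "!!x y. x \<in> K ==> y \<in> K' ==> delta <= norm (x - y)" by (auto simp: dist_norm)
 let ?F = "%(x, y). g x * h y / norm (x - y) powr beta"
 have "integrable (lborel2) (%(x, y). cplx (g x) * cplx (h y))"
  by (rule integrable_product_mult) (use g h in auto)
 from integrable_norm[OF this] have ip: "integrable (lborel2) (%z. \<bar>g (fst z) * h (snd z)\<bar>)"
  by (simp add: case_prod_unfold norm_mult abs_mult)
 have int: "integrable (lborel2) ?F"
 proof (rule L1_integrable_bound[OF integrable_mult_right[OF ip, of "1 / delta powr beta"] _ AE_I2])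
  fix z :: "'a \<times> 'a"
  obtain x y where z: "z = (x, y)" by (cases z)
  show "norm (?F z) <= norm (1 / delta powr beta * \<bar>g (fst z) * h (snd z)\<bar>)"
  proof (cases "x \<in> K \<and> y \<in> K'")
   case True
   then have "delta powr beta <= norm (x - y) powr beta" using delta beta by (intro powr_mono2) auto
   then have "\<bar>g x * h y\<bar> / norm (x - y) powr beta <= \<bar>g x * h y\<bar> / delta powr beta"
    using delta(1) True delta(2)[of x y] by (intro divide_left_mono mult_pos_pos) auto
   then show ?thesis unfolding z by simp
  qed (auto simp: z g(3) h(3))
 qed measurable
 have "(LI x. g x * (LI y. h y / norm (x - y) powr beta)) = (LI x. LI y. g x * h y / norm (x - y) powr beta)"
  by (simp flip: integral_mult_right_zero)
 also have "... = (LI y. LI x. g x * h y / norm (x - y) powr beta)"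
  by (rule lborel_pair.Fubini_integral[symmetric]) (use int in simp)
 also have "... = (LI y. h y * (LI x. g x / norm (y - x) powr beta))"
  by (simp add: norm_minus_commute mult.commute flip: integral_mult_right_zero)
 finally show ?thesis .
qed

section \<open>The exterior value problem\<close>

lemma test_function_sobolev_tilde:
 fixes f :: "'a::euclidean_space => real"
 assumes f: "f \<in> test_functions U" and t: "0 < t" "t < 1"
 shows "f \<in> sobolev_tilde t U"
proof -
 have "has_fourier (%x::'a. 0::real) (%xi. 0)"
  using has_fourier_lincomb[OF has_fourier_fourier[OF L2_zero] has_fourier_fourier[OF L2_zero], of 0 0] by simp
 from fourier_unique[OF this] have ae: "ae xi. fourier (%x::'a. 0) xi = 0" .
 have "(LI xi. (cmod (sobolev_weighted_fourier t (%x::'a. 0) xi))\<^sup>2) = 0"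
  by (rule integral_eq_zero_AE) (use ae in \<open>eventually_elim, simp add: sobolev_weighted_fourier_def\<close>)
 then have "sobolev_norm t (%x. f x - f x) = 0" by (simp add: sobolev_norm_def)
 then have "\<exists>phi\<in>test_functions U. sobolev_norm t (%x. f x - phi x) < eps" if "0 < eps" for eps
  using that f by (intro bexI[of _ f]) auto
 then show ?thesis
  using test_function_in_H[OF f t] t(1) by (auto simp: sobolev_tilde_def sobolev_iff_in_H)
qed

context lipschitz_domain
begin

lemma H0_integrable: "u \<in> H0 t ==> L1 u"
 by (rule L2_compact_support_integrable(1)[OF in_H_L2(1)[OF H0_D(1)] bounded_domain H0_D(2)])

lemma compact_closure_domain: "compact (closure Om)"
 using bounded_domain by (simp add: compact_closure)

lemma H0_off_closure: "u \<in> H0 t ==> x \<notin> closure Om ==> u x = 0"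
 using H0_D(2) closure_subset by blast

end

context schrodinger
begin

lemma form_AE_zero:
 assumes u: "u \<in> H0 t" and v: "v \<in> H0 t" and ae: "ae x. u x = 0"
 shows "form s t b q u v = 0"
proof -
 obtain B where "(form s t b q u v)\<^sup>2 <= B * sobolev_ip t u u * sobolev_ip t v v" using form_bounded u v by blast
 then show ?thesis using sobolev_ip_AE_zero[OF H0_D(1)[OF u] ae] by simp
qed

lemma form_diff: "u \<in> H0 t ==> v \<in> H0 t ==> w \<in> H0 t ==>
  form s t b q (%x. u x - v x) w = form s t b q u w - form s t b q v w"
 using form_lincomb[of u v w 1 "-1"] by simp

lemma H0_diff: "u \<in> H0 t ==> v \<in> H0 t ==> (%x. u x - v x) \<in> H0 t"
 using H0_lincomb[of u t v 1 "-1"] by simp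

end

text \<open>\<open>b\<^sub>0\<close> and \<open>q\<^sub>0\<close> are the given coefficients, \<open>b\<close> and \<open>q\<close> their representatives.\<close>

locale exterior_problem = schrodinger +
 fixes b\<^sub>0 q\<^sub>0 :: "'a => real"
 assumes b\<^sub>0: "(%x. indicator Om x * b\<^sub>0 x) \<in> Borel" "ae x. indicator Om x * b\<^sub>0 x = b x"
  and q\<^sub>0: "(%x. indicator Om x * q\<^sub>0 x) \<in> Borel" "ae x. indicator Om x * q\<^sub>0 x = q x"
  and eigenvalue: "eigenvalue_condition Om s t b\<^sub>0 q\<^sub>0"
begin

text \<open>Only the part of \<open>u\<close> in the domain enters the regional operator, so the equation for \<open>u\<close> is an inhomogeneous one for this part.\<close>

lemma weak_form_eq:
 assumes u: "in_H t u" and f: "in_H t f" and f0: "\<forall>x\<in>Om. f x = 0"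
  and ext: "ae x. x \<notin> Om \<longrightarrow> u x = f x" and phi: "phi \<in> H0 t"
 shows "(%x. indicator Om x * u x) \<in> H0 t"
  and "ae x. u x = indicator Om x * u x + f x"
  and "(LI x. \<Lambda> t u x * \<Lambda> t phi x) +
    (LINT x:Om|lborel. b\<^sub>0 x * regional_frac_laplacian Om (s / 2) u x * regional_frac_laplacian Om (s / 2) phi x) +
    (LINT x:Om|lborel. q\<^sub>0 x * u x * phi x)
   = inner2 (\<Lambda> t f) (\<Lambda> t phi) + form s t b q (%x. indicator Om x * u x) phi"
proof -
 let ?v = "%x. indicator Om x * u x"
 let ?L = "\<Lambda> t" and ?R = "%u x. indicator Om x * regional_frac_laplacian Om (s / 2) u x"
 have [measurable]: "u \<in> Borel" "f \<in> Borel" "phi \<in> Borel"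
  using u f H0_D(1)[OF phi] by (auto intro: L2_borel in_H_L2)
 note [measurable] = b\<^sub>0(1) q\<^sub>0(1) b(1) q(1)
 show ae: "ae x. u x = ?v x + f x" using ext by eventually_elim (auto simp: indicator_def f0)
 have "ae x. u x - f x = ?v x" using ae by eventually_elim simp
 then have "in_H t ?v" by (intro in_H_AE_cong(1)[OF in_H_diff[OF u f]]) auto
 then show v: "?v \<in> H0 t" by (simp add: H0_def)
 have "inner2 (?L u) (?L phi) = inner2 (?L (%x. 1 * ?v x + 1 * f x)) (?L phi)"
 proof (rule inner2_AE_cong)
  have vf: "in_H t (%x. 1 * ?v x + 1 * f x)" by (rule in_H_lincomb[OF H0_D(1)[OF v] f])
  show "ae x. ?L u x = ?L (%x. 1 * ?v x + 1 * f x) x"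
   by (rule frac_laplacian_AE_cong[OF u]) (use ae in auto)
  show "?L u \<in> Borel" "?L (%x. 1 * ?v x + 1 * f x) \<in> Borel" "?L phi \<in> Borel"
   using u vf H0_D(1)[OF phi] by (auto intro!: L2_borel L2_frac_laplacian)
 qed
 also have "... = inner2 (?L ?v) (?L phi) + inner2 (?L f) (?L phi)"
  using sobolev_ip_lincomb(2)[OF H0_D(1)[OF v] f H0_D(1)[OF phi], of 1 1] by simp
 finally have 1: "(LI x. ?L u x * ?L phi x) = inner2 (?L ?v) (?L phi) + inner2 (?L f) (?L phi)"
  by (simp add: inner2_def)
 have Ru: "regional_frac_laplacian Om (s / 2) u = regional_frac_laplacian Om (s / 2) ?v"
  by (rule regional_frac_laplacian_cong) simp
 note Rv = regional_frac_laplacian_AE[OF st v] and Rphi = regional_frac_laplacian_AE[OF st phi]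
 note [measurable] = Rv(1)[THEN L2_borel] Rphi(1)[THEN L2_borel] regional_L2[OF v, THEN L2_borel] regional_L2[OF phi, THEN L2_borel]
 have "(LINT x:Om|lborel. b\<^sub>0 x * regional_frac_laplacian Om (s / 2) u x * regional_frac_laplacian Om (s / 2) phi x)
  = (LI x. (indicator Om x * b\<^sub>0 x) * ?R ?v x * ?R phi x)"
  unfolding set_lebesgue_integral_def Ru by (rule L1_integral_cong) (auto simp: indicator_def)
 also have "... = (LI x. regional s ?v x * (b x * regional s phi x))"
 proof (rule integral_cong_AE)
  show "ae x. (indicator Om x * b\<^sub>0 x) * ?R ?v x * ?R phi x = regional s ?v x * (b x * regional s phi x)"
   using b\<^sub>0(2) Rv(2) Rphi(2)
  proof eventually_elim
   case (elim x) show ?case unfolding elim by (simp add: mult_ac)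
  qed
 qed measurable
 finally have 2: "(LINT x:Om|lborel. b\<^sub>0 x * regional_frac_laplacian Om (s / 2) u x * regional_frac_laplacian Om (s / 2) phi x)
  = inner2 (regional s ?v) (%x. b x * regional s phi x)" by (simp add: inner2_def)
 have "(LINT x:Om|lborel. q\<^sub>0 x * u x * phi x) = (LI x. (indicator Om x * q\<^sub>0 x) * u x * phi x)"
  unfolding set_lebesgue_integral_def by (rule L1_integral_cong) auto
 also have "... = (LI x. ?v x * (q x * phi x))"
 proof (rule integral_cong_AE)
  show "ae x. (indicator Om x * q\<^sub>0 x) * u x * phi x = ?v x * (q x * phi x)"
   using q\<^sub>0(2)
  proof eventually_elim
   case (elim x) show ?case using H0_D(2)[OF phi, of x] unfolding elim by (auto simp: indicator_def)
  qed
 qed measurable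
 finally have 3: "(LINT x:Om|lborel. q\<^sub>0 x * u x * phi x) = inner2 ?v (%x. q x * phi x)" by (simp add: inner2_def)
 show "(LI x. ?L u x * ?L phi x) +
    (LINT x:Om|lborel. b\<^sub>0 x * regional_frac_laplacian Om (s / 2) u x * regional_frac_laplacian Om (s / 2) phi x) +
    (LINT x:Om|lborel. q\<^sub>0 x * u x * phi x)
   = inner2 (?L f) (?L phi) + form s t b q ?v phi"
  unfolding 1 2 3 form_def by simp
qed

lemma test_H0: "phi \<in> test_functions Om ==> phi \<in> H0 t"
 using test_function_H0 st by auto

lemma weak_solution_iff:
 assumes f: "in_H t f" and f0: "\<forall>x\<in>Om. f x = 0"
 shows "weak_solution Om s t b\<^sub>0 q\<^sub>0 f u \<longleftrightarrow> in_H t u \<and> (ae x. x \<notin> Om \<longrightarrow> u x = f x) \<and>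
  (\<forall>phi\<in>test_functions Om. inner2 (\<Lambda> t f) (\<Lambda> t phi) + form s t b q (%x. indicator Om x * u x) phi = 0)"
proof -
 have t: "0 < t" using st by simp
 show ?thesis
  unfolding weak_solution_def sobolev_iff_in_H[OF t] AE_exterior_iff
  using weak_form_eq(3)[OF _ f f0 _ test_H0, of u] by (intro conj_cong refl ball_cong) auto
qed

lemma H0_zero: "(%x. 0) \<in> H0 t"
proof -
 interpret semi_hilbert "H0 t" "sobolev_ip t" by (rule semi_hilbert_H0)
 obtain u where "u \<in> H0 t" using nonempty by blast
 then show ?thesis using H0_lincomb[of u t u 0 0] by simp
qed

lemma laplacian_zero: "inner2 (\<Lambda> t (%x. 0)) (\<Lambda> t w) = 0" if "in_H t w" for w :: "'a => real"
 using sobolev_ip_lincomb(2)[OF H0_D(1)[OF H0_zero] H0_D(1)[OF H0_zero] that, of 0 0] by simp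

lemma H0_unique:
 assumes u: "u \<in> H0 t" and z: "!!phi. phi \<in> test_functions Om ==> form s t b q u phi = 0"
 shows "ae x. u x = 0"
proof -
 have ind: "(%x. indicator Om x * u x) = u" using H0_D(2)[OF u] by (auto simp: indicator_def fun_eq_iff)
 have "weak_solution Om s t b\<^sub>0 q\<^sub>0 (%_. 0) u"
  unfolding weak_solution_iff[OF H0_D(1)[OF H0_zero] ballI[OF refl]] ind
  using H0_D[OF u] z laplacian_zero[OF H0_D(1)[OF test_H0]] by auto
 then show ?thesis using eigenvalue unfolding eigenvalue_condition_def by blast
qed

lemma solve:
 assumes F_lin: "!!u v a c. u \<in> H0 t ==> v \<in> H0 t ==> F (%x. a * u x + c * v x) = a * F u + c * F v"
  and F_bound: "!!u. u \<in> H0 t ==> (F u)\<^sup>2 <= C * sobolev_ip t u u"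
 shows "\<exists>v\<in>H0 t. \<forall>w\<in>H0 t. form s t b q v w = F w"
 by (rule fredholm[OF H0_unique F_lin F_bound]) (use test_H0 in auto)

lemma interior_solution:
 assumes f: "in_H t f" and f0: "!!x. x \<in> Om ==> f x = 0"
 shows "\<exists>w\<in>H0 t. (\<forall>phi\<in>H0 t. form s t b q w phi = - inner2 (\<Lambda> t f) (\<Lambda> t phi)) \<and>
  in_H t (solution Om s t b\<^sub>0 q\<^sub>0 f) \<and> (ae x. solution Om s t b\<^sub>0 q\<^sub>0 f x = w x + f x)"
proof -
 let ?L = "\<Lambda> t"
 have f0': "\<forall>x\<in>Om. f x = 0" using f0 by blast
 have "\<exists>v\<in>H0 t. \<forall>phi\<in>H0 t. form s t b q v phi = - inner2 (?L f) (?L phi)"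
 proof (rule solve[where C="sqint (?L f)"])
  show "- inner2 (?L f) (?L (%x. a * u x + c * v x)) = a * (- inner2 (?L f) (?L u)) + c * (- inner2 (?L f) (?L v))"
   if "u \<in> H0 t" "v \<in> H0 t" for u v a c
   using sobolev_ip_lincomb(2)[OF H0_D(1)[OF that(1)] H0_D(1)[OF that(2)] f, of a c] by (simp add: inner2_commute[of "?L f"])
  show "(- inner2 (?L f) (?L u))\<^sup>2 <= sqint (?L f) * sobolev_ip t u u" if u: "u \<in> H0 t" for u
  proof -
   have "L2 (?L f)" by (rule L2_frac_laplacian) (use f in simp)
   then have "(inner2 (?L f) (?L u))\<^sup>2 <= sqint (?L f) * sqint (?L u)" by (rule inner2_cauchy_schwarz[OF _ H0_laplacian[OF u]])
   also have "... <= sqint (?L f) * sobolev_ip t u u" by (rule mult_left_mono) (auto simp: sobolev_ip_self)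
   finally show ?thesis by simp
  qed
 qed
 then obtain w where w: "w \<in> H0 t" "!!phi. phi \<in> H0 t ==> form s t b q w phi = - inner2 (?L f) (?L phi)" by blast
 let ?u = "solution Om s t b\<^sub>0 q\<^sub>0 f"
 have ind: "(%x. indicator Om x * (w x + f x)) = w" using H0_D(2)[OF w(1)] f0 by (auto simp: indicator_def fun_eq_iff)
 have "weak_solution Om s t b\<^sub>0 q\<^sub>0 f (%x. w x + f x)"
  unfolding weak_solution_iff[OF f f0'] ind
  using in_H_add[OF H0_D(1)[OF w(1)] f] H0_D(2)[OF w(1)] w(2)[OF test_H0] by auto
 then have "weak_solution Om s t b\<^sub>0 q\<^sub>0 f ?u" unfolding solution_def by (rule someI[of "weak_solution Om s t b\<^sub>0 q\<^sub>0 f"])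
 then have u: "in_H t ?u" "ae x. x \<notin> Om \<longrightarrow> ?u x = f x"
  and uf: "!!phi. phi \<in> test_functions Om ==> inner2 (?L f) (?L phi) + form s t b q (%x. indicator Om x * ?u x) phi = 0"
  unfolding weak_solution_iff[OF f f0'] by auto
 note v = weak_form_eq(1,2)[OF u(1) f f0' u(2) w(1)]
 have "ae x. indicator Om x * ?u x - w x = 0"
 proof (rule H0_unique[OF H0_diff[OF v(1) w(1)]])
  fix phi assume phi: "phi \<in> test_functions Om"
  show "form s t b q (%x. indicator Om x * ?u x - w x) phi = 0"
   using form_diff[OF v(1) w(1) test_H0[OF phi]] uf[OF phi] w(2)[OF test_H0[OF phi]] by simp
 qed
 with v(2) have "ae x. ?u x = w x + f x" by eventually_elim simp
 then show ?thesis using w u(1) by blast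
qed

text \<open>Runge approximation in dual form: a functional that annihilates all solutions with exterior
 data in \<open>W\<close> vanishes. The adjoint solution \<open>v\<close> has vanishing potential in \<open>W\<close>.\<close>

theorem runge:
 assumes W: "open W" "W ~= {}" "W \<subseteq> exterior Om"
  and F_lin: "!!u v a c. u \<in> H0 t ==> v \<in> H0 t ==> F (%x. a * u x + c * v x) = a * F u + c * F v"
  and F_bound: "!!u. u \<in> H0 t ==> (F u)\<^sup>2 <= C * sobolev_ip t u u"
  and F_zero: "!!f w. f \<in> test_functions W ==> w \<in> H0 t ==>
   (!!phi. phi \<in> H0 t ==> form s t b q w phi = - inner2 (\<Lambda> t f) (\<Lambda> t phi)) ==> F w = 0"
  and phi: "phi \<in> H0 t"
 shows "F phi = 0"
proof -
 let ?beta = "real DIM('a) + 2 * t"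
 have t: "0 < t" "t < 1" using st by auto
 obtain v where v: "v \<in> H0 t" "!!w. w \<in> H0 t ==> form s t b q v w = F w" using solve[OF F_lin F_bound] by blast
 have WK: "W \<inter> closure Om = {}" using W(3) by (auto simp: exterior_def)
 have vi: "L1 v" by (rule H0_integrable[OF v(1)])
 let ?P = "%x. LI y. v y / norm (x - y) powr ?beta"
 have cont: "continuous_on W ?P"
  by (rule continuous_on_subset[OF potential_continuous[OF vi compact_closure_domain H0_off_closure[OF v(1)]]])
   (use WK st in auto)
 have "ae x. x \<in> W \<longrightarrow> ?P x = 0"
 proof (rule fundamental_lemma[OF W(1)])
  have [measurable]: "v \<in> Borel" using vi by auto
  show "?P \<in> Borel" by measurable
  show "L1 (%x. indicator (cball p rho) x * ?P x)" if "cball p rho \<subseteq> W" for p rho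
   using borel_integrable_compact[OF compact_cball continuous_on_subset[OF cont that]] by simp
  fix f assume f: "f \<in> test_functions W"
  obtain S where S: "S \<subseteq> W" "!!x. x \<notin> S ==> f x = 0" using test_functionD(4)[OF f] by blast
  have fH: "in_H t f" by (rule test_function_in_H[OF f t])
  have f0: "f x = 0" if "x \<in> closure Om" for x using S WK that by blast
  have f0': "f x = 0" if "x \<in> Om" for x using f0 closure_subset that by blast
  obtain w where w: "w \<in> H0 t" "!!phi. phi \<in> H0 t ==> form s t b q w phi = - inner2 (\<Lambda> t f) (\<Lambda> t phi)"
   using interior_solution[OF fH f0'] by blast
  have "- inner2 (\<Lambda> t f) (\<Lambda> t v) = 0"
   using w(2)[OF v(1)] v(2)[OF w(1)] F_zero[OF f w] form_commute by simp
  moreover have "inner2 (\<Lambda> t f) (\<Lambda> t v) = - frac_constant TYPE('a) t * (LI x. f x * ?P x)"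
   by (rule nonlocal_pairing(2)[OF fH H0_D(1)[OF v(1)] t, of "- Om"]) (use f0' H0_D(2)[OF v(1)] in auto)
  ultimately have "(LI x. f x * ?P x) = 0" using frac_constant_pos[OF t, where 'a='a] by simp
  then show "(LI x. ?P x * f x) = 0" by (simp add: mult.commute)
 qed
 then have v0: "ae y. v y = 0"
  by (intro riesz_unique_continuation_AE[OF vi compact_closure_domain _ W(1,2) WK]) (use H0_off_closure[OF v(1)] st in auto)
 show ?thesis using v(2)[OF phi] form_AE_zero[OF v(1) phi v0] by simp
qed

end

section \<open>Determination of the coefficients\<close>

context exterior_problem
begin

text \<open>The first term depends on \<open>f\<close> only: two solutions with the same data are compared by their potentials.\<close>

lemma neumann_data_eq:
 assumes f: "in_H t f" and f0: "\<forall>x\<in>closure Om. f x = 0"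
  and w: "w \<in> H0 t" and u: "in_H t (solution Om s t b\<^sub>0 q\<^sub>0 f)" "ae x. solution Om s t b\<^sub>0 q\<^sub>0 f x = w x + f x"
 shows "ae x. x \<in> exterior Om \<longrightarrow> neumann_data Om s t b\<^sub>0 q\<^sub>0 f x = frac_constant TYPE('a) t *
  ((LI y. f x * indicator Om y / norm (x - y) powr (real DIM('a) + 2 * t)) - (LI y. w y / norm (x - y) powr (real DIM('a) + 2 * t)))"
 using u(2)
proof eventually_elim
 case (elim x)
 let ?k = "%y. norm (x - y) powr (real DIM('a) + 2 * t)" and ?u = "solution Om s t b\<^sub>0 q\<^sub>0 f"
 have [measurable]: "?u \<in> Borel" "w \<in> Borel"
  using u(1) H0_D(1)[OF w] by (auto intro: L2_borel in_H_L2)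
 show ?case
 proof
  assume "x \<in> exterior Om"
  then have x: "x \<notin> closure Om" by (simp add: exterior_def)
  have ux: "?u x = f x" using elim H0_off_closure[OF w x] by simp
  have "(LINT y:Om|lborel. (?u x - ?u y) / ?k y) = (LI y. f x * indicator Om y / ?k y - w y / ?k y)"
   unfolding set_lebesgue_integral_def ux
  proof (rule integral_cong_AE)
   show "ae y. indicator Om y *\<^sub>R ((f x - ?u y) / ?k y) = f x * indicator Om y / ?k y - w y / ?k y"
    using u(2)
   proof eventually_elim
    case (elim y)
    show ?case
    proof (cases "y \<in> Om")
     case True
     then have "f y = 0" using f0 closure_subset by blast
     then show ?thesis using True elim by (simp add: diff_divide_distrib)
    qed (simp add: H0_D(2)[OF w])
   qed
  qed measurable
  also have "... = (LI y. f x * indicator Om y / ?k y) - (LI y. w y / ?k y)"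
  proof (rule L1_integral_diff)
   have "L1 (indicator Om :: 'a => real)"
    using emeasure_bounded_finite[OF bounded_domain] by (intro integrable_real_indicator) auto
   then have "L1 (%y. f x * indicator Om y)" by simp
   then show "L1 (%y. f x * indicator Om y / ?k y)"
    by (rule integrable_potential[OF _ compact_closure_domain _ x]) (use closure_subset[of Om] in \<open>auto simp: indicator_def\<close>)
   show "L1 (%y. w y / ?k y)"
    by (rule integrable_potential[OF H0_integrable[OF w] compact_closure_domain H0_off_closure[OF w] x])
  qed
  finally show "neumann_data Om s t b\<^sub>0 q\<^sub>0 f x = frac_constant TYPE('a) t *
   ((LI y. f x * indicator Om y / ?k y) - (LI y. w y / ?k y))"
   by (simp add: neumann_data_def)
 qed
qed

lemma neumann_data_borel:
 assumes u: "in_H t (solution Om s t b\<^sub>0 q\<^sub>0 f)"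
 shows "neumann_data Om s t b\<^sub>0 q\<^sub>0 f \<in> borel_measurable lborel"
proof -
 have [measurable]: "solution Om s t b\<^sub>0 q\<^sub>0 f \<in> Borel" using u by (auto intro: L2_borel in_H_L2)
 show ?thesis unfolding neumann_data_def[abs_def] set_lebesgue_integral_def by measurable
qed

end

locale inverse_problem =
 P1: exterior_problem Om s t b\<^sub>1 q\<^sub>1 M K b\<^sub>0\<^sub>1 q\<^sub>0\<^sub>1 + P2: exterior_problem Om s t b\<^sub>2 q\<^sub>2 M K b\<^sub>0\<^sub>2 q\<^sub>0\<^sub>2
 for Om :: "'a::euclidean_space set" and s t b\<^sub>1 q\<^sub>1 M K b\<^sub>0\<^sub>1 q\<^sub>0\<^sub>1 b\<^sub>2 q\<^sub>2 b\<^sub>0\<^sub>2 q\<^sub>0\<^sub>2 +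
 fixes W W' :: "'a set"
 assumes W: "open W" "W ~= {}" "W \<subseteq> exterior Om" and W': "open W'" "W' ~= {}" "W' \<subseteq> exterior Om"
  and data: "cauchy_data Om s t b\<^sub>0\<^sub>1 q\<^sub>0\<^sub>1 W W' = cauchy_data Om s t b\<^sub>0\<^sub>2 q\<^sub>0\<^sub>2 W W'"
begin

definition solves :: "('a => real) => ('a => real) => bool" where
 "solves f w \<longleftrightarrow> w \<in> P1.H0 t \<and> (\<forall>phi\<in>P1.H0 t. P1.form s t b\<^sub>1 q\<^sub>1 w phi = - inner2 (\<Lambda> t f) (\<Lambda> t phi))"

lemma test_W:
 assumes f: "f \<in> test_functions W"
 shows "in_H t f" "\<forall>x\<in>closure Om. f x = 0"
proof -
 show "in_H t f" using test_function_in_H[OF f] P1.st by simp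
 show "\<forall>x\<in>closure Om. f x = 0"
  using test_functionD(4)[OF f] W(3) unfolding exterior_def by blast
qed

text \<open>The two solutions with the same exterior data differ by a function in \<open>Om\<close> whose potential
 vanishes in \<open>W'\<close>; so they agree.\<close>

lemma common_solution:
 assumes f: "f \<in> test_functions W" and w: "solves f w" and phi: "phi \<in> P1.H0 t"
 shows "P1.form s t b\<^sub>2 q\<^sub>2 w phi = - inner2 (\<Lambda> t f) (\<Lambda> t phi)"
proof -
 let ?beta = "real DIM('a) + 2 * t"
 have t: "0 < t" "t < 1" using P1.st by auto
 note fH = test_W(1)[OF f] and f0 = test_W(2)[OF f]
 have f0': "!!x. x \<in> Om ==> f x = 0" using f0 closure_subset by blast
 obtain w1 where w1: "w1 \<in> P1.H0 t" "\<forall>phi\<in>P1.H0 t. P1.form s t b\<^sub>1 q\<^sub>1 w1 phi = - inner2 (\<Lambda> t f) (\<Lambda> t phi)"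
  "in_H t (solution Om s t b\<^sub>0\<^sub>1 q\<^sub>0\<^sub>1 f)" "ae x. solution Om s t b\<^sub>0\<^sub>1 q\<^sub>0\<^sub>1 f x = w1 x + f x"
  using P1.interior_solution[OF fH f0'] by blast
 obtain w2 where w2: "w2 \<in> P1.H0 t" "\<forall>phi\<in>P1.H0 t. P1.form s t b\<^sub>2 q\<^sub>2 w2 phi = - inner2 (\<Lambda> t f) (\<Lambda> t phi)"
  "in_H t (solution Om s t b\<^sub>0\<^sub>2 q\<^sub>0\<^sub>2 f)" "ae x. solution Om s t b\<^sub>0\<^sub>2 q\<^sub>0\<^sub>2 f x = w2 x + f x"
  using P2.interior_solution[OF fH f0'] by blast
 have wH: "w \<in> P1.H0 t" using w by (simp add: solves_def)
 have "(f, neumann_data Om s t b\<^sub>0\<^sub>1 q\<^sub>0\<^sub>1 f) \<in> cauchy_data Om s t b\<^sub>0\<^sub>1 q\<^sub>0\<^sub>1 W W'"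
  using test_function_sobolev_tilde[OF f t] P1.neumann_data_borel[OF w1(3)] by (simp add: cauchy_data_def)
 then have "AE x\<in>W' in lborel. neumann_data Om s t b\<^sub>0\<^sub>1 q\<^sub>0\<^sub>1 f x = neumann_data Om s t b\<^sub>0\<^sub>2 q\<^sub>0\<^sub>2 f x"
  unfolding data by (simp add: cauchy_data_def)
 with P1.neumann_data_eq[OF fH f0 w1(1,3,4)] P2.neumann_data_eq[OF fH f0 w2(1,3,4)]
 have P: "ae x. x \<in> W' \<longrightarrow> (LI y. w1 y / norm (x - y) powr ?beta) = (LI y. w2 y / norm (x - y) powr ?beta)"
 proof eventually_elim
  case (elim x)
  have "0 < frac_constant TYPE('a) t" by (rule frac_constant_pos[OF t])
  then show ?case using elim W'(3) by auto
 qed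
 have d: "(%x. w1 x - w2 x) \<in> P1.H0 t" by (rule P1.H0_diff[OF w1(1) w2(1)])
 have "ae x. w1 x - w2 x = 0"
 proof (rule riesz_unique_continuation_AE[OF P1.H0_integrable[OF d] P1.compact_closure_domain _ W'(1,2)])
  show "w1 x - w2 x = 0" if "x \<notin> closure Om" for x by (rule P1.H0_off_closure[OF d that])
  show "W' \<inter> closure Om = {}" using W'(3) by (auto simp: exterior_def)
  show "real DIM('a) <= ?beta" using t by simp
  show "ae x. x \<in> W' \<longrightarrow> (LI y. (w1 y - w2 y) / norm (x - y) powr ?beta) = 0"
   using P
  proof eventually_elim
   case (elim x)
   show ?case
   proof
    assume x: "x \<in> W'"
    then have xc: "x \<notin> closure Om" using W'(3) by (auto simp: exterior_def)
    have "L1 (%y. v y / norm (x - y) powr ?beta)" if "v \<in> P1.H0 t" for v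
     by (rule integrable_potential[OF P1.H0_integrable[OF that] P1.compact_closure_domain P1.H0_off_closure[OF that] xc])
    then show "(LI y. (w1 y - w2 y) / norm (x - y) powr ?beta) = 0"
     using elim x w1(1) w2(1) by (simp add: diff_divide_distrib)
   qed
  qed
 qed
 moreover have "ae x. w x - w1 x = 0"
  by (rule P1.H0_unique[OF P1.H0_diff[OF wH w1(1)]])
   (use w w1(2) P1.form_diff[OF wH w1(1)] P1.test_H0 in \<open>auto simp: solves_def\<close>)
 ultimately have "ae x. w x - w2 x = 0" by eventually_elim simp
 then have "P1.form s t b\<^sub>2 q\<^sub>2 (%x. w x - w2 x) phi = 0"
  by (rule P2.form_AE_zero[OF P1.H0_diff[OF wH w2(1)] phi])
 then show ?thesis using P2.form_diff[OF wH w2(1) phi] w2(2) phi by simp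
qed

definition b :: "'a => real" where "b x = b\<^sub>1 x - b\<^sub>2 x"
definition q :: "'a => real" where "q x = q\<^sub>1 x - q\<^sub>2 x"

lemma b_borel [measurable]: "b \<in> Borel" and q_borel [measurable]: "q \<in> Borel"
 using P1.b(1) P1.q(1) P2.b(1) P2.q(1) by (auto simp: b_def[abs_def] q_def[abs_def])

lemma b_off: "x \<notin> K ==> b x = 0" and q_off: "x \<notin> K ==> q x = 0"
 using P1.b(3) P1.q(3) P2.b(3) P2.q(3) by (auto simp: b_def q_def)

lemma L2_b: "L2 w ==> L2 (%x. b x * w x)" and L2_q: "L2 w ==> L2 (%x. q x * w x)" for w :: "'a => real"
 using L2_diff[OF P1.L2_coeff[OF P1.b(1,2)] P2.L2_coeff[OF P2.b(1,2)], of w w]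
  L2_diff[OF P1.L2_coeff[OF P1.q(1,2)] P2.L2_coeff[OF P2.q(1,2)], of w w]
 by (simp_all add: b_def q_def left_diff_distrib)

lemma difference_identity:
 assumes f: "f \<in> test_functions W" and w: "solves f w" and phi: "phi \<in> P1.H0 t"
 shows "inner2 (%x. b x * P1.regional s w x) (P1.regional s phi) + inner2 (%x. q x * w x) phi = 0"
proof -
 have wH: "w \<in> P1.H0 t" using w by (simp add: solves_def)
 note R = P1.regional_L2[OF wH] P1.regional_L2[OF phi] and L = P1.zero_L2[OF wH] P1.zero_L2[OF phi]
 have "P1.form s t b\<^sub>1 q\<^sub>1 w phi = P1.form s t b\<^sub>2 q\<^sub>2 w phi"
  using common_solution[OF f w phi] w phi by (simp add: solves_def)
 then have "inner2 (P1.regional s w) (%x. b\<^sub>1 x * P1.regional s phi x) + inner2 w (%x. q\<^sub>1 x * phi x)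
  = inner2 (P1.regional s w) (%x. b\<^sub>2 x * P1.regional s phi x) + inner2 w (%x. q\<^sub>2 x * phi x)"
  unfolding P1.form_def by simp
 moreover have "inner2 (%x. b x * P1.regional s w x) (P1.regional s phi)
  = inner2 (P1.regional s w) (%x. b\<^sub>1 x * P1.regional s phi x) - inner2 (P1.regional s w) (%x. b\<^sub>2 x * P1.regional s phi x)"
  unfolding inner2_def
  using L2_inner_integrable[OF R(1) P1.L2_coeff[OF P1.b(1,2) R(2)]] L2_inner_integrable[OF R(1) P2.L2_coeff[OF P2.b(1,2) R(2)]]
  by (simp add: b_def algebra_simps flip: L1_integral_diff)
 moreover have "inner2 (%x. q x * w x) phi = inner2 w (%x. q\<^sub>1 x * phi x) - inner2 w (%x. q\<^sub>2 x * phi x)"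
  unfolding inner2_def
  using L2_inner_integrable[OF L(1) P1.L2_coeff[OF P1.q(1,2) L(2)]] L2_inner_integrable[OF L(1) P2.L2_coeff[OF P2.q(1,2) L(2)]]
  by (simp add: q_def algebra_simps flip: L1_integral_diff)
 ultimately show ?thesis by simp
qed

text \<open>A nonempty bounded open set is not compact.\<close>

lemma window: "\<exists>p rho. 0 < rho \<and> cball p rho \<subseteq> Om - K"
proof -
 have "\<not> Om \<subseteq> K"
 proof
  assume "Om \<subseteq> K"
  then have "Om = K" using P1.K(2) by blast
  then show False using P1.K(1) P1.open_domain P1.domain_nonempty compact_open[of Om] by simp
 qed
 then obtain p where "p \<in> Om - K" by blast
 moreover have "open (Om - K)" using P1.open_domain P1.K(1) by (simp add: open_Diff compact_imp_closed)
 ultimately show ?thesis by (meson open_contains_cball)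
qed

text \<open>On the support of \<open>b\<close> the regional operator of a test function living away from it is a Riesz
 potential; so \<open>b R w\<close> has vanishing potential in a ball.\<close>

lemma b_regional_pairing:
 assumes w: "w \<in> P1.H0 t" and S: "cball p rho \<subseteq> Om - K" and phi: "phi \<in> test_functions (ball p rho)"
  and h: "L2 h" "!!x. x \<notin> K ==> h x = 0"
 shows "inner2 h (P1.regional s phi)
  = - frac_constant TYPE('a) (s / 2) * (LI y. (LI x. h x / norm (y - x) powr (real DIM('a) + s)) * phi y)"
proof -
 let ?beta = "real DIM('a) + s" and ?c = "frac_constant TYPE('a) (s / 2)"
 have phiOm: "phi \<in> test_functions Om" by (rule test_functions_mono[OF _ phi]) (use S ball_subset_cball in blast)
 obtain S' where S': "compact S'" "S' \<subseteq> ball p rho" "!!x. x \<notin> S' ==> phi x = 0" using test_functionD(4)[OF phi] by blast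
 have disj: "K \<inter> S' = {}" using S S'(2) ball_subset_cball by blast
 have [measurable]: "h \<in> Borel" "P1.regional s phi \<in> Borel" "phi \<in> Borel"
  using h(1) P1.regional_L2[OF P1.test_H0[OF phiOm]] test_functionD(3)[OF phi] by auto
 have hi: "L1 h" by (rule L2_compact_support_integrable(1)[OF h(1) compact_imp_bounded[OF P1.K(1)] h(2)])
 have "inner2 h (P1.regional s phi) = (LI x. - ?c * (h x * (LI y. phi y / norm (x - y) powr ?beta)))"
  unfolding inner2_def
 proof (rule integral_cong_AE)
  show "ae x. h x \<bullet> P1.regional s phi x = - ?c * (h x * (LI y. phi y / norm (x - y) powr ?beta))"
   using P1.regional_off_support[OF P1.st phiOm S'(1,3), simplified]
  proof eventually_elim
   case (elim x)
   show ?case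
   proof (cases "x \<in> K")
    case True
    then have "x \<in> Om" "x \<notin> S'" using P1.K(2) disj by auto
    then show ?thesis using elim by simp
   qed (simp add: h(2))
  qed
 qed measurable
 also have "... = - ?c * (LI x. h x * (LI y. phi y / norm (x - y) powr ?beta))"
  by (rule integral_mult_right_zero)
 also have "(LI x. h x * (LI y. phi y / norm (x - y) powr ?beta)) = (LI y. phi y * (LI x. h x / norm (y - x) powr ?beta))"
  by (rule potential_symmetric[OF hi P1.K(1) h(2) test_function_integrable(1)[OF phi] S'(1,3) disj]) (use P1.st in auto)
 finally show ?thesis by (simp add: mult.commute)
qed

lemma regional_window_zero:
 assumes h: "L2 h" "!!x. x \<notin> K ==> h x = 0" and S: "0 < rho" "cball p rho \<subseteq> Om - K"
  and zero: "!!phi. phi \<in> test_functions (ball p rho) ==> inner2 h (P1.regional s phi) = 0"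
 shows "ae x. h x = 0"
proof -
 let ?beta = "real DIM('a) + s"
 let ?P = "%y. LI x. h x / norm (y - x) powr ?beta"
 have s: "0 < s / 2" "s / 2 < 1" using P1.st by auto
 have hi: "L1 h" by (rule L2_compact_support_integrable(1)[OF h(1) compact_imp_bounded[OF P1.K(1)] h(2)])
 have [measurable]: "h \<in> Borel" using h(1) by auto
 have disj: "ball p rho \<inter> K = {}" using S(2) ball_subset_cball by blast
 have beta0: "0 <= ?beta" using P1.st by simp
 have cont: "continuous_on (ball p rho) ?P"
  by (rule continuous_on_subset[OF potential_continuous[OF hi P1.K(1) h(2) beta0]]) (use disj in auto)
 have "ae y. y \<in> ball p rho \<longrightarrow> ?P y = 0"
 proof (rule fundamental_lemma[OF open_ball])
  show "?P \<in> Borel" by measurable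
  show "L1 (%x. indicator (cball z r) x * ?P x)" if "cball z r \<subseteq> ball p rho" for z r
   using borel_integrable_compact[OF compact_cball continuous_on_subset[OF cont that]] by simp
  show "(LI y. ?P y * phi y) = 0" if "phi \<in> test_functions (ball p rho)" for phi
   using zero[OF that] b_regional_pairing[OF _ S(2) that h] P1.H0_zero frac_constant_pos[OF s, where 'a='a] by auto
 qed
 then show ?thesis
  by (intro riesz_unique_continuation_AE[OF hi P1.K(1) h(2) open_ball _ disj]) (use S(1) P1.st in auto)
qed

lemma coefficients_annihilate:
 assumes f: "f \<in> test_functions W" and w: "solves f w"
 shows "ae x. b x * P1.regional s w x = 0" "ae x. q x * w x = 0"
proof -
 have wH: "w \<in> P1.H0 t" using w by (simp add: solves_def)
 have bL: "L2 (%x. b x * P1.regional s w x)" by (rule L2_b[OF P1.regional_L2[OF wH]])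
 have qL: "L2 (%x. q x * w x)" by (rule L2_q[OF P1.zero_L2[OF wH]])
 obtain p rho where S: "0 < rho" "cball p rho \<subseteq> Om - K" using window by blast
 show bz: "ae x. b x * P1.regional s w x = 0"
 proof (rule regional_window_zero[OF bL _ S])
  fix phi assume phi: "phi \<in> test_functions (ball p rho)"
  have phiOm: "phi \<in> test_functions Om" by (rule test_functions_mono[OF _ phi]) (use S ball_subset_cball in blast)
  obtain S' where S': "S' \<subseteq> ball p rho" "!!x. x \<notin> S' ==> phi x = 0" using test_functionD(4)[OF phi] by blast
  have qz: "q x * w x * phi x = 0" for x
  proof (cases "x \<in> K")
   case True
   then have "phi x = 0" using S'(1) S(2) ball_subset_cball by (intro S'(2)) blast
   then show ?thesis by simp
  qed (simp add: q_off)
  have "inner2 (%x. q x * w x) phi = 0" unfolding inner2_def inner_real_def qz by simp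
  then show "inner2 (%x. b x * P1.regional s w x) (P1.regional s phi) = 0"
   using difference_identity[OF f w P1.test_H0[OF phiOm]] by simp
 qed (simp add: b_off)
 have "ae x. x \<in> Om \<longrightarrow> q x * w x = 0"
 proof (rule fundamental_lemma[OF P1.open_domain L2_borel[OF qL]])
  have "L1 (%x. q x * w x)"
   by (rule L2_compact_support_integrable(1)[OF qL compact_imp_bounded[OF P1.K(1)]]) (simp add: q_off)
  then show "L1 (%x. indicator (cball z r) x * (q x * w x))" for z r
   by (subst mult.commute, intro integrable_real_mult_indicator) auto
  fix phi assume phi: "phi \<in> test_functions Om"
  have "inner2 (%x. b x * P1.regional s w x) (P1.regional s phi) = inner2 (%x. 0) (P1.regional s phi)"
   by (rule inner2_AE_cong) (use bz L2_borel[OF bL] P1.regional_L2[OF P1.test_H0[OF phi]] in auto)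
  then show "(LI x. q x * w x * phi x) = 0"
   using difference_identity[OF f w P1.test_H0[OF phi]] by (simp add: inner2_def)
 qed
 then show "ae x. q x * w x = 0"
  by eventually_elim (use P1.K(2) q_off in force)
qed

lemma L2_indicator_K:
 assumes E: "E \<in> sets borel" "E \<subseteq> K" shows "L2 (indicator E :: 'a => real)"
proof -
 have "emeasure lborel E < \<infinity>"
  using emeasure_mono[OF E(2), of lborel] emeasure_compact_finite[OF P1.K(1)] P1.borel_K by auto
 then show ?thesis by (rule L2_indicator_set[OF E(1)])
qed

text \<open>With \<open>E\<close> the set where \<open>q\<close> is nonzero, integration over \<open>E\<close> annihilates all solutions, and therefore all test functions.\<close>

lemma potentials_equal: "ae x. q x = 0"
proof -
 define E where "E = {x. q x ~= 0}"
 have E: "E \<in> sets borel" "E \<subseteq> K" using q_off by (auto simp: E_def)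
 note EL = L2_indicator_K[OF E]
 have zero: "inner2 (indicator E) phi = 0" if phi: "phi \<in> P1.H0 t" for phi
 proof (rule P1.runge[OF W _ _ _ phi, where C="sqint (indicator E :: 'a => real)" and F="inner2 (indicator E)"])
  show "inner2 (indicator E) (%x. a * u x + c * v x) = a * inner2 (indicator E) u + c * inner2 (indicator E) v"
   if "u \<in> P1.H0 t" "v \<in> P1.H0 t" for u v a c
   using inner2_lincomb_left[OF P1.zero_L2[OF that(1)] P1.zero_L2[OF that(2)] EL] by (simp add: inner2_commute[of "indicator E"])
  show "(inner2 (indicator E) u)\<^sup>2 <= sqint (indicator E :: 'a => real) * sobolev_ip t u u" if "u \<in> P1.H0 t" for u
   by (rule order_trans[OF inner2_cauchy_schwarz[OF EL P1.zero_L2[OF that]] mult_left_mono]) (auto simp: sobolev_ip_self)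
  fix f w assume f: "f \<in> test_functions W" and w: "w \<in> P1.H0 t"
   and sol: "!!phi. phi \<in> P1.H0 t ==> P1.form s t b\<^sub>1 q\<^sub>1 w phi = - inner2 (\<Lambda> t f) (\<Lambda> t phi)"
  have "solves f w" using w sol by (simp add: solves_def)
  from coefficients_annihilate(2)[OF f this] have "ae x. indicator E x * w x = 0"
   by eventually_elim (auto simp: E_def)
  then show "inner2 (indicator E) w = 0" unfolding inner2_def by (intro integral_eq_zero_AE) simp
 qed
 have "ae x. x \<in> Om \<longrightarrow> (indicator E x :: real) = 0"
 proof (rule fundamental_lemma[OF P1.open_domain L2_borel[OF EL]])
  have "L1 (indicator E :: 'a => real)"
   by (rule L2_compact_support_integrable(1)[OF EL compact_imp_bounded[OF P1.K(1)]]) (use E(2) in \<open>auto simp: indicator_def\<close>)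
  then show "L1 (%x. indicator (cball z r) x * (indicator E x :: real))" for z r
   by (subst mult.commute, intro integrable_real_mult_indicator) auto
  show "(LI x. indicator E x * phi x) = 0" if "phi \<in> test_functions Om" for phi
   using zero[OF P1.test_H0[OF that]] by (simp add: inner2_def)
 qed
 then show ?thesis by eventually_elim (use E(2) P1.K(2) in \<open>auto simp: E_def indicator_def split: if_splits\<close>)
qed

text \<open>As for \<open>q\<close>, now with the integral of \<open>R phi\<close> over \<open>E\<close>, tested by \<open>phi\<close> in a ball away from \<open>K\<close>.\<close>

lemma leading_coefficients_equal: "ae x. b x = 0"
proof -
 define E where "E = {x. b x ~= 0}"
 have E: "E \<in> sets borel" "E \<subseteq> K" using b_off by (auto simp: E_def)
 note EL = L2_indicator_K[OF E]
 obtain C where C: "C >= 0" "!!u. u \<in> P1.H0 t ==> sqint (%x. indicator K x * P1.regional s u x) <= C * sobolev_ip t u u"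
  using P1.regional_on_K_ip_bound by blast
 have zero: "inner2 (indicator E) (P1.regional s phi) = 0" if phi: "phi \<in> P1.H0 t" for phi
 proof (rule P1.runge[OF W _ _ _ phi, where C="sqint (indicator E :: 'a => real) * C" and F="%u. inner2 (indicator E) (P1.regional s u)"])
  show "inner2 (indicator E) (P1.regional s (%x. a * u x + c * v x)) = a * inner2 (indicator E) (P1.regional s u) + c * inner2 (indicator E) (P1.regional s v)"
   if u: "u \<in> P1.H0 t" and v: "v \<in> P1.H0 t" for u v a c
  proof -
   note R = P1.regional_L2[OF u] P1.regional_L2[OF v] P1.regional_L2[OF P1.H0_lincomb[OF u v]]
   have "inner2 (P1.regional s (%x. a * u x + c * v x)) (indicator E) = inner2 (%x. a * P1.regional s u x + c * P1.regional s v x) (indicator E)"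
    by (rule inner2_AE_cong[OF L2_borel[OF R(3)] L2_borel[OF L2_add[OF L2_mult[OF R(1)] L2_mult[OF R(2)]]] L2_borel[OF EL] P1.regional_lincomb[OF P1.st u v]])
   then show ?thesis using inner2_lincomb_left[OF R(1,2) EL] by (simp add: inner2_commute[of "indicator E"])
  qed
  show "(inner2 (indicator E) (P1.regional s u))\<^sup>2 <= sqint (indicator E :: 'a => real) * C * sobolev_ip t u u" if u: "u \<in> P1.H0 t" for u
  proof -
   have "inner2 (indicator E) (P1.regional s u) = inner2 (indicator E) (%x. indicator K x * P1.regional s u x)"
    unfolding inner2_def by (rule L1_integral_cong) (use E(2) in \<open>auto simp: indicator_def\<close>)
   then have "(inner2 (indicator E) (P1.regional s u))\<^sup>2 <= sqint (indicator E :: 'a => real) * sqint (%x. indicator K x * P1.regional s u x)"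
    using inner2_cauchy_schwarz[OF EL P1.L2_on_K[OF P1.regional_L2[OF u]]] by simp
   also have "... <= sqint (indicator E :: 'a => real) * (C * sobolev_ip t u u)" by (rule mult_left_mono[OF C(2)[OF u]]) simp
   finally show ?thesis by (simp add: mult.assoc)
  qed
  fix f w assume f: "f \<in> test_functions W" and w: "w \<in> P1.H0 t"
   and sol: "!!phi. phi \<in> P1.H0 t ==> P1.form s t b\<^sub>1 q\<^sub>1 w phi = - inner2 (\<Lambda> t f) (\<Lambda> t phi)"
  have "solves f w" using w sol by (simp add: solves_def)
  from coefficients_annihilate(1)[OF f this] have "ae x. indicator E x * P1.regional s w x = 0"
   by eventually_elim (auto simp: E_def)
  then show "inner2 (indicator E) (P1.regional s w) = 0" unfolding inner2_def by (intro integral_eq_zero_AE) simp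
 qed
 obtain p rho where S: "0 < rho" "cball p rho \<subseteq> Om - K" using window by blast
 have "ae x. (indicator E x :: real) = 0"
 proof (rule regional_window_zero[OF EL _ S])
  fix phi assume phi: "phi \<in> test_functions (ball p rho)"
  have "phi \<in> test_functions Om" by (rule test_functions_mono[OF _ phi]) (use S ball_subset_cball in blast)
  then show "inner2 (indicator E) (P1.regional s phi) = 0" by (rule zero[OF P1.test_H0])
 qed (use E(2) in \<open>auto simp: indicator_def\<close>)
 then show ?thesis by eventually_elim (auto simp: E_def indicator_def split: if_splits)
qed

end

text \<open>Representatives of the coefficients that are Borel, bounded and compactly supported everywhere,
 not only almost everywhere.\<close>

lemma coefficient_representative:
 fixes c :: "'a::euclidean_space => real"
 assumes Om: "Om \<in> sets borel" and c: "L_infinity Om c" "compactly_supported_in Om c"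
 shows "\<exists>M K c'. 0 <= M \<and> compact K \<and> K \<subseteq> Om \<and> c' \<in> Borel \<and> (\<forall>x. \<bar>c' x\<bar> <= M) \<and> (\<forall>x. x \<notin> K \<longrightarrow> c' x = 0) \<and>
  (%x. indicator Om x * c x) \<in> Borel \<and> (ae x. indicator Om x * c x = c' x)"
proof -
 let ?g = "%x. indicator Om x * c x"
 obtain M where M: "ae x. x \<in> Om \<longrightarrow> \<bar>c x\<bar> <= M" using c(1) by (auto simp: L_infinity_def)
 obtain K where K: "compact K" "K \<subseteq> Om" "ae x. x \<in> Om \<longrightarrow> x \<notin> K \<longrightarrow> c x = 0"
  using c(2) by (auto simp: compactly_supported_in_def)
 have g [measurable]: "?g \<in> Borel" using c(1) by (simp add: L_infinity_def set_borel_measurable_def)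
 have [measurable]: "K \<in> sets borel" using K(1) by (rule borel_compact)
 define c' where "c' = (%x. if x \<in> K \<and> \<bar>?g x\<bar> <= max M 0 then ?g x else 0)"
 have "ae x. ?g x = c' x"
  using M K(3) by eventually_elim (use K(2) in \<open>auto simp: c'_def indicator_def\<close>)
 moreover have "c' \<in> Borel" unfolding c'_def by measurable
 moreover have "\<bar>c' x\<bar> <= max M 0" "x \<notin> K \<longrightarrow> c' x = 0" for x by (auto simp: c'_def)
 ultimately show ?thesis using K(1,2) g by (intro exI[of _ "max M 0"] exI[of _ K] exI[of _ c']) auto
qed

theorem theorem1p1:
 fixes \<Omega> W W' :: "'a::euclidean_space set"
  and s t :: real
  and b\<^sub>1 b\<^sub>2 q\<^sub>1 q\<^sub>2 :: "'a => real"
 assumes "0 < s" "s < t" "t < 1"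
  and "bounded_lipschitz_domain \<Omega>"
  and "L_infinity \<Omega> b\<^sub>1" "compactly_supported_in \<Omega> b\<^sub>1"
  and "L_infinity \<Omega> b\<^sub>2" "compactly_supported_in \<Omega> b\<^sub>2"
  and "L_infinity \<Omega> q\<^sub>1" "compactly_supported_in \<Omega> q\<^sub>1"
  and "L_infinity \<Omega> q\<^sub>2" "compactly_supported_in \<Omega> q\<^sub>2"
  and "eigenvalue_condition \<Omega> s t b\<^sub>1 q\<^sub>1"
  and "eigenvalue_condition \<Omega> s t b\<^sub>2 q\<^sub>2"
  and "open W" "W ~= {}" "W \<subseteq> exterior \<Omega>"
  and "open W'" "W' ~= {}" "W' \<subseteq> exterior \<Omega>"
  and "cauchy_data \<Omega> s t b\<^sub>1 q\<^sub>1 W W' = cauchy_data \<Omega> s t b\<^sub>2 q\<^sub>2 W W'"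
 shows "(AE x\<in>\<Omega> in lborel. q\<^sub>1 x = q\<^sub>2 x) \<and> (AE x\<in>\<Omega> in lborel. b\<^sub>1 x = b\<^sub>2 x)"
proof -
 interpret lipschitz_domain \<Omega> by unfold_locales (rule assms(4))
 obtain M1 K1 c1 where 1: "0 <= M1" "compact K1" "K1 \<subseteq> \<Omega>" "c1 \<in> Borel" "!!x. \<bar>c1 x\<bar> <= M1" "!!x. x \<notin> K1 ==> c1 x = 0"
  "(%x. indicator \<Omega> x * b\<^sub>1 x) \<in> Borel" "ae x. indicator \<Omega> x * b\<^sub>1 x = c1 x"
  using coefficient_representative[OF borel_domain assms(5,6)] by blast
 obtain M2 K2 c2 where 2: "0 <= M2" "compact K2" "K2 \<subseteq> \<Omega>" "c2 \<in> Borel" "!!x. \<bar>c2 x\<bar> <= M2" "!!x. x \<notin> K2 ==> c2 x = 0"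
  "(%x. indicator \<Omega> x * b\<^sub>2 x) \<in> Borel" "ae x. indicator \<Omega> x * b\<^sub>2 x = c2 x"
  using coefficient_representative[OF borel_domain assms(7,8)] by blast
 obtain M3 K3 p1 where 3: "0 <= M3" "compact K3" "K3 \<subseteq> \<Omega>" "p1 \<in> Borel" "!!x. \<bar>p1 x\<bar> <= M3" "!!x. x \<notin> K3 ==> p1 x = 0"
  "(%x. indicator \<Omega> x * q\<^sub>1 x) \<in> Borel" "ae x. indicator \<Omega> x * q\<^sub>1 x = p1 x"
  using coefficient_representative[OF borel_domain assms(9,10)] by blast
 obtain M4 K4 p2 where 4: "0 <= M4" "compact K4" "K4 \<subseteq> \<Omega>" "p2 \<in> Borel" "!!x. \<bar>p2 x\<bar> <= M4" "!!x. x \<notin> K4 ==> p2 x = 0"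
  "(%x. indicator \<Omega> x * q\<^sub>2 x) \<in> Borel" "ae x. indicator \<Omega> x * q\<^sub>2 x = p2 x"
  using coefficient_representative[OF borel_domain assms(11,12)] by blast
 define M where "M = M1 + M2 + M3 + M4"
 define K where "K = K1 \<union> K2 \<union> K3 \<union> K4"
 have M: "0 <= M" "M1 <= M" "M2 <= M" "M3 <= M" "M4 <= M" using 1(1) 2(1) 3(1) 4(1) by (auto simp: M_def)
 have K: "compact K" "K \<subseteq> \<Omega>" using 1(2,3) 2(2,3) 3(2,3) 4(2,3) by (auto simp: K_def)
 interpret inverse_problem \<Omega> s t c1 p1 M K b\<^sub>1 q\<^sub>1 c2 p2 b\<^sub>2 q\<^sub>2 W W'
 proof unfold_locales
  show "\<bar>c1 x\<bar> <= M" "\<bar>c2 x\<bar> <= M" "\<bar>p1 x\<bar> <= M" "\<bar>p2 x\<bar> <= M" for x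
   using 1(5) 2(5) 3(5) 4(5) M by (meson order_trans)+
  show "c1 x = 0" "c2 x = 0" "p1 x = 0" "p2 x = 0" if "x \<notin> K" for x
   using that 1(6) 2(6) 3(6) 4(6) by (auto simp: K_def)
 qed (rule assms K M(1) 1(4,7,8) 2(4,7,8) 3(4,7,8) 4(4,7,8))+
 have "ae x. x \<in> \<Omega> \<longrightarrow> q\<^sub>1 x = q\<^sub>2 x"
  using potentials_equal 3(8) 4(8) by eventually_elim (auto simp: q_def)
 moreover have "ae x. x \<in> \<Omega> \<longrightarrow> b\<^sub>1 x = b\<^sub>2 x"
  using leading_coefficients_equal 1(8) 2(8) by eventually_elim (auto simp: b_def)
 ultimately show ?thesis by blast
qed

end
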